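(* Let $F$ be a nonarchimedean local field with residue field $\mathbb{F}_q$, $B$ the quaternion division $F$-algebra with maximal order $O_B$ and uniformizer $\Pi$ chosen as in the context. Taking the right truncation $L/L\Pi$ of an $(O_B,O_B)$-bilattice $L$ induces a one-to-one correspondence between the set of isomorphism classes of $(O_B,O_B)$-bilattices and the set of isomorphism classes of finitely generated $(\mathbb{F}_{q^2}[\varepsilon],\mathbb{F}_{q^2})$-bimodules. By symmetry, the same holds true if the right truncation $L/L\Pi$ and the $(\mathbb{F}_{q^2}[\varepsilon],\mathbb{F}_{q^2})$-bimodules are replaced respectively by the left truncation $L/\Pi L$ and the $(\mathbb{F}_{q^2},\mathbb{F}_{q^2}[\varepsilon])$-bimodules.
   Context: An $(O_B,O_B)$-bilattice is a finitely generated $O_F$-torsion-free $(O_B,O_B)$-bimodule with agreeing left and right $O_F$-actions. Let $K$ be the unramified quadratic extension of $F$, with nontrivial automorphism $\sigma$, embedded in $B$; $\pi$ is a uniformizer of $F$ and $\Pi\in O_B$ satisfies $O_B=O_K\oplus O_K\Pi$, $\Pi^2=\pi$, $\Pi a=a^\sigma\Pi$ for $a\in O_K$. Then $O_B/\Pi O_B=\mathbb{F}_{q^2}$ and $O_B/\pi O_B=\mathbb{F}_{q^2}[\varepsilon]=\mathbb{F}_{q^2}\oplus\mathbb{F}_{q^2}\varepsilon$, where $\varepsilon$ is the image of $\Pi$, with $\varepsilon^2=0$ and $\varepsilon a=a^q\varepsilon$ for $a\in\mathbb{F}_{q^2}$. The quotient $L/L\Pi$ is an $(O_B/\pi O_B,O_B/\Pi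 O_B)=(\mathbb{F}_{q^2}[\varepsilon],\mathbb{F}_{q^2})$-bimodule, and $L/\Pi L$ is an $(\mathbb{F}_{q^2},\mathbb{F}_{q^2}[\varepsilon])$-bimodule. All bimodules over these $\mathbb{F}_q$-algebras have agreeing left and right $\mathbb{F}_q$-actions. *)

theory Defs
  imports "HOL-Algebra.Algebra"
begin

section \<open>Bimodules\<close>

text \<open>As for \<^typ>\<open>('a, 'b) module\<close>, the fields \<^const>\<open>monoid.mult\<close> and \<^const>\<open>one\<close> inherited from
  rings carry no meaning.\<close>

record ('a, 'c, 'b) bimodule = "('a, 'b) module" +
  rsmult :: "['b, 'c] \<Rightarrow> 'b" (infixl \<open>\<odot>\<^sup>r\<index>\<close> 70)

locale bimodule = R: ring R + S: ring S + M?: abelian_group M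
  for R :: "('a, 'y) ring_scheme" (structure) and S :: "('c, 'z) ring_scheme" (structure)
    and M :: "('a, 'c, 'b) bimodule" (structure) +
  assumes smult_closed: "\<lbrakk>r \<in> carrier R; x \<in> carrier M\<rbrakk> \<Longrightarrow> r \<odot>\<^bsub>M\<^esub> x \<in> carrier M"
    and smult_l_distr: "\<lbrakk>r \<in> carrier R; r' \<in> carrier R; x \<in> carrier M\<rbrakk>
      \<Longrightarrow> (r \<oplus>\<^bsub>R\<^esub> r') \<odot>\<^bsub>M\<^esub> x = r \<odot>\<^bsub>M\<^esub> x \<oplus>\<^bsub>M\<^esub> r' \<odot>\<^bsub>M\<^esub> x"
    and smult_r_distr: "\<lbrakk>r \<in> carrier R; x \<in> carrier M; y \<in> carrier M\<rbrakk>
      \<Longrightarrow> r \<odot>\<^bsub>M\<^esub> (x \<oplus>\<^bsub>M\<^esub> y) = r \<odot>\<^bsub>M\<^esub> x \<oplus>\<^bsub>M\<^esub> r \<odot>\<^bsub>M\<^esub> y"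
    and smult_assoc: "\<lbrakk>r \<in> carrier R; r' \<in> carrier R; x \<in> carrier M\<rbrakk>
      \<Longrightarrow> (r \<otimes>\<^bsub>R\<^esub> r') \<odot>\<^bsub>M\<^esub> x = r \<odot>\<^bsub>M\<^esub> (r' \<odot>\<^bsub>M\<^esub> x)"
    and smult_one: "x \<in> carrier M \<Longrightarrow> \<one>\<^bsub>R\<^esub> \<odot>\<^bsub>M\<^esub> x = x"
    and rsmult_closed: "\<lbrakk>s \<in> carrier S; x \<in> carrier M\<rbrakk> \<Longrightarrow> x \<odot>\<^sup>r\<^bsub>M\<^esub> s \<in> carrier M"
    and rsmult_r_distr: "\<lbrakk>s \<in> carrier S; s' \<in> carrier S; x \<in> carrier M\<rbrakk>
      \<Longrightarrow> x \<odot>\<^sup>r\<^bsub>M\<^esub> (s \<oplus>\<^bsub>S\<^esub> s') = x \<odot>\<^sup>r\<^bsub>M\<^esub> s \<oplus>\<^bsub>M\<^esub> x \<odot>\<^sup>r\<^bsub>M\<^esub> s'"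
    and rsmult_l_distr: "\<lbrakk>s \<in> carrier S; x \<in> carrier M; y \<in> carrier M\<rbrakk>
      \<Longrightarrow> (x \<oplus>\<^bsub>M\<^esub> y) \<odot>\<^sup>r\<^bsub>M\<^esub> s = x \<odot>\<^sup>r\<^bsub>M\<^esub> s \<oplus>\<^bsub>M\<^esub> y \<odot>\<^sup>r\<^bsub>M\<^esub> s"
    and rsmult_assoc: "\<lbrakk>s \<in> carrier S; s' \<in> carrier S; x \<in> carrier M\<rbrakk>
      \<Longrightarrow> x \<odot>\<^sup>r\<^bsub>M\<^esub> (s \<otimes>\<^bsub>S\<^esub> s') = (x \<odot>\<^sup>r\<^bsub>M\<^esub> s) \<odot>\<^sup>r\<^bsub>M\<^esub> s'"
    and rsmult_one: "x \<in> carrier M \<Longrightarrow> x \<odot>\<^sup>r\<^bsub>M\<^esub> \<one>\<^bsub>S\<^esub> = x"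
    and smult_rsmult: "\<lbrakk>r \<in> carrier R; s \<in> carrier S; x \<in> carrier M\<rbrakk>
      \<Longrightarrow> (r \<odot>\<^bsub>M\<^esub> x) \<odot>\<^sup>r\<^bsub>M\<^esub> s = r \<odot>\<^bsub>M\<^esub> (x \<odot>\<^sup>r\<^bsub>M\<^esub> s)"

definition sub_bimodule ::
    "('a, 'y) ring_scheme \<Rightarrow> ('c, 'z) ring_scheme \<Rightarrow> 'b set \<Rightarrow> ('a, 'c, 'b) bimodule \<Rightarrow> bool"
  where "sub_bimodule R S N M \<longleftrightarrow> additive_subgroup N M
    \<and> (\<forall>r \<in> carrier R. \<forall>x \<in> N. r \<odot>\<^bsub>M\<^esub> x \<in> N)
    \<and> (\<forall>s \<in> carrier S. \<forall>x \<in> N. x \<odot>\<^sup>r\<^bsub>M\<^esub> s \<in> N)"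

definition fin_gen_bimodule ::
    "('a, 'y) ring_scheme \<Rightarrow> ('c, 'z) ring_scheme \<Rightarrow> ('a, 'c, 'b) bimodule \<Rightarrow> bool"
  where "fin_gen_bimodule R S M \<longleftrightarrow> bimodule R S M
    \<and> (\<exists>U. finite U \<and> U \<subseteq> carrier M \<and> (\<forall>N. sub_bimodule R S N M \<and> U \<subseteq> N \<longrightarrow> N = carrier M))"

text \<open>\<open>R\<close> and \<open>S\<close> are algebras over a ring with carrier \<open>A\<close> via the structure maps \<open>\<alpha>\<close> and \<open>\<beta>\<close>.\<close>

definition agreeing_actions ::
    "'d set \<Rightarrow> ('d \<Rightarrow> 'a) \<Rightarrow> ('d \<Rightarrow> 'c) \<Rightarrow> ('a, 'c, 'b) bimodule \<Rightarrow> bool"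
  where "agreeing_actions A \<alpha> \<beta> M \<longleftrightarrow> (\<forall>a \<in> A. \<forall>x \<in> carrier M. \<alpha> a \<odot>\<^bsub>M\<^esub> x = x \<odot>\<^sup>r\<^bsub>M\<^esub> \<beta> a)"

definition bimodule_iso ::
    "('a, 'y) ring_scheme \<Rightarrow> ('c, 'z) ring_scheme
      \<Rightarrow> ('a, 'c, 'm) bimodule \<Rightarrow> ('a, 'c, 'n) bimodule \<Rightarrow> ('m \<Rightarrow> 'n) set"
  where "bimodule_iso R S M N = {f \<in> iso (add_monoid M) (add_monoid N).
    (\<forall>r \<in> carrier R. \<forall>x \<in> carrier M. f (r \<odot>\<^bsub>M\<^esub> x) = r \<odot>\<^bsub>N\<^esub> f x) \<and>
    (\<forall>s \<in> carrier S. \<forall>x \<in> carrier M. f (x \<odot>\<^sup>r\<^bsub>M\<^esub> s) = f x \<odot>\<^sup>r\<^bsub>N\<^esub> s)}"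

text \<open>\<open>iso_class R S U M\<close> is the isomorphism class of \<open>M\<close> among the bimodules in \<open>U\<close>; the carrier of
  \<open>M\<close> may live in another type than the carriers of the elements of \<open>U\<close>.\<close>

definition iso_class ::
    "('a, 'y) ring_scheme \<Rightarrow> ('c, 'z) ring_scheme
      \<Rightarrow> ('a, 'c, 'n) bimodule set \<Rightarrow> ('a, 'c, 'm) bimodule \<Rightarrow> ('a, 'c, 'n) bimodule set"
  where "iso_class R S U M = {N \<in> U. bimodule_iso R S M N \<noteq> {}}"

definition iso_classes ::
    "('a, 'y) ring_scheme \<Rightarrow> ('c, 'z) ring_scheme
      \<Rightarrow> ('a, 'c, 'm) bimodule set \<Rightarrow> ('a, 'c, 'm) bimodule set set"
  where "iso_classes R S U = iso_class R S U ` U"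

definition induces_bijection ::
    "(('a, 'c, 'm) bimodule \<Rightarrow> ('a1, 'c1, 'k) bimodule)
      \<Rightarrow> ('a, 'y) ring_scheme \<Rightarrow> ('c, 'z) ring_scheme \<Rightarrow> ('a, 'c, 'm) bimodule set
      \<Rightarrow> ('a1, 'y1) ring_scheme \<Rightarrow> ('c1, 'z1) ring_scheme \<Rightarrow> ('a1, 'c1, 'n) bimodule set \<Rightarrow> bool"
  where "induces_bijection T R S U R' S' Y \<longleftrightarrow>
    (\<exists>\<Phi>. bij_betw \<Phi> (iso_classes R S U) (iso_classes R' S' Y)
      \<and> (\<forall>M \<in> U. \<Phi> (iso_class R S U M) = iso_class R' S' Y (T M)))"

text \<open>The quotient of \<open>M\<close> by a sub-bimodule \<open>N\<close>, as a bimodule over quotient rings of the rings acting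
  on \<open>M\<close>: scalars are cosets \<open>r\<close>, \<open>s\<close>, acting through any of their representatives.\<close>

definition quot_bimodule ::
    "('a, 'c, 'm) bimodule \<Rightarrow> 'm set \<Rightarrow> ('a set, 'c set, 'm set) bimodule"
  where "quot_bimodule M N =
    \<lparr>carrier = a_rcosets\<^bsub>M\<^esub> N, monoid.mult = undefined, one = undefined,
     ring.zero = N, add = set_add M,
     smult = (\<lambda>r U. \<Union>a \<in> r. \<Union>x \<in> U. N +>\<^bsub>M\<^esub> (a \<odot>\<^bsub>M\<^esub> x)),
     rsmult = (\<lambda>U s. \<Union>x \<in> U. \<Union>a \<in> s. N +>\<^bsub>M\<^esub> (x \<odot>\<^sup>r\<^bsub>M\<^esub> a))\<rparr>"


section \<open>Nonarchimedean local fields\<close>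

text \<open>The normalized discrete valuation \<open>v\<close> is integer valued; its value at zero, morally infinity,
  is irrelevant.\<close>

definition valuation_ring :: "('a, 'z) ring_scheme \<Rightarrow> ('a \<Rightarrow> int) \<Rightarrow> 'a set"
  where "valuation_ring F v = {x \<in> carrier F. x = \<zero>\<^bsub>F\<^esub> \<or> 0 \<le> v x}"

definition valuation_ideal :: "('a, 'z) ring_scheme \<Rightarrow> ('a \<Rightarrow> int) \<Rightarrow> 'a set"
  where "valuation_ideal F v = {x \<in> carrier F. x = \<zero>\<^bsub>F\<^esub> \<or> 0 < v x}"

definition v_close :: "('a, 'z) ring_scheme \<Rightarrow> ('a \<Rightarrow> int) \<Rightarrow> int \<Rightarrow> 'a \<Rightarrow> 'a \<Rightarrow> bool"
  where "v_close F v N x y \<longleftrightarrow> x \<ominus>\<^bsub>F\<^esub> y = \<zero>\<^bsub>F\<^esub> \<or> N \<le> v (x \<ominus>\<^bsub>F\<^esub> y)"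

locale nonarch_local_field = field F for F (structure) +
  fixes v :: "'a \<Rightarrow> int"
  assumes v_mult: "\<lbrakk>x \<in> carrier F - {\<zero>}; y \<in> carrier F - {\<zero>}\<rbrakk> \<Longrightarrow> v (x \<otimes> y) = v x + v y"
    and v_add: "\<lbrakk>x \<in> carrier F - {\<zero>}; y \<in> carrier F - {\<zero>}; x \<oplus> y \<noteq> \<zero>\<rbrakk>
      \<Longrightarrow> min (v x) (v y) \<le> v (x \<oplus> y)"
    and v_normalized: "\<exists>x \<in> carrier F - {\<zero>}. v x = 1"
    and v_complete: "\<lbrakk>range s \<subseteq> carrier F; \<And>N. \<exists>n0. \<forall>m \<ge> n0. \<forall>n \<ge> n0. v_close F v N (s m) (s n)\<rbrakk>
      \<Longrightarrow> \<exists>l \<in> carrier F. \<forall>N. \<exists>n0 :: nat. \<forall>n \<ge> n0. v_close F v N (s n) l"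
    and finite_residue_field:
      "finite (carrier (F\<lparr>carrier := valuation_ring F v\<rparr> Quot valuation_ideal F v))"


section \<open>Quaternion division algebras and their orders\<close>

locale quaternion_division_algebra = ring B for B (structure) +
  fixes F :: "'a set"
  assumes subfield: "subfield F B"
    and centre: "{z \<in> carrier B. \<forall>x \<in> carrier B. z \<otimes> x = x \<otimes> z} = F"
    and division: "Units B = carrier B - {\<zero>}"
    and dim_4: "dimension 4 F (carrier B)"

text \<open>An \<open>A\<close>-order, for a subring \<open>A\<close> with fraction field \<open>F\<close>, is a subring which is finitely generated
  as an \<open>A\<close>-module and spans the algebra over \<open>F\<close>.\<close>

definition is_order :: "('a, 'z) ring_scheme \<Rightarrow> 'a set \<Rightarrow> 'a set \<Rightarrow> 'a set \<Rightarrow> bool"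
  where "is_order B F A Q \<longleftrightarrow> subring Q B \<and> A \<subseteq> Q
    \<and> (\<exists>us. set us \<subseteq> carrier B \<and> Q = ring.Span B A us)
    \<and> (\<exists>us. set us \<subseteq> Q \<and> ring.Span B F us = carrier B)"

definition maximal_order :: "('a, 'z) ring_scheme \<Rightarrow> 'a set \<Rightarrow> 'a set \<Rightarrow> 'a set \<Rightarrow> bool"
  where "maximal_order B F A Q \<longleftrightarrow> is_order B F A Q
    \<and> (\<forall>Q'. is_order B F A Q' \<and> Q \<subseteq> Q' \<longrightarrow> Q' = Q)"

definition integral_closure :: "('a, 'z) ring_scheme \<Rightarrow> 'a set \<Rightarrow> 'a set \<Rightarrow> 'a set"
  where "integral_closure B A K =
    {x \<in> K. \<exists>p. p \<noteq> [] \<and> set p \<subseteq> A \<and> hd p = \<one>\<^bsub>B\<^esub> \<and> ring.eval B p x = \<zero>\<^bsub>B\<^esub>}"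

text \<open>Unramified means that a uniformizer of \<open>F\<close> generates the maximal ideal of the ring of integers of
  \<open>K\<close>; separability of the residue field extension is automatic, as residue fields are finite.\<close>

definition unramified_quadratic_extension ::
    "('a, 'z) ring_scheme \<Rightarrow> 'a set \<Rightarrow> ('a \<Rightarrow> int) \<Rightarrow> 'a set \<Rightarrow> bool"
  where "unramified_quadratic_extension B F v K \<longleftrightarrow>
    subfield K B \<and> F \<subseteq> K \<and> ring.dimension B 2 F K
    \<and> (\<exists>\<pi> \<in> F - {\<zero>\<^bsub>B\<^esub>}. v \<pi> = 1
        \<and> (let O\<^sub>K = integral_closure B (valuation_ring (B\<lparr>carrier := F\<rparr>) v) K
           in maximalideal (\<pi> <#\<^bsub>B\<^esub> O\<^sub>K) (B\<lparr>carrier := O\<^sub>K\<rparr>)))"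

text \<open>The quotient ring \<open>Q / xQ\<close> of a subring \<open>Q\<close> of \<open>B\<close>.\<close>

definition quot_by :: "('a, 'z) ring_scheme \<Rightarrow> 'a set \<Rightarrow> 'a \<Rightarrow> 'a set ring"
  where "quot_by B Q x = B\<lparr>carrier := Q\<rparr> Quot (x <#\<^bsub>B\<^esub> Q)"


section \<open>Bilattices, bimodules over the residue algebras, and truncations\<close>

definition bilattices :: "('a, 'z) ring_scheme \<Rightarrow> 'a set \<Rightarrow> 'a set \<Rightarrow> ('a, 'a, 'm) bimodule set"
  where "bilattices B A Q =
    {L. fin_gen_bimodule (B\<lparr>carrier := Q\<rparr>) (B\<lparr>carrier := Q\<rparr>) L
      \<and> agreeing_actions A id id L
      \<and> (\<forall>a \<in> A - {\<zero>\<^bsub>B\<^esub>}. \<forall>x \<in> carrier L. a \<odot>\<^bsub>L\<^esub> x = \<zero>\<^bsub>L\<^esub> \<longrightarrow> x = \<zero>\<^bsub>L\<^esub>)}"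

text \<open>Finitely generated \<open>(Q/xQ, Q/yQ)\<close>-bimodules with agreeing actions of \<open>A/\<pi>A\<close>.  The structure map
  from \<open>A/\<pi>A\<close> to \<open>Q/xQ\<close> sends a coset \<open>c\<close> to the coset \<open>c + xQ\<close>.\<close>

definition residue_bimodules ::
    "('a, 'z) ring_scheme \<Rightarrow> 'a set \<Rightarrow> 'a set \<Rightarrow> 'a \<Rightarrow> 'a \<Rightarrow> 'a \<Rightarrow> ('a set, 'a set, 'n) bimodule set"
  where "residue_bimodules B A Q \<pi> x y =
    {M. fin_gen_bimodule (quot_by B Q x) (quot_by B Q y) M
      \<and> agreeing_actions (carrier (quot_by B A \<pi>))
          (\<lambda>c. c <+>\<^bsub>B\<^esub> (x <#\<^bsub>B\<^esub> Q)) (\<lambda>c. c <+>\<^bsub>B\<^esub> (y <#\<^bsub>B\<^esub> Q)) M}"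

definition right_truncation :: "'a \<Rightarrow> ('a, 'a, 'm) bimodule \<Rightarrow> ('a set, 'a set, 'm set) bimodule"
  where "right_truncation P L = quot_bimodule L ((\<lambda>x. x \<odot>\<^sup>r\<^bsub>L\<^esub> P) ` carrier L)"

definition left_truncation :: "'a \<Rightarrow> ('a, 'a, 'm) bimodule \<Rightarrow> ('a set, 'a set, 'm set) bimodule"
  where "left_truncation P L = quot_bimodule L ((\<lambda>x. P \<odot>\<^bsub>L\<^esub> x) ` carrier L)"

end

theory Submission
  imports Defs
begin

text \<open>Write \<open>P\<close> for the uniformizer of \<open>O\<^sub>B\<close>.  In an \<open>(O\<^sub>B, O\<^sub>B)\<close>-bimodule an element \<open>x\<close> is
  homogeneous if \<open>a x = x a\<close> for all \<open>a \<in> O\<^sub>K\<close>, or \<open>a x = x \<sigma>(a)\<close> for all such \<open>a\<close>; as \<open>O\<^sub>K\<close> is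
  unramified over \<open>O\<^sub>F\<close>, every element is a sum of two homogeneous ones, compatibly with homomorphisms.
  A bimodule \<open>M\<close> killed by \<open>\<pi>\<close> on the left and by \<open>P\<close> on the right therefore has a homogeneous basis
  adapted to \<open>im P \<subseteq> ker P \<subseteq> M\<close>: vectors \<open>x\<close> and \<open>y = P x\<close>, and further vectors \<open>z\<close> killed by
  \<open>P\<close>.  It is the truncation of the bilattice with a right basis satisfying \<open>P x = y\<close>, \<open>P y = x P\<^sup>2\<close>
  and \<open>P z = z P\<close>.

  Conversely let \<open>M\<close> be the truncation of \<open>L\<close>.  The vectors \<open>x\<close>, \<open>y\<close> lift with these relations, but a
  prescribed \<open>z\<close> need not.  However, a descent argument shows that \<open>ker P\<close> is spanned by the
  reductions of homogeneous \<open>z \<in> L\<close> with \<open>P z = z P\<close>, so some adapted basis of \<open>M\<close> lifts.  By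
  Nakayama's lemma the lift is a right basis of \<open>L\<close>, and the numbers of vectors of each kind and degree
  depend on \<open>M\<close> only; hence so does \<open>L\<close>, up to isomorphism.\<close>

section \<open>Linear combinations in bimodules, homomorphisms\<close>

text \<open>The splitting into degrees needs some \<open>\<theta>\<close> in O_K with
  \<open>\<sigma> \<theta> - \<theta>\<close> a unit. Unramifiedness as defined only says that
  \<open>\<pi>\<close> generates the maximal ideal, so nontriviality of \<open>\<sigma>\<close>
  modulo \<open>\<pi>\<close> has to be proved; the finite residue field is used there. Lifting
  \<open>z\<close> from ker P fails as follows. A homogeneous lift \<open>x\<close> satisfies
  \<open>P x = y P\<close> for a unique \<open>y\<close>, and sending \<open>z\<close> to
  \<open>y\<close> mod P is well defined modulo im P, \<open>\<sigma>\<close>-semilinear, and an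
  involution because \<open>P P\<close> is central and acts alike on both sides. Liftable vectors
  are fixed by it, and the vectors \<open>x c + y \<sigma>(c)\<close> are its traces: that these
  span is Galois descent for a quadratic extension. Two lattices are compared through one free
  module given by structure constants, and dimensions are read off from cardinalities of finite
  spans. Residue bimodules become (O_B, O_B)-bimodules by restriction of scalars, so that a lattice
  and its truncation share one notion of homomorphism. As isomorphism classes are formed on fixed
  carrier types, existence also requires moving a bimodule into the given type along an
  injection.\<close>

lemma (in abelian_group) add_minus_cancel: "\<lbrakk>x \<in> carrier G; y \<in> carrier G\<rbrakk> \<Longrightarrow> (x \<ominus> y) \<oplus> y = x"
  by (simp add: a_minus_def a_assoc l_neg)

lemma (in abelian_group) minus_eq_zeroD:
  "\<lbrakk>x \<ominus> y = \<zero>; x \<in> carrier G; y \<in> carrier G\<rbrakk> \<Longrightarrow> x = y"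
  using add_minus_cancel[of x y] by simp

context bimodule
begin

lemma rsmult_zero: "x \<in> carrier M \<Longrightarrow> x \<odot>\<^sup>r\<^bsub>M\<^esub> \<zero>\<^bsub>S\<^esub> = \<zero>\<^bsub>M\<^esub>"
  using rsmult_r_distr[of "\<zero>\<^bsub>S\<^esub>" "\<zero>\<^bsub>S\<^esub>" x] rsmult_closed[of "\<zero>\<^bsub>S\<^esub>" x]
  by (metis M.add.r_cancel_one S.zero_closed S.r_zero)

lemma zero_rsmult: "s \<in> carrier S \<Longrightarrow> \<zero>\<^bsub>M\<^esub> \<odot>\<^sup>r\<^bsub>M\<^esub> s = \<zero>\<^bsub>M\<^esub>"
  using rsmult_l_distr[of s "\<zero>\<^bsub>M\<^esub>" "\<zero>\<^bsub>M\<^esub>"] rsmult_closed[of s "\<zero>\<^bsub>M\<^esub>"]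
  by (metis M.add.r_cancel_one M.zero_closed M.r_zero)

lemma zero_smult: "x \<in> carrier M \<Longrightarrow> \<zero>\<^bsub>R\<^esub> \<odot>\<^bsub>M\<^esub> x = \<zero>\<^bsub>M\<^esub>"
  using smult_l_distr[of "\<zero>\<^bsub>R\<^esub>" "\<zero>\<^bsub>R\<^esub>" x] smult_closed[of "\<zero>\<^bsub>R\<^esub>" x]
  by (metis M.add.r_cancel_one R.zero_closed R.r_zero)

lemma smult_zero: "r \<in> carrier R \<Longrightarrow> r \<odot>\<^bsub>M\<^esub> \<zero>\<^bsub>M\<^esub> = \<zero>\<^bsub>M\<^esub>"
  using smult_r_distr[of r "\<zero>\<^bsub>M\<^esub>" "\<zero>\<^bsub>M\<^esub>"] smult_closed[of r "\<zero>\<^bsub>M\<^esub>"]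
  by (metis M.add.r_cancel_one M.zero_closed M.r_zero)

lemma rsmult_minus:
  assumes "x \<in> carrier M" "s \<in> carrier S"
  shows "x \<odot>\<^sup>r\<^bsub>M\<^esub> (\<ominus>\<^bsub>S\<^esub> s) = \<ominus>\<^bsub>M\<^esub> (x \<odot>\<^sup>r\<^bsub>M\<^esub> s)"
  using assms rsmult_r_distr[of "\<ominus>\<^bsub>S\<^esub> s" s x]
  by (simp add: S.l_neg rsmult_zero rsmult_closed M.minus_equality)

lemma minus_rsmult:
  assumes "x \<in> carrier M" "s \<in> carrier S"
  shows "(\<ominus>\<^bsub>M\<^esub> x) \<odot>\<^sup>r\<^bsub>M\<^esub> s = \<ominus>\<^bsub>M\<^esub> (x \<odot>\<^sup>r\<^bsub>M\<^esub> s)"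
  using assms rsmult_l_distr[of s "\<ominus>\<^bsub>M\<^esub> x" x]
  by (simp add: M.l_neg zero_rsmult rsmult_closed M.minus_equality)

lemma smult_minus:
  assumes "x \<in> carrier M" "r \<in> carrier R"
  shows "r \<odot>\<^bsub>M\<^esub> (\<ominus>\<^bsub>M\<^esub> x) = \<ominus>\<^bsub>M\<^esub> (r \<odot>\<^bsub>M\<^esub> x)"
  using assms smult_r_distr[of r "\<ominus>\<^bsub>M\<^esub> x" x]
  by (simp add: M.l_neg smult_zero smult_closed M.minus_equality)

text \<open>Scalars stand on the right throughout: lattices are described by bases as right modules,
  and the left action is recorded by relations among the basis vectors.\<close>

definition lincomb :: "('i \<Rightarrow> 'c) \<Rightarrow> ('i \<Rightarrow> 'b) \<Rightarrow> 'i set \<Rightarrow> 'b"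
  where "lincomb c e I = (\<Oplus>\<^bsub>M\<^esub>i\<in>I. e i \<odot>\<^sup>r\<^bsub>M\<^esub> c i)"

lemma lincomb_closed:
  assumes "e \<in> I \<rightarrow> carrier M" "c \<in> I \<rightarrow> carrier S"
  shows "lincomb c e I \<in> carrier M"
  unfolding lincomb_def using assms by (intro M.finsum_closed) (auto intro: rsmult_closed)

lemma lincomb_cong:
  assumes "e \<in> I \<rightarrow> carrier M" "c \<in> I \<rightarrow> carrier S"
    "\<And>i. i \<in> I \<Longrightarrow> e i = e' i" "\<And>i. i \<in> I \<Longrightarrow> c i = c' i"
  shows "lincomb c e I = lincomb c' e' I"
proof -
  have "(\<lambda>i. e' i \<odot>\<^sup>r\<^bsub>M\<^esub> c' i) \<in> I \<rightarrow> carrier M"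
  proof
    fix i assume "i \<in> I"
    then show "e' i \<odot>\<^sup>r\<^bsub>M\<^esub> c' i \<in> carrier M"
      using assms rsmult_closed[of "c i" "e i"] by (auto simp: Pi_iff)
  qed
  then show ?thesis
    unfolding lincomb_def using assms by (intro M.finsum_cong') auto
qed

lemma lincomb_insert:
  assumes "finite I" "j \<notin> I" "e \<in> insert j I \<rightarrow> carrier M" "c \<in> insert j I \<rightarrow> carrier S"
  shows "lincomb c e (insert j I) = e j \<odot>\<^sup>r\<^bsub>M\<^esub> c j \<oplus>\<^bsub>M\<^esub> lincomb c e I"
  unfolding lincomb_def using assms
  by (intro M.finsum_insert) (auto intro: rsmult_closed)

lemma lincomb_empty [simp]: "lincomb c e {} = \<zero>\<^bsub>M\<^esub>"
  by (simp add: lincomb_def)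

lemma lincomb_add:
  assumes "e \<in> I \<rightarrow> carrier M" "c \<in> I \<rightarrow> carrier S" "c' \<in> I \<rightarrow> carrier S"
  shows "lincomb (\<lambda>i. c i \<oplus>\<^bsub>S\<^esub> c' i) e I = lincomb c e I \<oplus>\<^bsub>M\<^esub> lincomb c' e I"
proof -
  have "lincomb (\<lambda>i. c i \<oplus>\<^bsub>S\<^esub> c' i) e I = (\<Oplus>\<^bsub>M\<^esub>i\<in>I. e i \<odot>\<^sup>r\<^bsub>M\<^esub> c i \<oplus>\<^bsub>M\<^esub> e i \<odot>\<^sup>r\<^bsub>M\<^esub> c' i)"
    unfolding lincomb_def using assms
    by (intro M.finsum_cong') (auto intro!: rsmult_r_distr M.a_closed rsmult_closed)
  also have "\<dots> = lincomb c e I \<oplus>\<^bsub>M\<^esub> lincomb c' e I"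
    unfolding lincomb_def using assms
    by (intro M.finsum_addf) (auto intro: rsmult_closed)
  finally show ?thesis .
qed

lemma lincomb_rsmult:
  assumes "finite I" "e \<in> I \<rightarrow> carrier M" "c \<in> I \<rightarrow> carrier S" "s \<in> carrier S"
  shows "lincomb (\<lambda>i. c i \<otimes>\<^bsub>S\<^esub> s) e I = lincomb c e I \<odot>\<^sup>r\<^bsub>M\<^esub> s"
  using assms
proof (induction I rule: finite_induct)
  case (insert j I)
  then show ?case
    by (simp add: lincomb_insert Pi_iff rsmult_assoc rsmult_l_distr rsmult_closed lincomb_closed)
qed (simp add: zero_rsmult)

lemma lincomb_smult:
  assumes "finite I" "e \<in> I \<rightarrow> carrier M" "c \<in> I \<rightarrow> carrier S" "r \<in> carrier R"
  shows "lincomb c (\<lambda>i. r \<odot>\<^bsub>M\<^esub> e i) I = r \<odot>\<^bsub>M\<^esub> lincomb c e I"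
  using assms
proof (induction I rule: finite_induct)
  case (insert j I)
  then show ?case
    by (simp add: lincomb_insert Pi_iff smult_rsmult smult_r_distr rsmult_closed smult_closed lincomb_closed)
qed (simp add: smult_zero)

lemma lincomb_zero:
  assumes "\<And>i. i \<in> I \<Longrightarrow> e i \<odot>\<^sup>r\<^bsub>M\<^esub> c i = \<zero>\<^bsub>M\<^esub>"
  shows "lincomb c e I = \<zero>\<^bsub>M\<^esub>"
proof -
  have "lincomb c e I = (\<Oplus>\<^bsub>M\<^esub>i\<in>I. \<zero>\<^bsub>M\<^esub>)"
    unfolding lincomb_def using assms by (intro M.finsum_cong') auto
  then show ?thesis by simp
qed

lemma lincomb_reindex:
  assumes "inj_on h I" "e \<in> h ` I \<rightarrow> carrier M" "c \<in> h ` I \<rightarrow> carrier S"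
  shows "lincomb c e (h ` I) = lincomb (\<lambda>i. c (h i)) (\<lambda>i. e (h i)) I"
  unfolding lincomb_def using assms
  by (intro M.finsum_reindex) (auto intro!: rsmult_closed simp: Pi_iff)

lemma lincomb_Un:
  assumes "finite I" "finite J" "I \<inter> J = {}"
    "e \<in> I \<union> J \<rightarrow> carrier M" "c \<in> I \<union> J \<rightarrow> carrier S"
  shows "lincomb c e (I \<union> J) = lincomb c e I \<oplus>\<^bsub>M\<^esub> lincomb c e J"
  unfolding lincomb_def using assms
  by (intro M.finsum_Un_disjoint) (auto intro!: rsmult_closed simp: Pi_iff)

lemma lincomb_minus:
  assumes "finite I" "e \<in> I \<rightarrow> carrier M" "c \<in> I \<rightarrow> carrier S"
  shows "lincomb (\<lambda>i. \<ominus>\<^bsub>S\<^esub> c i) e I = \<ominus>\<^bsub>M\<^esub> lincomb c e I"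
  using assms
proof (induction I rule: finite_induct)
  case (insert j I)
  then show ?case
    by (simp add: lincomb_insert Pi_iff rsmult_minus rsmult_closed lincomb_closed M.minus_add)
qed (metis M.l_zero M.minus_equality M.zero_closed lincomb_empty)

definition right_submodule :: "'b set \<Rightarrow> bool"
  where "right_submodule H \<longleftrightarrow> H \<subseteq> carrier M \<and> \<zero>\<^bsub>M\<^esub> \<in> H
    \<and> (\<forall>x \<in> H. \<forall>y \<in> H. x \<oplus>\<^bsub>M\<^esub> y \<in> H) \<and> (\<forall>x \<in> H. \<forall>s \<in> carrier S. x \<odot>\<^sup>r\<^bsub>M\<^esub> s \<in> H)"

lemma right_submoduleD:
  assumes "right_submodule H"
  shows "\<And>x. x \<in> H \<Longrightarrow> x \<in> carrier M" "\<zero>\<^bsub>M\<^esub> \<in> H"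
    "\<And>x y. x \<in> H \<Longrightarrow> y \<in> H \<Longrightarrow> x \<oplus>\<^bsub>M\<^esub> y \<in> H"
    "\<And>x s. x \<in> H \<Longrightarrow> s \<in> carrier S \<Longrightarrow> x \<odot>\<^sup>r\<^bsub>M\<^esub> s \<in> H"
    "\<And>x. x \<in> H \<Longrightarrow> \<ominus>\<^bsub>M\<^esub> x \<in> H"
    "\<And>x y. x \<in> H \<Longrightarrow> y \<in> H \<Longrightarrow> x \<ominus>\<^bsub>M\<^esub> y \<in> H"
proof -
  show 1: "\<And>x. x \<in> H \<Longrightarrow> x \<in> carrier M" "\<zero>\<^bsub>M\<^esub> \<in> H"
    and 2: "\<And>x y. x \<in> H \<Longrightarrow> y \<in> H \<Longrightarrow> x \<oplus>\<^bsub>M\<^esub> y \<in> H"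
    and 3: "\<And>x s. x \<in> H \<Longrightarrow> s \<in> carrier S \<Longrightarrow> x \<odot>\<^sup>r\<^bsub>M\<^esub> s \<in> H"
    using assms by (auto simp: right_submodule_def)
  show 4: "\<And>x. x \<in> H \<Longrightarrow> \<ominus>\<^bsub>M\<^esub> x \<in> H"
    using 1 3[of _ "\<ominus>\<^bsub>S\<^esub> \<one>\<^bsub>S\<^esub>"] by (simp add: rsmult_minus rsmult_one)
  show "\<And>x y. x \<in> H \<Longrightarrow> y \<in> H \<Longrightarrow> x \<ominus>\<^bsub>M\<^esub> y \<in> H"
    using 2 4 by (simp add: a_minus_def)
qed

text \<open>Intersecting \<open>G\<close> with the carrier puts the whole module into the family for
  every \<open>G\<close>, so the span is always a submodule.\<close>

definition right_span :: "'b set \<Rightarrow> 'b set"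
  where "right_span G = \<Inter> {H. right_submodule H \<and> G \<inter> carrier M \<subseteq> H}"

lemma right_submodule_carrier: "right_submodule (carrier M)"
  by (auto simp: right_submodule_def rsmult_closed)

lemma right_submodule_span: "right_submodule (right_span G)"
  using right_submodule_carrier unfolding right_span_def
  by (auto simp: right_submodule_def)

lemma right_span_superset: "G \<subseteq> carrier M \<Longrightarrow> G \<subseteq> right_span G"
  unfolding right_span_def by auto

lemma right_span_least: "right_submodule H \<Longrightarrow> G \<subseteq> H \<Longrightarrow> right_span G \<subseteq> H"
  unfolding right_span_def by auto

lemma right_span_mono: "G \<subseteq> G' \<Longrightarrow> right_span G \<subseteq> right_span G'"
  unfolding right_span_def by auto

lemma lincomb_in_submodule:
  assumes "finite I" "right_submodule H" "e \<in> I \<rightarrow> H" "c \<in> I \<rightarrow> carrier S"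
  shows "lincomb c e I \<in> H"
  using assms
proof (induction I rule: finite_induct)
  case (insert j I)
  then have "e \<in> I \<rightarrow> carrier M" "e j \<in> carrier M"
    using right_submoduleD(1)[OF insert.prems(1)] by auto
  with insert show ?case
    by (simp add: lincomb_insert Pi_iff right_submoduleD)
qed (simp add: right_submoduleD)

lemma right_span_image_eq:
  assumes "finite I" "e \<in> I \<rightarrow> carrier M"
  shows "right_span (e ` I) = {lincomb c e I | c. c \<in> I \<rightarrow> carrier S}" (is "_ = ?T")
proof
  have "right_submodule ?T"
    unfolding right_submodule_def
  proof (intro conjI ballI)
    show "?T \<subseteq> carrier M" using assms lincomb_closed by auto
    have "lincomb (\<lambda>_. \<zero>\<^bsub>S\<^esub>) e I = \<zero>\<^bsub>M\<^esub>"
      using assms by (intro lincomb_zero) (auto intro: rsmult_zero)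
    then show "\<zero>\<^bsub>M\<^esub> \<in> ?T" by (auto intro!: exI[of _ "\<lambda>_. \<zero>\<^bsub>S\<^esub>"])
  next
    fix x y assume "x \<in> ?T" "y \<in> ?T"
    then obtain c c' where "x = lincomb c e I" "c \<in> I \<rightarrow> carrier S"
      "y = lincomb c' e I" "c' \<in> I \<rightarrow> carrier S" by auto
    then show "x \<oplus>\<^bsub>M\<^esub> y \<in> ?T"
      using assms by (auto intro!: exI[of _ "\<lambda>i. c i \<oplus>\<^bsub>S\<^esub> c' i"] simp: lincomb_add Pi_iff)
  next
    fix x s assume "x \<in> ?T" "s \<in> carrier S"
    then obtain c where "x = lincomb c e I" "c \<in> I \<rightarrow> carrier S" by auto
    then show "x \<odot>\<^sup>r\<^bsub>M\<^esub> s \<in> ?T"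
      using assms \<open>s \<in> carrier S\<close>
      by (auto intro!: exI[of _ "\<lambda>i. c i \<otimes>\<^bsub>S\<^esub> s"] simp: lincomb_rsmult Pi_iff)
  qed
  moreover have "e ` I \<subseteq> ?T"
  proof
    fix x assume "x \<in> e ` I"
    then obtain j where j: "j \<in> I" "x = e j" by auto
    let ?c = "\<lambda>i. if i = j then \<one>\<^bsub>S\<^esub> else \<zero>\<^bsub>S\<^esub>"
    have I: "I = insert j (I - {j})" using j by auto
    have "lincomb ?c e I = lincomb ?c e (insert j (I - {j}))" using I by metis
    also have "\<dots> = e j \<odot>\<^sup>r\<^bsub>M\<^esub> ?c j \<oplus>\<^bsub>M\<^esub> lincomb ?c e (I - {j})"
      using assms j by (intro lincomb_insert) auto
    also have "lincomb ?c e (I - {j}) = \<zero>\<^bsub>M\<^esub>"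
      using assms by (intro lincomb_zero) (auto intro: rsmult_zero)
    finally have "lincomb ?c e I = x"
      using assms j by (simp add: rsmult_one Pi_iff)
    then show "x \<in> ?T" using assms by (auto intro!: exI[of _ ?c])
  qed
  ultimately show "right_span (e ` I) \<subseteq> ?T" by (rule right_span_least)
  have "e \<in> I \<rightarrow> right_span (e ` I)" using right_span_superset[of "e ` I"] assms(2) by auto
  then show "?T \<subseteq> right_span (e ` I)"
    using lincomb_in_submodule[OF assms(1) right_submodule_span] by auto
qed

lemma right_span_eq:
  assumes "finite G" "G \<subseteq> carrier M"
  shows "right_span G = {lincomb c (\<lambda>x. x) G | c. c \<in> G \<rightarrow> carrier S}"
  using right_span_image_eq[of G "\<lambda>x. x"] assms by auto

text \<open>The elements \<open>g s + h\<close> form a right submodule. Splitting off one generator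
  is what the induction for Nakayama's lemma consumes.\<close>

lemma right_span_insert:
  assumes "g \<in> carrier M" "G \<subseteq> carrier M" "x \<in> right_span (insert g G)"
  shows "\<exists>s \<in> carrier S. \<exists>h \<in> right_span G. x = g \<odot>\<^sup>r\<^bsub>M\<^esub> s \<oplus>\<^bsub>M\<^esub> h"
proof -
  note sp = right_submoduleD[OF right_submodule_span[of G]]
  let ?T = "{g \<odot>\<^sup>r\<^bsub>M\<^esub> s \<oplus>\<^bsub>M\<^esub> h | s h. s \<in> carrier S \<and> h \<in> right_span G}"
  have "right_submodule ?T"
    unfolding right_submodule_def
  proof (intro conjI ballI)
    show "?T \<subseteq> carrier M" using assms sp(1) by (auto intro: rsmult_closed)
    show "\<zero>\<^bsub>M\<^esub> \<in> ?T" using assms sp(2)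
      by (auto intro!: exI[of _ "\<zero>\<^bsub>S\<^esub>"] exI[of _ "\<zero>\<^bsub>M\<^esub>"] simp: rsmult_zero)
  next
    fix x y assume "x \<in> ?T" "y \<in> ?T"
    then obtain s h s' h' where x: "x = g \<odot>\<^sup>r\<^bsub>M\<^esub> s \<oplus>\<^bsub>M\<^esub> h" "s \<in> carrier S" "h \<in> right_span G"
      and y: "y = g \<odot>\<^sup>r\<^bsub>M\<^esub> s' \<oplus>\<^bsub>M\<^esub> h'" "s' \<in> carrier S" "h' \<in> right_span G" by auto
    have "x \<oplus>\<^bsub>M\<^esub> y = g \<odot>\<^sup>r\<^bsub>M\<^esub> (s \<oplus>\<^bsub>S\<^esub> s') \<oplus>\<^bsub>M\<^esub> (h \<oplus>\<^bsub>M\<^esub> h')"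
      using assms(1) x(1,2) y(1,2) sp(1)[OF x(3)] sp(1)[OF y(3)] M.add.m_assoc M.add.m_comm M.add.m_lcomm
      by (simp add: rsmult_r_distr rsmult_closed)
    then show "x \<oplus>\<^bsub>M\<^esub> y \<in> ?T" using x y sp(3) by blast
  next
    fix x t assume "x \<in> ?T" and t: "t \<in> carrier S"
    then obtain s h where x: "x = g \<odot>\<^sup>r\<^bsub>M\<^esub> s \<oplus>\<^bsub>M\<^esub> h" "s \<in> carrier S" "h \<in> right_span G" by auto
    have "x \<odot>\<^sup>r\<^bsub>M\<^esub> t = g \<odot>\<^sup>r\<^bsub>M\<^esub> (s \<otimes>\<^bsub>S\<^esub> t) \<oplus>\<^bsub>M\<^esub> (h \<odot>\<^sup>r\<^bsub>M\<^esub> t)"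
      using assms x t sp(1) by (simp add: rsmult_assoc rsmult_l_distr rsmult_closed)
    then show "x \<odot>\<^sup>r\<^bsub>M\<^esub> t \<in> ?T" using x t sp(4) by blast
  qed
  moreover have "insert g G \<subseteq> ?T"
  proof
    fix x assume "x \<in> insert g G"
    then consider "x = g" | "x \<in> right_span G" using right_span_superset[OF assms(2)] by auto
    then show "x \<in> ?T"
    proof cases
      case 1
      then show ?thesis using assms sp(2)
        by (auto intro!: exI[of _ "\<one>\<^bsub>S\<^esub>"] exI[of _ "\<zero>\<^bsub>M\<^esub>"] simp: rsmult_one)
    next
      case 2
      then show ?thesis using assms sp(1)
        by (auto intro!: exI[of _ "\<zero>\<^bsub>S\<^esub>"] exI[of _ x] simp: rsmult_zero)
    qed
  qed
  ultimately have "right_span (insert g G) \<subseteq> ?T" by (rule right_span_least)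
  then show ?thesis using assms(3) by blast
qed

end


section \<open>Homomorphisms of bimodules\<close>

definition bimodule_hom ::
    "('a, 'y) ring_scheme \<Rightarrow> ('c, 'z) ring_scheme
      \<Rightarrow> ('a, 'c, 'm) bimodule \<Rightarrow> ('a, 'c, 'n) bimodule \<Rightarrow> ('m \<Rightarrow> 'n) set"
  where "bimodule_hom R S M N = {f \<in> hom (add_monoid M) (add_monoid N).
    (\<forall>r \<in> carrier R. \<forall>x \<in> carrier M. f (r \<odot>\<^bsub>M\<^esub> x) = r \<odot>\<^bsub>N\<^esub> f x) \<and>
    (\<forall>s \<in> carrier S. \<forall>x \<in> carrier M. f (x \<odot>\<^sup>r\<^bsub>M\<^esub> s) = f x \<odot>\<^sup>r\<^bsub>N\<^esub> s)}"

lemma bimodule_hom_closed: "f \<in> bimodule_hom R S M N \<Longrightarrow> x \<in> carrier M \<Longrightarrow> f x \<in> carrier N"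
  and bimodule_hom_add: "f \<in> bimodule_hom R S M N \<Longrightarrow> x \<in> carrier M \<Longrightarrow> y \<in> carrier M
      \<Longrightarrow> f (x \<oplus>\<^bsub>M\<^esub> y) = f x \<oplus>\<^bsub>N\<^esub> f y"
  and bimodule_hom_smult: "f \<in> bimodule_hom R S M N \<Longrightarrow> x \<in> carrier M \<Longrightarrow> r \<in> carrier R
      \<Longrightarrow> f (r \<odot>\<^bsub>M\<^esub> x) = r \<odot>\<^bsub>N\<^esub> f x"
  and bimodule_hom_rsmult: "f \<in> bimodule_hom R S M N \<Longrightarrow> x \<in> carrier M \<Longrightarrow> s \<in> carrier S
      \<Longrightarrow> f (x \<odot>\<^sup>r\<^bsub>M\<^esub> s) = f x \<odot>\<^sup>r\<^bsub>N\<^esub> s"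
  by (auto simp: bimodule_hom_def hom_def)

lemma bimodule_homI:
  assumes "\<And>x. x \<in> carrier M \<Longrightarrow> f x \<in> carrier N"
    "\<And>x y. x \<in> carrier M \<Longrightarrow> y \<in> carrier M \<Longrightarrow> f (x \<oplus>\<^bsub>M\<^esub> y) = f x \<oplus>\<^bsub>N\<^esub> f y"
    "\<And>r x. r \<in> carrier R \<Longrightarrow> x \<in> carrier M \<Longrightarrow> f (r \<odot>\<^bsub>M\<^esub> x) = r \<odot>\<^bsub>N\<^esub> f x"
    "\<And>s x. s \<in> carrier S \<Longrightarrow> x \<in> carrier M \<Longrightarrow> f (x \<odot>\<^sup>r\<^bsub>M\<^esub> s) = f x \<odot>\<^sup>r\<^bsub>N\<^esub> s"
  shows "f \<in> bimodule_hom R S M N"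
  using assms by (auto simp: bimodule_hom_def hom_def)

lemma bimodule_iso_iff:
  "f \<in> bimodule_iso R S M N \<longleftrightarrow> f \<in> bimodule_hom R S M N \<and> bij_betw f (carrier M) (carrier N)"
  by (auto simp: bimodule_iso_def bimodule_hom_def iso_def)

lemma bimodule_hom_comp:
  assumes "f \<in> bimodule_hom R S L M" "g \<in> bimodule_hom R S M N"
  shows "(\<lambda>x. g (f x)) \<in> bimodule_hom R S L N"
  using assms by (auto simp: bimodule_hom_def hom_def Pi_iff)

lemma bimodule_iso_comp:
  assumes "f \<in> bimodule_iso R S L M" "g \<in> bimodule_iso R S M N"
  shows "(\<lambda>x. g (f x)) \<in> bimodule_iso R S L N"
  using assms bimodule_hom_comp[of f R S L M g N] bij_betw_trans[of f _ _ g]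
  by (auto simp: bimodule_iso_iff comp_def)

text \<open>Membership in \<open>hom\<close> does not include preservation of the unit; right
  linearity applied to \<open>0 = 0 s\<close> with \<open>s = 0\<close> provides it.\<close>

lemma bimodule_hom_zero:
  assumes "bimodule R S M" "bimodule R S N" "f \<in> bimodule_hom R S M N"
  shows "f \<zero>\<^bsub>M\<^esub> = \<zero>\<^bsub>N\<^esub>"
proof -
  interpret M: bimodule R S M by fact
  interpret N: bimodule R S N by fact
  have "f \<zero>\<^bsub>M\<^esub> = f (\<zero>\<^bsub>M\<^esub> \<odot>\<^sup>r\<^bsub>M\<^esub> \<zero>\<^bsub>S\<^esub>)" by (simp add: M.zero_rsmult)
  also have "\<dots> = \<zero>\<^bsub>N\<^esub>"
    using assms(3) by (simp add: bimodule_hom_rsmult N.rsmult_zero bimodule_hom_closed)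
  finally show ?thesis .
qed

lemma bimodule_hom_minus:
  assumes "bimodule R S M" "bimodule R S N" "f \<in> bimodule_hom R S M N"
    "x \<in> carrier M" "y \<in> carrier M"
  shows "f (x \<ominus>\<^bsub>M\<^esub> y) = f x \<ominus>\<^bsub>N\<^esub> f y"
proof -
  interpret M: bimodule R S M by fact
  interpret N: bimodule R S N by fact
  have "f (\<ominus>\<^bsub>M\<^esub> y) = f (y \<odot>\<^sup>r\<^bsub>M\<^esub> (\<ominus>\<^bsub>S\<^esub> \<one>\<^bsub>S\<^esub>))"
    using assms by (simp add: M.rsmult_minus M.rsmult_one)
  also have "\<dots> = \<ominus>\<^bsub>N\<^esub> f y"
    using assms(3-) by (simp add: bimodule_hom_rsmult N.rsmult_minus N.rsmult_one bimodule_hom_closed)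
  finally show ?thesis
    using assms by (simp add: a_minus_def bimodule_hom_add)
qed

lemma bimodule_hom_lincomb:
  assumes "bimodule R S M" "bimodule R S N" "f \<in> bimodule_hom R S M N"
    "finite I" "e \<in> I \<rightarrow> carrier M" "c \<in> I \<rightarrow> carrier S"
  shows "f (bimodule.lincomb M c e I) = bimodule.lincomb N c (\<lambda>i. f (e i)) I"
proof -
  interpret M: bimodule R S M by fact
  interpret N: bimodule R S N by fact
  from assms(4-) show ?thesis
  proof (induction I rule: finite_induct)
    case empty
    show ?case using bimodule_hom_zero[OF assms(1-3)] by simp
  next
    case (insert j I)
    then have "f (M.lincomb c e (insert j I)) = f (e j) \<odot>\<^sup>r\<^bsub>N\<^esub> c j \<oplus>\<^bsub>N\<^esub> f (M.lincomb c e I)"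
      using assms(3)
      by (simp add: M.lincomb_insert Pi_iff bimodule_hom_add[OF assms(3)] M.rsmult_closed
          M.lincomb_closed bimodule_hom_rsmult[OF assms(3)])
    with insert show ?case
      using bimodule_hom_closed[OF assms(3)] by (simp add: N.lincomb_insert Pi_iff)
  qed
qed

lemma bimodule_iso_sym:
  assumes "bimodule R S M" "f \<in> bimodule_iso R S M N"
  shows "inv_into (carrier M) f \<in> bimodule_iso R S N M"
proof -
  interpret M: bimodule R S M by fact
  have f: "f \<in> bimodule_hom R S M N" and b: "bij_betw f (carrier M) (carrier N)"
    using assms(2) by (auto simp: bimodule_iso_iff)
  let ?g = "inv_into (carrier M) f"
  have gc: "?g y \<in> carrier M" and fg: "f (?g y) = y" if "y \<in> carrier N" for y
    using that b by (auto simp: bij_betw_def inv_into_into f_inv_into_f)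
  have eq: "?g y = x" if "x \<in> carrier M" "y = f x" for x y
    using that b by (simp add: bij_betw_def)
  have "?g \<in> bimodule_hom R S N M"
    by (rule bimodule_homI)
      (auto intro!: eq gc M.smult_closed M.rsmult_closed M.a_closed
        simp: bimodule_hom_add[OF f] bimodule_hom_smult[OF f] bimodule_hom_rsmult[OF f] gc fg)
  with b show ?thesis by (auto simp: bimodule_iso_iff bij_betw_inv_into)
qed

lemma bimodule_iso_refl: "(\<lambda>x. x) \<in> bimodule_iso R S M M"
  by (auto simp: bimodule_iso_iff bimodule_hom_def hom_def bij_betw_def)

section \<open>Quaternionic orders\<close>

text \<open>\<open>C\<close>, \<open>A\<close> and \<open>P\<close> stand for \<open>O\<^sub>K\<close>, \<open>O\<^sub>F\<close> and the uniformizer of \<open>O\<^sub>B\<close>, and \<open>\<theta>\<close> generates \<open>C\<close>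
  over \<open>A\<close>.  All axioms are symmetric under passing to the opposite ring; this is how the left
  truncation is reduced to the right one.\<close>

locale quat_order = R: ring R for R (structure) +
  fixes C A :: "'a set" and \<pi> P \<theta> \<eta> :: 'a and \<sigma> :: "'a \<Rightarrow> 'a"
  assumes C_subring: "subring C R" and A_subset: "A \<subseteq> C"
    and C_comm: "\<lbrakk>a \<in> C; b \<in> C\<rbrakk> \<Longrightarrow> a \<otimes> b = b \<otimes> a"
    and A_central: "\<lbrakk>a \<in> A; r \<in> carrier R\<rbrakk> \<Longrightarrow> a \<otimes> r = r \<otimes> a"
    and P_closed: "P \<in> carrier R" and P_square: "P \<otimes> P = \<pi>"
    and \<sigma>_closed: "a \<in> C \<Longrightarrow> \<sigma> a \<in> C"
    and \<sigma>_add: "\<lbrakk>a \<in> C; b \<in> C\<rbrakk> \<Longrightarrow> \<sigma> (a \<oplus> b) = \<sigma> a \<oplus> \<sigma> b"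
    and \<sigma>_mult: "\<lbrakk>a \<in> C; b \<in> C\<rbrakk> \<Longrightarrow> \<sigma> (a \<otimes> b) = \<sigma> a \<otimes> \<sigma> b"
    and \<sigma>_\<sigma>: "a \<in> C \<Longrightarrow> \<sigma> (\<sigma> a) = a"
    and \<sigma>_A: "a \<in> A \<Longrightarrow> \<sigma> a = a"
    and P_comm: "a \<in> C \<Longrightarrow> P \<otimes> a = \<sigma> a \<otimes> P"
    and decomp_ex: "r \<in> carrier R \<Longrightarrow> \<exists>a \<in> C. \<exists>b \<in> C. r = a \<oplus> b \<otimes> P"
    and decomp_unique: "\<lbrakk>a \<in> C; b \<in> C; a \<oplus> b \<otimes> P = \<zero>\<rbrakk> \<Longrightarrow> a = \<zero> \<and> b = \<zero>"
    and \<pi>_A: "\<pi> \<in> A" and \<pi>_nonzero: "\<pi> \<noteq> \<zero>"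
    and \<theta>_C: "\<theta> \<in> C" and \<eta>_C: "\<eta> \<in> C" and \<eta>_inv: "(\<sigma> \<theta> \<ominus> \<theta>) \<otimes> \<eta> = \<one>"
    and trace_A: "\<theta> \<oplus> \<sigma> \<theta> \<in> A" and norm_A: "\<theta> \<otimes> \<sigma> \<theta> \<in> A"
    and C_gen: "c \<in> C \<Longrightarrow> \<exists>s \<in> A. \<exists>t \<in> A. c = s \<oplus> t \<otimes> \<theta>"
    and C_local: "c \<in> C \<Longrightarrow> (\<exists>b \<in> C. c \<otimes> b = \<one>) \<or> (\<exists>b \<in> C. c = \<pi> \<otimes> b)"
    and \<pi>_nonunit: "b \<in> C \<Longrightarrow> \<pi> \<otimes> b \<noteq> \<one>"
    and separated: "\<lbrakk>r \<in> carrier R; \<And>n::nat. \<exists>s \<in> carrier R. r = s \<otimes> \<pi> [^] n\<rbrakk> \<Longrightarrow> r = \<zero>"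
    and torsion_free: "\<lbrakk>a \<in> A; a \<noteq> \<zero>; r \<in> carrier R; a \<otimes> r = \<zero>\<rbrakk> \<Longrightarrow> r = \<zero>"
    and residue_finite: "\<exists>D. finite D \<and> D \<subseteq> C \<and> (\<forall>c \<in> C. \<exists>d \<in> D. \<exists>b \<in> C. c = d \<oplus> \<pi> \<otimes> b)"
begin

lemma C_closed [simp]: "a \<in> C \<Longrightarrow> a \<in> carrier R"
  using subringE(1)[OF C_subring] by auto

lemma C_ops: "\<zero> \<in> C" "\<one> \<in> C" "a \<in> C \<Longrightarrow> \<ominus> a \<in> C"
  "\<lbrakk>a \<in> C; b \<in> C\<rbrakk> \<Longrightarrow> a \<oplus> b \<in> C" "\<lbrakk>a \<in> C; b \<in> C\<rbrakk> \<Longrightarrow> a \<otimes> b \<in> C"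
  "\<lbrakk>a \<in> C; b \<in> C\<rbrakk> \<Longrightarrow> a \<ominus> b \<in> C"
  using subringE[OF C_subring] by (auto simp: a_minus_def)

lemma A_C: "a \<in> A \<Longrightarrow> a \<in> C"
  using A_subset by auto

lemma A_closed [simp]: "a \<in> A \<Longrightarrow> a \<in> carrier R"
  using A_C by simp

lemma \<pi>_C: "\<pi> \<in> C" and \<pi>_closed [simp]: "\<pi> \<in> carrier R"
  using \<pi>_A A_subset by auto

declare P_closed [simp]

lemma C_P: "a \<in> C \<Longrightarrow> a \<otimes> P = P \<otimes> \<sigma> a"
  by (simp add: P_comm \<sigma>_closed \<sigma>_\<sigma>)

lemma \<sigma>_zero: "\<sigma> \<zero> = \<zero>"
  using \<sigma>_add[of \<zero> \<zero>] \<sigma>_closed[of \<zero>] by (simp add: C_ops R.add.r_cancel_one')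

lemma \<sigma>_one: "\<sigma> \<one> = \<one>"
  using \<sigma>_mult[of \<one> "\<sigma> \<one>"] \<sigma>_closed[of \<one>] by (simp add: C_ops \<sigma>_\<sigma>)

text \<open>Degrees are booleans, \<open>True\<close> meaning a twist by \<open>\<sigma>\<close>;
  inequality of booleans then plays the role of addition in Z/2.\<close>

definition twist :: "bool \<Rightarrow> 'a \<Rightarrow> 'a"
  where "twist d a = (if d then \<sigma> a else a)"

lemma twist_closed: "a \<in> C \<Longrightarrow> twist d a \<in> C"
  by (simp add: twist_def \<sigma>_closed)

lemma twist_carrier [simp]: "a \<in> C \<Longrightarrow> twist d a \<in> carrier R"
  by (simp add: twist_closed)

lemma twist_add: "\<lbrakk>a \<in> C; b \<in> C\<rbrakk> \<Longrightarrow> twist d (a \<oplus> b) = twist d a \<oplus> twist d b"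
  and twist_mult: "\<lbrakk>a \<in> C; b \<in> C\<rbrakk> \<Longrightarrow> twist d (a \<otimes> b) = twist d a \<otimes> twist d b"
  and twist_\<sigma>: "a \<in> C \<Longrightarrow> twist d (\<sigma> a) = twist (\<not> d) a"
  and \<sigma>_twist: "a \<in> C \<Longrightarrow> \<sigma> (twist d a) = twist (\<not> d) a"
  and twist_A: "a \<in> A \<Longrightarrow> twist d a = a"
  and twist_one: "twist d \<one> = \<one>"
  and twist_zero: "twist d \<zero> = \<zero>"
  by (auto simp: twist_def \<sigma>_add \<sigma>_mult \<sigma>_\<sigma> \<sigma>_A \<sigma>_one \<sigma>_zero)

lemma P_twist: "a \<in> C \<Longrightarrow> P \<otimes> twist d a = twist (\<not> d) a \<otimes> P"
  and twist_P: "a \<in> C \<Longrightarrow> twist d a \<otimes> P = P \<otimes> twist (\<not> d) a"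
  by (simp_all add: P_comm \<sigma>_twist twist_closed)

lemma P_pow_twist: "a \<in> C \<Longrightarrow> P [^] (n::nat) \<otimes> twist d a = twist (d \<noteq> odd n) a \<otimes> P [^] n"
proof (induction n arbitrary: d)
  case (Suc n)
  have "P [^] Suc n \<otimes> twist d a = P [^] n \<otimes> (P \<otimes> twist d a)"
    using Suc.prems by (simp add: R.m_assoc)
  also have "\<dots> = P [^] n \<otimes> twist (\<not> d) a \<otimes> P"
    using Suc.prems by (simp add: P_twist R.m_assoc)
  also have "\<dots> = twist ((\<not> d) \<noteq> odd n) a \<otimes> P [^] n \<otimes> P"
    by (subst Suc.IH[OF Suc.prems]) simp
  also have "((\<not> d) \<noteq> odd n) = (d \<noteq> odd (Suc n))" by auto
  finally show ?case using Suc.prems by (simp add: R.m_assoc)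
qed simp

lemma P_pow_pair:
  assumes "m + n = (2::nat)"
  shows "P [^] m \<otimes> P [^] n = \<pi>"
  using assms P_square by (simp add: R.nat_pow_mult numeral_2_eq_2)

section \<open>Components with respect to C and C P\<close>

definition comps :: "'a \<Rightarrow> 'a \<times> 'a"
  where "comps r = (SOME p. fst p \<in> C \<and> snd p \<in> C \<and> r = fst p \<oplus> snd p \<otimes> P)"

abbreviation comp0 :: "'a \<Rightarrow> 'a" where "comp0 r \<equiv> fst (comps r)"
abbreviation comp1 :: "'a \<Rightarrow> 'a" where "comp1 r \<equiv> snd (comps r)"

lemma comps: "r \<in> carrier R \<Longrightarrow> comp0 r \<in> C" "r \<in> carrier R \<Longrightarrow> comp1 r \<in> C"
  "r \<in> carrier R \<Longrightarrow> r = comp0 r \<oplus> comp1 r \<otimes> P"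
proof -
  assume "r \<in> carrier R"
  then have "\<exists>p. fst p \<in> C \<and> snd p \<in> C \<and> r = fst p \<oplus> snd p \<otimes> P"
    using decomp_ex by force
  from someI_ex[OF this] show "comp0 r \<in> C" "comp1 r \<in> C" "r = comp0 r \<oplus> comp1 r \<otimes> P"
    by (auto simp: comps_def)
qed

lemma comps_eq:
  assumes "a \<in> C" "b \<in> C"
  shows "comp0 (a \<oplus> b \<otimes> P) = a" "comp1 (a \<oplus> b \<otimes> P) = b"
proof -
  let ?r = "a \<oplus> b \<otimes> P"
  have r: "?r \<in> carrier R" using assms by simp
  note c = comps(1,2)[OF r]
  have "(a \<ominus> comp0 ?r) \<oplus> (b \<ominus> comp1 ?r) \<otimes> P
      = ?r \<ominus> (comp0 ?r \<oplus> comp1 ?r \<otimes> P)"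
    using assms c
    by (simp add: a_minus_def R.l_distr R.minus_add R.a_ac R.l_minus)
  also have "\<dots> = \<zero>"
    using comps(3)[OF r] r by (metis R.minus_eq R.r_neg)
  finally have "a \<ominus> comp0 ?r = \<zero> \<and> b \<ominus> comp1 ?r = \<zero>"
    using assms c by (intro decomp_unique) (auto simp: C_ops)
  then show "comp0 ?r = a" "comp1 ?r = b" using assms c by auto
qed

lemma comps_add:
  assumes "r \<in> carrier R" "s \<in> carrier R"
  shows "comp0 (r \<oplus> s) = comp0 r \<oplus> comp0 s" "comp1 (r \<oplus> s) = comp1 r \<oplus> comp1 s"
proof -
  have "r \<oplus> s = (comp0 r \<oplus> comp1 r \<otimes> P) \<oplus> (comp0 s \<oplus> comp1 s \<otimes> P)"
    using comps(3) assms by metis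
  also have "\<dots> = (comp0 r \<oplus> comp0 s) \<oplus> (comp1 r \<oplus> comp1 s) \<otimes> P"
    using assms comps(1,2) by (simp add: R.l_distr R.a_ac)
  finally have "r \<oplus> s = \<dots>" .
  then show "comp0 (r \<oplus> s) = comp0 r \<oplus> comp0 s" "comp1 (r \<oplus> s) = comp1 r \<oplus> comp1 s"
    using comps_eq assms comps(1,2) by (simp_all add: C_ops)
qed

text \<open>Moving \<open>P\<close> to the right past an element of \<open>C\<close> costs a
  \<open>\<sigma>\<close>, and \<open>P P\<close> becomes \<open>\<pi>\<close>: the product rule of
  a cyclic algebra.\<close>

lemma comps_mult:
  assumes "r \<in> carrier R" "s \<in> carrier R"
  shows "comp0 (r \<otimes> s) = comp0 r \<otimes> comp0 s \<oplus> comp1 r \<otimes> \<sigma> (comp1 s) \<otimes> \<pi>"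
    "comp1 (r \<otimes> s) = comp0 r \<otimes> comp1 s \<oplus> comp1 r \<otimes> \<sigma> (comp0 s)"
proof -
  note c = comps(1,2)
  let ?a = "comp0 r" and ?b = "comp1 r" and ?a' = "comp0 s" and ?b' = "comp1 s"
  have mem: "?a \<in> C" "?b \<in> C" "?a' \<in> C" "?b' \<in> C" "\<sigma> ?a' \<in> C" "\<sigma> ?b' \<in> C"
    using assms by (auto simp: c \<sigma>_closed)
  have "r \<otimes> s = (?a \<oplus> ?b \<otimes> P) \<otimes> (?a' \<oplus> ?b' \<otimes> P)"
    using comps(3) assms by metis
  also have "\<dots> = (?a \<otimes> ?a' \<oplus> ?a \<otimes> ?b' \<otimes> P) \<oplus> (?b \<otimes> (P \<otimes> ?a') \<oplus> ?b \<otimes> (P \<otimes> ?b') \<otimes> P)"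
    using mem by (simp add: R.l_distr R.r_distr R.m_assoc R.a_ac)
  also have "?b \<otimes> (P \<otimes> ?a') = ?b \<otimes> \<sigma> ?a' \<otimes> P"
    using mem by (simp add: P_comm R.m_assoc)
  also have "?b \<otimes> (P \<otimes> ?b') \<otimes> P = ?b \<otimes> \<sigma> ?b' \<otimes> \<pi>"
    using mem by (simp add: P_comm R.m_assoc P_square)
  also have "(?a \<otimes> ?a' \<oplus> ?a \<otimes> ?b' \<otimes> P) \<oplus> (?b \<otimes> \<sigma> ?a' \<otimes> P \<oplus> ?b \<otimes> \<sigma> ?b' \<otimes> \<pi>)
      = (?a \<otimes> ?a' \<oplus> ?b \<otimes> \<sigma> ?b' \<otimes> \<pi>) \<oplus> (?a \<otimes> ?b' \<oplus> ?b \<otimes> \<sigma> ?a') \<otimes> P"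
    using mem by (simp add: R.l_distr R.a_ac)
  finally have e: "r \<otimes> s = \<dots>" .
  show "comp0 (r \<otimes> s) = ?a \<otimes> ?a' \<oplus> ?b \<otimes> \<sigma> ?b' \<otimes> \<pi>"
    "comp1 (r \<otimes> s) = ?a \<otimes> ?b' \<oplus> ?b \<otimes> \<sigma> ?a'"
    unfolding e using mem \<pi>_C by (auto intro!: comps_eq simp: C_ops)
qed

lemma comps_C: "a \<in> C \<Longrightarrow> comp0 a = a \<and> comp1 a = \<zero>"
  using comps_eq[of a \<zero>] by (simp add: C_ops)

lemma comps_P: "comp0 P = \<zero> \<and> comp1 P = \<one>"
  using comps_eq[of \<zero> \<one>] by (simp add: C_ops)

section \<open>The local ring R with maximal ideal R P = P R\<close>

lemma P_swap_right: "r \<in> carrier R \<Longrightarrow> \<exists>s \<in> carrier R. r \<otimes> P = P \<otimes> s"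
proof -
  assume r: "r \<in> carrier R"
  note c = comps(1,2)[OF r] \<sigma>_closed[OF comps(1)[OF r]] \<sigma>_closed[OF comps(2)[OF r]]
  have "r \<otimes> P = (comp0 r \<oplus> comp1 r \<otimes> P) \<otimes> P" using comps(3)[OF r] by simp
  also have "\<dots> = P \<otimes> (\<sigma> (comp0 r) \<oplus> \<sigma> (comp1 r) \<otimes> P)"
    using c by (simp add: R.l_distr R.r_distr C_P[of "comp0 r"] C_P[of "comp1 r"] flip: R.m_assoc)
  finally show ?thesis using c by auto
qed

lemma P_swap_left: "r \<in> carrier R \<Longrightarrow> \<exists>s \<in> carrier R. P \<otimes> r = s \<otimes> P"
proof -
  assume r: "r \<in> carrier R"
  note c = comps(1,2)[OF r] \<sigma>_closed[OF comps(1)[OF r]] \<sigma>_closed[OF comps(2)[OF r]]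
  have "P \<otimes> r = P \<otimes> (comp0 r \<oplus> comp1 r \<otimes> P)" using comps(3)[OF r] by simp
  also have "\<dots> = (\<sigma> (comp0 r) \<oplus> \<sigma> (comp1 r) \<otimes> P) \<otimes> P"
    using c by (simp add: R.l_distr R.r_distr P_comm flip: R.m_assoc)
  finally show ?thesis using c by auto
qed

text \<open>By the product rule the C-component of \<open>s P\<close> is a multiple of
  \<open>\<pi>\<close>, and \<open>\<pi>\<close> is not invertible in \<open>C\<close>.\<close>

lemma one_not_P: "s \<in> carrier R \<Longrightarrow> s \<otimes> P \<noteq> \<one>"
proof
  assume s: "s \<in> carrier R" "s \<otimes> P = \<one>"
  then have "comp0 (s \<otimes> P) = \<one>" by (simp add: comps_C C_ops)
  then have "comp1 s \<otimes> \<pi> = \<one>"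
    using comps_mult(1)[OF s(1) P_closed] comps(1,2)[OF s(1)] by (simp add: comps_P \<sigma>_one)
  then show False using \<pi>_nonunit comps(2)[OF s(1)] A_central[OF \<pi>_A] by simp
qed

text \<open>Multiplication by the conjugate \<open>1 - d P\<close> gives
  \<open>1 - \<pi> d \<sigma>(d)\<close>. This lies in \<open>C\<close> and is invertible there,
  since otherwise \<open>1\<close> would be a multiple of \<open>\<pi>\<close>.\<close>

lemma unit_one_plus:
  assumes "d \<in> C"
  shows "\<exists>t \<in> carrier R. (\<one> \<oplus> d \<otimes> P) \<otimes> t = \<one>"
proof -
  let ?n = "\<one> \<ominus> \<pi> \<otimes> (d \<otimes> \<sigma> d)"
  have d: "\<sigma> d \<in> C" using assms \<sigma>_closed by simp
  have "(\<one> \<oplus> d \<otimes> P) \<otimes> (\<one> \<ominus> d \<otimes> P) = \<one> \<ominus> (d \<otimes> P) \<otimes> (d \<otimes> P)"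
    using assms by (simp add: R.ring_simprules)
  also have "(d \<otimes> P) \<otimes> (d \<otimes> P) = d \<otimes> \<sigma> d \<otimes> \<pi>"
  proof -
    have "(d \<otimes> P) \<otimes> (d \<otimes> P) = d \<otimes> (P \<otimes> d) \<otimes> P" using assms by (simp add: R.m_assoc)
    then show ?thesis using assms d P_square by (simp add: P_comm R.m_assoc)
  qed
  also have "\<dots> = \<pi> \<otimes> (d \<otimes> \<sigma> d)" using assms d A_central[OF \<pi>_A] by simp
  finally have e: "(\<one> \<oplus> d \<otimes> P) \<otimes> (\<one> \<ominus> d \<otimes> P) = ?n" .
  have nC: "?n \<in> C" using assms d \<pi>_C by (auto simp: C_ops)
  have "\<exists>b \<in> C. ?n \<otimes> b = \<one>"
  proof (rule ccontr)
    assume "\<not> ?thesis"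
    then obtain b where b: "b \<in> C" "?n = \<pi> \<otimes> b" using C_local[OF nC] by auto
    have "\<one> = ?n \<oplus> \<pi> \<otimes> (d \<otimes> \<sigma> d)"
      using assms d by (simp add: a_minus_def R.a_assoc R.l_neg)
    also have "\<dots> = \<pi> \<otimes> (b \<oplus> d \<otimes> \<sigma> d)" using b assms d by (simp add: R.r_distr)
    finally show False using \<pi>_nonunit[of "b \<oplus> d \<otimes> \<sigma> d"] b assms d by (auto simp: C_ops)
  qed
  then obtain b where b: "b \<in> C" "?n \<otimes> b = \<one>" by auto
  have "(\<one> \<oplus> d \<otimes> P) \<otimes> ((\<one> \<ominus> d \<otimes> P) \<otimes> b) = \<one>"
    using e b assms by (simp flip: R.m_assoc)
  then show ?thesis using assms b by (intro bexI[of _ "(\<one> \<ominus> d \<otimes> P) \<otimes> b"]) auto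
qed

text \<open>Write \<open>r = a + b P\<close>. If \<open>a\<close> is invertible, then
  \<open>r = a (1 + a^-1 b P)\<close>. If \<open>a\<close> is a multiple of
  \<open>\<pi> = P P\<close>, a factor \<open>P\<close> splits off on the right from both
  components.\<close>

lemma unit_or_P:
  assumes r: "r \<in> carrier R"
  shows "(\<exists>t \<in> carrier R. r \<otimes> t = \<one>) \<or> (\<exists>t \<in> carrier R. r = t \<otimes> P)"
  using C_local[OF comps(1)[OF r]]
proof
  note c = comps[OF r]
  assume "\<exists>b \<in> C. comp0 r \<otimes> b = \<one>"
  then obtain b where b: "b \<in> C" "comp0 r \<otimes> b = \<one>" by auto
  let ?d = "b \<otimes> comp1 r"
  have "comp0 r \<otimes> (\<one> \<oplus> ?d \<otimes> P) = comp0 r \<oplus> (comp0 r \<otimes> b) \<otimes> comp1 r \<otimes> P"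
    using b(1) c(1,2) by (simp add: R.r_distr R.m_assoc)
  then have r_eq: "r = comp0 r \<otimes> (\<one> \<oplus> ?d \<otimes> P)"
    using b c by simp
  obtain t where t: "t \<in> carrier R" "(\<one> \<oplus> ?d \<otimes> P) \<otimes> t = \<one>"
    using unit_one_plus[of ?d] b c by (auto simp: C_ops)
  have "r \<otimes> (t \<otimes> b) = (comp0 r \<otimes> (\<one> \<oplus> ?d \<otimes> P)) \<otimes> (t \<otimes> b)"
    using r_eq by simp
  also have "\<dots> = comp0 r \<otimes> (((\<one> \<oplus> ?d \<otimes> P) \<otimes> t) \<otimes> b)"
    using b(1) c(1,2) t(1) by (simp add: R.m_assoc)
  also have "\<dots> = \<one>"
    unfolding t(2) using b by simp
  finally show ?thesis using t b by (intro disjI1 bexI[of _ "t \<otimes> b"]) auto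
next
  note c = comps[OF r]
  assume "\<exists>b \<in> C. comp0 r = \<pi> \<otimes> b"
  then obtain b where b: "b \<in> C" "comp0 r = \<pi> \<otimes> b" by auto
  have "r = (b \<otimes> P \<oplus> comp1 r) \<otimes> P"
    using c(2,3) b A_central[OF \<pi>_A] P_square by (simp add: R.l_distr R.m_assoc)
  then show ?thesis using b c by (intro disjI2 bexI[of _ "b \<otimes> P \<oplus> comp1 r"]) auto
qed

text \<open>If \<open>1 - r P\<close> were a left multiple of \<open>P\<close>, then so would be
  \<open>1\<close>. This is the invertibility that Nakayama's lemma relies on.\<close>

lemma unit_one_minus_P:
  assumes "r \<in> carrier R"
  shows "\<exists>t \<in> carrier R. (\<one> \<ominus> r \<otimes> P) \<otimes> t = \<one>"
proof (rule ccontr)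
  assume "\<not> ?thesis"
  then obtain t where t: "t \<in> carrier R" "\<one> \<ominus> r \<otimes> P = t \<otimes> P"
    using unit_or_P[of "\<one> \<ominus> r \<otimes> P"] assms by auto
  have "\<one> = (\<one> \<ominus> r \<otimes> P) \<oplus> r \<otimes> P"
    using assms by (simp add: a_minus_def R.a_assoc R.l_neg)
  then have "\<one> = (t \<oplus> r) \<otimes> P" using t assms by (simp add: R.l_distr)
  then show False using one_not_P[of "t \<oplus> r"] t assms by auto
qed

end

section \<open>Standard bimodules\<close>

context quat_order
begin

text \<open>The standard bimodule is free over \<open>R\<close> as a right module.  The left action on its basis
  \<open>e\<close> is \<open>a e\<^sub>i = e\<^sub>i a\<close> or \<open>a e\<^sub>i = e\<^sub>i \<sigma>(a)\<close> for \<open>a \<in> C\<close>, depending on \<open>d i\<close>, and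
  \<open>P e\<^sub>i = e\<^bsub>\<tau> i\<^esub> P\<^bsup>k i\<^esup>\<close>.  For \<open>\<tau> i = i\<close> the summand spanned by \<open>e\<^sub>i\<close> is \<open>R\<close> itself, with
  the left action twisted by conjugation with \<open>P\<close> if \<open>d i\<close> holds.\<close>

definition struct_data :: "'i set \<Rightarrow> ('i \<Rightarrow> bool) \<Rightarrow> ('i \<Rightarrow> 'i) \<Rightarrow> ('i \<Rightarrow> nat) \<Rightarrow> bool"
  where "struct_data I d \<tau> k \<longleftrightarrow> finite I \<and> (\<forall>i. \<tau> (\<tau> i) = i) \<and> (\<forall>i \<in> I. \<tau> i \<in> I)
    \<and> (\<forall>i. k i + k (\<tau> i) = 2) \<and> (\<forall>i. d (\<tau> i) = (d i \<noteq> even (k i)))"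

text \<open>A family \<open>q\<close> stands for the sum of the \<open>e_i q_i\<close>. As
  \<open>\<tau>\<close> is an involution, \<open>b P e_(\<tau> i) = b e_i P^(k (\<tau> i)) = e_i
  (twist (d i) b) P^(k (\<tau> i))\<close>; hence the second summand, contributed at
  \<open>i\<close> by the P-component of the scalar.\<close>

definition std_bimodule ::
    "'i set \<Rightarrow> ('i \<Rightarrow> bool) \<Rightarrow> ('i \<Rightarrow> 'i) \<Rightarrow> ('i \<Rightarrow> nat) \<Rightarrow> ('a, 'a, 'i \<Rightarrow> 'a) bimodule"
  where "std_bimodule I d \<tau> k =
    \<lparr>carrier = {q. (\<forall>i. q i \<in> carrier R) \<and> (\<forall>i. i \<notin> I \<longrightarrow> q i = \<zero>)},
     monoid.mult = undefined, one = undefined,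
     ring.zero = (\<lambda>i. \<zero>), add = (\<lambda>p q i. p i \<oplus> q i),
     smult = (\<lambda>r q i. twist (d i) (comp0 r) \<otimes> q i
       \<oplus> twist (d i) (comp1 r) \<otimes> P [^] k (\<tau> i) \<otimes> q (\<tau> i)),
     rsmult = (\<lambda>q r i. q i \<otimes> r)\<rparr>"

lemma std_simps:
  "q \<in> carrier (std_bimodule I d \<tau> k) \<longleftrightarrow> (\<forall>i. q i \<in> carrier R) \<and> (\<forall>i. i \<notin> I \<longrightarrow> q i = \<zero>)"
  "\<zero>\<^bsub>std_bimodule I d \<tau> k\<^esub> = (\<lambda>i. \<zero>)"
  "p \<oplus>\<^bsub>std_bimodule I d \<tau> k\<^esub> q = (\<lambda>i. p i \<oplus> q i)"
  "r \<odot>\<^bsub>std_bimodule I d \<tau> k\<^esub> q = (\<lambda>i. twist (d i) (comp0 r) \<otimes> q i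
     \<oplus> twist (d i) (comp1 r) \<otimes> P [^] k (\<tau> i) \<otimes> q (\<tau> i))"
  "q \<odot>\<^sup>r\<^bsub>std_bimodule I d \<tau> k\<^esub> r = (\<lambda>i. q i \<otimes> r)"
  by (simp_all add: std_bimodule_def)

text \<open>Associativity of the left action at a single index. Here \<open>p\<close> and
  \<open>p'\<close> are the powers of \<open>P\<close> attached to \<open>\<tau> i\<close> and
  \<open>i\<close>, and the equations on \<open>a1, a2, b1, b2\<close> say how \<open>p\<close>
  moves past the components of the second scalar.\<close>

lemma std_action_identity:
  assumes "a \<in> carrier R" "b \<in> carrier R" "a' \<in> carrier R" "b' \<in> carrier R"
    "a1 \<in> carrier R" "b1 \<in> carrier R" "a2 \<in> carrier R" "b2 \<in> carrier R"
    "p \<in> carrier R" "p' \<in> carrier R" "x \<in> carrier R" "y \<in> carrier R"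
    "p \<otimes> a2 = a1 \<otimes> p" "p \<otimes> b2 = b1 \<otimes> p" "p \<otimes> p' = \<pi>"
  shows "(a \<otimes> a' \<oplus> b \<otimes> b1 \<otimes> \<pi>) \<otimes> x \<oplus> (a \<otimes> b' \<oplus> b \<otimes> a1) \<otimes> p \<otimes> y
    = a \<otimes> (a' \<otimes> x \<oplus> b' \<otimes> p \<otimes> y) \<oplus> b \<otimes> p \<otimes> (a2 \<otimes> y \<oplus> b2 \<otimes> p' \<otimes> x)"
proof -
  have "b \<otimes> p \<otimes> (a2 \<otimes> y \<oplus> b2 \<otimes> p' \<otimes> x) = b \<otimes> (p \<otimes> a2) \<otimes> y \<oplus> b \<otimes> (p \<otimes> b2) \<otimes> p' \<otimes> x"
    using assms(1-12) by (simp add: R.r_distr R.m_assoc)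
  also have "\<dots> = b \<otimes> (a1 \<otimes> p) \<otimes> y \<oplus> b \<otimes> (b1 \<otimes> p) \<otimes> p' \<otimes> x"
    by (simp only: assms(13,14))
  also have "\<dots> = b \<otimes> a1 \<otimes> p \<otimes> y \<oplus> b \<otimes> b1 \<otimes> (p \<otimes> p') \<otimes> x"
    using assms(1-12) by (simp add: R.m_assoc)
  finally have "b \<otimes> p \<otimes> (a2 \<otimes> y \<oplus> b2 \<otimes> p' \<otimes> x) = b \<otimes> a1 \<otimes> p \<otimes> y \<oplus> b \<otimes> b1 \<otimes> \<pi> \<otimes> x"
    by (simp only: assms(15))
  with assms(1-12) show ?thesis
    by (simp add: R.l_distr R.r_distr R.m_assoc R.a_ac)
qed

text \<open>The conditions of \<open>struct_data\<close> enter through associativity: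
  \<open>k i + k (\<tau> i) = 2\<close> makes \<open>P P\<close> act as \<open>\<pi>\<close>, and
  the condition on \<open>d\<close> says that left multiplication by \<open>P\<close> reverses the
  degree, so that \<open>e_(\<tau> i) P^(k i)\<close> has degree opposite to
  \<open>e_i\<close>.\<close>

lemma std_bimodule:
  assumes D: "struct_data I d \<tau> k"
  shows "bimodule R R (std_bimodule I d \<tau> k)"
proof -
  let ?M = "std_bimodule I d \<tau> k"
  have \<tau>: "\<tau> (\<tau> i) = i" "i \<in> I \<Longrightarrow> \<tau> i \<in> I" "k i + k (\<tau> i) = 2" "d (\<tau> i) = (d i \<noteq> even (k i))" for i
    using D by (auto simp: struct_data_def)
  \<comment> \<open>Since \<open>\<tau>\<close> is an involution of the whole index type, the left
    action does not enlarge supports.\<close>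
  have \<tau>I: "\<tau> i \<notin> I" if "i \<notin> I" for i using \<tau>(1,2) that by metis
  have ab: "abelian_group ?M"
  proof (rule abelian_groupI)
    fix x assume x: "x \<in> carrier ?M"
    then show "\<exists>y\<in>carrier ?M. y \<oplus>\<^bsub>?M\<^esub> x = \<zero>\<^bsub>?M\<^esub>"
      by (intro bexI[of _ "\<lambda>i. \<ominus> x i"]) (auto simp: std_simps R.l_neg)
  qed (auto simp: std_simps R.a_ac)
  show ?thesis
  proof (intro bimodule.intro bimodule_axioms.intro R.ring_axioms ab)
    fix r x assume "r \<in> carrier R" "x \<in> carrier ?M"
    then show "r \<odot>\<^bsub>?M\<^esub> x \<in> carrier ?M"
      using comps(1,2) \<tau>I by (auto simp: std_simps)
  next
    fix r s x assume "r \<in> carrier R" "s \<in> carrier R" "x \<in> carrier ?M"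
    then show "(r \<oplus> s) \<odot>\<^bsub>?M\<^esub> x = r \<odot>\<^bsub>?M\<^esub> x \<oplus>\<^bsub>?M\<^esub> s \<odot>\<^bsub>?M\<^esub> x"
      using comps(1,2) by (auto simp: std_simps comps_add twist_add R.l_distr R.a_ac)
  next
    fix r x y assume "r \<in> carrier R" "x \<in> carrier ?M" "y \<in> carrier ?M"
    then show "r \<odot>\<^bsub>?M\<^esub> (x \<oplus>\<^bsub>?M\<^esub> y) = r \<odot>\<^bsub>?M\<^esub> x \<oplus>\<^bsub>?M\<^esub> r \<odot>\<^bsub>?M\<^esub> y"
      using comps(1,2) by (auto simp: std_simps R.r_distr R.a_ac)
  next
    fix r s x assume rs: "r \<in> carrier R" "s \<in> carrier R" and x: "x \<in> carrier ?M"
    have c: "comp0 r \<in> C" "comp1 r \<in> C" "comp0 s \<in> C" "comp1 s \<in> C" using comps rs by auto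
    have xc: "x i \<in> carrier R" for i using x by (simp add: std_simps)
    show "(r \<otimes> s) \<odot>\<^bsub>?M\<^esub> x = r \<odot>\<^bsub>?M\<^esub> (s \<odot>\<^bsub>?M\<^esub> x)"
    proof
      fix i
      have sw: "P [^] k (\<tau> i) \<otimes> twist (d (\<tau> i)) a = twist (\<not> d i) a \<otimes> P [^] k (\<tau> i)"
        if "a \<in> C" for a
      proof -
        have "(d (\<tau> i) \<noteq> odd (k (\<tau> i))) = (\<not> d i)" using \<tau>(1)[of i] \<tau>(4)[of "\<tau> i"] by auto
        then show ?thesis using P_pow_twist[OF that, of "k (\<tau> i)" "d (\<tau> i)"] by simp
      qed
      have "((r \<otimes> s) \<odot>\<^bsub>?M\<^esub> x) i
        = (twist (d i) (comp0 r) \<otimes> twist (d i) (comp0 s)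
            \<oplus> twist (d i) (comp1 r) \<otimes> twist (\<not> d i) (comp1 s) \<otimes> \<pi>) \<otimes> x i
          \<oplus> (twist (d i) (comp0 r) \<otimes> twist (d i) (comp1 s)
            \<oplus> twist (d i) (comp1 r) \<otimes> twist (\<not> d i) (comp0 s)) \<otimes> P [^] k (\<tau> i) \<otimes> x (\<tau> i)"
        using c \<sigma>_closed \<pi>_C \<pi>_A
        by (simp add: std_simps comps_mult rs twist_add twist_mult C_ops twist_\<sigma> twist_A)
      also have "\<dots> = (r \<odot>\<^bsub>?M\<^esub> (s \<odot>\<^bsub>?M\<^esub> x)) i"
        unfolding std_simps \<tau>(1)
        using c xc sw[OF c(3)] sw[OF c(4)] P_pow_pair[of "k (\<tau> i)" "k i"] \<tau>(3)[of i]
        by (intro std_action_identity) auto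
      finally show "((r \<otimes> s) \<odot>\<^bsub>?M\<^esub> x) i = (r \<odot>\<^bsub>?M\<^esub> (s \<odot>\<^bsub>?M\<^esub> x)) i" .
    qed
  next
    fix x assume "x \<in> carrier ?M"
    then show "\<one> \<odot>\<^bsub>?M\<^esub> x = x"
      by (auto simp: std_simps comps_C C_ops twist_one twist_zero)
  next
    fix r s x assume "r \<in> carrier R" "s \<in> carrier R" "x \<in> carrier ?M"
    then show "(r \<odot>\<^bsub>?M\<^esub> x) \<odot>\<^sup>r\<^bsub>?M\<^esub> s = r \<odot>\<^bsub>?M\<^esub> (x \<odot>\<^sup>r\<^bsub>?M\<^esub> s)"
      using comps(1,2) by (auto simp: std_simps R.l_distr R.m_assoc)
  qed (auto simp: std_simps R.l_distr R.r_distr R.m_assoc)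
qed

end

locale quat_bimodule = quat_order R C A \<pi> P \<theta> \<eta> \<sigma> + M: bimodule R R M
  for R (structure) and C A \<pi> P \<theta> \<eta> \<sigma> and M (structure) +
  assumes agree: "\<lbrakk>a \<in> A; x \<in> carrier M\<rbrakk> \<Longrightarrow> a \<odot>\<^bsub>M\<^esub> x = x \<odot>\<^sup>r\<^bsub>M\<^esub> a"
begin

definition struct_rel :: "'d set \<Rightarrow> ('d \<Rightarrow> bool) \<Rightarrow> ('d \<Rightarrow> 'd) \<Rightarrow> ('d \<Rightarrow> nat) \<Rightarrow> ('d \<Rightarrow> 'c) \<Rightarrow> bool"
  where "struct_rel I d \<tau> k e \<longleftrightarrow> (\<forall>i \<in> I. e i \<in> carrier M
    \<and> (\<forall>a \<in> C. a \<odot>\<^bsub>M\<^esub> e i = e i \<odot>\<^sup>r\<^bsub>M\<^esub> twist (d i) a)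
    \<and> P \<odot>\<^bsub>M\<^esub> e i = e (\<tau> i) \<odot>\<^sup>r\<^bsub>M\<^esub> P [^] k i)"

text \<open>A basis over the residue ring \<open>R / R P\<close>, meant for bimodules killed by
  \<open>P\<close> on the right: there a coefficient acts only through its class modulo
  \<open>R P\<close>, so a relation can force it no further than into \<open>R P\<close>.\<close>

definition basis :: "'d set \<Rightarrow> ('d \<Rightarrow> 'c) \<Rightarrow> bool"
  where "basis I b \<longleftrightarrow> finite I \<and> b \<in> I \<rightarrow> carrier M \<and> M.right_span (b ` I) = carrier M
    \<and> (\<forall>c \<in> I \<rightarrow> carrier R. M.lincomb c b I = \<zero>\<^bsub>M\<^esub> \<longrightarrow> (\<forall>i \<in> I. \<exists>t \<in> carrier R. c i = t \<otimes> P))"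

text \<open>The universal property of the standard bimodule: vectors satisfying its relations are
  the images of its basis.\<close>

lemma std_hom:
  assumes D: "struct_data I d \<tau> k" and e: "struct_rel I d \<tau> k e"
  shows "(\<lambda>q. M.lincomb q e I) \<in> bimodule_hom R R (std_bimodule I d \<tau> k) M"
proof -
  let ?S = "std_bimodule I d \<tau> k"
  have fin: "finite I" and \<tau>: "\<tau> (\<tau> i) = i" "i \<in> I \<Longrightarrow> \<tau> i \<in> I" for i
    using D by (auto simp: struct_data_def)
  have eM: "e \<in> I \<rightarrow> carrier M" using e by (auto simp: struct_rel_def)
  have ei: "i \<in> I \<Longrightarrow> e i \<in> carrier M" for i using eM by auto
  have q: "q \<in> I \<rightarrow> carrier R" if "q \<in> carrier ?S" for q using that by (auto simp: std_simps)
  show ?thesis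
  proof (rule bimodule_homI)
    fix r x assume r: "r \<in> carrier R" and x: "x \<in> carrier ?S"
    have c: "comp0 r \<in> C" "comp1 r \<in> C" using comps r by auto
    have xc: "x i \<in> carrier R" for i using x by (simp add: std_simps)
    have rel: "r \<odot>\<^bsub>M\<^esub> e i = e i \<odot>\<^sup>r\<^bsub>M\<^esub> twist (d i) (comp0 r)
        \<oplus>\<^bsub>M\<^esub> e (\<tau> i) \<odot>\<^sup>r\<^bsub>M\<^esub> (twist (d (\<tau> i)) (comp1 r) \<otimes> P [^] k i)" if i: "i \<in> I" for i
    proof -
      have "r \<odot>\<^bsub>M\<^esub> e i = (comp0 r \<oplus> comp1 r \<otimes> P) \<odot>\<^bsub>M\<^esub> e i" using comps(3)[OF r] by simp
      also have "\<dots> = comp0 r \<odot>\<^bsub>M\<^esub> e i \<oplus>\<^bsub>M\<^esub> comp1 r \<odot>\<^bsub>M\<^esub> (P \<odot>\<^bsub>M\<^esub> e i)"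
        using c ei[OF i] by (simp add: M.smult_l_distr M.smult_assoc)
      also have "comp0 r \<odot>\<^bsub>M\<^esub> e i = e i \<odot>\<^sup>r\<^bsub>M\<^esub> twist (d i) (comp0 r)"
        using e i c by (auto simp: struct_rel_def)
      also have "comp1 r \<odot>\<^bsub>M\<^esub> (P \<odot>\<^bsub>M\<^esub> e i) = comp1 r \<odot>\<^bsub>M\<^esub> (e (\<tau> i) \<odot>\<^sup>r\<^bsub>M\<^esub> P [^] k i)"
        using e i by (auto simp: struct_rel_def)
      also have "\<dots> = (comp1 r \<odot>\<^bsub>M\<^esub> e (\<tau> i)) \<odot>\<^sup>r\<^bsub>M\<^esub> P [^] k i"
        using c ei[OF \<tau>(2)[OF i]] by (simp add: M.smult_rsmult)
      also have "comp1 r \<odot>\<^bsub>M\<^esub> e (\<tau> i) = e (\<tau> i) \<odot>\<^sup>r\<^bsub>M\<^esub> twist (d (\<tau> i)) (comp1 r)"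
        using e \<tau>(2)[OF i] c by (auto simp: struct_rel_def)
      also have "e (\<tau> i) \<odot>\<^sup>r\<^bsub>M\<^esub> twist (d (\<tau> i)) (comp1 r) \<odot>\<^sup>r\<^bsub>M\<^esub> P [^] k i
          = e (\<tau> i) \<odot>\<^sup>r\<^bsub>M\<^esub> (twist (d (\<tau> i)) (comp1 r) \<otimes> P [^] k i)"
        using c ei[OF \<tau>(2)[OF i]] by (simp add: M.rsmult_assoc)
      finally show ?thesis .
    qed
    have "r \<odot>\<^bsub>M\<^esub> M.lincomb x e I = M.lincomb x (\<lambda>i. r \<odot>\<^bsub>M\<^esub> e i) I"
      using M.lincomb_smult[OF fin eM q[OF x] r] by simp
    also have "\<dots> = (\<Oplus>\<^bsub>M\<^esub>i\<in>I. e i \<odot>\<^sup>r\<^bsub>M\<^esub> (twist (d i) (comp0 r) \<otimes> x i)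
        \<oplus>\<^bsub>M\<^esub> e (\<tau> i) \<odot>\<^sup>r\<^bsub>M\<^esub> (twist (d (\<tau> i)) (comp1 r) \<otimes> P [^] k i \<otimes> x i))"
      unfolding M.lincomb_def using c ei \<tau>(2) xc
      by (intro M.finsum_cong')
        (auto simp: rel M.rsmult_l_distr M.rsmult_closed M.rsmult_assoc Pi_iff)
    also have "\<dots> = (\<Oplus>\<^bsub>M\<^esub>i\<in>I. e i \<odot>\<^sup>r\<^bsub>M\<^esub> (twist (d i) (comp0 r) \<otimes> x i))
        \<oplus>\<^bsub>M\<^esub> (\<Oplus>\<^bsub>M\<^esub>i\<in>I. e (\<tau> i) \<odot>\<^sup>r\<^bsub>M\<^esub> (twist (d (\<tau> i)) (comp1 r) \<otimes> P [^] k i \<otimes> x i))"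
      using c ei \<tau>(2) xc
      by (intro M.finsum_addf) (auto simp: M.rsmult_closed)
    \<comment> \<open>The terms coming from the P-component sit at \<open>\<tau> i\<close>;
      reindexing along the involution turns them into the second summand of the left action.\<close>
    also have "(\<Oplus>\<^bsub>M\<^esub>i\<in>I. e (\<tau> i) \<odot>\<^sup>r\<^bsub>M\<^esub> (twist (d (\<tau> i)) (comp1 r) \<otimes> P [^] k i \<otimes> x i))
        = (\<Oplus>\<^bsub>M\<^esub>i\<in>\<tau> ` I. e i \<odot>\<^sup>r\<^bsub>M\<^esub> (twist (d i) (comp1 r) \<otimes> P [^] k (\<tau> i) \<otimes> x (\<tau> i)))"
      using c ei \<tau> xc
      by (subst M.finsum_reindex) (auto simp: M.rsmult_closed intro: inj_on_inverseI)
    also have "\<tau> ` I = I" using \<tau> by (metis image_subset_iff subsetI subset_antisym rev_image_eqI)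
    also have "(\<Oplus>\<^bsub>M\<^esub>i\<in>I. e i \<odot>\<^sup>r\<^bsub>M\<^esub> (twist (d i) (comp0 r) \<otimes> x i))
        \<oplus>\<^bsub>M\<^esub> (\<Oplus>\<^bsub>M\<^esub>i\<in>I. e i \<odot>\<^sup>r\<^bsub>M\<^esub> (twist (d i) (comp1 r) \<otimes> P [^] k (\<tau> i) \<otimes> x (\<tau> i)))
        = M.lincomb (r \<odot>\<^bsub>?S\<^esub> x) e I"
      using M.lincomb_add[OF eM, of "\<lambda>i. twist (d i) (comp0 r) \<otimes> x i"
          "\<lambda>i. twist (d i) (comp1 r) \<otimes> P [^] k (\<tau> i) \<otimes> x (\<tau> i)"] c xc
      by (simp add: std_simps M.lincomb_def)
    finally show "M.lincomb (r \<odot>\<^bsub>?S\<^esub> x) e I = r \<odot>\<^bsub>M\<^esub> M.lincomb x e I" by simp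
  next
    fix x y assume x: "x \<in> carrier ?S" and y: "y \<in> carrier ?S"
    then show "M.lincomb (x \<oplus>\<^bsub>?S\<^esub> y) e I = M.lincomb x e I \<oplus>\<^bsub>M\<^esub> M.lincomb y e I"
      using M.lincomb_add[OF eM q[OF x] q[OF y]] by (simp add: std_simps)
  next
    fix s x assume s: "s \<in> carrier R" and x: "x \<in> carrier ?S"
    then show "M.lincomb (x \<odot>\<^sup>r\<^bsub>?S\<^esub> s) e I = M.lincomb x e I \<odot>\<^sup>r\<^bsub>M\<^esub> s"
      using M.lincomb_rsmult[OF fin eM q[OF x] s] by (simp add: std_simps)
  qed (use M.lincomb_closed[OF eM] q in auto)
qed

text \<open>Generators are discarded one at a time. If \<open>g = h + y P\<close> and
  \<open>y = g s + h'\<close> with \<open>h'\<close> in the span of \<open>H\<close> and the other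
  generators, then \<open>g (1 - s P)\<close> lies in that span, and \<open>1 - s P\<close> has a
  right inverse.\<close>

lemma nakayama:
  assumes "finite G" "G \<subseteq> carrier M" "M.right_submodule H" "M.right_span (H \<union> G) = carrier M"
    "\<And>x. x \<in> carrier M \<Longrightarrow> \<exists>h \<in> H. \<exists>y \<in> carrier M. x = h \<oplus>\<^bsub>M\<^esub> y \<odot>\<^sup>r\<^bsub>M\<^esub> P"
  shows "H = carrier M"
  using assms
proof (induction G rule: finite_induct)
  case empty
  then show ?case
    using M.right_span_least[of H H] M.right_submoduleD(1)[of H] by auto
next
  case (insert g G)
  let ?H = "M.right_span (H \<union> G)"
  have Hc: "H \<subseteq> carrier M" using insert.prems(2) by (auto simp: M.right_submoduleD)
  have HG: "H \<union> G \<subseteq> carrier M" and g: "g \<in> carrier M" using Hc insert.prems(1) by auto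
  note sub = M.right_submodule_span[of "H \<union> G"]
  note sp = M.right_submoduleD[OF sub]
  have top: "M.right_span (insert g (H \<union> G)) = carrier M" using insert.prems(3) by simp
  obtain h y where h: "h \<in> H" and y: "y \<in> carrier M" and gy: "g = h \<oplus>\<^bsub>M\<^esub> y \<odot>\<^sup>r\<^bsub>M\<^esub> P"
    using insert.prems(4)[OF g] by auto
  obtain s h' where s: "s \<in> carrier R" and h': "h' \<in> ?H" and yy: "y = g \<odot>\<^sup>r\<^bsub>M\<^esub> s \<oplus>\<^bsub>M\<^esub> h'"
    using M.right_span_insert[OF g HG, of y] top y by auto
  have hH: "h \<in> ?H" using h M.right_span_superset[OF HG] by auto
  have hc: "h \<in> carrier M" "h' \<in> carrier M" using sp(1) hH h' by auto
  have w: "h \<oplus>\<^bsub>M\<^esub> h' \<odot>\<^sup>r\<^bsub>M\<^esub> P \<in> ?H" using hH h' sp by simp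
  have "g = h \<oplus>\<^bsub>M\<^esub> (g \<odot>\<^sup>r\<^bsub>M\<^esub> s \<oplus>\<^bsub>M\<^esub> h') \<odot>\<^sup>r\<^bsub>M\<^esub> P" using gy yy by simp
  also have "\<dots> = (h \<oplus>\<^bsub>M\<^esub> h' \<odot>\<^sup>r\<^bsub>M\<^esub> P) \<oplus>\<^bsub>M\<^esub> g \<odot>\<^sup>r\<^bsub>M\<^esub> (s \<otimes> P)"
    using hc g s by (simp add: M.rsmult_l_distr M.rsmult_assoc M.rsmult_closed M.a_ac)
  finally have ge: "g = (h \<oplus>\<^bsub>M\<^esub> h' \<odot>\<^sup>r\<^bsub>M\<^esub> P) \<oplus>\<^bsub>M\<^esub> g \<odot>\<^sup>r\<^bsub>M\<^esub> (s \<otimes> P)" .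
  have "g \<odot>\<^sup>r\<^bsub>M\<^esub> (\<one> \<ominus> s \<otimes> P) = g \<ominus>\<^bsub>M\<^esub> g \<odot>\<^sup>r\<^bsub>M\<^esub> (s \<otimes> P)"
    using g s by (simp add: a_minus_def M.rsmult_r_distr M.rsmult_minus M.rsmult_one)
  also have "\<dots> = h \<oplus>\<^bsub>M\<^esub> h' \<odot>\<^sup>r\<^bsub>M\<^esub> P"
    using g s hc by (subst ge) (simp add: a_minus_def M.rsmult_closed M.a_assoc M.r_neg)
  finally have gH: "g \<odot>\<^sup>r\<^bsub>M\<^esub> (\<one> \<ominus> s \<otimes> P) \<in> ?H" using w by simp
  obtain t where t: "t \<in> carrier R" "(\<one> \<ominus> s \<otimes> P) \<otimes> t = \<one>" using unit_one_minus_P[OF s] by auto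
  have "g = g \<odot>\<^sup>r\<^bsub>M\<^esub> (\<one> \<ominus> s \<otimes> P) \<odot>\<^sup>r\<^bsub>M\<^esub> t"
    using g s t M.rsmult_assoc[of "\<one> \<ominus> s \<otimes> P" t g] by (simp add: M.rsmult_one)
  then have "g \<in> ?H" using sp(4)[OF gH t(1)] by simp
  then have "insert g (H \<union> G) \<subseteq> ?H" using M.right_span_superset[OF HG] by auto
  then have "?H = carrier M" using M.right_span_least[OF sub, of "insert g (H \<union> G)"] top sp(1) by auto
  then show ?case using insert.IH insert.prems by auto
qed

end

context quat_order
begin

abbreviation qbimodule :: "('a, 'a, 'm) bimodule \<Rightarrow> bool"
  where "qbimodule M \<equiv> quat_bimodule R C A \<pi> P \<theta> \<eta> \<sigma> M"

text \<open>The quotient \<open>L / L P\<close> up to isomorphism, without cosets and over the same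
  rings as \<open>L\<close>.\<close>

definition right_trunc :: "('m \<Rightarrow> 'n) \<Rightarrow> ('a, 'a, 'm) bimodule \<Rightarrow> ('a, 'a, 'n) bimodule \<Rightarrow> bool"
  where "right_trunc p L M \<longleftrightarrow> p \<in> bimodule_hom R R L M \<and> p ` carrier L = carrier M
    \<and> (\<forall>x \<in> carrier L. p x = \<zero>\<^bsub>M\<^esub> \<longleftrightarrow> (\<exists>y \<in> carrier L. x = y \<odot>\<^sup>r\<^bsub>L\<^esub> P))"

lemma std_qbimodule:
  assumes D: "struct_data I d \<tau> k"
  shows "qbimodule (std_bimodule I d \<tau> k)"
proof -
  interpret S: bimodule R R "std_bimodule I d \<tau> k" using std_bimodule[OF D] .
  show ?thesis
  proof unfold_locales
    fix a x assume "a \<in> A" "x \<in> carrier (std_bimodule I d \<tau> k)"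
    then show "a \<odot>\<^bsub>std_bimodule I d \<tau> k\<^esub> x = x \<odot>\<^sup>r\<^bsub>std_bimodule I d \<tau> k\<^esub> a"
      using A_C A_central by (auto simp: std_simps comps_C twist_A twist_zero fun_eq_iff)
  qed
qed

text \<open>The vectors \<open>b i\<close> satisfy the relations of the standard basis, which yields
  the homomorphism. Any relation among them has coefficients in \<open>R P\<close>, so the kernel
  consists of right multiples of \<open>P\<close>.\<close>

lemma std_trunc:
  assumes D: "struct_data I d \<tau> k" and M: "qbimodule M"
    and MP: "\<And>x. x \<in> carrier M \<Longrightarrow> x \<odot>\<^sup>r\<^bsub>M\<^esub> P = \<zero>\<^bsub>M\<^esub>"
    and b: "quat_bimodule.struct_rel R C P \<sigma> M I d \<tau> k b" "quat_bimodule.basis R P M I b"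
  shows "right_trunc (\<lambda>q. bimodule.lincomb M q b I) (std_bimodule I d \<tau> k) M"
proof -
  interpret M: quat_bimodule R C A \<pi> P \<theta> \<eta> \<sigma> M by fact
  let ?S = "std_bimodule I d \<tau> k"
  interpret S: bimodule R R ?S using std_bimodule[OF D] .
  have fin: "finite I" and bM: "b \<in> I \<rightarrow> carrier M"
    and span: "M.M.right_span (b ` I) = carrier M"
    and ind: "\<And>c. c \<in> I \<rightarrow> carrier R \<Longrightarrow> M.M.lincomb c b I = \<zero>\<^bsub>M\<^esub>
      \<Longrightarrow> \<forall>i \<in> I. \<exists>t \<in> carrier R. c i = t \<otimes> P"
    using b(2) by (auto simp: M.basis_def)
  show ?thesis
    unfolding right_trunc_def
  proof (intro conjI ballI M.std_hom D b)
    show "(\<lambda>q. M.M.lincomb q b I) ` carrier ?S = carrier M"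
    proof (intro equalityI subsetI)
      fix x assume "x \<in> carrier M"
      then obtain c where c: "x = M.M.lincomb c b I" "c \<in> I \<rightarrow> carrier R"
        using M.M.right_span_image_eq[OF fin bM] unfolding span by blast
      let ?c = "\<lambda>i. if i \<in> I then c i else \<zero>"
      have "M.M.lincomb ?c b I = x" unfolding c(1) using bM c(2) by (intro M.M.lincomb_cong) auto
      moreover have "?c \<in> carrier ?S" using c(2) by (auto simp: std_simps)
      ultimately show "x \<in> (\<lambda>q. M.M.lincomb q b I) ` carrier ?S"
        by (intro image_eqI[where x = ?c]) simp_all
    qed (use M.M.lincomb_closed[OF bM] in \<open>auto simp: std_simps\<close>)
  next
    fix x assume x: "x \<in> carrier ?S"
    have xI: "x \<in> I \<rightarrow> carrier R" using x by (auto simp: std_simps)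
    show "M.M.lincomb x b I = \<zero>\<^bsub>M\<^esub> \<longleftrightarrow> (\<exists>y \<in> carrier ?S. x = y \<odot>\<^sup>r\<^bsub>?S\<^esub> P)"
    proof
      assume "M.M.lincomb x b I = \<zero>\<^bsub>M\<^esub>"
      then obtain t where t: "\<And>i. i \<in> I \<Longrightarrow> t i \<in> carrier R \<and> x i = t i \<otimes> P"
        using ind[OF xI] by metis
      let ?t = "\<lambda>i. if i \<in> I then t i else \<zero>"
      have "?t \<in> carrier ?S" "x = ?t \<odot>\<^sup>r\<^bsub>?S\<^esub> P" using t x by (auto simp: std_simps)
      then show "\<exists>y \<in> carrier ?S. x = y \<odot>\<^sup>r\<^bsub>?S\<^esub> P" by blast
    next
      assume "\<exists>y \<in> carrier ?S. x = y \<odot>\<^sup>r\<^bsub>?S\<^esub> P"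
      then obtain y where y: "y \<in> carrier ?S" "x = y \<odot>\<^sup>r\<^bsub>?S\<^esub> P" by auto
      then have yI: "y \<in> I \<rightarrow> carrier R" and xe: "x = (\<lambda>i. y i \<otimes> P)" by (auto simp: std_simps)
      show "M.M.lincomb x b I = \<zero>\<^bsub>M\<^esub>"
        unfolding xe using M.M.lincomb_rsmult[OF fin bM yI P_closed] MP M.M.lincomb_closed[OF bM yI]
        by simp
    qed
  qed
qed

text \<open>Surjectivity is Nakayama's lemma. For injectivity, an element of the kernel can be
  divided by \<open>P\<close> again and again without leaving the kernel, so its values are
  divisible by all powers of \<open>\<pi>\<close>.\<close>

lemma std_iso:
  assumes D: "struct_data I d \<tau> k" and L: "qbimodule L" and M: "qbimodule M"
    and LP: "\<And>x. x \<in> carrier L \<Longrightarrow> x \<odot>\<^sup>r\<^bsub>L\<^esub> P = \<zero>\<^bsub>L\<^esub> \<Longrightarrow> x = \<zero>\<^bsub>L\<^esub>"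
    and G: "finite G" "G \<subseteq> carrier L" "bimodule.right_span R L G = carrier L"
    and p: "right_trunc p L M"
    and e: "quat_bimodule.struct_rel R C P \<sigma> L I d \<tau> k e"
    and b: "quat_bimodule.basis R P M I (\<lambda>i. p (e i))"
  shows "(\<lambda>q. bimodule.lincomb L q e I) \<in> bimodule_iso R R (std_bimodule I d \<tau> k) L"
proof -
  interpret L: quat_bimodule R C A \<pi> P \<theta> \<eta> \<sigma> L by fact
  interpret M: quat_bimodule R C A \<pi> P \<theta> \<eta> \<sigma> M by fact
  let ?S = "std_bimodule I d \<tau> k"
  interpret S: bimodule R R ?S using std_bimodule[OF D] .
  have fin: "finite I" and bM: "(\<lambda>i. p (e i)) \<in> I \<rightarrow> carrier M"
    and span: "M.M.right_span ((\<lambda>i. p (e i)) ` I) = carrier M"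
    and ind: "\<And>c. c \<in> I \<rightarrow> carrier R \<Longrightarrow> M.M.lincomb c (\<lambda>i. p (e i)) I = \<zero>\<^bsub>M\<^esub>
      \<Longrightarrow> \<forall>i \<in> I. \<exists>t \<in> carrier R. c i = t \<otimes> P"
    using b by (auto simp: M.basis_def)
  have eL: "e \<in> I \<rightarrow> carrier L" using e by (auto simp: L.struct_rel_def)
  let ?f = "\<lambda>q. L.M.lincomb q e I"
  have hom: "?f \<in> bimodule_hom R R ?S L" by (rule L.std_hom[OF D e])
  have ph: "p \<in> bimodule_hom R R L M" and ker: "\<And>x. x \<in> carrier L \<Longrightarrow> p x = \<zero>\<^bsub>M\<^esub>
      \<longleftrightarrow> (\<exists>y \<in> carrier L. x = y \<odot>\<^sup>r\<^bsub>L\<^esub> P)"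
    using p by (auto simp: right_trunc_def)
  have plc: "p (L.M.lincomb c e I) = M.M.lincomb c (\<lambda>i. p (e i)) I" if "c \<in> I \<rightarrow> carrier R" for c
    by (rule bimodule_hom_lincomb[OF L.M.bimodule_axioms M.M.bimodule_axioms ph fin eL that])
  have surj: "?f ` carrier ?S = carrier L"
  proof -
    let ?H = "L.M.right_span (e ` I)"
    have Hc: "?H \<subseteq> carrier L"
      using L.M.right_submoduleD(1)[OF L.M.right_submodule_span] by auto
    \<comment> \<open>The images of the \<open>e i\<close> span \<open>M\<close>, so every
      \<open>x\<close> agrees with a combination of the \<open>e i\<close> up to the kernel
      \<open>L P\<close> of \<open>p\<close>.\<close>
    have "?H = carrier L"
    proof (rule L.nakayama[OF G(1,2) L.M.right_submodule_span])
      have "L.M.right_span (?H \<union> G) \<supseteq> L.M.right_span G" by (rule L.M.right_span_mono) auto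
      then show "L.M.right_span (?H \<union> G) = carrier L"
        using G(3) L.M.right_submoduleD(1)[OF L.M.right_submodule_span] by auto
    next
      fix x assume x: "x \<in> carrier L"
      then have "p x \<in> carrier M" using bimodule_hom_closed[OF ph] by simp
      then obtain c where c: "p x = M.M.lincomb c (\<lambda>i. p (e i)) I" "c \<in> I \<rightarrow> carrier R"
        using M.M.right_span_image_eq[OF fin bM] unfolding span by blast
      let ?h = "L.M.lincomb c e I"
      have h: "?h \<in> ?H" using L.M.right_span_image_eq[OF fin eL] c by auto
      have hL: "?h \<in> carrier L" using h Hc by auto
      have "p (x \<ominus>\<^bsub>L\<^esub> ?h) = p x \<ominus>\<^bsub>M\<^esub> p ?h"
        by (rule bimodule_hom_minus[OF L.M.bimodule_axioms M.M.bimodule_axioms ph x hL])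
      also have "\<dots> = \<zero>\<^bsub>M\<^esub>"
        using c plc[OF c(2)] bimodule_hom_closed[OF ph x] by (simp add: a_minus_def M.M.M.r_neg)
      finally obtain y where y: "y \<in> carrier L" "x \<ominus>\<^bsub>L\<^esub> ?h = y \<odot>\<^sup>r\<^bsub>L\<^esub> P"
        using ker[of "x \<ominus>\<^bsub>L\<^esub> ?h"] x hL by auto
      have "x = ?h \<oplus>\<^bsub>L\<^esub> (x \<ominus>\<^bsub>L\<^esub> ?h)"
        using x hL by (simp add: a_minus_def L.M.M.a_ac L.M.M.r_neg)
      then show "\<exists>h \<in> ?H. \<exists>y \<in> carrier L. x = h \<oplus>\<^bsub>L\<^esub> y \<odot>\<^sup>r\<^bsub>L\<^esub> P"
        using h y by metis
    qed
    show ?thesis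
    proof (intro equalityI subsetI)
      fix x assume "x \<in> carrier L"
      then obtain c where c: "x = L.M.lincomb c e I" "c \<in> I \<rightarrow> carrier R"
        using L.M.right_span_image_eq[OF fin eL] unfolding \<open>?H = carrier L\<close> by blast
      let ?c = "\<lambda>i. if i \<in> I then c i else \<zero>"
      have "L.M.lincomb ?c e I = x" unfolding c(1) using eL c(2) by (intro L.M.lincomb_cong) auto
      moreover have "?c \<in> carrier ?S" using c(2) by (auto simp: std_simps)
      ultimately show "x \<in> ?f ` carrier ?S"
        by (intro image_eqI[where x = ?c]) simp_all
    qed (use bimodule_hom_closed[OF hom] in auto)
  qed
  \<comment> \<open>Independence of the images makes all coefficients divisible by \<open>P\<close>;
    the quotient is again in the kernel because \<open>P\<close> acts injectively on
    \<open>L\<close>.\<close>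
  have step: "\<exists>q' \<in> carrier ?S. q = (\<lambda>i. q' i \<otimes> P) \<and> ?f q' = \<zero>\<^bsub>L\<^esub>"
    if q: "q \<in> carrier ?S" "?f q = \<zero>\<^bsub>L\<^esub>" for q
  proof -
    have qI: "q \<in> I \<rightarrow> carrier R" using q by (auto simp: std_simps)
    have "M.M.lincomb q (\<lambda>i. p (e i)) I = \<zero>\<^bsub>M\<^esub>"
      using plc[OF qI] q(2) bimodule_hom_zero[OF L.M.bimodule_axioms M.M.bimodule_axioms ph] by simp
    then obtain t where t: "\<And>i. i \<in> I \<Longrightarrow> t i \<in> carrier R \<and> q i = t i \<otimes> P"
      using ind[OF qI] by metis
    let ?t = "\<lambda>i. if i \<in> I then t i else \<zero>"
    have tS: "?t \<in> carrier ?S" and tq: "q = (\<lambda>i. ?t i \<otimes> P)" using t q by (auto simp: std_simps)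
    have tI: "?t \<in> I \<rightarrow> carrier R" using t by auto
    have "?f ?t \<odot>\<^sup>r\<^bsub>L\<^esub> P = ?f (\<lambda>i. ?t i \<otimes> P)"
      using L.M.lincomb_rsmult[OF fin eL tI P_closed] by simp
    also have "(\<lambda>i. ?t i \<otimes> P) = q" using tq by simp
    finally have "?f ?t = \<zero>\<^bsub>L\<^esub>" using q(2) LP[OF L.M.lincomb_closed[OF eL tI]] by simp
    then show ?thesis using tS tq by (intro bexI[of _ ?t] conjI)
  qed
  have descent: "\<exists>q' \<in> carrier ?S. q = (\<lambda>i. q' i \<otimes> P [^] n) \<and> ?f q' = \<zero>\<^bsub>L\<^esub>"
    if q: "q \<in> carrier ?S" "?f q = \<zero>\<^bsub>L\<^esub>" for q and n :: nat
  proof (induction n)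
    case 0
    have "q = (\<lambda>i. q i \<otimes> P [^] (0::nat))" using q by (auto simp: std_simps)
    then show ?case using q by blast
  next
    case (Suc n)
    then obtain q1 where q1: "q1 \<in> carrier ?S" "q = (\<lambda>i. q1 i \<otimes> P [^] n)" "?f q1 = \<zero>\<^bsub>L\<^esub>" by auto
    obtain q2 where q2: "q2 \<in> carrier ?S" "q1 = (\<lambda>i. q2 i \<otimes> P)" "?f q2 = \<zero>\<^bsub>L\<^esub>"
      using step[OF q1(1,3)] by auto
    have "P \<otimes> P [^] n = P [^] Suc n" by (rule R.nat_pow_Suc2[OF P_closed, symmetric])
    then have "q = (\<lambda>i. q2 i \<otimes> P [^] Suc n)"
      using q1(2) q2(1,2) by (auto simp: std_simps R.m_assoc simp del: R.nat_pow_Suc)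
    then show ?case using q2 by blast
  qed
  have inj0: "q = \<zero>\<^bsub>?S\<^esub>" if q: "q \<in> carrier ?S" "?f q = \<zero>\<^bsub>L\<^esub>" for q
  proof
    fix i
    \<comment> \<open>Division by \<open>P\<close> is carried out \<open>2 n\<close> times, because
      \<open>separated\<close> speaks of powers of \<open>\<pi> = P P\<close>.\<close>
    have "\<exists>s \<in> carrier R. q i = s \<otimes> \<pi> [^] n" for n :: nat
    proof -
      obtain q' where q': "q' \<in> carrier ?S" "q = (\<lambda>i. q' i \<otimes> P [^] (2 * n))"
        using descent[OF q] by blast
      have "P [^] (2 * n) = (P [^] (2::nat)) [^] n" by (simp add: R.nat_pow_pow)
      also have "P [^] (2::nat) = \<pi>" using P_square by (simp add: numeral_2_eq_2)
      finally show ?thesis using q' by (auto simp: std_simps)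
    qed
    then show "q i = \<zero>\<^bsub>?S\<^esub> i" using separated[of "q i"] q(1) by (auto simp: std_simps)
  qed
  have "inj_on ?f (carrier ?S)"
  proof (rule inj_onI)
    fix x y assume x: "x \<in> carrier ?S" and y: "y \<in> carrier ?S" and xy: "?f x = ?f y"
    have "?f (x \<ominus>\<^bsub>?S\<^esub> y) = ?f x \<ominus>\<^bsub>L\<^esub> ?f y"
      by (rule bimodule_hom_minus[OF S.bimodule_axioms L.M.bimodule_axioms hom x y])
    also have "\<dots> = \<zero>\<^bsub>L\<^esub>"
      using xy bimodule_hom_closed[OF hom y] by (simp add: a_minus_def L.M.M.r_neg)
    finally have "x \<ominus>\<^bsub>?S\<^esub> y = \<zero>\<^bsub>?S\<^esub>" using inj0[of "x \<ominus>\<^bsub>?S\<^esub> y"] x y by simp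
    then show "x = y" using S.M.minus_eq_zeroD x y by blast
  qed
  then show ?thesis using hom surj by (auto simp: bimodule_iso_iff bij_betw_def)
qed

end

section \<open>Homogeneous elements\<close>

context bimodule
begin

lemma right_submodule_additive: "right_submodule H \<Longrightarrow> additive_subgroup H M"
proof -
  assume H: "right_submodule H"
  note h = right_submoduleD[OF H]
  show ?thesis
    by unfold_locales
      (use h in \<open>auto simp: a_inv_def[symmetric]\<close>)
qed

end

context quat_order
begin

text \<open>Representatives for \<open>R / R P\<close>. They make spans in residue bimodules finite
  and countable by coefficient families.\<close>

lemma transversal:
  obtains T rep where "finite T" "T \<subseteq> carrier R" "2 \<le> card T"
    "\<And>r. r \<in> carrier R \<Longrightarrow> rep r \<in> T"
    "\<And>r. r \<in> carrier R \<Longrightarrow> \<exists>t \<in> carrier R. r = rep r \<oplus> t \<otimes> P"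
    "\<And>a b t. \<lbrakk>a \<in> T; b \<in> T; t \<in> carrier R; a = b \<oplus> t \<otimes> P\<rbrakk> \<Longrightarrow> a = b"
proof -
  let ?E = "\<lambda>r s. s \<in> carrier R \<and> (\<exists>t \<in> carrier R. r = s \<oplus> t \<otimes> P)"
  define rep where "rep r = (SOME s. ?E r s)" for r
  have refl: "?E r r" if "r \<in> carrier R" for r
    using that by (auto intro!: bexI[of _ \<zero>])
  have sym: "?E s r" if rs: "?E r s" "r \<in> carrier R" for r s
  proof -
    obtain t where t: "t \<in> carrier R" "r = s \<oplus> t \<otimes> P" using rs by auto
    have "s = r \<oplus> (\<ominus> t) \<otimes> P" using t that by (simp add: R.l_minus R.a_assoc R.r_neg)
    then show ?thesis using t that by blast
  qed
  have trans: "?E r u" if rs: "?E r s" "?E s u" "r \<in> carrier R" for r s u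
  proof -
    obtain t t' where t: "t \<in> carrier R" "r = s \<oplus> t \<otimes> P" "t' \<in> carrier R" "s = u \<oplus> t' \<otimes> P"
      using rs by auto
    have "r = u \<oplus> (t' \<oplus> t) \<otimes> P" using t that by (simp add: R.l_distr R.a_assoc)
    then show ?thesis using t that by blast
  qed
  have rep: "?E r (rep r)" if "r \<in> carrier R" for r
    unfolding rep_def by (rule someI[of "?E r", OF refl[OF that]])
  have rep_eq: "rep r = rep s" if rs: "?E r s" "r \<in> carrier R" for r s
  proof -
    have "?E r u = ?E s u" for u
    proof
      show "?E r u" if "?E s u" by (rule trans[OF rs(1) that rs(2)])
      show "?E s u" if "?E r u" using trans[OF sym[OF rs] that] rs(1) by blast
    qed
    then show ?thesis unfolding rep_def by simp
  qed
  obtain D where D: "finite D" "D \<subseteq> C" "\<And>c. c \<in> C \<Longrightarrow> \<exists>d \<in> D. \<exists>b \<in> C. c = d \<oplus> \<pi> \<otimes> b"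
    using residue_finite by auto
  let ?T = "rep ` carrier R"
  \<comment> \<open>Modulo \<open>R P\<close> only the C-component of \<open>r\<close> matters, and
    this only modulo \<open>\<pi>\<close>, as \<open>\<pi> b = b P P\<close>.\<close>
  have "?T \<subseteq> rep ` D"
  proof
    fix x assume "x \<in> ?T"
    then obtain r where r: "r \<in> carrier R" "x = rep r" by auto
    obtain d b where d: "d \<in> D" "b \<in> C" "comp0 r = d \<oplus> \<pi> \<otimes> b" using D(3) comps(1)[OF r(1)] by blast
    have dc: "d \<in> carrier R" using d D(2) by auto
    have "r = d \<oplus> b \<otimes> P \<otimes> P \<oplus> comp1 r \<otimes> P"
      using comps(2,3)[OF r(1)] d dc A_central[OF \<pi>_A] P_square by (simp add: R.m_assoc)
    also have "\<dots> = d \<oplus> (b \<otimes> P \<oplus> comp1 r) \<otimes> P"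
      using comps(2)[OF r(1)] d dc by (simp add: R.l_distr R.a_assoc)
    finally have rd: "?E r d"
      using dc d comps(2)[OF r(1)] by (intro conjI bexI[of _ "b \<otimes> P \<oplus> comp1 r"]) auto
    then have "x = rep d" using rep_eq[OF rd r(1)] r(2) by simp
    then show "x \<in> rep ` D" using d by simp
  qed
  then have fin: "finite ?T" using D(1) finite_surj by blast
  have inj: "a = b" if ab: "a \<in> ?T" "b \<in> ?T" "t \<in> carrier R" "a = b \<oplus> t \<otimes> P" for a b t
  proof -
    obtain r s where r: "r \<in> carrier R" "a = rep r" and s: "s \<in> carrier R" "b = rep s" using ab by auto
    have ra: "?E r a" and sb: "?E s b" using rep[OF r(1)] rep[OF s(1)] unfolding r(2) s(2) .
    have "?E a b" 
      by (rule conjI[OF conjunct1[OF sb]], rule bexI[of _ t], rule ab(4), rule ab(3))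
    have ac: "a \<in> carrier R" using ra by blast
    show ?thesis
      using rep_eq[OF ra r(1)] rep_eq[OF \<open>?E a b\<close> ac] rep_eq[OF sb s(1)] r(2) s(2) by metis
  qed
  \<comment> \<open>Two classes are needed later: equality of powers of the number of classes must
    force equality of exponents.\<close>
  have "rep \<zero> \<noteq> rep \<one>"
  proof
    assume eq: "rep \<zero> = rep \<one>"
    have "?E \<one> (rep \<zero>)" unfolding eq by (rule rep) simp
    moreover have "?E (rep \<zero>) \<zero>" by (rule sym[OF rep]) simp_all
    ultimately have "?E \<one> \<zero>" by (rule trans) simp
    then obtain t where t: "t \<in> carrier R" "\<one> = \<zero> \<oplus> t \<otimes> P" by auto
    then have "t \<otimes> P = \<one>" by simp
    then show False using one_not_P[OF t(1)] by contradiction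
  qed
  then have "card {rep \<zero>, rep \<one>} = 2" by simp
  then have "2 \<le> card ?T" using card_mono[OF fin, of "{rep \<zero>, rep \<one>}"] by auto
  then show thesis
    using fin inj rep by (intro that[of ?T rep]) (blast, blast, simp, blast, blast, blast)
qed

text \<open>The normalizing factor of the projection to degree \<open>d\<close>; exchanging
  \<open>\<theta>\<close> and its conjugate changes the sign.\<close>

definition homog_inv :: "bool \<Rightarrow> 'a"
  where "homog_inv d = (if d then \<eta> else \<ominus> \<eta>)"

lemma homog_inv: "homog_inv d \<in> C" "(twist d \<theta> \<ominus> twist (\<not> d) \<theta>) \<otimes> homog_inv d = \<one>"
proof -
  show "homog_inv d \<in> C" using \<eta>_C by (simp add: homog_inv_def C_ops)
  have "\<theta> \<ominus> \<sigma> \<theta> = \<ominus> (\<sigma> \<theta> \<ominus> \<theta>)" using \<theta>_C \<sigma>_closed by (simp add: a_minus_def R.minus_add R.a_comm)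
  then have "(\<theta> \<ominus> \<sigma> \<theta>) \<otimes> (\<ominus> \<eta>) = (\<sigma> \<theta> \<ominus> \<theta>) \<otimes> \<eta>"
    using \<theta>_C \<eta>_C \<sigma>_closed by (simp add: R.l_minus R.r_minus)
  then show "(twist d \<theta> \<ominus> twist (\<not> d) \<theta>) \<otimes> homog_inv d = \<one>"
    using \<eta>_inv by (auto simp: homog_inv_def twist_def)
qed

lemma R_gen:
  assumes r: "r \<in> carrier R"
  obtains s t s' t' where "s \<in> A" "t \<in> A" "s' \<in> A" "t' \<in> A"
    "r = (s \<oplus> t \<otimes> \<theta>) \<oplus> (s' \<otimes> P \<oplus> t' \<otimes> (\<theta> \<otimes> P))"
proof -
  obtain s t where st: "s \<in> A" "t \<in> A" "comp0 r = s \<oplus> t \<otimes> \<theta>" using C_gen comps(1)[OF r] by blast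
  obtain s' t' where st': "s' \<in> A" "t' \<in> A" "comp1 r = s' \<oplus> t' \<otimes> \<theta>" using C_gen comps(2)[OF r] by blast
  have "r = (s \<oplus> t \<otimes> \<theta>) \<oplus> (s' \<oplus> t' \<otimes> \<theta>) \<otimes> P" using comps(3)[OF r] st st' by simp
  also have "\<dots> = (s \<oplus> t \<otimes> \<theta>) \<oplus> (s' \<otimes> P \<oplus> t' \<otimes> (\<theta> \<otimes> P))"
    using st st' \<theta>_C by (simp add: R.l_distr R.m_assoc)
  finally show thesis using st st' that by blast
qed

end

context quat_bimodule
begin

text \<open>\<open>R\<close> is generated over \<open>A\<close> by
  \<open>1, \<theta>, P, \<theta> P\<close>, and left scalars from \<open>A\<close> can be moved to
  the right. So left multiples of \<open>U\<close> by these four elements generate on the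
  right.\<close>

lemma right_finite:
  assumes U: "finite U" "U \<subseteq> carrier M" "\<And>N. sub_bimodule R R N M \<Longrightarrow> U \<subseteq> N \<Longrightarrow> N = carrier M"
  obtains G where "finite G" "G \<subseteq> carrier M" "M.right_span G = carrier M"
proof
  let ?G = "(\<lambda>(r, u). r \<odot>\<^bsub>M\<^esub> u) ` ({\<one>, \<theta>, P, \<theta> \<otimes> P} \<times> U)"
  show "finite ?G" using U(1) by simp
  show GM: "?G \<subseteq> carrier M" using U(2) \<theta>_C by (auto intro!: M.smult_closed)
  note H = M.right_submodule_span[of ?G]
  note sp = M.right_submoduleD[OF H]
  \<comment> \<open>The elements whose left multiples all stay in the right span form a
    sub-bimodule; minimality of generation by \<open>U\<close> applies to it.\<close>
  let ?N = "{x \<in> carrier M. \<forall>r \<in> carrier R. r \<odot>\<^bsub>M\<^esub> x \<in> M.right_span ?G}"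
  have N: "M.right_submodule ?N"
    unfolding M.right_submodule_def
    using sp by (auto simp: M.smult_zero M.smult_r_distr M.rsmult_closed M.smult_rsmult[symmetric])
  have "sub_bimodule R R ?N M"
    unfolding sub_bimodule_def
    using M.right_submodule_additive[OF N] M.right_submoduleD(4)[OF N]
    by (auto simp: M.smult_closed M.smult_assoc[symmetric])
  moreover have "U \<subseteq> ?N"
  proof
    fix u assume u: "u \<in> U"
    then have uM: "u \<in> carrier M" using U by auto
    have g: "u \<in> M.right_span ?G" "\<theta> \<odot>\<^bsub>M\<^esub> u \<in> M.right_span ?G" "P \<odot>\<^bsub>M\<^esub> u \<in> M.right_span ?G"
      "(\<theta> \<otimes> P) \<odot>\<^bsub>M\<^esub> u \<in> M.right_span ?G"
    proof -
      have "(r \<odot>\<^bsub>M\<^esub> u) \<in> M.right_span ?G" if "r \<in> {\<one>, \<theta>, P, \<theta> \<otimes> P}" for r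
        using M.right_span_superset[OF GM] that u by blast
      from this[of \<one>] this[of \<theta>] this[of P] this[of "\<theta> \<otimes> P"]
      show "u \<in> M.right_span ?G" "\<theta> \<odot>\<^bsub>M\<^esub> u \<in> M.right_span ?G" "P \<odot>\<^bsub>M\<^esub> u \<in> M.right_span ?G"
        "(\<theta> \<otimes> P) \<odot>\<^bsub>M\<^esub> u \<in> M.right_span ?G" using uM by (auto simp: M.smult_one)
    qed
    have "r \<odot>\<^bsub>M\<^esub> u \<in> M.right_span ?G" if r: "r \<in> carrier R" for r
    proof -
      obtain s t s' t' where st: "s \<in> A" "t \<in> A" "s' \<in> A" "t' \<in> A"
        and e: "r = (s \<oplus> t \<otimes> \<theta>) \<oplus> (s' \<otimes> P \<oplus> t' \<otimes> (\<theta> \<otimes> P))" using R_gen[OF r] by metis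
      have "r \<odot>\<^bsub>M\<^esub> u = (s \<odot>\<^bsub>M\<^esub> u \<oplus>\<^bsub>M\<^esub> t \<odot>\<^bsub>M\<^esub> (\<theta> \<odot>\<^bsub>M\<^esub> u))
          \<oplus>\<^bsub>M\<^esub> (s' \<odot>\<^bsub>M\<^esub> (P \<odot>\<^bsub>M\<^esub> u) \<oplus>\<^bsub>M\<^esub> t' \<odot>\<^bsub>M\<^esub> ((\<theta> \<otimes> P) \<odot>\<^bsub>M\<^esub> u))"
        unfolding e using st \<theta>_C uM
        by (simp add: M.smult_l_distr M.smult_assoc[of t] M.smult_assoc[of s'] M.smult_assoc[of t'])
      then show ?thesis
        using st g sp(1,3,4) by (simp add: agree)
    qed
    then show "u \<in> ?N" using uM by auto
  qed
  ultimately have "?N = carrier M" by (rule U(3))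
  then have "\<one> \<odot>\<^bsub>M\<^esub> x \<in> M.right_span ?G" if "x \<in> carrier M" for x using that by blast
  then show "M.right_span ?G = carrier M" using sp(1) by (auto simp: M.smult_one)
qed

lemma lincomb_mod_P:
  assumes P0: "\<And>x. x \<in> carrier M \<Longrightarrow> x \<odot>\<^sup>r\<^bsub>M\<^esub> P = \<zero>\<^bsub>M\<^esub>"
    and e: "e \<in> I \<rightarrow> carrier M" and c: "c \<in> I \<rightarrow> carrier R" "c' \<in> I \<rightarrow> carrier R"
    and eq: "\<And>i. i \<in> I \<Longrightarrow> \<exists>t \<in> carrier R. c i = c' i \<oplus> t \<otimes> P"
  shows "M.lincomb c e I = M.lincomb c' e I"
  unfolding M.lincomb_def
proof (rule M.finsum_cong')
  fix i assume i: "i \<in> I"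
  then have ci: "c' i \<in> carrier R" "e i \<in> carrier M" using e c by auto
  obtain t where t: "t \<in> carrier R" "c i = c' i \<oplus> t \<otimes> P" using eq[OF i] by auto
  show "e i \<odot>\<^sup>r\<^bsub>M\<^esub> c i = e i \<odot>\<^sup>r\<^bsub>M\<^esub> c' i"
    unfolding t(2) using ci t(1) P0[OF M.rsmult_closed[OF t(1) ci(2)]]
    by (simp add: M.rsmult_r_distr M.rsmult_assoc M.rsmult_closed)
qed (use e c in \<open>auto simp: Pi_iff intro!: M.rsmult_closed\<close>)

section \<open>The grading by degree\<close>

definition homog :: "bool \<Rightarrow> 'c set"
  where "homog d = {x \<in> carrier M. \<forall>a \<in> C. a \<odot>\<^bsub>M\<^esub> x = x \<odot>\<^sup>r\<^bsub>M\<^esub> twist d a}"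

lemma homogD: "x \<in> homog d \<Longrightarrow> x \<in> carrier M"
  "x \<in> homog d \<Longrightarrow> a \<in> C \<Longrightarrow> a \<odot>\<^bsub>M\<^esub> x = x \<odot>\<^sup>r\<^bsub>M\<^esub> twist d a"
  by (auto simp: homog_def)

text \<open>\<open>C\<close> is generated over \<open>A\<close> by \<open>\<theta>\<close>, and
  \<open>A\<close> acts alike on both sides and is fixed by \<open>\<sigma>\<close>.\<close>

lemma homogI:
  assumes x: "x \<in> carrier M" and e: "\<theta> \<odot>\<^bsub>M\<^esub> x = x \<odot>\<^sup>r\<^bsub>M\<^esub> twist d \<theta>"
  shows "x \<in> homog d"
proof -
  have "a \<odot>\<^bsub>M\<^esub> x = x \<odot>\<^sup>r\<^bsub>M\<^esub> twist d a" if "a \<in> C" for a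
  proof -
    obtain s t where st: "s \<in> A" "t \<in> A" "a = s \<oplus> t \<otimes> \<theta>" using C_gen \<open>a \<in> C\<close> by blast
    note stC = st(1,2)[THEN A_C]
    have "a \<odot>\<^bsub>M\<^esub> x = x \<odot>\<^sup>r\<^bsub>M\<^esub> s \<oplus>\<^bsub>M\<^esub> (x \<odot>\<^sup>r\<^bsub>M\<^esub> twist d \<theta>) \<odot>\<^sup>r\<^bsub>M\<^esub> t"
      using st stC \<theta>_C x e M.rsmult_closed[of "twist d \<theta>" x]
      by (simp add: M.smult_l_distr M.smult_assoc agree)
    also have "\<dots> = x \<odot>\<^sup>r\<^bsub>M\<^esub> (s \<oplus> t \<otimes> twist d \<theta>)"
      using st \<theta>_C x A_central[OF st(2), of "twist d \<theta>"]
      by (simp add: M.rsmult_r_distr M.rsmult_assoc[symmetric])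
    also have "s \<oplus> t \<otimes> twist d \<theta> = twist d a"
      using st stC \<theta>_C by (simp add: twist_add twist_mult C_ops twist_A)
    finally show ?thesis .
  qed
  then show ?thesis using x by (auto simp: homog_def)
qed

lemma homog_zero: "\<zero>\<^bsub>M\<^esub> \<in> homog d"
  by (auto simp: homog_def M.smult_zero M.zero_rsmult)

lemma homog_add: "x \<in> homog d \<Longrightarrow> y \<in> homog d \<Longrightarrow> x \<oplus>\<^bsub>M\<^esub> y \<in> homog d"
  by (auto simp: homog_def M.smult_r_distr M.rsmult_l_distr)

lemma homog_rsmult: "x \<in> homog d \<Longrightarrow> c \<in> C \<Longrightarrow> x \<odot>\<^sup>r\<^bsub>M\<^esub> c \<in> homog d"
proof -
  assume x: "x \<in> homog d" and c: "c \<in> C"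
  have "a \<odot>\<^bsub>M\<^esub> (x \<odot>\<^sup>r\<^bsub>M\<^esub> c) = x \<odot>\<^sup>r\<^bsub>M\<^esub> c \<odot>\<^sup>r\<^bsub>M\<^esub> twist d a" if a: "a \<in> C" for a
    using homogD[OF x] a c C_comm[OF twist_closed[OF a, of d] c]
    by (simp add: M.smult_rsmult[symmetric] M.rsmult_assoc[symmetric])
  then show ?thesis using homogD(1)[OF x] c by (simp add: homog_def M.rsmult_closed)
qed

lemma homog_P:
  assumes x: "x \<in> homog d" shows "P \<odot>\<^bsub>M\<^esub> x \<in> homog (\<not> d)"
proof -
  have "a \<odot>\<^bsub>M\<^esub> (P \<odot>\<^bsub>M\<^esub> x) = P \<odot>\<^bsub>M\<^esub> x \<odot>\<^sup>r\<^bsub>M\<^esub> twist (\<not> d) a" if a: "a \<in> C" for a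
  proof -
    have "a \<odot>\<^bsub>M\<^esub> (P \<odot>\<^bsub>M\<^esub> x) = P \<odot>\<^bsub>M\<^esub> (\<sigma> a \<odot>\<^bsub>M\<^esub> x)"
      using homogD(1)[OF x] a \<sigma>_closed by (simp add: M.smult_assoc[symmetric] C_P[OF a])
    also have "\<dots> = P \<odot>\<^bsub>M\<^esub> (x \<odot>\<^sup>r\<^bsub>M\<^esub> twist (\<not> d) a)"
      using homogD(2)[OF x \<sigma>_closed[OF a]] a by (simp add: twist_\<sigma>)
    finally show ?thesis using homogD(1)[OF x] a by (simp add: M.smult_rsmult)
  qed
  then show ?thesis using homogD(1)[OF x] by (simp add: homog_def M.smult_closed)
qed

text \<open>Lagrange interpolation for left multiplication by \<open>\<theta>\<close>: the bracket
  vanishes in degree \<open>\<not> d\<close>, and in degree \<open>d\<close> it is right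
  multiplication by the difference that \<open>homog_inv d\<close> inverts.\<close>

definition proj :: "bool \<Rightarrow> 'c \<Rightarrow> 'c"
  where "proj d x = (\<theta> \<odot>\<^bsub>M\<^esub> x \<ominus>\<^bsub>M\<^esub> x \<odot>\<^sup>r\<^bsub>M\<^esub> twist (\<not> d) \<theta>) \<odot>\<^sup>r\<^bsub>M\<^esub> homog_inv d"

text \<open>Cayley-Hamilton: trace and norm of \<open>\<theta>\<close> lie in \<open>A\<close>,
  hence act alike on both sides. So left \<open>\<theta>\<close> minus right
  \<open>twist d \<theta>\<close>, composed with left \<open>\<theta>\<close> minus right
  \<open>twist (\<not> d) \<theta>\<close>, is zero.\<close>

lemma proj_homog:
  assumes x: "x \<in> carrier M" shows "proj d x \<in> homog d"
proof -
  let ?t = "twist d \<theta>" and ?t' = "twist (\<not> d) \<theta>"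
  have t: "?t \<in> carrier R" "?t' \<in> carrier R" "\<theta> \<in> carrier R" using \<theta>_C by auto
  have tr: "?t' \<oplus> ?t = \<theta> \<oplus> \<sigma> \<theta>" and nm: "?t' \<otimes> ?t = \<theta> \<otimes> \<sigma> \<theta>"
    using \<theta>_C \<sigma>_closed C_comm by (auto simp: twist_def R.a_comm)
  let ?y = "\<theta> \<odot>\<^bsub>M\<^esub> x \<ominus>\<^bsub>M\<^esub> x \<odot>\<^sup>r\<^bsub>M\<^esub> ?t'"
  have y: "?y \<in> carrier M" using x t by (auto intro!: M.smult_closed M.rsmult_closed)
  have a: "\<theta> \<odot>\<^bsub>M\<^esub> (\<theta> \<odot>\<^bsub>M\<^esub> x) \<in> carrier M" "(\<theta> \<odot>\<^bsub>M\<^esub> x) \<odot>\<^sup>r\<^bsub>M\<^esub> ?t \<in> carrier M"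
    "(\<theta> \<odot>\<^bsub>M\<^esub> x) \<odot>\<^sup>r\<^bsub>M\<^esub> ?t' \<in> carrier M" "(x \<odot>\<^sup>r\<^bsub>M\<^esub> ?t') \<odot>\<^sup>r\<^bsub>M\<^esub> ?t \<in> carrier M"
    using x t by (auto intro!: M.smult_closed M.rsmult_closed)
  have "\<theta> \<odot>\<^bsub>M\<^esub> (\<theta> \<odot>\<^bsub>M\<^esub> x) \<oplus>\<^bsub>M\<^esub> (x \<odot>\<^sup>r\<^bsub>M\<^esub> ?t') \<odot>\<^sup>r\<^bsub>M\<^esub> ?t
      = (\<theta> \<otimes> \<theta>) \<odot>\<^bsub>M\<^esub> x \<oplus>\<^bsub>M\<^esub> (\<theta> \<otimes> \<sigma> \<theta>) \<odot>\<^bsub>M\<^esub> x"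
    using x t agree[OF norm_A x] by (simp add: M.smult_assoc M.rsmult_assoc[symmetric] nm)
  also have "\<dots> = \<theta> \<odot>\<^bsub>M\<^esub> ((\<theta> \<oplus> \<sigma> \<theta>) \<odot>\<^bsub>M\<^esub> x)"
    using x t \<theta>_C \<sigma>_closed by (simp add: M.smult_l_distr[symmetric] R.r_distr M.smult_assoc[symmetric])
  also have "\<dots> = (\<theta> \<odot>\<^bsub>M\<^esub> x) \<odot>\<^sup>r\<^bsub>M\<^esub> ?t' \<oplus>\<^bsub>M\<^esub> (\<theta> \<odot>\<^bsub>M\<^esub> x) \<odot>\<^sup>r\<^bsub>M\<^esub> ?t"
    using x t agree[OF trace_A x]
    by (simp add: M.smult_rsmult tr[symmetric] M.rsmult_r_distr M.smult_r_distr M.rsmult_closed)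
  finally have sum: "\<theta> \<odot>\<^bsub>M\<^esub> (\<theta> \<odot>\<^bsub>M\<^esub> x) \<oplus>\<^bsub>M\<^esub> (x \<odot>\<^sup>r\<^bsub>M\<^esub> ?t') \<odot>\<^sup>r\<^bsub>M\<^esub> ?t
      = (\<theta> \<odot>\<^bsub>M\<^esub> x) \<odot>\<^sup>r\<^bsub>M\<^esub> ?t' \<oplus>\<^bsub>M\<^esub> (\<theta> \<odot>\<^bsub>M\<^esub> x) \<odot>\<^sup>r\<^bsub>M\<^esub> ?t" .
  have swap: "u \<ominus>\<^bsub>M\<^esub> v = w \<ominus>\<^bsub>M\<^esub> z" if "u \<oplus>\<^bsub>M\<^esub> z = v \<oplus>\<^bsub>M\<^esub> w"
    "u \<in> carrier M" "v \<in> carrier M" "w \<in> carrier M" "z \<in> carrier M" for u v w z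
  proof -
    have "u \<ominus>\<^bsub>M\<^esub> v = (u \<oplus>\<^bsub>M\<^esub> z) \<ominus>\<^bsub>M\<^esub> z \<ominus>\<^bsub>M\<^esub> v"
      using that(2-) by (simp add: a_minus_def M.a_assoc M.r_neg)
    also have "\<dots> = (w \<ominus>\<^bsub>M\<^esub> z) \<oplus>\<^bsub>M\<^esub> (v \<oplus>\<^bsub>M\<^esub> \<ominus>\<^bsub>M\<^esub> v)"
      unfolding that(1) using that(2-) by (simp add: a_minus_def M.a_ac)
    also have "\<dots> = w \<ominus>\<^bsub>M\<^esub> z"
      using that(2-) by (simp add: M.r_neg)
    finally show ?thesis .
  qed
  have "\<theta> \<odot>\<^bsub>M\<^esub> ?y = \<theta> \<odot>\<^bsub>M\<^esub> (\<theta> \<odot>\<^bsub>M\<^esub> x) \<ominus>\<^bsub>M\<^esub> (\<theta> \<odot>\<^bsub>M\<^esub> x) \<odot>\<^sup>r\<^bsub>M\<^esub> ?t'"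
    using x t by (simp add: a_minus_def M.smult_r_distr M.smult_minus M.smult_closed M.rsmult_closed M.smult_rsmult)
  also have "\<dots> = (\<theta> \<odot>\<^bsub>M\<^esub> x) \<odot>\<^sup>r\<^bsub>M\<^esub> ?t \<ominus>\<^bsub>M\<^esub> (x \<odot>\<^sup>r\<^bsub>M\<^esub> ?t') \<odot>\<^sup>r\<^bsub>M\<^esub> ?t"
    by (rule swap[OF sum a(1,3,2,4)])
  also have "\<dots> = ?y \<odot>\<^sup>r\<^bsub>M\<^esub> ?t"
    using x t by (simp add: a_minus_def M.rsmult_l_distr M.minus_rsmult M.smult_closed M.rsmult_closed)
  finally have "?y \<in> homog d" by (rule homogI[OF y])
  then show ?thesis unfolding proj_def by (rule homog_rsmult) (rule homog_inv)
qed

lemma proj_id: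
  assumes x: "x \<in> homog d" shows "proj d x = x"
proof -
  note xc = homogD(1)[OF x]
  have t: "twist d \<theta> \<in> carrier R" "twist (\<not> d) \<theta> \<in> carrier R" using \<theta>_C by auto
  have "\<theta> \<odot>\<^bsub>M\<^esub> x \<ominus>\<^bsub>M\<^esub> x \<odot>\<^sup>r\<^bsub>M\<^esub> twist (\<not> d) \<theta> = x \<odot>\<^sup>r\<^bsub>M\<^esub> (twist d \<theta> \<ominus> twist (\<not> d) \<theta>)"
    using xc t homogD(2)[OF x \<theta>_C] by (simp add: a_minus_def M.rsmult_r_distr M.rsmult_minus)
  then show ?thesis
    unfolding proj_def using xc t homog_inv[of d]
    by (simp add: M.rsmult_assoc[symmetric] M.rsmult_one)
qed

lemma proj_sum:
  assumes x: "x \<in> carrier M" shows "proj True x \<oplus>\<^bsub>M\<^esub> proj False x = x"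
proof -
  have t: "\<theta> \<in> carrier R" "\<sigma> \<theta> \<in> carrier R" "\<eta> \<in> carrier R" using \<theta>_C \<sigma>_closed \<eta>_C by auto
  let ?u = "\<theta> \<odot>\<^bsub>M\<^esub> x"
  have u: "?u \<in> carrier M" "x \<odot>\<^sup>r\<^bsub>M\<^esub> \<theta> \<in> carrier M" "x \<odot>\<^sup>r\<^bsub>M\<^esub> \<sigma> \<theta> \<in> carrier M"
    using x t by (auto intro: M.smult_closed M.rsmult_closed)
  have "proj True x \<oplus>\<^bsub>M\<^esub> proj False x
      = ((?u \<ominus>\<^bsub>M\<^esub> x \<odot>\<^sup>r\<^bsub>M\<^esub> \<theta>) \<ominus>\<^bsub>M\<^esub> (?u \<ominus>\<^bsub>M\<^esub> x \<odot>\<^sup>r\<^bsub>M\<^esub> \<sigma> \<theta>)) \<odot>\<^sup>r\<^bsub>M\<^esub> \<eta>"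
    using u t by (simp add: proj_def twist_def homog_inv_def a_minus_def M.rsmult_l_distr
        M.rsmult_minus M.minus_rsmult)
  also have "(?u \<ominus>\<^bsub>M\<^esub> x \<odot>\<^sup>r\<^bsub>M\<^esub> \<theta>) \<ominus>\<^bsub>M\<^esub> (?u \<ominus>\<^bsub>M\<^esub> x \<odot>\<^sup>r\<^bsub>M\<^esub> \<sigma> \<theta>)
      = (x \<odot>\<^sup>r\<^bsub>M\<^esub> \<sigma> \<theta> \<ominus>\<^bsub>M\<^esub> x \<odot>\<^sup>r\<^bsub>M\<^esub> \<theta>) \<oplus>\<^bsub>M\<^esub> (?u \<oplus>\<^bsub>M\<^esub> \<ominus>\<^bsub>M\<^esub> ?u)"
    using u by (simp add: a_minus_def M.minus_add M.a_ac)
  also have "\<dots> = x \<odot>\<^sup>r\<^bsub>M\<^esub> \<sigma> \<theta> \<ominus>\<^bsub>M\<^esub> x \<odot>\<^sup>r\<^bsub>M\<^esub> \<theta>"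
    using u by (simp add: M.r_neg)
  also have "\<dots> = x \<odot>\<^sup>r\<^bsub>M\<^esub> (\<sigma> \<theta> \<ominus> \<theta>)"
    using x t by (simp add: a_minus_def M.rsmult_r_distr M.rsmult_minus)
  also have "\<dots> \<odot>\<^sup>r\<^bsub>M\<^esub> \<eta> = x"
    using x t \<eta>_inv by (simp add: M.rsmult_assoc[symmetric] M.rsmult_one)
  finally show ?thesis .
qed

text \<open>Both degrees together give \<open>x (\<sigma> \<theta> - \<theta>) = 0\<close>, and the
  factor is invertible.\<close>

lemma homog_disjoint:
  assumes "x \<in> homog True" "x \<in> homog False" shows "x = \<zero>\<^bsub>M\<^esub>"
proof -
  note xc = homogD(1)[OF assms(1)]
  have t: "\<theta> \<in> carrier R" "\<sigma> \<theta> \<in> carrier R" "\<eta> \<in> carrier R" using \<theta>_C \<sigma>_closed \<eta>_C by auto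
  have "x \<odot>\<^sup>r\<^bsub>M\<^esub> \<sigma> \<theta> = x \<odot>\<^sup>r\<^bsub>M\<^esub> \<theta>"
    using homogD(2)[OF assms(1) \<theta>_C] homogD(2)[OF assms(2) \<theta>_C] by (simp add: twist_def)
  then have "x \<odot>\<^sup>r\<^bsub>M\<^esub> (\<sigma> \<theta> \<ominus> \<theta>) = \<zero>\<^bsub>M\<^esub>"
    using xc t by (simp add: a_minus_def M.rsmult_r_distr M.rsmult_minus M.r_neg M.rsmult_closed)
  then have "x \<odot>\<^sup>r\<^bsub>M\<^esub> ((\<sigma> \<theta> \<ominus> \<theta>) \<otimes> \<eta>) = \<zero>\<^bsub>M\<^esub>"
    using xc t by (simp add: M.rsmult_assoc M.zero_rsmult)
  then show ?thesis using \<eta>_inv xc by (simp add: M.rsmult_one)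
qed

end

context quat_order
begin

lemma proj_hom:
  assumes "qbimodule L" "qbimodule M" and p: "p \<in> bimodule_hom R R L M" and x: "x \<in> carrier L"
  shows "p (quat_bimodule.proj R \<theta> \<eta> \<sigma> L d x) = quat_bimodule.proj R \<theta> \<eta> \<sigma> M d (p x)"
proof -
  interpret L: quat_bimodule R C A \<pi> P \<theta> \<eta> \<sigma> L by fact
  interpret M: quat_bimodule R C A \<pi> P \<theta> \<eta> \<sigma> M by fact
  have m: "p (x \<ominus>\<^bsub>L\<^esub> y) = p x \<ominus>\<^bsub>M\<^esub> p y" if "x \<in> carrier L" "y \<in> carrier L" for x y
    by (rule bimodule_hom_minus[OF L.M.bimodule_axioms M.M.bimodule_axioms p that])
  show ?thesis
    unfolding L.proj_def M.proj_def using x \<theta>_C homog_inv(1)[of d]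
    by (simp add: bimodule_hom_rsmult[OF p] bimodule_hom_smult[OF p] m
        L.M.smult_closed L.M.rsmult_closed)
qed

lemma homog_hom:
  assumes "qbimodule L" "qbimodule M" and p: "p \<in> bimodule_hom R R L M"
    and x: "x \<in> quat_bimodule.homog C \<sigma> L d"
  shows "p x \<in> quat_bimodule.homog C \<sigma> M d"
proof -
  interpret L: quat_bimodule R C A \<pi> P \<theta> \<eta> \<sigma> L by fact
  interpret M: quat_bimodule R C A \<pi> P \<theta> \<eta> \<sigma> M by fact
  have "\<theta> \<odot>\<^bsub>M\<^esub> p x = p x \<odot>\<^sup>r\<^bsub>M\<^esub> twist d \<theta>"
    using L.homogD[OF x] \<theta>_C
    by (simp add: bimodule_hom_rsmult[OF p, symmetric] bimodule_hom_smult[OF p, symmetric])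
  then show ?thesis by (rule M.homogI[OF bimodule_hom_closed[OF p L.homogD(1)[OF x]]])
qed

text \<open>An arbitrary lift is projected to degree \<open>d\<close>; projections commute with
  homomorphisms.\<close>

lemma homog_lift:
  assumes "qbimodule L" "qbimodule M" and p: "p \<in> bimodule_hom R R L M"
    and surj: "p ` carrier L = carrier M" and m: "m \<in> quat_bimodule.homog C \<sigma> M d"
  obtains x where "x \<in> quat_bimodule.homog C \<sigma> L d" "p x = m"
proof -
  interpret L: quat_bimodule R C A \<pi> P \<theta> \<eta> \<sigma> L by fact
  interpret M: quat_bimodule R C A \<pi> P \<theta> \<eta> \<sigma> M by fact
  obtain x where x: "x \<in> carrier L" "p x = m" using M.homogD(1)[OF m] unfolding surj[symmetric] by (elim imageE) (rule that, simp_all)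
  have "p (L.proj d x) = m"
    unfolding proj_hom[OF assms(1-3) x(1)] x(2) by (rule M.proj_id[OF m])
  then show thesis by (rule that[OF L.proj_homog[OF x(1)]])
qed

end

section \<open>Bases of residue bimodules\<close>

locale residue_qbimodule = quat_bimodule +
  assumes P_zero: "x \<in> carrier M \<Longrightarrow> x \<odot>\<^sup>r\<^bsub>M\<^esub> P = \<zero>\<^bsub>M\<^esub>"
    and finite_carrier: "finite (carrier M)"
begin

text \<open>Linear independence over \<open>R / R P\<close>, formulated with scalars from
  \<open>R\<close>.\<close>

definition indep :: "'c set \<Rightarrow> bool"
  where "indep B \<longleftrightarrow> B \<subseteq> carrier M \<and> (\<forall>c \<in> B \<rightarrow> carrier R.
    M.lincomb c (\<lambda>x. x) B = \<zero>\<^bsub>M\<^esub> \<longrightarrow> (\<forall>b \<in> B. \<exists>t \<in> carrier R. c b = t \<otimes> P))"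

definition kerP :: "'c set"
  where "kerP = {x \<in> carrier M. P \<odot>\<^bsub>M\<^esub> x = \<zero>\<^bsub>M\<^esub>}"

lemma finite_sub: "B \<subseteq> carrier M \<Longrightarrow> finite B"
  using finite_carrier finite_subset by blast

lemma indepD: "indep B \<Longrightarrow> B \<subseteq> carrier M" "indep B \<Longrightarrow> finite B"
  "\<lbrakk>indep B; c \<in> B \<rightarrow> carrier R; M.lincomb c (\<lambda>x. x) B = \<zero>\<^bsub>M\<^esub>; b \<in> B\<rbrakk>
    \<Longrightarrow> \<exists>t \<in> carrier R. c b = t \<otimes> P"
  using finite_sub by (auto simp: indep_def)

lemma rsmult_tP: "x \<in> carrier M \<Longrightarrow> t \<in> carrier R \<Longrightarrow> x \<odot>\<^sup>r\<^bsub>M\<^esub> (t \<otimes> P) = \<zero>\<^bsub>M\<^esub>"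
  by (simp add: M.rsmult_assoc P_zero M.rsmult_closed)

text \<open>\<open>P P = \<pi>\<close> may act from the right instead, where \<open>P\<close>
  already acts as zero.\<close>

lemma PP_zero: "x \<in> carrier M \<Longrightarrow> P \<odot>\<^bsub>M\<^esub> (P \<odot>\<^bsub>M\<^esub> x) = \<zero>\<^bsub>M\<^esub>"
  by (simp add: M.smult_assoc[symmetric] P_square agree[OF \<pi>_A])
    (simp add: P_square[symmetric] rsmult_tP)

lemma kerP_submodule: "M.right_submodule kerP"
  by (auto simp: M.right_submodule_def kerP_def M.smult_zero M.smult_r_distr M.rsmult_closed
      M.smult_rsmult[symmetric] M.zero_rsmult)

lemma imP_submodule: "M.right_submodule ((\<lambda>x. P \<odot>\<^bsub>M\<^esub> x) ` carrier M)"
  unfolding M.right_submodule_def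
proof (intro conjI ballI)
  show "\<zero>\<^bsub>M\<^esub> \<in> (\<lambda>x. P \<odot>\<^bsub>M\<^esub> x) ` carrier M"
    by (rule image_eqI[where x = "\<zero>\<^bsub>M\<^esub>"]) (simp_all add: M.smult_zero)
next
  fix x y assume "x \<in> (\<lambda>x. P \<odot>\<^bsub>M\<^esub> x) ` carrier M" "y \<in> (\<lambda>x. P \<odot>\<^bsub>M\<^esub> x) ` carrier M"
  then obtain u v where "u \<in> carrier M" "x = P \<odot>\<^bsub>M\<^esub> u" "v \<in> carrier M" "y = P \<odot>\<^bsub>M\<^esub> v" by auto
  then show "x \<oplus>\<^bsub>M\<^esub> y \<in> (\<lambda>x. P \<odot>\<^bsub>M\<^esub> x) ` carrier M"
    by (intro image_eqI[where x = "u \<oplus>\<^bsub>M\<^esub> v"]) (simp_all add: M.smult_r_distr)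
next
  fix x s assume "x \<in> (\<lambda>x. P \<odot>\<^bsub>M\<^esub> x) ` carrier M" "s \<in> carrier R"
  then show "x \<odot>\<^sup>r\<^bsub>M\<^esub> s \<in> (\<lambda>x. P \<odot>\<^bsub>M\<^esub> x) ` carrier M"
    by (auto simp: M.smult_rsmult M.rsmult_closed)
qed (auto intro: M.smult_closed)

text \<open>The grading is always stable under \<open>C\<close> on the right; here \<open>R\<close>
  acts through its C-component, as \<open>P\<close> acts as zero.\<close>

lemma homog_submodule: "M.right_submodule (homog d)"
  unfolding M.right_submodule_def
proof (intro conjI ballI)
  fix x r assume x: "x \<in> homog d" and r: "r \<in> carrier R"
  note c = comps[OF r]
  have "x \<odot>\<^sup>r\<^bsub>M\<^esub> r = x \<odot>\<^sup>r\<^bsub>M\<^esub> (comp0 r \<oplus> comp1 r \<otimes> P)" using c(3) by simp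
  also have "\<dots> = x \<odot>\<^sup>r\<^bsub>M\<^esub> comp0 r"
    using c(1,2) homogD(1)[OF x] by (simp add: M.rsmult_r_distr rsmult_tP M.rsmult_closed)
  finally show "x \<odot>\<^sup>r\<^bsub>M\<^esub> r \<in> homog d" using homog_rsmult[OF x c(1)] by simp
qed (auto simp: homogD homog_zero homog_add)

lemma indep_empty: "indep {}"
  by (simp add: indep_def)

lemma indep_zero: assumes "indep B" shows "\<zero>\<^bsub>M\<^esub> \<notin> B"
proof
  assume z: "\<zero>\<^bsub>M\<^esub> \<in> B"
  let ?c = "\<lambda>b. if b = \<zero>\<^bsub>M\<^esub> then \<one> else \<zero>"
  have "M.lincomb ?c (\<lambda>x. x) B = \<zero>\<^bsub>M\<^esub>"
    using indepD(1)[OF assms] by (intro M.lincomb_zero) (auto simp: M.zero_rsmult M.rsmult_zero)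
  then obtain t where "t \<in> carrier R" "\<one> = t \<otimes> P"
    using indepD(3)[OF assms, of ?c, OF _ _ z] by auto
  then show False using one_not_P[of t] by simp
qed

text \<open>A coefficient of \<open>g\<close> outside \<open>R P\<close> is invertible, and the
  relation would then place \<open>g\<close> in the span of \<open>B\<close>.\<close>

lemma indep_insert:
  assumes B: "indep B" and g: "g \<in> carrier M" "g \<notin> M.right_span B"
  shows "indep (insert g B)"
  unfolding indep_def
proof (intro conjI ballI impI)
  note BM = indepD(1)[OF B] and fin = indepD(2)[OF B]
  show "insert g B \<subseteq> carrier M" using BM g by auto
  have gB: "g \<notin> B" using g M.right_span_superset[OF BM] by auto
  note sp = M.right_submoduleD[OF M.right_submodule_span[of B]]
  fix c b assume c: "c \<in> insert g B \<rightarrow> carrier R" and z: "M.lincomb c (\<lambda>x. x) (insert g B) = \<zero>\<^bsub>M\<^esub>"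
    and b: "b \<in> insert g B"
  have cg: "c g \<in> carrier R" and cB: "c \<in> B \<rightarrow> carrier R" using c by auto
  let ?h = "M.lincomb c (\<lambda>x. x) B"
  have idB: "(\<lambda>x. x) \<in> B \<rightarrow> carrier M" using BM by auto
  have hB: "?h \<in> M.right_span B"
    unfolding M.right_span_eq[OF fin BM] using cB by blast
  then have hM: "?h \<in> carrier M" by (rule sp(1))
  have eq: "g \<odot>\<^sup>r\<^bsub>M\<^esub> c g \<oplus>\<^bsub>M\<^esub> ?h = \<zero>\<^bsub>M\<^esub>"
    using M.lincomb_insert[OF fin gB, of "\<lambda>x. x" c] z c g BM idB by (auto simp: Pi_iff)
  have gt: "\<exists>t \<in> carrier R. c g = t \<otimes> P"
  proof (rule ccontr)
    assume "\<not> ?thesis"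
    then obtain t where t: "t \<in> carrier R" "c g \<otimes> t = \<one>" using unit_or_P[OF cg] by auto
    have "g \<odot>\<^sup>r\<^bsub>M\<^esub> c g = \<ominus>\<^bsub>M\<^esub> ?h"
      using M.minus_equality[OF eq] hM M.rsmult_closed[OF cg g(1)] by simp
    then have "g \<odot>\<^sup>r\<^bsub>M\<^esub> c g \<in> M.right_span B" using sp(5)[OF hB] by simp
    then have "g \<odot>\<^sup>r\<^bsub>M\<^esub> c g \<odot>\<^sup>r\<^bsub>M\<^esub> t \<in> M.right_span B" using sp(4) t by simp
    then show False using g t cg by (simp add: M.rsmult_assoc[symmetric] M.rsmult_one)
  qed
  then have "g \<odot>\<^sup>r\<^bsub>M\<^esub> c g = \<zero>\<^bsub>M\<^esub>" using g rsmult_tP by auto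
  then have "?h = \<zero>\<^bsub>M\<^esub>" using eq hM by simp
  then show "\<exists>t \<in> carrier R. c b = t \<otimes> P" using gt indepD(3)[OF B cB] b by auto
qed

lemma indep_extend:
  assumes "G \<subseteq> carrier M" "indep B"
  obtains B' where "B \<subseteq> B'" "B' \<subseteq> B \<union> G" "indep B'" "G \<subseteq> M.right_span B'"
proof -
  have "finite G" using assms(1) finite_sub by blast
  then have "\<exists>B'. B \<subseteq> B' \<and> B' \<subseteq> B \<union> G \<and> indep B' \<and> G \<subseteq> M.right_span B'" using assms(1)
  proof (induction G rule: finite_induct)
    case empty
    then show ?case using assms(2) by auto
  next
    case (insert g G)
    then obtain B' where B': "B \<subseteq> B'" "B' \<subseteq> B \<union> G" "indep B'" "G \<subseteq> M.right_span B'" by auto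
    show ?case
    proof (cases "g \<in> M.right_span B'")
      case True
      then show ?thesis using B' by (intro exI[of _ B']) auto
    next
      case False
      have gM: "g \<in> carrier M" using insert.prems by auto
      have sub: "insert g B' \<subseteq> carrier M" using gM indepD(1)[OF B'(3)] by auto
      have "M.right_span B' \<subseteq> M.right_span (insert g B')" by (rule M.right_span_mono) auto
      then have "insert g G \<subseteq> M.right_span (insert g B')"
        using B'(4) M.right_span_superset[OF sub] by auto
      then show ?thesis
        using B' indep_insert[OF B'(3) gM False] by (intro exI[of _ "insert g B'"]) auto
    qed
  qed
  then show thesis using that by blast
qed

text \<open>Coefficients from a transversal of \<open>R / R P\<close> represent each vector of the
  span exactly once. As \<open>q\<close> does not depend on \<open>B\<close>, cardinalities of spans
  take the place of dimensions.\<close>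

lemma card_span:
  obtains q :: nat where "2 \<le> q" "\<And>B. indep B \<Longrightarrow> card (M.right_span B) = q ^ card B"
proof -
  obtain T rep where T: "finite T" "T \<subseteq> carrier R" "2 \<le> card T"
    and rep: "\<And>r. r \<in> carrier R \<Longrightarrow> rep r \<in> T"
      "\<And>r. r \<in> carrier R \<Longrightarrow> \<exists>t \<in> carrier R. r = rep r \<oplus> t \<otimes> P"
    and uniq: "\<And>a b t. \<lbrakk>a \<in> T; b \<in> T; t \<in> carrier R; a = b \<oplus> t \<otimes> P\<rbrakk> \<Longrightarrow> a = b"
    using transversal by metis
  have "card (M.right_span B) = card T ^ card B" if B: "indep B" for B
  proof -
    note BM = indepD(1)[OF B] and fin = indepD(2)[OF B]
    have idB: "(\<lambda>x. x) \<in> B \<rightarrow> carrier M" using BM by auto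
    let ?f = "\<lambda>c. M.lincomb c (\<lambda>x. x) B"
    have TR: "c \<in> B \<rightarrow> carrier R" if "c \<in> B \<rightarrow>\<^sub>E T" for c using that T(2) by (auto simp: PiE_iff)
    have "inj_on ?f (B \<rightarrow>\<^sub>E T)"
    proof (rule inj_onI)
      fix c c' assume c: "c \<in> B \<rightarrow>\<^sub>E T" and c': "c' \<in> B \<rightarrow>\<^sub>E T" and eq: "?f c = ?f c'"
      note cR = TR[OF c] and cR' = TR[OF c']
      have "?f (\<lambda>i. c i \<oplus> \<ominus> c' i) = ?f c \<oplus>\<^bsub>M\<^esub> \<ominus>\<^bsub>M\<^esub> ?f c'"
        using M.lincomb_add[OF idB cR, of "\<lambda>i. \<ominus> c' i"] M.lincomb_minus[OF fin idB cR'] cR'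
        by (simp add: Pi_iff)
      also have "\<dots> = \<zero>\<^bsub>M\<^esub>" using eq M.lincomb_closed[OF idB cR'] by (simp add: M.r_neg)
      finally have z: "?f (\<lambda>i. c i \<oplus> \<ominus> c' i) = \<zero>\<^bsub>M\<^esub>" .
      show "c = c'"
      proof (rule PiE_ext[OF c c'])
        fix b assume b: "b \<in> B"
        have cb: "c b \<in> carrier R" "c' b \<in> carrier R" using cR cR' b by auto
        obtain t where t: "t \<in> carrier R" "c b \<oplus> \<ominus> c' b = t \<otimes> P"
          using indepD(3)[OF B _ z b] cR cR' by (auto simp: Pi_iff)
        have "c b = (c b \<oplus> \<ominus> c' b) \<oplus> c' b" using cb by (simp add: R.a_assoc R.l_neg)
        then have "c b = c' b \<oplus> t \<otimes> P" unfolding t(2) using cb t(1) by (simp add: R.a_comm)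
        then show "c b = c' b" by (rule uniq[OF PiE_mem[OF c b] PiE_mem[OF c' b] t(1)])
      qed
    qed
    moreover have "?f ` (B \<rightarrow>\<^sub>E T) = M.right_span B"
      unfolding M.right_span_eq[OF fin BM]
    proof (intro equalityI subsetI)
      fix x assume "x \<in> ?f ` (B \<rightarrow>\<^sub>E T)"
      then show "x \<in> {?f c | c. c \<in> B \<rightarrow> carrier R}" using TR by blast
    next
      fix x assume "x \<in> {?f c | c. c \<in> B \<rightarrow> carrier R}"
      then obtain c where c: "c \<in> B \<rightarrow> carrier R" "x = ?f c" by blast
      let ?c = "\<lambda>b \<in> B. rep (c b)"
      have cT: "?c \<in> B \<rightarrow>\<^sub>E T" using c rep(1) by auto
      have "?f c = ?f ?c"
        using rep(2) c(1) by (intro lincomb_mod_P P_zero idB c(1) TR[OF cT]) (auto simp: Pi_iff)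
      then show "x \<in> ?f ` (B \<rightarrow>\<^sub>E T)" unfolding c(2) by (rule image_eqI[OF _ cT])
    qed
    ultimately have "card (M.right_span B) = card (B \<rightarrow>\<^sub>E T)" by (metis card_image)
    then show ?thesis using fin by (simp add: card_funcsetE)
  qed
  then show thesis using T(3) that by blast
qed

definition hdeg :: "'c \<Rightarrow> bool"
  where "hdeg m \<longleftrightarrow> m \<notin> homog False"

lemma hdeg:
  assumes "m \<in> homog d" "m \<noteq> \<zero>\<^bsub>M\<^esub>" shows "hdeg m = d"
  using assms homog_disjoint[of m] by (cases d) (auto simp: hdeg_def)

text \<open>Homogeneity of \<open>Y\<close> is implied: \<open>\<xi> y\<close> has degree opposite
  to \<open>hdeg y\<close>, and \<open>P\<close> reverses degrees.\<close>

definition frame :: "'c set \<Rightarrow> ('c \<Rightarrow> 'c) \<Rightarrow> bool"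
  where "frame Y \<xi> \<longleftrightarrow> indep Y \<and> M.right_span Y = (\<lambda>x. P \<odot>\<^bsub>M\<^esub> x) ` carrier M
    \<and> (\<forall>y \<in> Y. \<xi> y \<in> homog (\<not> hdeg y) \<and> P \<odot>\<^bsub>M\<^esub> \<xi> y = y)"

definition kerP_basis :: "'c set \<Rightarrow> 'c set \<Rightarrow> bool"
  where "kerP_basis Y K \<longleftrightarrow> Y \<subseteq> K \<and> indep K \<and> M.right_span K = kerP \<and> K \<subseteq> homog False \<union> homog True"

lemma kerP_basis_hdeg:
  assumes "kerP_basis Y K" "m \<in> K"
  shows "m \<in> homog (hdeg m)" "m \<in> kerP" "m \<in> carrier M"
proof -
  have "indep K" "K \<subseteq> homog False \<union> homog True" "M.right_span K = kerP"
    using assms(1) by (auto simp: kerP_basis_def)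
  moreover from this have "m \<noteq> \<zero>\<^bsub>M\<^esub>" using indep_zero assms(2) by blast
  ultimately show "m \<in> homog (hdeg m)" "m \<in> kerP" "m \<in> carrier M"
    using hdeg[of m] assms(2) indepD(1)[of K] M.right_span_superset[of K] by auto
qed

text \<open>im P is spanned by the images of homogeneous vectors, so a basis can be selected among
  these images and comes with homogeneous preimages.\<close>

lemma frame_ex: obtains Y \<xi> where "frame Y \<xi>"
proof -
  let ?G = "(\<lambda>x. P \<odot>\<^bsub>M\<^esub> x) ` (homog False \<union> homog True)"
  have GM: "?G \<subseteq> carrier M" using homogD(1) by (auto intro!: M.smult_closed)
  obtain Y where Y: "Y \<subseteq> ?G" "indep Y" "?G \<subseteq> M.right_span Y"
    using indep_extend[OF GM indep_empty] by auto
  note sp = M.right_submoduleD[OF M.right_submodule_span[of Y]]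
  have span: "M.right_span Y = (\<lambda>x. P \<odot>\<^bsub>M\<^esub> x) ` carrier M"
  proof
    show "M.right_span Y \<subseteq> (\<lambda>x. P \<odot>\<^bsub>M\<^esub> x) ` carrier M"
      using Y(1) homogD(1) by (intro M.right_span_least[OF imP_submodule]) blast
    show "(\<lambda>x. P \<odot>\<^bsub>M\<^esub> x) ` carrier M \<subseteq> M.right_span Y"
    proof (rule image_subsetI)
      fix x assume x: "x \<in> carrier M"
      note h = proj_homog[OF x]
      have "P \<odot>\<^bsub>M\<^esub> x = P \<odot>\<^bsub>M\<^esub> (proj True x \<oplus>\<^bsub>M\<^esub> proj False x)" using proj_sum[OF x] by simp
      also have "\<dots> = P \<odot>\<^bsub>M\<^esub> proj True x \<oplus>\<^bsub>M\<^esub> P \<odot>\<^bsub>M\<^esub> proj False x"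
        using homogD(1)[OF h] by (simp add: M.smult_r_distr)
      also have "\<dots> \<in> M.right_span Y" using h[of True] h[of False] Y(3) by (intro sp(3)) auto
      finally show "P \<odot>\<^bsub>M\<^esub> x \<in> M.right_span Y" .
    qed
  qed
  have "\<exists>x. x \<in> homog (\<not> hdeg y) \<and> P \<odot>\<^bsub>M\<^esub> x = y" if y: "y \<in> Y" for y
  proof -
    obtain x d where x: "x \<in> homog d" "y = P \<odot>\<^bsub>M\<^esub> x" using Y(1) y by blast
    have "y \<noteq> \<zero>\<^bsub>M\<^esub>" using indep_zero[OF Y(2)] y by auto
    then have "hdeg y = (\<not> d)" using hdeg[of y] homog_P[OF x(1)] x(2) by auto
    then show ?thesis using x by auto
  qed
  then have "\<exists>\<xi>. \<forall>y \<in> Y. \<xi> y \<in> homog (\<not> hdeg y) \<and> P \<odot>\<^bsub>M\<^esub> \<xi> y = y" by (intro bchoice) blast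
  then show thesis using that Y(2) span by (auto simp: frame_def)
qed

text \<open>The set \<open>W\<close> is left open because it is used in two ways: as all homogeneous
  vectors of ker P when a lattice is constructed, and as the reductions of vectors commuting with
  \<open>P\<close> when a given lattice is analysed.\<close>

lemma kerP_basis_ex:
  assumes Y: "frame Y \<xi>" and W: "W \<subseteq> (homog False \<union> homog True) \<inter> kerP" "kerP \<subseteq> M.right_span W"
  obtains K where "kerP_basis Y K" "K \<subseteq> Y \<union> W"
proof -
  have Yi: "indep Y" and WM: "W \<subseteq> carrier M" using Y W(1) by (auto simp: frame_def kerP_def)
  have YP: "Y \<subseteq> (homog False \<union> homog True) \<inter> kerP"
  proof
    fix y assume y: "y \<in> Y"
    then have h: "\<xi> y \<in> homog (\<not> hdeg y)" "P \<odot>\<^bsub>M\<^esub> \<xi> y = y" using Y by (auto simp: frame_def)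
    then have "y \<in> homog (hdeg y)" using homog_P[OF h(1)] by simp
    moreover have "P \<odot>\<^bsub>M\<^esub> y = \<zero>\<^bsub>M\<^esub>" using PP_zero[OF homogD(1)[OF h(1)]] h(2) by simp
    ultimately show "y \<in> (homog False \<union> homog True) \<inter> kerP"
      using homogD(1) by (cases "hdeg y") (auto simp: kerP_def)
  qed
  obtain K where K: "Y \<subseteq> K" "K \<subseteq> Y \<union> W" "indep K" "W \<subseteq> M.right_span K"
    using indep_extend[OF WM Yi] by blast
  have "M.right_span K \<subseteq> kerP"
    using K(2) YP W(1) by (intro M.right_span_least kerP_submodule) blast
  moreover have "M.right_span W \<subseteq> M.right_span K"
    using K(4) by (intro M.right_span_least M.right_submodule_span)
  ultimately have "M.right_span K = kerP" using W(2) by auto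
  moreover have "K \<subseteq> homog False \<union> homog True" using K(2) YP W(1) by blast
  ultimately show thesis using that[of K] K by (auto simp: kerP_basis_def)
qed

text \<open>In an expansion of a vector of degree \<open>d\<close>, the terms outside
  \<open>homog d\<close> add up to a vector of both degrees, that is, to zero.\<close>

lemma span_homog:
  assumes K: "kerP_basis Y K"
  shows "M.right_span (K \<inter> homog d) = kerP \<inter> homog d"
proof
  have Ki: "indep K" and Kh: "K \<subseteq> homog False \<union> homog True" and Ks: "M.right_span K = kerP"
    using K by (auto simp: kerP_basis_def)
  note KM = indepD(1)[OF Ki] and fin = indepD(2)[OF Ki]
  note hs = homog_submodule
  have "K \<subseteq> kerP" using Ks M.right_span_superset[OF KM] by simp
  then have "M.right_span (K \<inter> homog d) \<subseteq> kerP" "M.right_span (K \<inter> homog d) \<subseteq> homog d"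
    by (intro M.right_span_least kerP_submodule hs; blast)+
  then show "M.right_span (K \<inter> homog d) \<subseteq> kerP \<inter> homog d" by simp
  show "kerP \<inter> homog d \<subseteq> M.right_span (K \<inter> homog d)"
  proof
    fix m assume m: "m \<in> kerP \<inter> homog d"
    let ?D = "K \<inter> homog d" and ?E = "K - homog d"
    have KDE: "K = ?D \<union> ?E" by blast
    have mK: "m \<in> M.right_span K" using m Ks by simp
    obtain c where c: "m = M.lincomb c (\<lambda>x. x) K" "c \<in> K \<rightarrow> carrier R"
      using mK unfolding M.right_span_eq[OF fin KM] by blast
    have cD: "c \<in> ?D \<rightarrow> carrier R" and cE: "c \<in> ?E \<rightarrow> carrier R" using c(2) by auto
    have idD: "(\<lambda>x. x) \<in> ?D \<rightarrow> carrier M" and idE: "(\<lambda>x. x) \<in> ?E \<rightarrow> carrier M" using KM by auto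
    let ?u = "M.lincomb c (\<lambda>x. x) ?D" and ?v = "M.lincomb c (\<lambda>x. x) ?E"
    have "M.lincomb c (\<lambda>x. x) (?D \<union> ?E) = ?u \<oplus>\<^bsub>M\<^esub> ?v"
      using fin KM c(2) by (intro M.lincomb_Un) auto
    then have muv: "m = ?u \<oplus>\<^bsub>M\<^esub> ?v" using c(1) KDE by simp
    have u: "?u \<in> homog d"
      using cD fin by (intro M.lincomb_in_submodule hs) auto
    have v: "?v \<in> homog (\<not> d)"
      using cE fin Kh by (intro M.lincomb_in_submodule hs) (cases d; auto)+
    have uM: "?u \<in> carrier M" "?v \<in> carrier M" using homogD(1) u v by auto
    have "m \<ominus>\<^bsub>M\<^esub> ?u = ?v"
      unfolding muv using uM by (simp add: a_minus_def M.a_ac M.r_neg M.r_neg2)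
    then have "?v \<in> homog d" using M.right_submoduleD(6)[OF hs, of m d ?u] m u by auto
    then have "?v = \<zero>\<^bsub>M\<^esub>" using v homog_disjoint[of ?v] by (cases d) auto
    then have "m = ?u" using muv uM by simp
    moreover have DM: "?D \<subseteq> carrier M" "finite ?D" using KM fin by auto
    ultimately show "m \<in> M.right_span ?D"
      unfolding M.right_span_eq[OF DM(2,1)] using cD by blast
  qed
qed

text \<open>The number of vectors of degree \<open>d\<close> in either basis is the exponent of
  \<open>q\<close> in the cardinality of the degree \<open>d\<close> part of ker P. After removing
  the common subset \<open>Y\<close>, equal numbers remain in each degree and can be
  matched.\<close>

lemma kerP_basis_match:
  assumes K: "kerP_basis Y K" and K': "kerP_basis Y K'"
  obtains \<zeta> where "bij_betw \<zeta> K K'" "\<And>y. y \<in> Y \<Longrightarrow> \<zeta> y = y" "\<And>m. m \<in> K \<Longrightarrow> hdeg (\<zeta> m) = hdeg m"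
proof -
  obtain q :: nat where q: "2 \<le> q" "\<And>B. indep B \<Longrightarrow> card (M.right_span B) = q ^ card B"
    using card_span by blast
  have sub: "indep (K \<inter> homog d)" if "indep K" for K d
    unfolding indep_def
  proof (intro conjI ballI impI)
    note KM = indepD(1)[OF that] and fin = indepD(2)[OF that]
    show "K \<inter> homog d \<subseteq> carrier M" using KM by auto
    fix c b assume c: "c \<in> K \<inter> homog d \<rightarrow> carrier R"
      and z: "M.lincomb c (\<lambda>x. x) (K \<inter> homog d) = \<zero>\<^bsub>M\<^esub>" and b: "b \<in> K \<inter> homog d"
    \<comment> \<open>Extension by zero turns a relation on the degree \<open>d\<close> part into a
      relation on all of \<open>K\<close>.\<close>
    let ?c = "\<lambda>x. if x \<in> homog d then c x else \<zero>"
    have "M.lincomb ?c (\<lambda>x. x) ((K \<inter> homog d) \<union> (K - homog d))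
        = M.lincomb ?c (\<lambda>x. x) (K \<inter> homog d) \<oplus>\<^bsub>M\<^esub> M.lincomb ?c (\<lambda>x. x) (K - homog d)"
      using fin KM c by (intro M.lincomb_Un) auto
    also have "M.lincomb ?c (\<lambda>x. x) (K - homog d) = \<zero>\<^bsub>M\<^esub>"
      using KM by (intro M.lincomb_zero) (auto intro: M.rsmult_zero)
    also have "M.lincomb ?c (\<lambda>x. x) (K \<inter> homog d) = M.lincomb c (\<lambda>x. x) (K \<inter> homog d)"
      using KM c by (intro M.lincomb_cong) auto
    also have "(K \<inter> homog d) \<union> (K - homog d) = K" by blast
    finally have "M.lincomb ?c (\<lambda>x. x) K = \<zero>\<^bsub>M\<^esub>" using z by simp
    then have "\<exists>t \<in> carrier R. ?c b = t \<otimes> P"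
      using c b by (intro indepD(3)[OF that]) auto
    then show "\<exists>t \<in> carrier R. c b = t \<otimes> P" using b by simp
  qed
  have i: "indep K" "indep K'" "Y \<subseteq> K" "Y \<subseteq> K'" using K K' by (auto simp: kerP_basis_def)
  note fin = indepD(2)[OF i(1)] indepD(2)[OF i(2)]
  have cd: "card (K \<inter> homog d) = card (K' \<inter> homog d)" for d
  proof -
    have "q ^ card (K \<inter> homog d) = q ^ card (K' \<inter> homog d)"
      using q(2)[OF sub[OF i(1)], of d] q(2)[OF sub[OF i(2)], of d]
        span_homog[OF K] span_homog[OF K'] by simp
    then show ?thesis using q(1) by simp
  qed
  have "\<exists>f. bij_betw f (K \<inter> homog d - Y) (K' \<inter> homog d - Y)" for d
  proof -
    have e: "K \<inter> homog d - Y = K \<inter> homog d - (Y \<inter> homog d)"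
      "K' \<inter> homog d - Y = K' \<inter> homog d - (Y \<inter> homog d)" by blast+
    have s: "Y \<inter> homog d \<subseteq> K \<inter> homog d" "Y \<inter> homog d \<subseteq> K' \<inter> homog d" "finite (Y \<inter> homog d)"
      using i(3,4) finite_subset[OF i(3) fin(1)] by auto
    have "card (K \<inter> homog d - Y) = card (K' \<inter> homog d - Y)"
      unfolding e by (simp only: card_Diff_subset[OF s(3,1)] card_Diff_subset[OF s(3,2)] cd)
    then show ?thesis using fin by (intro finite_same_card_bij) auto
  qed
  then obtain f where f: "\<And>d. bij_betw (f d) (K \<inter> homog d - Y) (K' \<inter> homog d - Y)" by metis
  define \<zeta> where "\<zeta> m = (if m \<in> Y then m else f (hdeg m) m)" for m
  have hd: "m \<in> homog d \<longleftrightarrow> hdeg m = d" if "m \<in> K \<or> m \<in> K'" for m d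
    using that kerP_basis_hdeg(1)[OF K] kerP_basis_hdeg(1)[OF K'] hdeg[of m d]
      indep_zero i(1,2) by blast
  have fm: "f (hdeg m) m \<in> K' - Y \<and> hdeg (f (hdeg m) m) = hdeg m" if "m \<in> K - Y" for m
    using bij_betwE[OF f[of "hdeg m"]] that hd by auto
  have "bij_betw \<zeta> K K'"
  proof (rule bij_betw_imageI)
    show "inj_on \<zeta> K"
    proof (rule inj_onI)
      fix x y assume xy: "x \<in> K" "y \<in> K" "\<zeta> x = \<zeta> y"
      show "x = y"
      proof (cases "x \<in> Y \<or> y \<in> Y")
        case True
        then show ?thesis using xy fm[of x] fm[of y] by (auto simp: \<zeta>_def split: if_splits)
      next
        case False
        then have e: "f (hdeg x) x = f (hdeg y) y" using xy by (simp add: \<zeta>_def)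
        then have "hdeg x = hdeg y" using fm[of x] fm[of y] xy(1,2) False by (metis Diff_iff)
        then show ?thesis
          using e xy False hd bij_betw_imp_inj_on[OF f[of "hdeg x"]]
          by (auto dest: inj_onD)
      qed
    qed
    show "\<zeta> ` K = K'"
    proof (intro equalityI subsetI)
      fix x assume "x \<in> \<zeta> ` K"
      then show "x \<in> K'" using fm i(4) by (auto simp: \<zeta>_def)
    next
      fix x assume x: "x \<in> K'"
      show "x \<in> \<zeta> ` K"
      proof (cases "x \<in> Y")
        case True
        then show ?thesis using i(3) by (intro image_eqI[of _ _ x]) (auto simp: \<zeta>_def)
      next
        case False
        then have "x \<in> K' \<inter> homog (hdeg x) - Y" using x hd by auto
        then obtain z where z: "z \<in> K \<inter> homog (hdeg x) - Y" "x = f (hdeg x) z"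
          using bij_betw_imp_surj_on[OF f[of "hdeg x"]] by blast
        then have "hdeg z = hdeg x" using hd by auto
        then show ?thesis using z by (intro image_eqI[of _ _ z]) (auto simp: \<zeta>_def)
      qed
    qed
  qed
  moreover have "hdeg (\<zeta> m) = hdeg m" if "m \<in> K" for m using fm[of m] that by (simp add: \<zeta>_def)
  ultimately show thesis using that[of \<zeta>] by (simp add: \<zeta>_def)
qed

end

text \<open>A basis of a residue bimodule consists of a basis \<open>K\<close> of \<open>ker P\<close> extending a basis \<open>Y\<close> of
  \<open>im P\<close>, and of elements \<open>\<xi> y\<close> with \<open>P (\<xi> y) = y\<close>.  The indices are \<open>(m, False)\<close> for \<open>m \<in> K\<close>
  and \<open>(y, True)\<close>, for \<open>\<xi> y\<close>.\<close>

definition frame_index :: "'d set \<Rightarrow> 'd set \<Rightarrow> ('d \<times> bool) set"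
  where "frame_index Y K = K \<times> {False} \<union> Y \<times> {True}"

definition frame_deg :: "('d \<Rightarrow> bool) \<Rightarrow> 'd \<times> bool \<Rightarrow> bool"
  where "frame_deg g = (\<lambda>(m, t). g m \<noteq> t)"

definition frame_swap :: "'d set \<Rightarrow> 'd \<times> bool \<Rightarrow> 'd \<times> bool"
  where "frame_swap Y = (\<lambda>(m, t). (m, if m \<in> Y then \<not> t else t))"

text \<open>The exponents come from \<open>P z = z P\<close> for the vectors outside
  \<open>Y\<close>, from \<open>P (\<xi> y) = y\<close>, and from
  \<open>P y = P P (\<xi> y) = (\<xi> y) P^2\<close>.\<close>

definition frame_exp :: "'d set \<Rightarrow> 'd \<times> bool \<Rightarrow> nat"
  where "frame_exp Y = (\<lambda>(m, t). if m \<notin> Y then 1 else if t then 0 else 2)"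

definition frame_vec :: "('d \<Rightarrow> 'e) \<Rightarrow> ('d \<Rightarrow> 'e) \<Rightarrow> 'd \<times> bool \<Rightarrow> 'e"
  where "frame_vec \<xi> \<zeta> = (\<lambda>(m, t). if t then \<xi> m else \<zeta> m)"

lemmas frame_defs = frame_index_def frame_deg_def frame_swap_def frame_exp_def frame_vec_def

lemma (in quat_order) frame_struct_data:
  assumes "finite K" "Y \<subseteq> K"
  shows "struct_data (frame_index Y K) (frame_deg g) (frame_swap Y) (frame_exp Y)"
  using assms finite_subset[OF assms(2,1)] by (auto simp: struct_data_def frame_defs)

text \<open>The one relation to be derived is that for \<open>P (\<zeta> y)\<close> with
  \<open>y\<close> in \<open>Y\<close>: it equals \<open>\<pi> (\<xi> y)\<close>, and
  \<open>\<pi>\<close> can be moved to the right as \<open>P^2\<close>.\<close>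

lemma (in quat_bimodule) frame_struct_rel:
  assumes "Y \<subseteq> K"
    and "\<And>m. m \<in> K \<Longrightarrow> \<zeta> m \<in> homog (g m)" "\<And>y. y \<in> Y \<Longrightarrow> \<xi> y \<in> homog (\<not> g y)"
    and "\<And>m. m \<in> K - Y \<Longrightarrow> P \<odot>\<^bsub>M\<^esub> \<zeta> m = \<zeta> m \<odot>\<^sup>r\<^bsub>M\<^esub> P" "\<And>y. y \<in> Y \<Longrightarrow> P \<odot>\<^bsub>M\<^esub> \<xi> y = \<zeta> y"
  shows "struct_rel (frame_index Y K) (frame_deg g) (frame_swap Y) (frame_exp Y) (frame_vec \<xi> \<zeta>)"
  unfolding struct_rel_def
proof (intro ballI conjI)
  fix i assume i: "i \<in> frame_index Y K"
  then consider m where "i = (m, False)" "m \<in> K - Y" | y where "i = (y, False)" "y \<in> Y"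
    | y where "i = (y, True)" "y \<in> Y" using assms(1) by (auto simp: frame_index_def)
  then have "frame_vec \<xi> \<zeta> i \<in> homog (frame_deg g i)
    \<and> P \<odot>\<^bsub>M\<^esub> frame_vec \<xi> \<zeta> i = frame_vec \<xi> \<zeta> (frame_swap Y i) \<odot>\<^sup>r\<^bsub>M\<^esub> P [^] frame_exp Y i"
  proof cases
    case (1 m)
    then show ?thesis using assms(2,4)[of m] by (simp add: frame_defs)
  next
    case (2 y)
    have x: "\<xi> y \<in> carrier M" using assms(3)[OF 2(2)] homogD by blast
    have "P \<odot>\<^bsub>M\<^esub> \<zeta> y = P \<odot>\<^bsub>M\<^esub> (P \<odot>\<^bsub>M\<^esub> \<xi> y)" using assms(5) 2 by simp
    also have "\<dots> = \<pi> \<odot>\<^bsub>M\<^esub> \<xi> y" using x by (simp add: M.smult_assoc[symmetric] P_square)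
    also have "\<dots> = \<xi> y \<odot>\<^sup>r\<^bsub>M\<^esub> P [^] (2::nat)"
      using agree[OF \<pi>_A x] P_square by (simp add: numeral_2_eq_2)
    finally show ?thesis using 2 assms(1) assms(2)[of y] by (auto simp: frame_defs)
  next
    case (3 y)
    then show ?thesis using assms(1) assms(2,3,5)[of y] by (auto simp: frame_defs M.rsmult_one homogD(1))
  qed
  then show "frame_vec \<xi> \<zeta> i \<in> carrier M"
    "P \<odot>\<^bsub>M\<^esub> frame_vec \<xi> \<zeta> i = frame_vec \<xi> \<zeta> (frame_swap Y i) \<odot>\<^sup>r\<^bsub>M\<^esub> P [^] frame_exp Y i"
    "\<And>a. a \<in> C \<Longrightarrow> a \<odot>\<^bsub>M\<^esub> frame_vec \<xi> \<zeta> i = frame_vec \<xi> \<zeta> i \<odot>\<^sup>r\<^bsub>M\<^esub> twist (frame_deg g i) a"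
    using homogD by blast+
qed

context residue_qbimodule
begin

text \<open>The bijection \<open>\<zeta>\<close> indexes a second basis \<open>K'\<close> of ker P
  by \<open>K\<close>; this lets two lattices with different liftable bases share one index
  set.\<close>

lemma frame_basis:
  assumes Y: "frame Y \<xi>" and K: "kerP_basis Y K'" and \<zeta>: "bij_betw \<zeta> K K'" "Y \<subseteq> K" "\<And>y. y \<in> Y \<Longrightarrow> \<zeta> y = y"
  shows "basis (frame_index Y K) (frame_vec \<xi> \<zeta>)"
proof -
  have Yi: "indep Y" and Ys: "M.right_span Y = (\<lambda>x. P \<odot>\<^bsub>M\<^esub> x) ` carrier M"
    and \<xi>: "\<And>y. y \<in> Y \<Longrightarrow> \<xi> y \<in> carrier M" "\<And>y. y \<in> Y \<Longrightarrow> P \<odot>\<^bsub>M\<^esub> \<xi> y = y"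
    using Y homogD(1) by (auto simp: frame_def)
  have Ki: "indep K'" and Ks: "M.right_span K' = kerP" using K by (auto simp: kerP_basis_def)
  note YM = indepD(1)[OF Yi] and KM = indepD(1)[OF Ki]
  have finY: "finite Y" and finK: "finite K"
    using indepD(2) Yi Ki bij_betw_finite[OF \<zeta>(1)] by auto
  have im: "\<zeta> ` K = K'" and inj: "inj_on \<zeta> K" using \<zeta>(1) by (auto simp: bij_betw_def)
  have \<zeta>M: "\<zeta> \<in> K \<rightarrow> carrier M" and \<xi>M: "\<xi> \<in> Y \<rightarrow> carrier M" using im KM \<xi> by auto
  let ?I = "frame_index Y K" and ?b = "frame_vec \<xi> \<zeta>"
  have fin: "finite ?I" using finY finK by (simp add: frame_index_def)
  have bM: "?b \<in> ?I \<rightarrow> carrier M" using \<zeta>M \<xi>M by (auto simp: frame_defs)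
  show ?thesis
    unfolding basis_def
  proof (intro conjI fin bM ballI impI)
    note sub = M.right_submodule_span[of "?b ` ?I"]
    note sp = M.right_submoduleD[OF sub]
    have b: "?b i \<in> M.right_span (?b ` ?I)" if "i \<in> ?I" for i
      using M.right_span_superset[of "?b ` ?I"] bM that by blast
    have "K' \<subseteq> M.right_span (?b ` ?I)"
    proof
      fix x assume "x \<in> K'"
      then obtain m where "m \<in> K" "x = \<zeta> m" using im by auto
      then show "x \<in> M.right_span (?b ` ?I)" using b[of "(m, False)"] by (simp add: frame_defs)
    qed
    then have ker: "kerP \<subseteq> M.right_span (?b ` ?I)"
      using M.right_span_least[OF sub] Ks by blast
    show "M.right_span (?b ` ?I) = carrier M"
    proof (intro equalityI subsetI)
      fix x assume x: "x \<in> carrier M"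
      then have "P \<odot>\<^bsub>M\<^esub> x \<in> M.right_span Y" using Ys by blast
      then obtain c where c: "c \<in> Y \<rightarrow> carrier R" "P \<odot>\<^bsub>M\<^esub> x = M.lincomb c (\<lambda>x. x) Y"
        unfolding M.right_span_eq[OF finY YM] by blast
      \<comment> \<open>The combination of the \<open>\<xi> y\<close> with the same image under
        \<open>P\<close> as \<open>x\<close>; the difference lies in ker P.\<close>
      let ?l = "M.lincomb c \<xi> Y"
      have l: "?l \<in> carrier M" by (rule M.lincomb_closed[OF \<xi>M c(1)])
      have "P \<odot>\<^bsub>M\<^esub> ?l = M.lincomb c (\<lambda>y. P \<odot>\<^bsub>M\<^esub> \<xi> y) Y"
        using M.lincomb_smult[OF finY \<xi>M c(1) P_closed] by simp
      also have "\<dots> = P \<odot>\<^bsub>M\<^esub> x"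
        unfolding c(2) using c(1) \<xi> by (intro M.lincomb_cong) (auto intro: M.smult_closed)
      finally have "P \<odot>\<^bsub>M\<^esub> (x \<ominus>\<^bsub>M\<^esub> ?l) = \<zero>\<^bsub>M\<^esub>"
        using x l by (simp add: a_minus_def M.smult_r_distr M.smult_minus M.r_neg M.smult_closed)
      then have "x \<ominus>\<^bsub>M\<^esub> ?l \<in> M.right_span (?b ` ?I)" using ker x l by (auto simp: kerP_def)
      moreover have "?l \<in> M.right_span (?b ` ?I)"
      proof (rule M.lincomb_in_submodule[OF finY sub _ c(1)])
        show "\<xi> \<in> Y \<rightarrow> M.right_span (?b ` ?I)"
        proof
          fix y assume "y \<in> Y"
          then show "\<xi> y \<in> M.right_span (?b ` ?I)" using b[of "(y, True)"] by (simp add: frame_defs)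
        qed
      qed
      ultimately show "x \<in> M.right_span (?b ` ?I)" using sp(3) M.add_minus_cancel[OF x l] by metis
    qed (rule sp(1))
  next
    fix c i assume c: "c \<in> ?I \<rightarrow> carrier R" and z: "M.lincomb c ?b ?I = \<zero>\<^bsub>M\<^esub>" and i: "i \<in> ?I"
    let ?cK = "\<lambda>m. c (m, False)" and ?cY = "\<lambda>y. c (y, True)"
    have cK: "?cK \<in> K \<rightarrow> carrier R" and cY: "?cY \<in> Y \<rightarrow> carrier R" using c by (auto simp: frame_index_def)
    let ?u = "M.lincomb ?cK \<zeta> K" and ?v = "M.lincomb ?cY \<xi> Y"
    have uM: "?u \<in> carrier M" and vM: "?v \<in> carrier M"
      by (rule M.lincomb_closed[OF \<zeta>M cK], rule M.lincomb_closed[OF \<xi>M cY])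
    have KF: "K \<times> {False} = (\<lambda>m. (m, False)) ` K" and YT: "Y \<times> {True} = (\<lambda>y. (y, True)) ` Y" by auto
    have "M.lincomb c ?b ?I = M.lincomb c ?b (K \<times> {False}) \<oplus>\<^bsub>M\<^esub> M.lincomb c ?b (Y \<times> {True})"
      unfolding frame_index_def using finY finK bM c
      by (intro M.lincomb_Un) (auto simp: frame_index_def)
    also have "M.lincomb c ?b (K \<times> {False}) = M.lincomb ?cK (\<lambda>m. ?b (m, False)) K"
      unfolding KF using bM c by (intro M.lincomb_reindex) (auto simp: inj_on_def frame_index_def)
    also have "M.lincomb c ?b (Y \<times> {True}) = M.lincomb ?cY (\<lambda>y. ?b (y, True)) Y"
      unfolding YT using bM c by (intro M.lincomb_reindex) (auto simp: inj_on_def frame_index_def)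
    finally have uv: "?u \<oplus>\<^bsub>M\<^esub> ?v = \<zero>\<^bsub>M\<^esub>" using z by (simp add: frame_vec_def)
    have "?u \<in> M.right_span K'"
      unfolding im[symmetric] M.right_span_image_eq[OF finK \<zeta>M] using cK by blast
    then have Pu: "P \<odot>\<^bsub>M\<^esub> ?u = \<zero>\<^bsub>M\<^esub>" using Ks by (simp add: kerP_def)
    \<comment> \<open>Applying \<open>P\<close> removes the part in ker P and turns the
      \<open>\<xi> y\<close> into the independent vectors \<open>y\<close>.\<close>
    have "P \<odot>\<^bsub>M\<^esub> ?v = \<zero>\<^bsub>M\<^esub>"
      using uv Pu uM vM M.smult_r_distr[OF P_closed uM vM] by (simp add: M.smult_zero M.smult_closed)
    moreover have "M.lincomb ?cY (\<lambda>y. P \<odot>\<^bsub>M\<^esub> \<xi> y) Y = P \<odot>\<^bsub>M\<^esub> ?v"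
      by (rule M.lincomb_smult[OF finY \<xi>M cY P_closed])
    moreover have "M.lincomb ?cY (\<lambda>y. P \<odot>\<^bsub>M\<^esub> \<xi> y) Y = M.lincomb ?cY (\<lambda>y. y) Y"
      using cY \<xi> by (intro M.lincomb_cong) (auto intro: M.smult_closed)
    ultimately have "M.lincomb ?cY (\<lambda>y. y) Y = \<zero>\<^bsub>M\<^esub>" by simp
    then have tY: "\<exists>t \<in> carrier R. ?cY y = t \<otimes> P" if "y \<in> Y" for y
      by (rule indepD(3)[OF Yi cY _ that])
    have "?v = \<zero>\<^bsub>M\<^esub>"
    proof (rule M.lincomb_zero)
      fix y assume y: "y \<in> Y"
      then obtain t where "t \<in> carrier R" "?cY y = t \<otimes> P" using tY by blast
      then show "\<xi> y \<odot>\<^sup>r\<^bsub>M\<^esub> ?cY y = \<zero>\<^bsub>M\<^esub>" using rsmult_tP \<xi>(1)[OF y] by simp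
    qed
    then have u0: "?u = \<zero>\<^bsub>M\<^esub>" using uv uM by simp
    let ?c' = "\<lambda>x. ?cK (inv_into K \<zeta> x)"
    have c': "?c' \<in> K' \<rightarrow> carrier R" using cK im inv_into_into[of _ \<zeta> K] by auto
    have "M.lincomb ?c' (\<lambda>x. x) K' = M.lincomb (\<lambda>m. ?c' (\<zeta> m)) (\<lambda>m. \<zeta> m) K"
      using M.lincomb_reindex[OF inj, of "\<lambda>x. x" ?c'] KM c' unfolding im by auto
    also have "\<dots> = ?u"
      using \<zeta>M cK inj by (intro M.lincomb_cong) (auto simp: inv_into_f_f)
    finally have c'0: "M.lincomb ?c' (\<lambda>x. x) K' = \<zero>\<^bsub>M\<^esub>" using u0 by simp
    have tK: "\<exists>t \<in> carrier R. ?cK m = t \<otimes> P" if m: "m \<in> K" for m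
      using indepD(3)[OF Ki c' c'0, of "\<zeta> m"] im inj m by (auto simp: inv_into_f_f)
    show "\<exists>t \<in> carrier R. c i = t \<otimes> P"
      using i tK tY by (auto simp: frame_index_def)
  qed
qed

end

context quat_order
begin

abbreviation residue_qb :: "('a, 'a, 'm) bimodule \<Rightarrow> bool"
  where "residue_qb M \<equiv> residue_qbimodule R C A \<pi> P \<theta> \<eta> \<sigma> M"

text \<open>Vectors \<open>z\<close> with \<open>P z = z P\<close> need not lift an arbitrary basis of \<open>ker P\<close>, but their reductions
  span: for homogeneous \<open>x\<close> with \<open>P x = y P\<close>, all \<open>x c + y \<sigma>(c)\<close> are such vectors.\<close>

lemma commuting_lifts_span:
  assumes "qbimodule L" "residue_qb M"
    and LP: "\<And>x. x \<in> carrier L \<Longrightarrow> x \<odot>\<^sup>r\<^bsub>L\<^esub> P = \<zero>\<^bsub>L\<^esub> \<Longrightarrow> x = \<zero>\<^bsub>L\<^esub>"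
    and p: "right_trunc p L M"
  shows "residue_qbimodule.kerP P M \<subseteq> bimodule.right_span R M
    {p z | z d. z \<in> quat_bimodule.homog C \<sigma> L d \<and> P \<odot>\<^bsub>L\<^esub> z = z \<odot>\<^sup>r\<^bsub>L\<^esub> P}"
    (is "_ \<subseteq> bimodule.right_span R M ?W")
proof
  interpret L: quat_bimodule R C A \<pi> P \<theta> \<eta> \<sigma> L by fact
  interpret M: residue_qbimodule R C A \<pi> P \<theta> \<eta> \<sigma> M by fact
  have ph: "p \<in> bimodule_hom R R L M" and surj: "p ` carrier L = carrier M"
    and ker: "\<And>x. x \<in> carrier L \<Longrightarrow> p x = \<zero>\<^bsub>M\<^esub> \<longleftrightarrow> (\<exists>y \<in> carrier L. x = y \<odot>\<^sup>r\<^bsub>L\<^esub> P)"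
    using p by (auto simp: right_trunc_def)
  have inj: "u = v" if uv: "u \<in> carrier L" "v \<in> carrier L" "u \<odot>\<^sup>r\<^bsub>L\<^esub> P = v \<odot>\<^sup>r\<^bsub>L\<^esub> P" for u v
  proof -
    have "(u \<ominus>\<^bsub>L\<^esub> v) \<odot>\<^sup>r\<^bsub>L\<^esub> P = \<zero>\<^bsub>L\<^esub>"
      using uv by (simp add: a_minus_def L.M.rsmult_l_distr L.M.minus_rsmult L.M.M.r_neg L.M.rsmult_closed)
    then show ?thesis using LP[of "u \<ominus>\<^bsub>L\<^esub> v"] uv L.M.M.minus_eq_zeroD by auto
  qed
  have WM: "?W \<subseteq> carrier M" using bimodule_hom_closed[OF ph] L.homogD(1) by blast
  note sp = M.M.right_submoduleD[OF M.M.right_submodule_span[of ?W]]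
  have main: "m \<in> M.M.right_span ?W" if m: "m \<in> M.homog d" "P \<odot>\<^bsub>M\<^esub> m = \<zero>\<^bsub>M\<^esub>" for m d
  proof -
    obtain x where x: "x \<in> L.homog d" "p x = m"
      by (rule homog_lift[OF assms(1) M.quat_bimodule_axioms ph surj m(1)])
    note xL = L.homogD(1)[OF x(1)]
    have "p (P \<odot>\<^bsub>L\<^esub> x) = \<zero>\<^bsub>M\<^esub>" using bimodule_hom_smult[OF ph xL P_closed] x(2) m(2) by simp
    then obtain y where y: "y \<in> carrier L" "P \<odot>\<^bsub>L\<^esub> x = y \<odot>\<^sup>r\<^bsub>L\<^esub> P"
      using ker[OF L.M.smult_closed[OF P_closed xL]] by blast
    \<comment> \<open>Multiplied by \<open>P\<close> on the right, both sides become
      \<open>P P x\<close>, because \<open>\<pi>\<close> acts alike on both sides; then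
      \<open>P\<close> is cancelled.\<close>
    have Py: "P \<odot>\<^bsub>L\<^esub> y = x \<odot>\<^sup>r\<^bsub>L\<^esub> P"
    proof (rule inj)
      have "(P \<odot>\<^bsub>L\<^esub> y) \<odot>\<^sup>r\<^bsub>L\<^esub> P = P \<odot>\<^bsub>L\<^esub> (P \<odot>\<^bsub>L\<^esub> x)" using y by (simp add: L.M.smult_rsmult)
      also have "\<dots> = x \<odot>\<^sup>r\<^bsub>L\<^esub> P \<odot>\<^sup>r\<^bsub>L\<^esub> P"
        using xL L.agree[OF \<pi>_A xL] by (simp add: L.M.smult_assoc[symmetric] L.M.rsmult_assoc[symmetric] P_square)
      finally show "(P \<odot>\<^bsub>L\<^esub> y) \<odot>\<^sup>r\<^bsub>L\<^esub> P = x \<odot>\<^sup>r\<^bsub>L\<^esub> P \<odot>\<^sup>r\<^bsub>L\<^esub> P" .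
    qed (use y xL in \<open>auto intro: L.M.smult_closed L.M.rsmult_closed\<close>)
    \<comment> \<open>\<open>y P = P x\<close> has the degree opposite to that of \<open>x\<close>,
      and cancelling \<open>P\<close> on the right reverses it once more.\<close>
    have yh: "y \<in> L.homog d"
    proof (rule L.homogI[OF y(1)], rule inj)
      have c: "\<theta> \<in> C" "\<sigma> \<theta> \<in> C" "twist d \<theta> \<in> C" using \<theta>_C \<sigma>_closed twist_closed by auto
      have "\<theta> \<odot>\<^bsub>L\<^esub> y \<odot>\<^sup>r\<^bsub>L\<^esub> P = \<theta> \<odot>\<^bsub>L\<^esub> (P \<odot>\<^bsub>L\<^esub> x)" using y c by (simp add: L.M.smult_rsmult)
      also have "\<dots> = P \<odot>\<^bsub>L\<^esub> x \<odot>\<^sup>r\<^bsub>L\<^esub> twist (\<not> d) \<theta>"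
        by (rule L.homogD(2)[OF L.homog_P[OF x(1)] \<theta>_C])
      also have "\<dots> = y \<odot>\<^sup>r\<^bsub>L\<^esub> twist d \<theta> \<odot>\<^sup>r\<^bsub>L\<^esub> P"
        using y \<theta>_C by (simp add: L.M.rsmult_assoc[symmetric] twist_P)
      finally show "\<theta> \<odot>\<^bsub>L\<^esub> y \<odot>\<^sup>r\<^bsub>L\<^esub> P = y \<odot>\<^sup>r\<^bsub>L\<^esub> twist d \<theta> \<odot>\<^sup>r\<^bsub>L\<^esub> P" .
    qed (use y \<theta>_C in \<open>auto intro!: L.M.smult_closed L.M.rsmult_closed\<close>)
    have W: "m \<odot>\<^sup>r\<^bsub>M\<^esub> c \<oplus>\<^bsub>M\<^esub> p y \<odot>\<^sup>r\<^bsub>M\<^esub> \<sigma> c \<in> M.M.right_span ?W" if c: "c \<in> C" for c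
    proof -
      let ?z = "x \<odot>\<^sup>r\<^bsub>L\<^esub> c \<oplus>\<^bsub>L\<^esub> y \<odot>\<^sup>r\<^bsub>L\<^esub> \<sigma> c"
      have cc: "c \<in> carrier R" "\<sigma> c \<in> carrier R" "\<sigma> c \<in> C" using c \<sigma>_closed by auto
      have z: "?z \<in> L.homog d" using x(1) yh c cc by (intro L.homog_add L.homog_rsmult)
      have "P \<odot>\<^bsub>L\<^esub> ?z = y \<odot>\<^sup>r\<^bsub>L\<^esub> P \<odot>\<^sup>r\<^bsub>L\<^esub> c \<oplus>\<^bsub>L\<^esub> x \<odot>\<^sup>r\<^bsub>L\<^esub> P \<odot>\<^sup>r\<^bsub>L\<^esub> \<sigma> c"
        using xL y cc Py by (simp add: L.M.smult_r_distr L.M.smult_rsmult[symmetric] L.M.rsmult_closed)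
      also have "\<dots> = ?z \<odot>\<^sup>r\<^bsub>L\<^esub> P"
        using xL y(1) c cc by (simp add: L.M.rsmult_l_distr L.M.rsmult_assoc[symmetric] L.M.rsmult_closed
            C_P \<sigma>_\<sigma> L.M.M.a_comm)
      finally have "p ?z \<in> ?W" using z by blast
      moreover have "p ?z = m \<odot>\<^sup>r\<^bsub>M\<^esub> c \<oplus>\<^bsub>M\<^esub> p y \<odot>\<^sup>r\<^bsub>M\<^esub> \<sigma> c"
        using xL y(1) cc x(2)
        by (simp add: bimodule_hom_add[OF ph] bimodule_hom_rsmult[OF ph] L.M.rsmult_closed)
      ultimately show ?thesis using M.M.right_span_superset[OF WM] by auto
    qed
    have mM: "m \<in> carrier M" using M.homogD m by blast
    have pyM: "p y \<in> carrier M" using bimodule_hom_closed[OF ph y(1)] .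
    have c: "\<theta> \<in> carrier R" "\<sigma> \<theta> \<in> carrier R" "\<eta> \<in> carrier R" using \<theta>_C \<sigma>_closed \<eta>_C by auto
    \<comment> \<open>The choices \<open>c = 1\<close> and \<open>c = \<sigma> \<theta>\<close>. The
      combination \<open>?z2 - ?z1 \<theta>\<close> eliminates \<open>p y\<close> and leaves
      \<open>m (\<sigma> \<theta> - \<theta>)\<close>, with an invertible factor.\<close>
    let ?z1 = "m \<odot>\<^sup>r\<^bsub>M\<^esub> \<one> \<oplus>\<^bsub>M\<^esub> p y \<odot>\<^sup>r\<^bsub>M\<^esub> \<one>"
      and ?z2 = "m \<odot>\<^sup>r\<^bsub>M\<^esub> \<sigma> \<theta> \<oplus>\<^bsub>M\<^esub> p y \<odot>\<^sup>r\<^bsub>M\<^esub> \<theta>"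
    have z: "?z1 \<in> M.M.right_span ?W" "?z2 \<in> M.M.right_span ?W"
      using W[of \<one>] W[of "\<sigma> \<theta>"] \<theta>_C by (auto simp: C_ops \<sigma>_one \<sigma>_closed \<sigma>_\<sigma>)
    have g: "m \<odot>\<^sup>r\<^bsub>M\<^esub> \<sigma> \<theta> \<in> carrier M" "m \<odot>\<^sup>r\<^bsub>M\<^esub> \<theta> \<in> carrier M" "p y \<odot>\<^sup>r\<^bsub>M\<^esub> \<theta> \<in> carrier M"
      using mM pyM c by (auto intro: M.M.rsmult_closed)
    have "?z2 \<ominus>\<^bsub>M\<^esub> ?z1 \<odot>\<^sup>r\<^bsub>M\<^esub> \<theta>
        = (m \<odot>\<^sup>r\<^bsub>M\<^esub> \<sigma> \<theta> \<ominus>\<^bsub>M\<^esub> m \<odot>\<^sup>r\<^bsub>M\<^esub> \<theta>) \<oplus>\<^bsub>M\<^esub> (p y \<odot>\<^sup>r\<^bsub>M\<^esub> \<theta> \<oplus>\<^bsub>M\<^esub> \<ominus>\<^bsub>M\<^esub> (p y \<odot>\<^sup>r\<^bsub>M\<^esub> \<theta>))"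
      using mM pyM c g by (simp add: M.M.rsmult_one M.M.rsmult_l_distr a_minus_def M.M.M.minus_add M.M.M.a_ac)
    also have "\<dots> = m \<odot>\<^sup>r\<^bsub>M\<^esub> (\<sigma> \<theta> \<ominus> \<theta>)"
      using mM c g by (simp add: M.M.M.r_neg a_minus_def M.M.rsmult_r_distr M.M.rsmult_minus)
    finally have "m \<odot>\<^sup>r\<^bsub>M\<^esub> (\<sigma> \<theta> \<ominus> \<theta>) \<odot>\<^sup>r\<^bsub>M\<^esub> \<eta> \<in> M.M.right_span ?W"
      using sp(4)[OF sp(6)[OF z(2) sp(4)[OF z(1) c(1)]] c(3)] by simp
    then show ?thesis using mM c \<eta>_inv by (simp add: M.M.rsmult_assoc[symmetric] M.M.rsmult_one)
  qed
  fix m assume "m \<in> M.kerP"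
  then have m: "m \<in> carrier M" "P \<odot>\<^bsub>M\<^esub> m = \<zero>\<^bsub>M\<^esub>" by (auto simp: M.kerP_def)
  \<comment> \<open>ker P is graded: \<open>P \<theta> = \<sigma>(\<theta>) P\<close> on the left,
    and right multiplications commute with \<open>P\<close>.\<close>
  have "P \<odot>\<^bsub>M\<^esub> M.proj d m = \<zero>\<^bsub>M\<^esub>" for d
  proof -
    have c: "\<theta> \<in> C" "twist (\<not> d) \<theta> \<in> C" "homog_inv d \<in> C" "\<sigma> \<theta> \<in> C"
      using \<theta>_C twist_closed homog_inv \<sigma>_closed by auto
    have "P \<odot>\<^bsub>M\<^esub> (\<theta> \<odot>\<^bsub>M\<^esub> m) = \<sigma> \<theta> \<odot>\<^bsub>M\<^esub> (P \<odot>\<^bsub>M\<^esub> m)"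
      using m(1) c by (simp add: M.M.smult_assoc[symmetric] P_comm)
    then have "P \<odot>\<^bsub>M\<^esub> (\<theta> \<odot>\<^bsub>M\<^esub> m \<ominus>\<^bsub>M\<^esub> m \<odot>\<^sup>r\<^bsub>M\<^esub> twist (\<not> d) \<theta>) = \<zero>\<^bsub>M\<^esub>"
      using m c by (simp add: a_minus_def M.M.smult_r_distr M.M.smult_minus M.M.smult_closed
          M.M.rsmult_closed M.M.smult_rsmult[symmetric] M.M.smult_zero M.M.zero_rsmult M.M.M.r_neg)
    then show ?thesis
      unfolding M.proj_def using m c by (simp add: M.M.smult_rsmult[symmetric] M.M.zero_rsmult
          M.M.smult_closed M.M.rsmult_closed)
  qed
  then have "M.proj True m \<oplus>\<^bsub>M\<^esub> M.proj False m \<in> M.M.right_span ?W"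
    using M.proj_homog[OF m(1)] main by (intro sp(3)) blast+
  then show "m \<in> M.M.right_span ?W" using M.proj_sum[OF m(1)] by simp
qed

text \<open>\<open>K\<close> is completed from \<open>Y\<close> by reductions of vectors that
  commute with \<open>P\<close>, so these lifts come with \<open>K\<close>. Only the
  \<open>\<xi> y\<close> need arbitrary homogeneous lifts.\<close>

lemma frame_lift:
  assumes "qbimodule L" "residue_qb M"
    and LP: "\<And>x. x \<in> carrier L \<Longrightarrow> x \<odot>\<^sup>r\<^bsub>L\<^esub> P = \<zero>\<^bsub>L\<^esub> \<Longrightarrow> x = \<zero>\<^bsub>L\<^esub>"
    and p: "right_trunc p L M" and Y: "residue_qbimodule.frame R C P \<sigma> M Y \<xi>"
  obtains K e\<xi> e\<zeta> where "residue_qbimodule.kerP_basis R C P \<sigma> M Y K"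
    "\<And>m. m \<in> K \<Longrightarrow> e\<zeta> m \<in> quat_bimodule.homog C \<sigma> L (residue_qbimodule.hdeg C \<sigma> M m) \<and> p (e\<zeta> m) = m"
    "\<And>m. m \<in> K - Y \<Longrightarrow> P \<odot>\<^bsub>L\<^esub> e\<zeta> m = e\<zeta> m \<odot>\<^sup>r\<^bsub>L\<^esub> P"
    "\<And>y. y \<in> Y \<Longrightarrow> e\<xi> y \<in> quat_bimodule.homog C \<sigma> L (\<not> residue_qbimodule.hdeg C \<sigma> M y) \<and> p (e\<xi> y) = \<xi> y"
    "\<And>y. y \<in> Y \<Longrightarrow> P \<odot>\<^bsub>L\<^esub> e\<xi> y = e\<zeta> y"
proof -
  interpret L: quat_bimodule R C A \<pi> P \<theta> \<eta> \<sigma> L by fact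
  interpret M: residue_qbimodule R C A \<pi> P \<theta> \<eta> \<sigma> M by fact
  have ph: "p \<in> bimodule_hom R R L M" and surj: "p ` carrier L = carrier M"
    using p by (auto simp: right_trunc_def)
  let ?W = "{p z | z d. z \<in> L.homog d \<and> P \<odot>\<^bsub>L\<^esub> z = z \<odot>\<^sup>r\<^bsub>L\<^esub> P}"
  have hh: "p z \<in> M.homog d" if "z \<in> L.homog d" for z d
    by (rule homog_hom[OF assms(1) M.quat_bimodule_axioms ph that])
  have "?W \<subseteq> (M.homog False \<union> M.homog True) \<inter> M.kerP"
  proof
    fix w assume "w \<in> ?W"
    then obtain z d where z: "w = p z" "z \<in> L.homog d" "P \<odot>\<^bsub>L\<^esub> z = z \<odot>\<^sup>r\<^bsub>L\<^esub> P" by blast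
    note zL = L.homogD(1)[OF z(2)]
    have wM: "w \<in> carrier M" using z(1) bimodule_hom_closed[OF ph zL] by simp
    have "P \<odot>\<^bsub>M\<^esub> w = p z \<odot>\<^sup>r\<^bsub>M\<^esub> P"
      unfolding z(1) by (simp only: bimodule_hom_smult[OF ph zL P_closed, symmetric] z(3)
          bimodule_hom_rsmult[OF ph zL P_closed])
    then have "P \<odot>\<^bsub>M\<^esub> w = \<zero>\<^bsub>M\<^esub>" using M.P_zero wM z(1) by simp
    then show "w \<in> (M.homog False \<union> M.homog True) \<inter> M.kerP"
      using hh[OF z(2)] z(1) wM by (cases d) (auto simp: M.kerP_def)
  qed
  then obtain K where K: "M.kerP_basis Y K" "K \<subseteq> Y \<union> ?W"
    using M.kerP_basis_ex[OF Y _ commuting_lifts_span[OF assms(1,2) LP p]] by blast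
  have \<xi>: "\<xi> y \<in> M.homog (\<not> M.hdeg y)" "P \<odot>\<^bsub>M\<^esub> \<xi> y = y" if "y \<in> Y" for y
    using Y that by (auto simp: M.frame_def)
  have "\<exists>x. x \<in> L.homog (\<not> M.hdeg y) \<and> p x = \<xi> y" if "y \<in> Y" for y
    by (rule homog_lift[OF assms(1) M.quat_bimodule_axioms ph surj \<xi>(1)[OF that]], rule exI, rule conjI)
  then obtain e\<xi> where e\<xi>: "\<And>y. y \<in> Y \<Longrightarrow> e\<xi> y \<in> L.homog (\<not> M.hdeg y) \<and> p (e\<xi> y) = \<xi> y" by metis
  have "\<exists>z. z \<in> L.homog (M.hdeg m) \<and> p z = m \<and> P \<odot>\<^bsub>L\<^esub> z = z \<odot>\<^sup>r\<^bsub>L\<^esub> P" if m: "m \<in> K - Y" for m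
  proof -
    obtain z d where z: "m = p z" "z \<in> L.homog d" "P \<odot>\<^bsub>L\<^esub> z = z \<odot>\<^sup>r\<^bsub>L\<^esub> P" using K(2) m by blast
    have "m \<noteq> \<zero>\<^bsub>M\<^esub>" using M.indep_zero[of K] K(1) m by (auto simp: M.kerP_basis_def)
    then have "M.hdeg m = d" using M.hdeg hh[OF z(2)] z(1) by blast
    then show ?thesis using z by auto
  qed
  then obtain e\<zeta> where e\<zeta>: "\<And>m. m \<in> K - Y \<Longrightarrow> e\<zeta> m \<in> L.homog (M.hdeg m) \<and> p (e\<zeta> m) = m
    \<and> P \<odot>\<^bsub>L\<^esub> e\<zeta> m = e\<zeta> m \<odot>\<^sup>r\<^bsub>L\<^esub> P" by metis
  \<comment> \<open>For \<open>y\<close> in \<open>Y\<close> the lift is defined as \<open>P\<close>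
    times the lift of \<open>\<xi> y\<close>; an arbitrary lift of \<open>y\<close> would satisfy
    the relation only modulo \<open>L P\<close>.\<close>
  let ?e = "\<lambda>m. if m \<in> Y then P \<odot>\<^bsub>L\<^esub> e\<xi> m else e\<zeta> m"
  have eY: "P \<odot>\<^bsub>L\<^esub> e\<xi> y \<in> L.homog (M.hdeg y) \<and> p (P \<odot>\<^bsub>L\<^esub> e\<xi> y) = y" if y: "y \<in> Y" for y
    using L.homog_P[of "e\<xi> y" "\<not> M.hdeg y"] e\<xi>[OF y] \<xi>(2)[OF y]
      bimodule_hom_smult[OF ph _ P_closed, of "e\<xi> y"] L.homogD(1)[of "e\<xi> y"] by auto
  show thesis
    by (rule that[of K ?e e\<xi>]) (use K(1) e\<xi> e\<zeta> eY in auto)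
qed

text \<open>\<open>Y\<close> and \<open>\<xi>\<close> are chosen in \<open>M\<close> once, while
  \<open>K\<close> and \<open>K'\<close> depend on the lattices and are matched by
  \<open>\<zeta>\<close>. Both lattices are then isomorphic to the same standard bimodule. The
  isomorphism sends a lift of \<open>m\<close> to a lift of \<open>\<zeta> m\<close>, so it need not
  be compatible with \<open>p\<close> and \<open>p'\<close>.\<close>

theorem trunc_determines:
  assumes L: "qbimodule L" "\<And>x. x \<in> carrier L \<Longrightarrow> x \<odot>\<^sup>r\<^bsub>L\<^esub> P = \<zero>\<^bsub>L\<^esub> \<Longrightarrow> x = \<zero>\<^bsub>L\<^esub>"
    "finite G" "G \<subseteq> carrier L" "bimodule.right_span R L G = carrier L"
    and L': "qbimodule L'" "\<And>x. x \<in> carrier L' \<Longrightarrow> x \<odot>\<^sup>r\<^bsub>L'\<^esub> P = \<zero>\<^bsub>L'\<^esub> \<Longrightarrow> x = \<zero>\<^bsub>L'\<^esub>"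
    "finite G'" "G' \<subseteq> carrier L'" "bimodule.right_span R L' G' = carrier L'"
    and M: "residue_qb M" and p: "right_trunc p L M" and p': "right_trunc p' L' M"
  shows "bimodule_iso R R L L' \<noteq> {}"
proof -
  interpret L: quat_bimodule R C A \<pi> P \<theta> \<eta> \<sigma> L by fact
  interpret L': quat_bimodule R C A \<pi> P \<theta> \<eta> \<sigma> L' by fact
  interpret M: residue_qbimodule R C A \<pi> P \<theta> \<eta> \<sigma> M by fact
  obtain Y \<xi> where Y: "M.frame Y \<xi>" using M.frame_ex by blast
  obtain K e\<xi> e\<zeta> where K: "M.kerP_basis Y K"
    and e\<zeta>: "\<And>m. m \<in> K \<Longrightarrow> e\<zeta> m \<in> L.homog (M.hdeg m) \<and> p (e\<zeta> m) = m"
      "\<And>m. m \<in> K - Y \<Longrightarrow> P \<odot>\<^bsub>L\<^esub> e\<zeta> m = e\<zeta> m \<odot>\<^sup>r\<^bsub>L\<^esub> P"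
    and e\<xi>: "\<And>y. y \<in> Y \<Longrightarrow> e\<xi> y \<in> L.homog (\<not> M.hdeg y) \<and> p (e\<xi> y) = \<xi> y"
      "\<And>y. y \<in> Y \<Longrightarrow> P \<odot>\<^bsub>L\<^esub> e\<xi> y = e\<zeta> y"
    by (rule frame_lift[OF L(1) M L(2) p Y], assumption+, rule that)
  obtain K' e\<xi>' e\<zeta>' where K': "M.kerP_basis Y K'"
    and e\<zeta>': "\<And>m. m \<in> K' \<Longrightarrow> e\<zeta>' m \<in> L'.homog (M.hdeg m) \<and> p' (e\<zeta>' m) = m"
      "\<And>m. m \<in> K' - Y \<Longrightarrow> P \<odot>\<^bsub>L'\<^esub> e\<zeta>' m = e\<zeta>' m \<odot>\<^sup>r\<^bsub>L'\<^esub> P"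
    and e\<xi>': "\<And>y. y \<in> Y \<Longrightarrow> e\<xi>' y \<in> L'.homog (\<not> M.hdeg y) \<and> p' (e\<xi>' y) = \<xi> y"
      "\<And>y. y \<in> Y \<Longrightarrow> P \<odot>\<^bsub>L'\<^esub> e\<xi>' y = e\<zeta>' y"
    by (rule frame_lift[OF L'(1) M L'(2) p' Y], assumption+, rule that)
  obtain \<zeta> where \<zeta>: "bij_betw \<zeta> K K'" "\<And>y. y \<in> Y \<Longrightarrow> \<zeta> y = y" "\<And>m. m \<in> K \<Longrightarrow> M.hdeg (\<zeta> m) = M.hdeg m"
    using M.kerP_basis_match[OF K K'] by blast
  have YK: "Y \<subseteq> K" and fin: "finite K" using K M.indepD(2) by (auto simp: M.kerP_basis_def)
  let ?I = "frame_index Y K" and ?d = "frame_deg M.hdeg" and ?\<tau> = "frame_swap Y" and ?k = "frame_exp Y"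
  have D: "struct_data ?I ?d ?\<tau> ?k" by (rule frame_struct_data[OF fin YK])
  have rel: "L.struct_rel ?I ?d ?\<tau> ?k (frame_vec e\<xi> e\<zeta>)"
    using e\<xi> e\<zeta> by (intro L.frame_struct_rel YK) auto
  \<comment> \<open>\<open>\<zeta>\<close> fixes \<open>Y\<close> pointwise, so by injectivity it
    maps nothing else into \<open>Y\<close>.\<close>
  have mem: "\<zeta> m \<in> K'" "m \<in> K - Y \<Longrightarrow> \<zeta> m \<in> K' - Y" if "m \<in> K" for m
  proof -
    show mK: "\<zeta> m \<in> K'" using bij_betwE[OF \<zeta>(1)] that by auto
    assume m: "m \<in> K - Y"
    have "\<zeta> m \<notin> Y"
    proof
      assume "\<zeta> m \<in> Y"
      then have "\<zeta> (\<zeta> m) = \<zeta> m" "\<zeta> m \<in> K" using \<zeta>(2) YK by auto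
      then have "\<zeta> m = m" using inj_onD[OF bij_betw_imp_inj_on[OF \<zeta>(1)]] that by blast
      then show False using m \<open>\<zeta> m \<in> Y\<close> by simp
    qed
    then show "\<zeta> m \<in> K' - Y" using mK by simp
  qed
  have rel': "L'.struct_rel ?I ?d ?\<tau> ?k (frame_vec e\<xi>' (\<lambda>m. e\<zeta>' (\<zeta> m)))"
  proof (rule L'.frame_struct_rel[OF YK])
    show "e\<zeta>' (\<zeta> m) \<in> L'.homog (M.hdeg m)" if "m \<in> K" for m
      using e\<zeta>'(1)[OF mem(1)[OF that]] \<zeta>(3)[OF that] by simp
    show "P \<odot>\<^bsub>L'\<^esub> e\<zeta>' (\<zeta> m) = e\<zeta>' (\<zeta> m) \<odot>\<^sup>r\<^bsub>L'\<^esub> P" if "m \<in> K - Y" for m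
      using e\<zeta>'(2)[OF mem(2)[OF _ that]] that by simp
  qed (use e\<xi>' \<zeta>(2) in auto)
  have img: "M.basis ?I f \<longleftrightarrow> M.basis ?I g" if fg: "\<And>i. i \<in> ?I \<Longrightarrow> f i = g i" for f g
  proof -
    have "f ` ?I = g ` ?I" using fg by auto
    moreover have "f \<in> ?I \<rightarrow> carrier M \<longleftrightarrow> g \<in> ?I \<rightarrow> carrier M" using fg by (auto simp: Pi_iff)
    moreover have "M.M.lincomb c f ?I = M.M.lincomb c g ?I"
      if "f \<in> ?I \<rightarrow> carrier M" "c \<in> ?I \<rightarrow> carrier R" for c
      using that fg by (intro M.M.lincomb_cong) auto
    ultimately show ?thesis unfolding M.basis_def by auto
  qed
  have pe: "p (frame_vec e\<xi> e\<zeta> i) = frame_vec \<xi> (\<lambda>m. m) i" if "i \<in> ?I" for i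
    using that e\<xi>(1) e\<zeta>(1) by (auto simp: frame_index_def frame_vec_def)
  have pe': "p' (frame_vec e\<xi>' (\<lambda>m. e\<zeta>' (\<zeta> m)) i) = frame_vec \<xi> \<zeta> i" if "i \<in> ?I" for i
    using that e\<xi>'(1) e\<zeta>'(1) mem(1) by (auto simp: frame_index_def frame_vec_def)
  have b: "M.basis ?I (\<lambda>i. p (frame_vec e\<xi> e\<zeta> i))"
    using M.frame_basis[OF Y K _ YK, of "\<lambda>m. m"]
    by (subst img[of _ "frame_vec \<xi> (\<lambda>m. m)"]) (rule pe, assumption, simp add: bij_betw_def)
  have b': "M.basis ?I (\<lambda>i. p' (frame_vec e\<xi>' (\<lambda>m. e\<zeta>' (\<zeta> m)) i))"
    using M.frame_basis[OF Y K' \<zeta>(1) YK \<zeta>(2)]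
    by (subst img[of _ "frame_vec \<xi> \<zeta>"]) (rule pe', assumption, simp)
  have "(\<lambda>q. L.M.lincomb q (frame_vec e\<xi> e\<zeta>) ?I) \<in> bimodule_iso R R (std_bimodule ?I ?d ?\<tau> ?k) L"
    by (rule std_iso[OF D L(1) M.quat_bimodule_axioms L(2-5) p rel b])
  then have i1: "inv_into (carrier (std_bimodule ?I ?d ?\<tau> ?k)) (\<lambda>q. L.M.lincomb q (frame_vec e\<xi> e\<zeta>) ?I)
      \<in> bimodule_iso R R L (std_bimodule ?I ?d ?\<tau> ?k)"
    by (rule bimodule_iso_sym[OF std_bimodule[OF D]])
  have i2: "(\<lambda>q. L'.M.lincomb q (frame_vec e\<xi>' (\<lambda>m. e\<zeta>' (\<zeta> m))) ?I)
      \<in> bimodule_iso R R (std_bimodule ?I ?d ?\<tau> ?k) L'"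
    by (rule std_iso[OF D L'(1) M.quat_bimodule_axioms L'(2-5) p' rel' b'])
  from bimodule_iso_comp[OF i1 i2] show ?thesis by blast
qed

text \<open>An adapted basis of \<open>M\<close> itself satisfies the relations wanted in a lattice:
  \<open>P z = z P\<close> and \<open>P y = (\<xi> y) P^2\<close> both read \<open>0 = 0\<close> in
  \<open>M\<close>.\<close>

theorem trunc_exists:
  fixes M :: "('a, 'a, 'm) bimodule"
  assumes M: "residue_qb M"
  obtains I d \<tau> k p where "struct_data (I :: ('m \<times> bool) set) d \<tau> k" "right_trunc p (std_bimodule I d \<tau> k) M"
proof -
  interpret M: residue_qbimodule R C A \<pi> P \<theta> \<eta> \<sigma> M by fact
  obtain Y \<xi> where Y: "M.frame Y \<xi>" using M.frame_ex by blast
  let ?W = "(M.homog False \<union> M.homog True) \<inter> M.kerP"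
  have "M.kerP \<subseteq> M.M.right_span ?W"
  proof
    fix m assume "m \<in> M.kerP"
    then have m: "m \<in> carrier M" "P \<odot>\<^bsub>M\<^esub> m = \<zero>\<^bsub>M\<^esub>" by (auto simp: M.kerP_def)
    have WM: "?W \<subseteq> carrier M" by (auto simp: M.kerP_def)
    note h = M.proj_homog[OF m(1)]
    note hM = M.homogD(1)[OF h]
    \<comment> \<open>The two summands of \<open>P m = 0\<close> have opposite degrees, so each of
      them vanishes.\<close>
    have "P \<odot>\<^bsub>M\<^esub> M.proj True m \<oplus>\<^bsub>M\<^esub> P \<odot>\<^bsub>M\<^esub> M.proj False m = \<zero>\<^bsub>M\<^esub>"
      using m M.proj_sum[OF m(1)] hM by (metis M.M.smult_r_distr P_closed)
    then have "P \<odot>\<^bsub>M\<^esub> M.proj True m = \<ominus>\<^bsub>M\<^esub> (P \<odot>\<^bsub>M\<^esub> M.proj False m)"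
      "P \<odot>\<^bsub>M\<^esub> M.proj False m = \<ominus>\<^bsub>M\<^esub> (P \<odot>\<^bsub>M\<^esub> M.proj True m)"
      using hM by (metis M.M.M.minus_equality M.M.M.minus_minus M.M.smult_closed P_closed M.M.M.a_comm)+
    moreover have "P \<odot>\<^bsub>M\<^esub> M.proj True m \<in> M.homog False" "P \<odot>\<^bsub>M\<^esub> M.proj False m \<in> M.homog True"
      using M.homog_P[OF h, of True] M.homog_P[OF h, of False] by auto
    ultimately have "P \<odot>\<^bsub>M\<^esub> M.proj True m = \<zero>\<^bsub>M\<^esub>" "P \<odot>\<^bsub>M\<^esub> M.proj False m = \<zero>\<^bsub>M\<^esub>"
      using M.homog_disjoint M.M.right_submoduleD(5)[OF M.homog_submodule] by metis+
    then have "M.proj True m \<in> ?W" "M.proj False m \<in> ?W" using h hM by (auto simp: M.kerP_def)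
    then have "M.proj True m \<oplus>\<^bsub>M\<^esub> M.proj False m \<in> M.M.right_span ?W"
      using M.M.right_span_superset[OF WM]
      by (intro M.M.right_submoduleD(3)[OF M.M.right_submodule_span]) blast+
    then show "m \<in> M.M.right_span ?W" using M.proj_sum[OF m(1)] by simp
  qed
  then obtain K where K: "M.kerP_basis Y K" using M.kerP_basis_ex[OF Y subset_refl] by blast
  have YK: "Y \<subseteq> K" and fin: "finite K" using K M.indepD(2) by (auto simp: M.kerP_basis_def)
  let ?I = "frame_index Y K" and ?d = "frame_deg M.hdeg" and ?\<tau> = "frame_swap Y" and ?k = "frame_exp Y"
  have D: "struct_data ?I ?d ?\<tau> ?k" by (rule frame_struct_data[OF fin YK])
  have rel: "M.struct_rel ?I ?d ?\<tau> ?k (frame_vec \<xi> (\<lambda>m. m))"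
  proof (rule M.frame_struct_rel[OF YK])
    show "P \<odot>\<^bsub>M\<^esub> m = m \<odot>\<^sup>r\<^bsub>M\<^esub> P" if "m \<in> K - Y" for m
      using M.kerP_basis_hdeg(2,3)[OF K, of m] that M.P_zero by (auto simp: M.kerP_def)
  qed (use Y M.kerP_basis_hdeg(1)[OF K] in \<open>auto simp: M.frame_def\<close>)
  have b: "M.basis ?I (frame_vec \<xi> (\<lambda>m. m))"
    using M.frame_basis[OF Y K _ YK, of "\<lambda>m. m"] by (simp add: bij_betw_def)
  show thesis
    by (rule that[OF D std_trunc[OF D M.quat_bimodule_axioms M.P_zero rel b]])
qed

end

section \<open>Lattices and their truncations\<close>

lemma (in bimodule) sub_bimodule_iff:
  "sub_bimodule R S N M \<longleftrightarrow> right_submodule N \<and> (\<forall>r \<in> carrier R. \<forall>x \<in> N. r \<odot>\<^bsub>M\<^esub> x \<in> N)"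
proof
  assume N: "sub_bimodule R S N M"
  then interpret N: additive_subgroup N M by (simp add: sub_bimodule_def)
  show "right_submodule N \<and> (\<forall>r \<in> carrier R. \<forall>x \<in> N. r \<odot>\<^bsub>M\<^esub> x \<in> N)"
    using N N.a_subset N.zero_closed N.a_closed by (auto simp: right_submodule_def sub_bimodule_def)
next
  assume "right_submodule N \<and> (\<forall>r \<in> carrier R. \<forall>x \<in> N. r \<odot>\<^bsub>M\<^esub> x \<in> N)"
  then show "sub_bimodule R S N M"
    using right_submodule_additive[of N] right_submoduleD(4)[of N] by (auto simp: sub_bimodule_def)
qed

lemma fin_gen_surj:
  assumes L: "fin_gen_bimodule R S L" and M: "bimodule R S M"
    and p: "p \<in> bimodule_hom R S L M" "p ` carrier L = carrier M"
  shows "fin_gen_bimodule R S M"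
proof -
  interpret L: bimodule R S L using L by (simp add: fin_gen_bimodule_def)
  interpret M: bimodule R S M by fact
  obtain U where U: "finite U" "U \<subseteq> carrier L" "\<And>N. sub_bimodule R S N L \<Longrightarrow> U \<subseteq> N \<Longrightarrow> N = carrier L"
    using L by (auto simp: fin_gen_bimodule_def)
  have "N = carrier M" if N: "sub_bimodule R S N M" "p ` U \<subseteq> N" for N
  proof -
    have N': "M.right_submodule N" "\<And>r x. r \<in> carrier R \<Longrightarrow> x \<in> N \<Longrightarrow> r \<odot>\<^bsub>M\<^esub> x \<in> N"
      using N(1) by (auto simp: M.sub_bimodule_iff)
    note sp = M.right_submoduleD[OF N'(1)]
    let ?V = "{x \<in> carrier L. p x \<in> N}"
    have "sub_bimodule R S ?V L"
      unfolding L.sub_bimodule_iff L.right_submodule_def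
      using sp N'(2) bimodule_hom_zero[OF L.bimodule_axioms M.bimodule_axioms p(1)]
      by (auto simp: bimodule_hom_add[OF p(1)] bimodule_hom_smult[OF p(1)] bimodule_hom_rsmult[OF p(1)]
          L.smult_closed L.rsmult_closed)
    moreover have "U \<subseteq> ?V" using N(2) U(2) by auto
    ultimately have V: "?V = carrier L" by (rule U(3))
    have "carrier M \<subseteq> N"
    proof
      fix y assume "y \<in> carrier M"
      then obtain x where "x \<in> carrier L" "y = p x" using p(2) by blast
      then show "y \<in> N" using V by blast
    qed
    then show ?thesis using sp(1) by auto
  qed
  moreover have "p ` U \<subseteq> carrier M" using U(2) p(2) by blast
  ultimately show ?thesis
    unfolding fin_gen_bimodule_def using M.bimodule_axioms U(1) by (intro conjI exI[of _ "p ` U"]) auto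
qed

text \<open>The bimodule laws are equations between images, so they pass along a surjection over
  surjective ring homomorphisms. This serves quotients, where the scalars change, as well as
  isomorphic copies.\<close>

lemma bimodule_surj_image:
  assumes M: "bimodule R S M" and R': "ring R'" and S': "ring S'"
    and \<phi>: "\<phi> \<in> ring_hom R R'" "\<phi> ` carrier R = carrier R'"
    and \<psi>: "\<psi> \<in> ring_hom S S'" "\<psi> ` carrier S = carrier S'"
    and f: "f ` carrier M = carrier N" "f \<zero>\<^bsub>M\<^esub> = \<zero>\<^bsub>N\<^esub>"
      "\<And>x y. \<lbrakk>x \<in> carrier M; y \<in> carrier M\<rbrakk> \<Longrightarrow> f (x \<oplus>\<^bsub>M\<^esub> y) = f x \<oplus>\<^bsub>N\<^esub> f y"
      "\<And>r x. \<lbrakk>r \<in> carrier R; x \<in> carrier M\<rbrakk> \<Longrightarrow> f (r \<odot>\<^bsub>M\<^esub> x) = \<phi> r \<odot>\<^bsub>N\<^esub> f x"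
      "\<And>s x. \<lbrakk>s \<in> carrier S; x \<in> carrier M\<rbrakk> \<Longrightarrow> f (x \<odot>\<^sup>r\<^bsub>M\<^esub> s) = f x \<odot>\<^sup>r\<^bsub>N\<^esub> \<psi> s"
  shows "bimodule R' S' N"
proof -
  interpret M: bimodule R S M by fact
  have ex: "\<exists>x \<in> carrier M. y = f x" if "y \<in> carrier N" for y using f(1) that by blast
  have exr: "\<exists>r \<in> carrier R. y = \<phi> r" if "y \<in> carrier R'" for y using \<phi>(2) that by blast
  have exs: "\<exists>s \<in> carrier S. y = \<psi> s" if "y \<in> carrier S'" for y using \<psi>(2) that by blast
  have fc: "x \<in> carrier M \<Longrightarrow> f x \<in> carrier N" for x using f(1) by blast
  note fs = f(3-5)[symmetric] fc
    ring_hom_add[OF \<phi>(1), symmetric] ring_hom_mult[OF \<phi>(1), symmetric] ring_hom_one[OF \<phi>(1), symmetric]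
    ring_hom_add[OF \<psi>(1), symmetric] ring_hom_mult[OF \<psi>(1), symmetric] ring_hom_one[OF \<psi>(1), symmetric]
  note cl = M.smult_closed M.rsmult_closed M.a_closed
  show ?thesis
  proof (intro bimodule.intro bimodule_axioms.intro R' S')
    show "abelian_group N"
    proof (rule abelian_groupI)
      show "\<zero>\<^bsub>N\<^esub> \<in> carrier N" using fc[OF M.zero_closed] f(2) by simp
    next
      fix x assume "x \<in> carrier N"
      then obtain u where u: "u \<in> carrier M" "x = f u" using ex by blast
      show "\<zero>\<^bsub>N\<^esub> \<oplus>\<^bsub>N\<^esub> x = x" using u by (simp add: f(2)[symmetric] fs)
      show "\<exists>y \<in> carrier N. y \<oplus>\<^bsub>N\<^esub> x = \<zero>\<^bsub>N\<^esub>"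
        using u by (intro bexI[of _ "f (\<ominus>\<^bsub>M\<^esub> u)"]) (simp_all add: fs M.l_neg f(2))
    qed (auto dest!: ex simp: fs cl M.a_ac)
  qed (auto dest!: ex exr exs simp: fs cl M.smult_l_distr M.smult_r_distr M.smult_assoc M.smult_one
      M.rsmult_r_distr M.rsmult_l_distr M.rsmult_assoc M.rsmult_one M.smult_rsmult)
qed

lemma bimodule_transfer:
  assumes M: "bimodule R S M" and f: "f \<in> bimodule_iso R S M N" and z: "f \<zero>\<^bsub>M\<^esub> = \<zero>\<^bsub>N\<^esub>"
  shows "bimodule R S N"
proof -
  interpret M: bimodule R S M by fact
  have "f \<in> bimodule_hom R S M N" "f ` carrier M = carrier N"
    using f by (auto simp: bimodule_iso_iff bij_betw_def)
  then show ?thesis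
    by (intro bimodule_surj_image[OF M M.R.ring_axioms M.S.ring_axioms, of "\<lambda>r. r" "\<lambda>s. s" f] z)
      (auto simp: ring_hom_def bimodule_hom_add bimodule_hom_smult bimodule_hom_rsmult)
qed

text \<open>A copy of a bimodule on another carrier type, by which representatives are brought into
  the types of the statement.\<close>

definition transport :: "('m \<Rightarrow> 'n) \<Rightarrow> ('a, 'c, 'm) bimodule \<Rightarrow> ('a, 'c, 'n) bimodule"
  where "transport f M = (let g = inv_into (carrier M) f in
    \<lparr>carrier = f ` carrier M, monoid.mult = undefined, one = undefined,
     ring.zero = f \<zero>\<^bsub>M\<^esub>, add = (\<lambda>x y. f (g x \<oplus>\<^bsub>M\<^esub> g y)),
     smult = (\<lambda>r x. f (r \<odot>\<^bsub>M\<^esub> g x)), rsmult = (\<lambda>x s. f (g x \<odot>\<^sup>r\<^bsub>M\<^esub> s))\<rparr>)"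

lemma transport:
  assumes M: "bimodule R S M" and f: "inj_on f (carrier M)"
  shows "f \<in> bimodule_iso R S M (transport f M)" "bimodule R S (transport f M)"
proof -
  show "f \<in> bimodule_iso R S M (transport f M)"
    unfolding bimodule_iso_iff
    by (auto intro!: bimodule_homI simp: transport_def Let_def bij_betw_def f inv_into_f_f)
  then show "bimodule R S (transport f M)"
    by (rule bimodule_transfer[OF M]) (simp add: transport_def Let_def)
qed

lemma agreeing_surj:
  assumes "agreeing_actions A id id L" "p \<in> bimodule_hom R S L M" "p ` carrier L = carrier M"
    "A \<subseteq> carrier R" "A \<subseteq> carrier S"
  shows "agreeing_actions A id id M"
  unfolding agreeing_actions_def
proof (intro ballI)
  fix a y assume a: "a \<in> A" and "y \<in> carrier M"
  then obtain x where x: "x \<in> carrier L" "y = p x" using assms(3) by blast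
  have "a \<odot>\<^bsub>L\<^esub> x = x \<odot>\<^sup>r\<^bsub>L\<^esub> a" using assms(1) a x by (simp add: agreeing_actions_def)
  moreover have "a \<in> carrier R" "a \<in> carrier S" using assms(4,5) a by auto
  ultimately show "id a \<odot>\<^bsub>M\<^esub> y = y \<odot>\<^sup>r\<^bsub>M\<^esub> id a"
    using x bimodule_hom_smult[OF assms(2) x(1)] bimodule_hom_rsmult[OF assms(2) x(1)] by (metis id_apply)
qed

text \<open>An infinite set is equipotent to its square. Consequently a type that can hold
  \<open>R\<close> can hold the carrier of every standard bimodule.\<close>

lemma inj_finite_support:
  assumes A: "infinite A" "z \<in> A" and I: "finite I"
  shows "\<exists>g. inj_on g {q. (\<forall>i. q i \<in> A) \<and> (\<forall>i. i \<notin> I \<longrightarrow> q i = z)}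
    \<and> g ` {q. (\<forall>i. q i \<in> A) \<and> (\<forall>i. i \<notin> I \<longrightarrow> q i = z)} \<subseteq> A"
  using I
proof (induction I rule: finite_induct)
  case empty
  have "{q. (\<forall>i. q i \<in> A) \<and> (\<forall>i. i \<notin> {} \<longrightarrow> q i = z)} \<subseteq> {\<lambda>i. z}" by auto
  then show ?case using A(2)
    by (intro exI[of _ "\<lambda>q. z"] conjI image_subsetI inj_onI) blast+
next
  case (insert j I)
  let ?S = "\<lambda>I. {q. (\<forall>i. q i \<in> A) \<and> (\<forall>i. i \<notin> I \<longrightarrow> q i = z)}"
  obtain g where g: "inj_on g (?S I)" "g ` ?S I \<subseteq> A" using insert.IH by blast
  obtain h where h: "bij_betw h (A \<times> A) A"
    using card_of_Times_same_infinite[OF A(1)] card_of_ordIso[of "A \<times> A" A] by blast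
  \<comment> \<open>The value at \<open>j\<close> is paired with the code of the remaining values,
    and the pair is coded in \<open>A\<close>.\<close>
  let ?g = "\<lambda>q. h (q j, g (q(j := z)))"
  have u: "q(j := z) \<in> ?S I" if "q \<in> ?S (insert j I)" for q using that A(2) by auto
  have m: "(q j, g (q(j := z))) \<in> A \<times> A" if "q \<in> ?S (insert j I)" for q
    using u[OF that] that g(2) by blast
  have "inj_on ?g (?S (insert j I))"
  proof (rule inj_onI)
    fix p q assume p: "p \<in> ?S (insert j I)" and q: "q \<in> ?S (insert j I)" and eq: "?g p = ?g q"
    have "(p j, g (p(j := z))) = (q j, g (q(j := z)))"
      using inj_onD[OF bij_betw_imp_inj_on[OF h] eq m[OF p] m[OF q]] .
    then have "p j = q j" "p(j := z) = q(j := z)" using inj_onD[OF g(1) _ u[OF p] u[OF q]] by auto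
    then show "p = q" by (metis fun_upd_triv fun_upd_upd)
  qed
  moreover have "?g ` ?S (insert j I) \<subseteq> A"
    using m bij_betwE[OF h] by blast
  ultimately show ?case by blast
qed

context quat_order
begin

definition lattice :: "('a, 'a, 'm) bimodule \<Rightarrow> bool"
  where "lattice L \<longleftrightarrow> fin_gen_bimodule R R L \<and> agreeing_actions A id id L
    \<and> (\<forall>a \<in> A - {\<zero>}. \<forall>x \<in> carrier L. a \<odot>\<^bsub>L\<^esub> x = \<zero>\<^bsub>L\<^esub> \<longrightarrow> x = \<zero>\<^bsub>L\<^esub>)"

text \<open>Residue bimodules after restriction of scalars to \<open>R\<close>. Annihilation by
  \<open>\<pi>\<close> from the left follows, since \<open>\<pi> = P P\<close> acts alike on both
  sides.\<close>

definition residual :: "('a, 'a, 'm) bimodule \<Rightarrow> bool"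
  where "residual M \<longleftrightarrow> fin_gen_bimodule R R M \<and> agreeing_actions A id id M
    \<and> (\<forall>x \<in> carrier M. x \<odot>\<^sup>r\<^bsub>M\<^esub> P = \<zero>\<^bsub>M\<^esub>)"

lemma qbimoduleI: "bimodule R R M \<Longrightarrow> agreeing_actions A id id M \<Longrightarrow> qbimodule M"
  by (intro quat_bimodule.intro quat_order_axioms quat_bimodule_axioms.intro)
    (auto simp: agreeing_actions_def)

lemma qbimodule_right_finite:
  assumes "fin_gen_bimodule R R M" "agreeing_actions A id id M"
  obtains G where "finite G" "G \<subseteq> carrier M" "bimodule.right_span R M G = carrier M"
proof -
  interpret M: quat_bimodule R C A \<pi> P \<theta> \<eta> \<sigma> M
    using assms by (intro qbimoduleI) (auto simp: fin_gen_bimodule_def)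
  obtain U where U: "finite U" "U \<subseteq> carrier M" "\<And>N. sub_bimodule R R N M \<Longrightarrow> U \<subseteq> N \<Longrightarrow> N = carrier M"
    using assms(1) by (auto simp: fin_gen_bimodule_def)
  show thesis by (rule M.right_finite[OF U], assumption+) (rule that)
qed

text \<open>There are finitely many right generators, and coefficients matter only up to a finite
  transversal of \<open>R / R P\<close>.\<close>

lemma residual_finite:
  assumes M: "residual M" shows "finite (carrier M)"
proof -
  have as: "fin_gen_bimodule R R M" "agreeing_actions A id id M" "\<And>x. x \<in> carrier M \<Longrightarrow> x \<odot>\<^sup>r\<^bsub>M\<^esub> P = \<zero>\<^bsub>M\<^esub>"
    using M by (auto simp: residual_def)
  interpret M: quat_bimodule R C A \<pi> P \<theta> \<eta> \<sigma> M
    using as by (intro qbimoduleI) (auto simp: fin_gen_bimodule_def)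
  obtain G where G: "finite G" "G \<subseteq> carrier M" "M.M.right_span G = carrier M"
    by (rule qbimodule_right_finite[OF as(1,2)])
  obtain T rep where T: "finite T" "T \<subseteq> carrier R"
    and rep: "\<And>r. r \<in> carrier R \<Longrightarrow> rep r \<in> T"
      "\<And>r. r \<in> carrier R \<Longrightarrow> \<exists>t \<in> carrier R. r = rep r \<oplus> t \<otimes> P"
    using transversal by metis
  have "carrier M \<subseteq> (\<lambda>c. M.M.lincomb c (\<lambda>x. x) G) ` (G \<rightarrow>\<^sub>E T)"
  proof
    fix x assume "x \<in> carrier M"
    then obtain c where c: "c \<in> G \<rightarrow> carrier R" "x = M.M.lincomb c (\<lambda>x. x) G"
      using M.M.right_span_eq[OF G(1,2)] unfolding G(3) by blast
    let ?c = "\<lambda>b \<in> G. rep (c b)"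
    have cT: "?c \<in> G \<rightarrow>\<^sub>E T" using c rep(1) by auto
    have "M.M.lincomb c (\<lambda>x. x) G = M.M.lincomb ?c (\<lambda>x. x) G"
      using G(2) c(1) rep T(2) by (intro M.lincomb_mod_P as(3)) (auto simp: Pi_iff)
    then show "x \<in> (\<lambda>c. M.M.lincomb c (\<lambda>x. x) G) ` (G \<rightarrow>\<^sub>E T)" unfolding c(2) by (rule image_eqI[OF _ cT])
  qed
  then show ?thesis using G(1) T(1) by (meson finite_PiE finite_surj)
qed

lemma residual_qb: "residual M \<Longrightarrow> residue_qb M"
  by (intro residue_qbimodule.intro residue_qbimodule_axioms.intro qbimoduleI residual_finite)
    (auto simp: residual_def fin_gen_bimodule_def)

text \<open>Torsion-freeness over \<open>A\<close> is applied to
  \<open>\<pi> x = x P P\<close>.\<close>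

lemma lattice_P_cancel:
  assumes L: "lattice L" and x: "x \<in> carrier L" "x \<odot>\<^sup>r\<^bsub>L\<^esub> P = \<zero>\<^bsub>L\<^esub>" shows "x = \<zero>\<^bsub>L\<^esub>"
proof -
  interpret L: quat_bimodule R C A \<pi> P \<theta> \<eta> \<sigma> L
    using L by (intro qbimoduleI) (auto simp: lattice_def fin_gen_bimodule_def)
  have "\<pi> \<odot>\<^bsub>L\<^esub> x = x \<odot>\<^sup>r\<^bsub>L\<^esub> P \<odot>\<^sup>r\<^bsub>L\<^esub> P"
    using x(1) L.agree[OF \<pi>_A x(1)] by (simp add: L.M.rsmult_assoc[symmetric] P_square)
  also have "\<dots> = \<zero>\<^bsub>L\<^esub>" using x by (simp add: L.M.zero_rsmult)
  finally show ?thesis using L x(1) \<pi>_A \<pi>_nonzero by (auto simp: lattice_def)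
qed

lemma lattice_unique:
  assumes L: "lattice L" and L': "lattice L'" and M: "residual M"
    and p: "right_trunc p L M" "right_trunc p' L' M"
  shows "bimodule_iso R R L L' \<noteq> {}"
proof -
  have l: "qbimodule L" "qbimodule L'" "fin_gen_bimodule R R L" "agreeing_actions A id id L"
    "fin_gen_bimodule R R L'" "agreeing_actions A id id L'"
    using L L' by (auto simp: lattice_def fin_gen_bimodule_def intro!: qbimoduleI)
  obtain G where G: "finite G" "G \<subseteq> carrier L" "bimodule.right_span R L G = carrier L"
    by (rule qbimodule_right_finite[OF l(3,4)])
  obtain G' where G': "finite G'" "G' \<subseteq> carrier L'" "bimodule.right_span R L' G' = carrier L'"
    by (rule qbimodule_right_finite[OF l(5,6)])
  show ?thesis
    by (rule trunc_determines[OF l(1) lattice_P_cancel[OF L] G l(2) lattice_P_cancel[OF L'] G'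
          residual_qb[OF M] p])
qed

text \<open>On a finite \<open>R\<close> the injective multiplication by \<open>\<pi>\<close> would
  be surjective, and the C-component of a preimage of \<open>1\<close> would invert
  \<open>\<pi>\<close> in \<open>C\<close>.\<close>

lemma infinite_R: "infinite (carrier R)"
proof
  assume fin: "finite (carrier R)"
  have "inj_on (\<lambda>r. \<pi> \<otimes> r) (carrier R)"
  proof (rule inj_onI)
    fix x y assume xy: "x \<in> carrier R" "y \<in> carrier R" "\<pi> \<otimes> x = \<pi> \<otimes> y"
    then have "\<pi> \<otimes> (x \<ominus> y) = \<zero>" by (simp add: a_minus_def R.r_distr R.r_minus R.r_neg)
    then have "x \<ominus> y = \<zero>" using torsion_free[OF \<pi>_A \<pi>_nonzero, of "x \<ominus> y"] xy by simp
    then show "x = y" using xy by simp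
  qed
  then have "(\<lambda>r. \<pi> \<otimes> r) ` carrier R = carrier R"
    by (intro endo_inj_surj[OF fin]) auto
  then obtain r where r: "r \<in> carrier R" "\<one> = \<pi> \<otimes> r" using R.one_closed by blast
  have "comp0 (\<pi> \<otimes> r) = \<pi> \<otimes> comp0 r"
    using comps_mult(1)[OF \<pi>_closed r(1)] comps[OF r(1)] \<sigma>_closed \<pi>_C by (simp add: comps_C)
  then have "\<pi> \<otimes> comp0 r = \<one>" using r(2)[symmetric] by (simp add: comps_C C_ops)
  then show False using \<pi>_nonunit comps(1)[OF r(1)] by simp
qed

lemma std_lattice:
  assumes D: "struct_data I d \<tau> k"
  shows "lattice (std_bimodule I d \<tau> k)"
proof -
  let ?S = "std_bimodule I d \<tau> k"
  interpret S: quat_bimodule R C A \<pi> P \<theta> \<eta> \<sigma> ?S using std_qbimodule[OF D] .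
  have fin: "finite I" using D by (simp add: struct_data_def)
  \<comment> \<open>The unit vectors; the coefficients of \<open>q\<close> with respect to them are
    its values.\<close>
  let ?u = "\<lambda>i j. if j = i then \<one> else \<zero>"
  have u: "?u \<in> I \<rightarrow> carrier ?S" by (auto simp: std_simps)
  have lc: "S.M.lincomb q ?u J = (\<lambda>i. if i \<in> J then q i else \<zero>)" if q: "q \<in> carrier ?S" and J: "J \<subseteq> I" for q J
    using finite_subset[OF J fin] J
  proof (induction J rule: finite_induct)
    case empty
    then show ?case by (simp add: std_simps)
  next
    case (insert j J)
    have m: "?u \<in> insert j J \<rightarrow> carrier ?S" "q \<in> insert j J \<rightarrow> carrier R" using u insert.prems q
      by (auto simp: std_simps)
    show ?case
      unfolding S.M.lincomb_insert[OF insert(1,2) m] using insert q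
      by (auto simp: std_simps fun_eq_iff)
  qed
  have "N = carrier ?S" if N: "sub_bimodule R R N ?S" "?u ` I \<subseteq> N" for N
  proof -
    have N': "S.M.right_submodule N" using N(1) by (auto simp: S.M.sub_bimodule_iff)
    have "carrier ?S \<subseteq> N"
    proof
      fix q assume q: "q \<in> carrier ?S"
      have "S.M.lincomb q ?u I \<in> N"
        using N(2) q by (intro S.M.lincomb_in_submodule fin N') (auto simp: std_simps)
      moreover have "S.M.lincomb q ?u I = q" using lc[OF q subset_refl] q by (auto simp: std_simps)
      ultimately show "q \<in> N" by simp
    qed
    then show ?thesis using S.M.right_submoduleD(1)[OF N'] by auto
  qed
  then have "fin_gen_bimodule R R ?S"
    unfolding fin_gen_bimodule_def using S.M.bimodule_axioms fin u
    by (intro conjI exI[of _ "?u ` I"]) auto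
  moreover have "agreeing_actions A id id ?S" by (auto simp: agreeing_actions_def S.agree)
  moreover have "x = \<zero>\<^bsub>?S\<^esub>" if a: "a \<in> A" "a \<noteq> \<zero>" and x: "x \<in> carrier ?S" "a \<odot>\<^bsub>?S\<^esub> x = \<zero>\<^bsub>?S\<^esub>" for a x
  proof -
    have "a \<otimes> x i = \<zero>" for i
      using fun_cong[OF x(2), of i] x(1) A_C[OF a(1)] a(1)
      by (simp add: std_simps comps_C twist_A twist_zero)
    then show ?thesis using torsion_free[OF a] x(1) by (auto simp: std_simps)
  qed
  ultimately show ?thesis by (auto simp: lattice_def)
qed

lemma lattice_iso:
  assumes L: "lattice L" and f: "f \<in> bimodule_iso R R L N" and N: "bimodule R R N"
  shows "lattice N"
proof -
  interpret L: bimodule R R L using L by (simp add: lattice_def fin_gen_bimodule_def)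
  interpret N: bimodule R R N by fact
  have h: "f \<in> bimodule_hom R R L N" and im: "f ` carrier L = carrier N" and inj: "inj_on f (carrier L)"
    using f by (auto simp: bimodule_iso_iff bij_betw_def)
  have z: "f \<zero>\<^bsub>L\<^esub> = \<zero>\<^bsub>N\<^esub>" by (rule bimodule_hom_zero[OF L.bimodule_axioms N h])
  have "fin_gen_bimodule R R N"
    using L by (intro fin_gen_surj[OF _ N h im]) (simp add: lattice_def)
  moreover have "agreeing_actions A id id N"
    using L by (intro agreeing_surj[OF _ h im]) (auto simp: lattice_def)
  moreover have "y = \<zero>\<^bsub>N\<^esub>" if a: "a \<in> A - {\<zero>}" "y \<in> carrier N" "a \<odot>\<^bsub>N\<^esub> y = \<zero>\<^bsub>N\<^esub>" for a y
  proof -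
    obtain x where x: "x \<in> carrier L" "y = f x" using a(2) im by blast
    have aR: "a \<in> carrier R" using a by simp
    have "f (a \<odot>\<^bsub>L\<^esub> x) = f \<zero>\<^bsub>L\<^esub>" using a(3) x bimodule_hom_smult[OF h x(1) aR] z by simp
    then have "a \<odot>\<^bsub>L\<^esub> x = \<zero>\<^bsub>L\<^esub>"
      by (rule inj_onD[OF inj]) (simp_all add: L.smult_closed[OF aR x(1)])
    then show ?thesis using L a(1) x z by (auto simp: lattice_def)
  qed
  ultimately show ?thesis by (auto simp: lattice_def)
qed

lemma right_trunc_iso:
  assumes L': "bimodule R R L'" and f: "f \<in> bimodule_iso R R L' L" and p: "right_trunc p L M"
  shows "right_trunc (\<lambda>x. p (f x)) L' M"
proof -
  interpret L': bimodule R R L' by fact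
  have h: "f \<in> bimodule_hom R R L' L" and im: "f ` carrier L' = carrier L" and inj: "inj_on f (carrier L')"
    using f by (auto simp: bimodule_iso_iff bij_betw_def)
  have ph: "p \<in> bimodule_hom R R L M" and pim: "p ` carrier L = carrier M"
    and ker: "\<And>x. x \<in> carrier L \<Longrightarrow> p x = \<zero>\<^bsub>M\<^esub> \<longleftrightarrow> (\<exists>y \<in> carrier L. x = y \<odot>\<^sup>r\<^bsub>L\<^esub> P)"
    using p by (auto simp: right_trunc_def)
  show ?thesis
    unfolding right_trunc_def
  proof (intro conjI ballI)
    show "(\<lambda>x. p (f x)) \<in> bimodule_hom R R L' M" by (rule bimodule_hom_comp[OF h ph])
    show "(\<lambda>x. p (f x)) ` carrier L' = carrier M"
      unfolding pim[symmetric] im[symmetric] by (simp add: image_image)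
    fix x assume x: "x \<in> carrier L'"
    have "p (f x) = \<zero>\<^bsub>M\<^esub> \<longleftrightarrow> (\<exists>y \<in> f ` carrier L'. f x = y \<odot>\<^sup>r\<^bsub>L\<^esub> P)"
      unfolding im by (rule ker[OF bimodule_hom_closed[OF h x]])
    also have "\<dots> \<longleftrightarrow> (\<exists>y \<in> carrier L'. f x = f (y \<odot>\<^sup>r\<^bsub>L'\<^esub> P))"
      using bimodule_hom_rsmult[OF h _ P_closed] by simp
    also have "\<dots> \<longleftrightarrow> (\<exists>y \<in> carrier L'. x = y \<odot>\<^sup>r\<^bsub>L'\<^esub> P)"
      using inj_on_eq_iff[OF inj x L'.rsmult_closed[OF P_closed]] by simp
    finally show "p (f x) = \<zero>\<^bsub>M\<^esub> \<longleftrightarrow> (\<exists>y \<in> carrier L'. x = y \<odot>\<^sup>r\<^bsub>L'\<^esub> P)" .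
  qed
qed

text \<open>The standard bimodule consists of functions on an index type built from the carrier type
  of \<open>M\<close>. Its carrier is first coded inside \<open>R\<close>, then mapped by
  \<open>f\<close> into the prescribed type, and the structure is carried along.\<close>

lemma lattice_exists:
  fixes M :: "('a, 'a, 'n) bimodule" and f :: "'a \<Rightarrow> 'm"
  assumes M: "residual M" and f: "inj_on f (carrier R)"
  obtains L :: "('a, 'a, 'm) bimodule" and p where "lattice L" "right_trunc p L M"
proof -
  obtain I d \<tau> k p where D: "struct_data (I :: ('n \<times> bool) set) d \<tau> k"
    and p: "right_trunc p (std_bimodule I d \<tau> k) M"
    by (rule trunc_exists[OF residual_qb[OF M]])
  let ?S = "std_bimodule I d \<tau> k"
  note S = std_bimodule[OF D]
  have c: "carrier ?S = {q. (\<forall>i. q i \<in> carrier R) \<and> (\<forall>i. i \<notin> I \<longrightarrow> q i = \<zero>)}"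
    by (auto simp: std_simps)
  obtain g where g: "inj_on g (carrier ?S)" "g ` carrier ?S \<subseteq> carrier R"
    unfolding c using inj_finite_support[OF infinite_R R.zero_closed, of I] D
    by (auto simp: struct_data_def)
  have "inj_on (\<lambda>q. f (g q)) (carrier ?S)"
    using comp_inj_on[OF g(1) inj_on_subset[OF f g(2)]] by (simp add: comp_def)
  note t = transport[OF S this]
  show thesis
    by (rule that[OF lattice_iso[OF std_lattice[OF D] t]
          right_trunc_iso[OF t(2) bimodule_iso_sym[OF S t(1)] p]])
qed

end

section \<open>Quotient bimodules and isomorphism classes\<close>

text \<open>Restriction of scalars along \<open>R -> R/I\<close> and
  \<open>S -> S/J\<close>.\<close>

definition pullback ::
    "('a, 'y) ring_scheme \<Rightarrow> 'a set \<Rightarrow> ('c, 'z) ring_scheme \<Rightarrow> 'c set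
      \<Rightarrow> ('a set, 'c set, 'm) bimodule \<Rightarrow> ('a, 'c, 'm) bimodule"
  where "pullback R I S J M =
    \<lparr>carrier = carrier M, monoid.mult = undefined, one = undefined,
     ring.zero = \<zero>\<^bsub>M\<^esub>, add = add M,
     smult = (\<lambda>r x. (I +>\<^bsub>R\<^esub> r) \<odot>\<^bsub>M\<^esub> x), rsmult = (\<lambda>x s. x \<odot>\<^sup>r\<^bsub>M\<^esub> (J +>\<^bsub>S\<^esub> s))\<rparr>"

lemma pullback_simps [simp]:
  "carrier (pullback R I S J M) = carrier M"
  "\<zero>\<^bsub>pullback R I S J M\<^esub> = \<zero>\<^bsub>M\<^esub>"
  "add (pullback R I S J M) = add M"
  "r \<odot>\<^bsub>pullback R I S J M\<^esub> x = (I +>\<^bsub>R\<^esub> r) \<odot>\<^bsub>M\<^esub> x"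
  "x \<odot>\<^sup>r\<^bsub>pullback R I S J M\<^esub> s = x \<odot>\<^sup>r\<^bsub>M\<^esub> (J +>\<^bsub>S\<^esub> s)"
  by (simp_all add: pullback_def)

lemma carrier_Quot: "carrier (R Quot I) = (\<lambda>r. I +>\<^bsub>R\<^esub> r) ` carrier R"
  by (auto simp: FactRing_def A_RCOSETS_def')

lemma pullback_bimodule:
  assumes I: "ideal I R" and J: "ideal J S" and M: "bimodule (R Quot I) (S Quot J) M"
  shows "bimodule R S (pullback R I S J M)"
proof -
  interpret I: ideal I R by fact
  interpret J: ideal J S by fact
  interpret M: bimodule "R Quot I" "S Quot J" M by fact
  note h = I.rcos_ring_hom J.rcos_ring_hom
  have c: "r \<in> carrier R \<Longrightarrow> I +>\<^bsub>R\<^esub> r \<in> carrier (R Quot I)"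
    "s \<in> carrier S \<Longrightarrow> J +>\<^bsub>S\<^esub> s \<in> carrier (S Quot J)" for r s
    by (auto simp: carrier_Quot)
  have "abelian_group (pullback R I S J M)"
  proof (rule abelian_groupI)
    fix x assume x: "x \<in> carrier (pullback R I S J M)"
    then show "\<exists>y \<in> carrier (pullback R I S J M). y \<oplus>\<^bsub>pullback R I S J M\<^esub> x = \<zero>\<^bsub>pullback R I S J M\<^esub>"
      by (intro bexI[of _ "\<ominus>\<^bsub>M\<^esub> x"]) (simp_all add: M.M.l_neg)
  qed (simp_all add: M.M.a_ac)
  then show ?thesis
    by (intro bimodule.intro bimodule_axioms.intro I.ring_axioms J.ring_axioms)
      (simp_all add: c ring_hom_add[OF h(1)] ring_hom_add[OF h(2)] ring_hom_mult[OF h(1)]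
        ring_hom_mult[OF h(2)] ring_hom_one[OF h(1)] ring_hom_one[OF h(2)]
        M.smult_closed M.smult_l_distr M.smult_r_distr M.smult_assoc M.smult_one M.rsmult_closed
        M.rsmult_r_distr M.rsmult_l_distr M.rsmult_assoc M.rsmult_one M.smult_rsmult)
qed

lemma pullback_hom:
  "f \<in> bimodule_hom R S (pullback R I S J M) (pullback R I S J M')
    \<longleftrightarrow> f \<in> bimodule_hom (R Quot I) (S Quot J) M M'"
  unfolding bimodule_hom_def carrier_Quot by (auto simp: hom_def)

text \<open>Every scalar of a quotient ring is the coset of some element, so both bimodules have the
  same sub-bimodules.\<close>

lemma pullback_fin_gen:
  assumes I: "ideal I R" and J: "ideal J S" and M: "bimodule (R Quot I) (S Quot J) M"
  shows "fin_gen_bimodule R S (pullback R I S J M) \<longleftrightarrow> fin_gen_bimodule (R Quot I) (S Quot J) M"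
proof -
  interpret M: bimodule "R Quot I" "S Quot J" M by fact
  interpret pb: bimodule R S "pullback R I S J M" by (rule pullback_bimodule[OF assms])
  have "sub_bimodule R S N (pullback R I S J M) \<longleftrightarrow> sub_bimodule (R Quot I) (S Quot J) N M" for N
    unfolding M.sub_bimodule_iff pb.sub_bimodule_iff M.right_submodule_def pb.right_submodule_def
      carrier_Quot by auto
  then show ?thesis
    using pullback_bimodule[OF assms] M by (simp add: fin_gen_bimodule_def)
qed

text \<open>The actions of \<open>quot_bimodule\<close> are unions over all representatives; when
  these all give the same coset, the union is that coset.\<close>

lemma UN2_const:
  assumes "\<And>a z. \<lbrakk>a \<in> A; z \<in> Z\<rbrakk> \<Longrightarrow> g a z = V" "a \<in> A" "z \<in> Z"
  shows "(\<Union>a\<in>A. \<Union>z\<in>Z. g a z) = V"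
  using assms by auto

lemma quot_actions:
  "r \<odot>\<^bsub>quot_bimodule M N\<^esub> U = (\<Union>a \<in> r. \<Union>x \<in> U. N +>\<^bsub>M\<^esub> (a \<odot>\<^bsub>M\<^esub> x))"
  "U \<odot>\<^sup>r\<^bsub>quot_bimodule M N\<^esub> s = (\<Union>x \<in> U. \<Union>a \<in> s. N +>\<^bsub>M\<^esub> (x \<odot>\<^sup>r\<^bsub>M\<^esub> a))"
  by (simp_all add: quot_bimodule_def)

section \<open>Quotients of bimodules by sub-bimodules\<close>

locale bimodule_quotient = L: bimodule R S L + I: ideal I R + J: ideal J S
  for R :: "('a, 'y) ring_scheme" and S :: "('c, 'z) ring_scheme" and L :: "('a, 'c, 'm) bimodule"
    and I J and N :: "'m set" +
  assumes N: "sub_bimodule R S N L"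
    and I_N: "\<lbrakk>r \<in> I; x \<in> carrier L\<rbrakk> \<Longrightarrow> r \<odot>\<^bsub>L\<^esub> x \<in> N"
    and J_N: "\<lbrakk>s \<in> J; x \<in> carrier L\<rbrakk> \<Longrightarrow> x \<odot>\<^sup>r\<^bsub>L\<^esub> s \<in> N"
begin

abbreviation Q :: "('a set, 'c set, 'm set) bimodule" where "Q \<equiv> quot_bimodule L N"

sublocale N: abelian_subgroup N L
  using N L.abelian_group_axioms by (intro abelian_subgroupI3) (auto simp: sub_bimodule_def)

lemma N_submodule: "L.right_submodule N" "\<lbrakk>r \<in> carrier R; x \<in> N\<rbrakk> \<Longrightarrow> r \<odot>\<^bsub>L\<^esub> x \<in> N"
  using N by (auto simp: L.sub_bimodule_iff)

lemmas N_ops = L.right_submoduleD[OF N_submodule(1)]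

lemma coset_eq:
  assumes "x \<in> carrier L" "y \<in> carrier L"
  shows "N +>\<^bsub>L\<^esub> x = N +>\<^bsub>L\<^esub> y \<longleftrightarrow> x \<ominus>\<^bsub>L\<^esub> y \<in> N"
proof
  assume "N +>\<^bsub>L\<^esub> x = N +>\<^bsub>L\<^esub> y"
  then have "x \<in> N +>\<^bsub>L\<^esub> y" using N.a_rcos_self[OF assms(1)] by simp
  then show "x \<ominus>\<^bsub>L\<^esub> y \<in> N" using N.a_rcos_module_imp[OF assms(2)] by (simp add: a_minus_def)
next
  assume "x \<ominus>\<^bsub>L\<^esub> y \<in> N"
  then have "x \<in> N +>\<^bsub>L\<^esub> y" using N.a_rcos_module_rev[OF assms(2,1)] by (simp add: a_minus_def)
  then show "N +>\<^bsub>L\<^esub> x = N +>\<^bsub>L\<^esub> y" using N.a_repr_independence'[of x y] assms by simp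
qed

lemma Q_carrier: "carrier Q = (\<lambda>x. N +>\<^bsub>L\<^esub> x) ` carrier L"
  by (auto simp: quot_bimodule_def A_RCOSETS_def')

lemma Q_zero: "\<zero>\<^bsub>Q\<^esub> = N +>\<^bsub>L\<^esub> \<zero>\<^bsub>L\<^esub>"
  using N_ops(1) by (simp add: quot_bimodule_def subsetI)

lemma Q_add: "\<lbrakk>x \<in> carrier L; y \<in> carrier L\<rbrakk> \<Longrightarrow> (N +>\<^bsub>L\<^esub> x) \<oplus>\<^bsub>Q\<^esub> (N +>\<^bsub>L\<^esub> y) = N +>\<^bsub>L\<^esub> (x \<oplus>\<^bsub>L\<^esub> y)"
  by (simp add: quot_bimodule_def N.a_rcos_sum)

lemma Q_smult:
  assumes r: "r \<in> carrier R" and x: "x \<in> carrier L"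
  shows "(I +>\<^bsub>R\<^esub> r) \<odot>\<^bsub>Q\<^esub> (N +>\<^bsub>L\<^esub> x) = N +>\<^bsub>L\<^esub> (r \<odot>\<^bsub>L\<^esub> x)"
proof -
  have "N +>\<^bsub>L\<^esub> (a \<odot>\<^bsub>L\<^esub> z) = N +>\<^bsub>L\<^esub> (r \<odot>\<^bsub>L\<^esub> x)" if a: "a \<in> I +>\<^bsub>R\<^esub> r" and z: "z \<in> N +>\<^bsub>L\<^esub> x" for a z
  proof -
    obtain i where i: "i \<in> I" "a = i \<oplus>\<^bsub>R\<^esub> r" using a by (auto simp: a_r_coset_def')
    obtain n where n: "n \<in> N" "z = n \<oplus>\<^bsub>L\<^esub> x" using z by (auto simp: a_r_coset_def')
    note m = I.Icarr[OF i(1)] N_ops(1)[OF n(1)] r x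
    have cl: "i \<odot>\<^bsub>L\<^esub> z \<in> carrier L" "r \<odot>\<^bsub>L\<^esub> n \<in> carrier L" "r \<odot>\<^bsub>L\<^esub> x \<in> carrier L" "z \<in> carrier L"
      using m n by (auto intro!: L.smult_closed)
    have "a \<odot>\<^bsub>L\<^esub> z = i \<odot>\<^bsub>L\<^esub> z \<oplus>\<^bsub>L\<^esub> r \<odot>\<^bsub>L\<^esub> z" unfolding i(2) using m cl by (simp add: L.smult_l_distr)
    also have "r \<odot>\<^bsub>L\<^esub> z = r \<odot>\<^bsub>L\<^esub> n \<oplus>\<^bsub>L\<^esub> r \<odot>\<^bsub>L\<^esub> x" unfolding n(2) using m by (simp add: L.smult_r_distr)
    finally have e: "a \<odot>\<^bsub>L\<^esub> z = i \<odot>\<^bsub>L\<^esub> z \<oplus>\<^bsub>L\<^esub> (r \<odot>\<^bsub>L\<^esub> n \<oplus>\<^bsub>L\<^esub> r \<odot>\<^bsub>L\<^esub> x)" .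
    \<comment> \<open>The two error terms, from changing the scalar and from changing the vector,
      both lie in \<open>N\<close>.\<close>
    then have "a \<odot>\<^bsub>L\<^esub> z \<ominus>\<^bsub>L\<^esub> r \<odot>\<^bsub>L\<^esub> x = i \<odot>\<^bsub>L\<^esub> z \<oplus>\<^bsub>L\<^esub> r \<odot>\<^bsub>L\<^esub> n"
      using cl by (simp add: a_minus_def L.a_assoc L.r_neg)
    moreover have "i \<odot>\<^bsub>L\<^esub> z \<oplus>\<^bsub>L\<^esub> r \<odot>\<^bsub>L\<^esub> n \<in> N" using I_N[OF i(1) cl(4)] N_submodule(2)[OF r n(1)] by (rule N_ops(3))
    ultimately show ?thesis using e cl by (subst coset_eq) auto
  qed
  moreover have "r \<in> I +>\<^bsub>R\<^esub> r" "x \<in> N +>\<^bsub>L\<^esub> x" using I.a_rcos_self r N.a_rcos_self x by auto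
  ultimately show ?thesis unfolding quot_actions by (rule UN2_const)
qed

lemma Q_rsmult:
  assumes s: "s \<in> carrier S" and x: "x \<in> carrier L"
  shows "(N +>\<^bsub>L\<^esub> x) \<odot>\<^sup>r\<^bsub>Q\<^esub> (J +>\<^bsub>S\<^esub> s) = N +>\<^bsub>L\<^esub> (x \<odot>\<^sup>r\<^bsub>L\<^esub> s)"
proof -
  have "N +>\<^bsub>L\<^esub> (z \<odot>\<^sup>r\<^bsub>L\<^esub> a) = N +>\<^bsub>L\<^esub> (x \<odot>\<^sup>r\<^bsub>L\<^esub> s)" if z: "z \<in> N +>\<^bsub>L\<^esub> x" and a: "a \<in> J +>\<^bsub>S\<^esub> s" for z a
  proof -
    obtain i where i: "i \<in> J" "a = i \<oplus>\<^bsub>S\<^esub> s" using a by (auto simp: a_r_coset_def')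
    obtain n where n: "n \<in> N" "z = n \<oplus>\<^bsub>L\<^esub> x" using z by (auto simp: a_r_coset_def')
    note m = J.Icarr[OF i(1)] N_ops(1)[OF n(1)] s x
    have cl: "z \<odot>\<^sup>r\<^bsub>L\<^esub> i \<in> carrier L" "n \<odot>\<^sup>r\<^bsub>L\<^esub> s \<in> carrier L" "x \<odot>\<^sup>r\<^bsub>L\<^esub> s \<in> carrier L" "z \<in> carrier L"
      using m n by (auto intro!: L.rsmult_closed)
    have "z \<odot>\<^sup>r\<^bsub>L\<^esub> a = z \<odot>\<^sup>r\<^bsub>L\<^esub> i \<oplus>\<^bsub>L\<^esub> z \<odot>\<^sup>r\<^bsub>L\<^esub> s" unfolding i(2) using m cl by (simp add: L.rsmult_r_distr)
    also have "z \<odot>\<^sup>r\<^bsub>L\<^esub> s = n \<odot>\<^sup>r\<^bsub>L\<^esub> s \<oplus>\<^bsub>L\<^esub> x \<odot>\<^sup>r\<^bsub>L\<^esub> s" unfolding n(2) using m by (simp add: L.rsmult_l_distr)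
    finally have e: "z \<odot>\<^sup>r\<^bsub>L\<^esub> a = z \<odot>\<^sup>r\<^bsub>L\<^esub> i \<oplus>\<^bsub>L\<^esub> (n \<odot>\<^sup>r\<^bsub>L\<^esub> s \<oplus>\<^bsub>L\<^esub> x \<odot>\<^sup>r\<^bsub>L\<^esub> s)" .
    then have "z \<odot>\<^sup>r\<^bsub>L\<^esub> a \<ominus>\<^bsub>L\<^esub> x \<odot>\<^sup>r\<^bsub>L\<^esub> s = z \<odot>\<^sup>r\<^bsub>L\<^esub> i \<oplus>\<^bsub>L\<^esub> n \<odot>\<^sup>r\<^bsub>L\<^esub> s"
      using cl by (simp add: a_minus_def L.a_assoc L.r_neg)
    moreover have "z \<odot>\<^sup>r\<^bsub>L\<^esub> i \<oplus>\<^bsub>L\<^esub> n \<odot>\<^sup>r\<^bsub>L\<^esub> s \<in> N" using J_N[OF i(1) cl(4)] N_ops(4)[OF n(1) s] by (rule N_ops(3))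
    ultimately show ?thesis using e cl by (subst coset_eq) auto
  qed
  moreover have "x \<in> N +>\<^bsub>L\<^esub> x" "s \<in> J +>\<^bsub>S\<^esub> s" using J.a_rcos_self s N.a_rcos_self x by auto
  ultimately show ?thesis unfolding quot_actions by (rule UN2_const)
qed

lemma Q_bimodule: "bimodule (R Quot I) (S Quot J) Q"
  by (rule bimodule_surj_image[OF L.bimodule_axioms I.quotient_is_ring J.quotient_is_ring
        I.rcos_ring_hom carrier_Quot[symmetric] J.rcos_ring_hom carrier_Quot[symmetric]
        Q_carrier[symmetric] Q_zero[symmetric]])
    (simp_all add: Q_add Q_smult Q_rsmult)

lemma Q_hom: "(\<lambda>x. N +>\<^bsub>L\<^esub> x) \<in> bimodule_hom R S L (pullback R I S J Q)"
  by (rule bimodule_homI) (simp_all add: Q_add Q_smult Q_rsmult, simp add: Q_carrier)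

lemma Q_kernel: "x \<in> carrier L \<Longrightarrow> N +>\<^bsub>L\<^esub> x = \<zero>\<^bsub>Q\<^esub> \<longleftrightarrow> x \<in> N"
  unfolding Q_zero by (subst coset_eq) (simp_all add: a_minus_def L.minus_equality[of "\<zero>\<^bsub>L\<^esub>" "\<zero>\<^bsub>L\<^esub>"])

text \<open>The first isomorphism theorem, for a surjection that is linear over the rings acting on
  \<open>L\<close>.\<close>

lemma Q_iso:
  assumes M: "bimodule (R Quot I) (S Quot J) M" and p: "p \<in> bimodule_hom R S L (pullback R I S J M)"
    and surj: "p ` carrier L = carrier M" and ker: "\<And>x. x \<in> carrier L \<Longrightarrow> p x = \<zero>\<^bsub>M\<^esub> \<longleftrightarrow> x \<in> N"
  shows "bimodule_iso (R Quot I) (S Quot J) Q M \<noteq> {}"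
proof -
  let ?M = "pullback R I S J M"
  have pb: "bimodule R S ?M" by (rule pullback_bimodule[OF I.ideal_axioms J.ideal_axioms M])
  interpret M: bimodule "R Quot I" "S Quot J" M by fact
  have eq: "p x = p y \<longleftrightarrow> N +>\<^bsub>L\<^esub> x = N +>\<^bsub>L\<^esub> y" if "x \<in> carrier L" "y \<in> carrier L" for x y
  proof -
    have c: "p x \<in> carrier M" "p y \<in> carrier M" "p (x \<ominus>\<^bsub>L\<^esub> y) \<in> carrier M"
      using surj that L.minus_closed[OF that] by blast+
    have "p x = p ((x \<ominus>\<^bsub>L\<^esub> y) \<oplus>\<^bsub>L\<^esub> y)" using L.add_minus_cancel[OF that] by simp
    also have "\<dots> = p (x \<ominus>\<^bsub>L\<^esub> y) \<oplus>\<^bsub>M\<^esub> p y"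
      using bimodule_hom_add[OF p, of "x \<ominus>\<^bsub>L\<^esub> y" y] that by simp
    finally have d: "p x = p (x \<ominus>\<^bsub>L\<^esub> y) \<oplus>\<^bsub>M\<^esub> p y" .
    have "p x = p y \<longleftrightarrow> p (x \<ominus>\<^bsub>L\<^esub> y) = \<zero>\<^bsub>M\<^esub>"
      unfolding d using c by (metis M.add.r_cancel_one')
    also have "\<dots> \<longleftrightarrow> x \<ominus>\<^bsub>L\<^esub> y \<in> N" using ker[of "x \<ominus>\<^bsub>L\<^esub> y"] that by simp
    finally show ?thesis using coset_eq[OF that] by simp
  qed
  \<comment> \<open>\<open>f\<close> evaluates \<open>p\<close> at an arbitrary representative; by
    \<open>eq\<close> the choice does not matter.\<close>
  define f where "f U = p (SOME x. x \<in> carrier L \<and> U = N +>\<^bsub>L\<^esub> x)" for U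
  have f: "f (N +>\<^bsub>L\<^esub> x) = p x" if x: "x \<in> carrier L" for x
  proof -
    let ?y = "SOME y. y \<in> carrier L \<and> N +>\<^bsub>L\<^esub> x = N +>\<^bsub>L\<^esub> y"
    have "?y \<in> carrier L \<and> N +>\<^bsub>L\<^esub> x = N +>\<^bsub>L\<^esub> ?y"
      by (rule someI[of "\<lambda>y. y \<in> carrier L \<and> N +>\<^bsub>L\<^esub> x = N +>\<^bsub>L\<^esub> y" x]) (use x in simp)
    then show ?thesis unfolding f_def using eq[OF x, of ?y] by simp
  qed
  have "f \<in> bimodule_hom R S (pullback R I S J Q) ?M"
    by (rule bimodule_homI)
      (auto simp: Q_carrier Q_add Q_smult Q_rsmult f bimodule_hom_add[OF p] bimodule_hom_smult[OF p]
        bimodule_hom_rsmult[OF p] L.smult_closed L.rsmult_closed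
        bimodule_hom_closed[OF p, simplified])
  moreover have "bij_betw f (carrier Q) (carrier M)"
    unfolding bij_betw_def
  proof
    show "inj_on f (carrier Q)" unfolding Q_carrier by (rule inj_onI) (auto simp: f eq)
    show "f ` carrier Q = carrier M" unfolding Q_carrier surj[symmetric] image_image by (simp add: f)
  qed
  ultimately show ?thesis by (auto simp: bimodule_iso_iff pullback_hom)
qed

end

lemma bimodule_iso_trans:
  "\<lbrakk>bimodule_iso R S L M \<noteq> {}; bimodule_iso R S M N \<noteq> {}\<rbrakk> \<Longrightarrow> bimodule_iso R S L N \<noteq> {}"
  using bimodule_iso_comp by blast

text \<open>The existence of \<open>Z\<close> excludes an empty class, which nonisomorphic bimodules
  without representatives in \<open>U\<close> would share.\<close>

lemma iso_class_eq_iff: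
  assumes "bimodule R S M" "bimodule R S M'" and "\<exists>Z \<in> U. bimodule_iso R S M Z \<noteq> {}"
  shows "iso_class R S U M = iso_class R S U M' \<longleftrightarrow> bimodule_iso R S M M' \<noteq> {}"
proof
  assume eq: "iso_class R S U M = iso_class R S U M'"
  obtain Z where "Z \<in> iso_class R S U M" using assms(3) by (auto simp: iso_class_def)
  moreover from this have "Z \<in> iso_class R S U M'" using eq by simp
  ultimately obtain f g where "f \<in> bimodule_iso R S M Z" "g \<in> bimodule_iso R S M' Z"
    by (auto simp: iso_class_def)
  from bimodule_iso_comp[OF this(1) bimodule_iso_sym[OF assms(2) this(2)]]
  show "bimodule_iso R S M M' \<noteq> {}" by blast
next
  assume "bimodule_iso R S M M' \<noteq> {}"
  then obtain f where f: "f \<in> bimodule_iso R S M M'" by blast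
  note g = bimodule_iso_sym[OF assms(1) f]
  have "bimodule_iso R S M Z \<noteq> {} \<longleftrightarrow> bimodule_iso R S M' Z \<noteq> {}" for Z
    using bimodule_iso_comp[OF f, of _ Z] bimodule_iso_comp[OF g, of _ Z] by blast
  then show "iso_class R S U M = iso_class R S U M'" unfolding iso_class_def by blast
qed

text \<open>The values of \<open>T\<close> and the members of \<open>Y\<close> may have different
  carrier types, so a value of \<open>T\<close> is not itself a member of \<open>Y\<close>;
  \<open>TY\<close> provides a representative of its class.\<close>

lemma induces_bijectionI:
  assumes U: "\<And>L. L \<in> U \<Longrightarrow> bimodule R S L" and Y: "\<And>M. M \<in> Y \<Longrightarrow> bimodule R' S' M"
    and TB: "\<And>L. L \<in> U \<Longrightarrow> bimodule R' S' (T L)"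
    and TY: "\<And>L. L \<in> U \<Longrightarrow> \<exists>M \<in> Y. bimodule_iso R' S' (T L) M \<noteq> {}"
    and T: "\<And>L L'. \<lbrakk>L \<in> U; L' \<in> U\<rbrakk>
      \<Longrightarrow> bimodule_iso R S L L' \<noteq> {} \<longleftrightarrow> bimodule_iso R' S' (T L) (T L') \<noteq> {}"
    and surj: "\<And>M. M \<in> Y \<Longrightarrow> \<exists>L \<in> U. bimodule_iso R' S' (T L) M \<noteq> {}"
  shows "induces_bijection T R S U R' S' Y"
proof -
  let ?c = "iso_class R S U" and ?d = "iso_class R' S' Y"
  have c: "?c L = ?c L' \<longleftrightarrow> bimodule_iso R S L L' \<noteq> {}" if "L \<in> U" "L' \<in> U" for L L'
    using that U bimodule_iso_refl by (intro iso_class_eq_iff) blast+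
  have d: "?d (T L) = ?d (T L') \<longleftrightarrow> bimodule_iso R' S' (T L) (T L') \<noteq> {}" if "L \<in> U" "L' \<in> U" for L L'
    using that TB TY by (intro iso_class_eq_iff) blast+
  have d': "?d (T L) = ?d M \<longleftrightarrow> bimodule_iso R' S' (T L) M \<noteq> {}" if "L \<in> U" "M \<in> Y" for L M
    using that TB TY Y by (intro iso_class_eq_iff) blast+
  \<comment> \<open>A class is evaluated at a chosen member; \<open>T\<close> makes the result
    independent of the choice.\<close>
  define \<Phi> where "\<Phi> Z = ?d (T (SOME L. L \<in> U \<and> ?c L = Z))" for Z
  have \<Phi>: "\<Phi> (?c L) = ?d (T L)" if L: "L \<in> U" for L
  proof -
    let ?L = "SOME L'. L' \<in> U \<and> ?c L' = ?c L"
    have LL: "?L \<in> U \<and> ?c ?L = ?c L" by (rule someI[of "\<lambda>L'. L' \<in> U \<and> ?c L' = ?c L" L]) (use L in simp)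
    then have "bimodule_iso R S ?L L \<noteq> {}" using c[OF _ L] by blast
    then have "?d (T ?L) = ?d (T L)" using d[OF _ L] T[OF _ L] LL by blast
    then show ?thesis by (simp only: \<Phi>_def)
  qed
  have "bij_betw \<Phi> (?c ` U) (?d ` Y)"
    unfolding bij_betw_def
  proof
    show "inj_on \<Phi> (?c ` U)"
    proof (rule inj_onI)
      fix Z Z' assume "Z \<in> ?c ` U" "Z' \<in> ?c ` U" and eq: "\<Phi> Z = \<Phi> Z'"
      then obtain L L' where L: "L \<in> U" "L' \<in> U" "Z = ?c L" "Z' = ?c L'" by blast
      then show "Z = Z'" using eq \<Phi> c d T by simp
    qed
    have "?d (T L) \<in> ?d ` Y" if "L \<in> U" for L using TY[OF that] d'[OF that] by blast
    moreover have "?d M \<in> \<Phi> ` ?c ` U" if M: "M \<in> Y" for M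
    proof -
      obtain L where L: "L \<in> U" "bimodule_iso R' S' (T L) M \<noteq> {}" using surj[OF M] by blast
      then have "\<Phi> (?c L) = ?d M" using \<Phi> d' M by simp
      then show ?thesis using L(1) by blast
    qed
    ultimately show "\<Phi> ` ?c ` U = ?d ` Y" using \<Phi> by auto
  qed
  then show ?thesis using \<Phi> by (auto simp: induces_bijection_def iso_classes_def)
qed

definition truncation_map ::
    "('a, 'y) ring_scheme \<Rightarrow> 'a set \<Rightarrow> ('c, 'z) ring_scheme \<Rightarrow> 'c set
      \<Rightarrow> 'm set \<Rightarrow> ('a, 'c, 'm) bimodule \<Rightarrow> ('a set, 'c set, 'n) bimodule \<Rightarrow> ('m \<Rightarrow> 'n) \<Rightarrow> bool"
  where "truncation_map R I S J N L M p \<longleftrightarrow> p \<in> bimodule_hom R S L (pullback R I S J M)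
    \<and> p ` carrier L = carrier M \<and> (\<forall>x \<in> carrier L. p x = \<zero>\<^bsub>M\<^esub> \<longleftrightarrow> x \<in> N)"

text \<open>Both halves of the theorem reduce to the same three facts: each lattice has a truncation
  in \<open>Y\<close>, a truncation determines the lattice, and each member of \<open>Y\<close> is a
  truncation.\<close>

lemma truncation_bijection:
  assumes q: "\<And>L. L \<in> U \<Longrightarrow> bimodule_quotient R S L I J (N L)"
    and Y: "\<And>M. M \<in> Y \<Longrightarrow> bimodule (R Quot I) (S Quot J) M"
    and iso: "\<And>L L' f x. \<lbrakk>L \<in> U; L' \<in> U; f \<in> bimodule_iso R S L L'; x \<in> carrier L\<rbrakk>
      \<Longrightarrow> f x \<in> N L' \<longleftrightarrow> x \<in> N L"
    and trunc: "\<And>L. L \<in> U \<Longrightarrow> \<exists>M \<in> Y. \<exists>p. truncation_map R I S J (N L) L M p"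
    and unique: "\<And>L L' M p p'. \<lbrakk>L \<in> U; L' \<in> U; M \<in> Y; truncation_map R I S J (N L) L M p;
      truncation_map R I S J (N L') L' M p'\<rbrakk> \<Longrightarrow> bimodule_iso R S L L' \<noteq> {}"
    and lift: "\<And>M. M \<in> Y \<Longrightarrow> \<exists>L \<in> U. \<exists>p. truncation_map R I S J (N L) L M p"
  shows "induces_bijection (\<lambda>L. quot_bimodule L (N L)) R S U (R Quot I) (S Quot J) Y"
proof -
  let ?iso = "bimodule_iso (R Quot I) (S Quot J)" and ?T = "\<lambda>L. quot_bimodule L (N L)"
  have first_iso: "?iso (?T L) M \<noteq> {}"
    if "L \<in> U" "M \<in> Y" "truncation_map R I S J (N L) L M p" for L M p
    using bimodule_quotient.Q_iso[OF q[OF that(1)] Y[OF that(2)], of p] that(3)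
    by (auto simp: truncation_map_def)
  \<comment> \<open>An isomorphism from the coset model yields a truncation map by composition with
    the projection.\<close>
  have conv: "\<exists>p. truncation_map R I S J (N L) L M p"
    if L: "L \<in> U" and M: "M \<in> Y" and f: "f \<in> ?iso (?T L) M" for L M f
  proof -
    interpret bimodule_quotient R S L I J "N L" by (rule q[OF L])
    interpret M: bimodule "R Quot I" "S Quot J" M by (rule Y[OF M])
    have fh: "f \<in> bimodule_hom (R Quot I) (S Quot J) (?T L) M"
      and im: "f ` carrier (?T L) = carrier M" and inj: "inj_on f (carrier (?T L))"
      using f by (auto simp: bimodule_iso_iff bij_betw_def)
    have z: "f \<zero>\<^bsub>?T L\<^esub> = \<zero>\<^bsub>M\<^esub>" by (rule bimodule_hom_zero[OF Q_bimodule M.bimodule_axioms fh])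
    have "truncation_map R I S J (N L) L M (\<lambda>x. f (N L +>\<^bsub>L\<^esub> x))"
      unfolding truncation_map_def
    proof (intro conjI ballI)
      show "(\<lambda>x. f (N L +>\<^bsub>L\<^esub> x)) \<in> bimodule_hom R S L (pullback R I S J M)"
        by (rule bimodule_hom_comp[OF Q_hom]) (simp add: pullback_hom fh)
      show "(\<lambda>x. f (N L +>\<^bsub>L\<^esub> x)) ` carrier L = carrier M"
        using im unfolding Q_carrier by (simp add: image_image)
      fix x assume x: "x \<in> carrier L"
      have "f (N L +>\<^bsub>L\<^esub> x) = \<zero>\<^bsub>M\<^esub> \<longleftrightarrow> N L +>\<^bsub>L\<^esub> x = \<zero>\<^bsub>?T L\<^esub>"
        unfolding z[symmetric] using x by (intro inj_on_eq_iff[OF inj]) (auto simp: Q_carrier Q_zero)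
      then show "f (N L +>\<^bsub>L\<^esub> x) = \<zero>\<^bsub>M\<^esub> \<longleftrightarrow> x \<in> N L" using Q_kernel[OF x] by simp
    qed
    then show ?thesis by blast
  qed
  have TB: "bimodule (R Quot I) (S Quot J) (?T L)" if "L \<in> U" for L
    by (rule bimodule_quotient.Q_bimodule[OF q[OF that]])
  have sym: "?iso M (?T L) \<noteq> {}" if "M \<in> Y" "?iso (?T L) M \<noteq> {}" "L \<in> U" for L M
    using that bimodule_iso_sym[OF TB] by blast
  show ?thesis
  proof (rule induces_bijectionI)
    fix L assume L: "L \<in> U"
    show "bimodule R S L" using q[OF L] by (simp add: bimodule_quotient_def)
    show "bimodule (R Quot I) (S Quot J) (?T L)" by (rule TB[OF L])
    show "\<exists>M \<in> Y. ?iso (?T L) M \<noteq> {}" using trunc[OF L] first_iso[OF L] by blast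
  next
    fix L L' assume L: "L \<in> U" and L': "L' \<in> U"
    \<comment> \<open>One \<open>M\<close> in \<open>Y\<close>, isomorphic to the quotient of
      \<open>L'\<close>, serves as common target for both lattices, as \<open>unique\<close>
      requires.\<close>
    obtain M p' where M: "M \<in> Y" and p': "truncation_map R I S J (N L') L' M p'" using trunc[OF L'] by blast
    note iso' = first_iso[OF L' M p']
    show "bimodule_iso R S L L' \<noteq> {} \<longleftrightarrow> ?iso (?T L) (?T L') \<noteq> {}"
    proof
      assume "bimodule_iso R S L L' \<noteq> {}"
      then obtain f where f: "f \<in> bimodule_iso R S L L'" by blast
      have fh: "f \<in> bimodule_hom R S L L'" and im: "f ` carrier L = carrier L'"
        using f by (auto simp: bimodule_iso_iff bij_betw_def)
      have "truncation_map R I S J (N L) L M (\<lambda>x. p' (f x))"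
        unfolding truncation_map_def
      proof (intro conjI ballI)
        show "(\<lambda>x. p' (f x)) \<in> bimodule_hom R S L (pullback R I S J M)"
          by (rule bimodule_hom_comp[OF fh]) (use p' in \<open>simp add: truncation_map_def\<close>)
        show "(\<lambda>x. p' (f x)) ` carrier L = carrier M"
          using p' unfolding truncation_map_def im[symmetric] by (simp add: image_image)
        fix x assume x: "x \<in> carrier L"
        show "p' (f x) = \<zero>\<^bsub>M\<^esub> \<longleftrightarrow> x \<in> N L"
          using p' bimodule_hom_closed[OF fh x] iso[OF L L' f x] by (simp add: truncation_map_def)
      qed
      then have "?iso (?T L) M \<noteq> {}" by (rule first_iso[OF L M])
      then show "?iso (?T L) (?T L') \<noteq> {}" using sym[OF M iso' L'] by (rule bimodule_iso_trans)
    next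
      assume "?iso (?T L) (?T L') \<noteq> {}"
      then have "?iso (?T L) M \<noteq> {}" using iso' by (rule bimodule_iso_trans)
      then obtain p where "truncation_map R I S J (N L) L M p" using conv[OF L M] by blast
      then show "bimodule_iso R S L L' \<noteq> {}" using unique[OF L L' M _ p'] by blast
    qed
  next
    fix M assume M: "M \<in> Y"
    show "bimodule (R Quot I) (S Quot J) M" by (rule Y[OF M])
    show "\<exists>L \<in> U. ?iso (?T L) M \<noteq> {}" using lift[OF M] first_iso[OF _ M] by blast
  qed
qed

section \<open>The two truncations\<close>

definition opposite_ring :: "('a, 'z) ring_scheme \<Rightarrow> ('a, 'z) ring_scheme"
  where "opposite_ring R = R\<lparr>monoid.mult := \<lambda>x y. y \<otimes>\<^bsub>R\<^esub> x\<rparr>"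

definition opposite :: "('a, 'c, 'm) bimodule \<Rightarrow> ('c, 'a, 'm) bimodule"
  where "opposite M = \<lparr>carrier = carrier M, monoid.mult = undefined, one = undefined,
    ring.zero = \<zero>\<^bsub>M\<^esub>, add = add M, smult = (\<lambda>s x. x \<odot>\<^sup>r\<^bsub>M\<^esub> s), rsmult = (\<lambda>x r. r \<odot>\<^bsub>M\<^esub> x)\<rparr>"

lemma opposite_ring_simps [simp]:
  "carrier (opposite_ring R) = carrier R" "\<zero>\<^bsub>opposite_ring R\<^esub> = \<zero>\<^bsub>R\<^esub>" "\<one>\<^bsub>opposite_ring R\<^esub> = \<one>\<^bsub>R\<^esub>"
  "add (opposite_ring R) = add R" "x \<otimes>\<^bsub>opposite_ring R\<^esub> y = y \<otimes>\<^bsub>R\<^esub> x"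
  "opposite_ring (opposite_ring R) = R"
  by (simp_all add: opposite_ring_def)

lemma opposite_ring_minus [simp]:
  "\<ominus>\<^bsub>opposite_ring R\<^esub> x = \<ominus>\<^bsub>R\<^esub> x" "x \<ominus>\<^bsub>opposite_ring R\<^esub> y = x \<ominus>\<^bsub>R\<^esub> y"
  by (simp_all add: a_minus_def a_inv_def)

lemma opposite_simps [simp]:
  "carrier (opposite M) = carrier M" "\<zero>\<^bsub>opposite M\<^esub> = \<zero>\<^bsub>M\<^esub>" "add (opposite M) = add M"
  "s \<odot>\<^bsub>opposite M\<^esub> x = x \<odot>\<^sup>r\<^bsub>M\<^esub> s" "x \<odot>\<^sup>r\<^bsub>opposite M\<^esub> r = r \<odot>\<^bsub>M\<^esub> x"
  by (simp_all add: opposite_def)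

lemma opposite_ring_is_ring: assumes "ring R" shows "ring (opposite_ring R)"
proof -
  interpret R: ring R by fact
  show ?thesis
    by (rule ringI)
      (auto intro!: abelian_groupI monoidI bexI[of _ "\<ominus>\<^bsub>R\<^esub> _"]
        simp: R.a_ac R.m_assoc R.l_distr R.r_distr R.l_neg R.r_neg)
qed

lemma opposite_bimodule: assumes "bimodule R S M" shows "bimodule (opposite_ring S) (opposite_ring R) (opposite M)"
proof -
  interpret M: bimodule R S M by fact
  have "abelian_group (opposite M)"
  proof (rule abelian_groupI)
    fix x assume x: "x \<in> carrier (opposite M)"
    then show "\<exists>y \<in> carrier (opposite M). y \<oplus>\<^bsub>opposite M\<^esub> x = \<zero>\<^bsub>opposite M\<^esub>"
      by (intro bexI[of _ "\<ominus>\<^bsub>M\<^esub> x"]) (simp_all add: M.l_neg)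
  qed (simp_all add: M.a_ac)
  then show ?thesis
    by (intro bimodule.intro bimodule_axioms.intro opposite_ring_is_ring M.R.ring_axioms M.S.ring_axioms)
      (simp_all add: M.smult_closed M.smult_l_distr M.smult_r_distr M.smult_assoc M.smult_one M.rsmult_closed
        M.rsmult_r_distr M.rsmult_l_distr M.rsmult_assoc M.rsmult_one M.smult_rsmult)
qed

lemma opposite_hom:
  "bimodule_hom (opposite_ring S) (opposite_ring R) (opposite L) (opposite M) = bimodule_hom R S L M"
  by (auto simp: bimodule_hom_def hom_def)

lemma opposite_iso:
  "bimodule_iso (opposite_ring S) (opposite_ring R) (opposite L) (opposite M) = bimodule_iso R S L M"
  unfolding set_eq_iff by (simp add: bimodule_iso_iff opposite_hom)

lemma opposite_fin_gen:
  assumes "fin_gen_bimodule R S M"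
  shows "fin_gen_bimodule (opposite_ring S) (opposite_ring R) (opposite M)"
proof -
  interpret M: bimodule R S M using assms by (simp add: fin_gen_bimodule_def)
  interpret O: bimodule "opposite_ring S" "opposite_ring R" "opposite M"
    by (rule opposite_bimodule[OF M.bimodule_axioms])
  have "sub_bimodule (opposite_ring S) (opposite_ring R) N (opposite M) \<longleftrightarrow> sub_bimodule R S N M" for N
    unfolding M.sub_bimodule_iff O.sub_bimodule_iff M.right_submodule_def O.right_submodule_def by auto
  then show ?thesis using assms O.bimodule_axioms by (simp add: fin_gen_bimodule_def)
qed

lemma opposite_agreeing: "agreeing_actions A id id (opposite M) \<longleftrightarrow> agreeing_actions A id id M"
  by (auto simp: agreeing_actions_def)

context quat_order
begin

text \<open>\<open>A\<close> is central and \<open>C\<close> commutative, so reversing products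
  leaves most axioms unchanged. The decomposition \<open>a + b P\<close> becomes
  \<open>a + P \<sigma>(b)\<close>, and the commutation rule is applied with the inverse of
  \<open>\<sigma>\<close>, which is \<open>\<sigma>\<close>.\<close>

lemma opposite_quat_order: "quat_order (opposite_ring R) C A \<pi> P \<theta> \<eta> \<sigma>"
proof -
  interpret O: ring "opposite_ring R" by (rule opposite_ring_is_ring[OF R.ring_axioms])
  have pow: "\<pi> [^]\<^bsub>opposite_ring R\<^esub> n = \<pi> [^] n" for n :: nat
    by (induction n) (simp_all add: A_central[OF \<pi>_A])
  have pow_central: "\<pi> [^] n \<otimes> r = r \<otimes> \<pi> [^] n" if "r \<in> carrier R" for r and n :: nat
  proof (induction n)
    case (Suc n)
    have "\<pi> [^] Suc n \<otimes> r = \<pi> [^] n \<otimes> (\<pi> \<otimes> r)" using that by (simp add: R.m_assoc)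
    also have "\<dots> = (\<pi> [^] n \<otimes> r) \<otimes> \<pi>" using that A_central[OF \<pi>_A that] by (simp add: R.m_assoc)
    finally show ?case unfolding Suc using that by (simp add: R.m_assoc)
  qed (use that in simp)
  show ?thesis
  proof (intro quat_order.intro quat_order_axioms.intro O.ring_axioms)
    show "subring C (opposite_ring R)"
      by (rule O.subringI) (auto simp: C_ops)
    show "\<exists>a \<in> C. \<exists>b \<in> C. r = a \<oplus>\<^bsub>opposite_ring R\<^esub> b \<otimes>\<^bsub>opposite_ring R\<^esub> P"
      if "r \<in> carrier (opposite_ring R)" for r
    proof (rule bexI[of _ "comp0 r"], rule bexI[of _ "\<sigma> (comp1 r)"])
      show "r = comp0 r \<oplus>\<^bsub>opposite_ring R\<^esub> \<sigma> (comp1 r) \<otimes>\<^bsub>opposite_ring R\<^esub> P"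
        using comps[of r] that C_P[of "comp1 r"] by simp
    qed (use that in \<open>auto intro: comps \<sigma>_closed\<close>)
    show "a = \<zero>\<^bsub>opposite_ring R\<^esub> \<and> b = \<zero>\<^bsub>opposite_ring R\<^esub>"
      if "a \<in> C" "b \<in> C" "a \<oplus>\<^bsub>opposite_ring R\<^esub> b \<otimes>\<^bsub>opposite_ring R\<^esub> P = \<zero>\<^bsub>opposite_ring R\<^esub>" for a b
      using decomp_unique[of a "\<sigma> b"] that \<sigma>_closed P_comm[of b] \<sigma>_\<sigma>[of b] \<sigma>_zero by auto
    show "r = \<zero>\<^bsub>opposite_ring R\<^esub>"
      if "r \<in> carrier (opposite_ring R)" "\<And>n::nat. \<exists>s \<in> carrier (opposite_ring R).
        r = s \<otimes>\<^bsub>opposite_ring R\<^esub> \<pi> [^]\<^bsub>opposite_ring R\<^esub> n" for r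
      using separated[of r] that by (simp add: pow pow_central)
    show "r = \<zero>\<^bsub>opposite_ring R\<^esub>"
      if "a \<in> A" "a \<noteq> \<zero>\<^bsub>opposite_ring R\<^esub>" "r \<in> carrier (opposite_ring R)"
        "a \<otimes>\<^bsub>opposite_ring R\<^esub> r = \<zero>\<^bsub>opposite_ring R\<^esub>" for a r
      using torsion_free[of a r] that A_central[of a r] by simp
    show "\<exists>s \<in> A. \<exists>t \<in> A. c = s \<oplus>\<^bsub>opposite_ring R\<^esub> t \<otimes>\<^bsub>opposite_ring R\<^esub> \<theta>" if "c \<in> C" for c
      using C_gen[OF that] A_central \<theta>_C by force
    show "(\<exists>b \<in> C. c \<otimes>\<^bsub>opposite_ring R\<^esub> b = \<one>\<^bsub>opposite_ring R\<^esub>)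
        \<or> (\<exists>b \<in> C. c = \<pi> \<otimes>\<^bsub>opposite_ring R\<^esub> b)" if "c \<in> C" for c
      using C_local[OF that] C_comm[OF that] C_comm[OF \<pi>_C] by force
    show "\<exists>D. finite D \<and> D \<subseteq> C \<and> (\<forall>c \<in> C. \<exists>d \<in> D. \<exists>b \<in> C.
        c = d \<oplus>\<^bsub>opposite_ring R\<^esub> \<pi> \<otimes>\<^bsub>opposite_ring R\<^esub> b)"
      using residue_finite C_comm[OF \<pi>_C] by simp
    show "(\<sigma> \<theta> \<ominus>\<^bsub>opposite_ring R\<^esub> \<theta>) \<otimes>\<^bsub>opposite_ring R\<^esub> \<eta> = \<one>\<^bsub>opposite_ring R\<^esub>"
      using \<eta>_inv C_comm[of "\<sigma> \<theta> \<ominus> \<theta>" \<eta>] \<theta>_C \<eta>_C by (simp add: C_ops \<sigma>_closed)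
    show "\<theta> \<otimes>\<^bsub>opposite_ring R\<^esub> \<sigma> \<theta> \<in> A"
      using norm_A C_comm[OF \<theta>_C \<sigma>_closed[OF \<theta>_C]] by simp
    show "\<pi> \<otimes>\<^bsub>opposite_ring R\<^esub> b \<noteq> \<one>\<^bsub>opposite_ring R\<^esub>" if "b \<in> C" for b
      using \<pi>_nonunit[OF that] C_comm[OF \<pi>_C that] by simp
    show "a \<otimes>\<^bsub>opposite_ring R\<^esub> r = r \<otimes>\<^bsub>opposite_ring R\<^esub> a"
      if "a \<in> A" "r \<in> carrier (opposite_ring R)" for a r
      using A_central[of a r] that by simp
    show "a \<otimes>\<^bsub>opposite_ring R\<^esub> b = b \<otimes>\<^bsub>opposite_ring R\<^esub> a" if "a \<in> C" "b \<in> C" for a b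
      using C_comm[OF that] by simp
    show "\<sigma> (a \<otimes>\<^bsub>opposite_ring R\<^esub> b) = \<sigma> a \<otimes>\<^bsub>opposite_ring R\<^esub> \<sigma> b" if "a \<in> C" "b \<in> C" for a b
      using \<sigma>_mult[OF that(2,1)] by simp
  qed (use A_subset P_square \<sigma>_closed \<sigma>_add \<sigma>_\<sigma> \<sigma>_A C_P \<pi>_A \<pi>_nonzero \<theta>_C
      \<eta>_C trace_A in \<open>simp_all add: P_comm\<close>)
qed

lemma opposite_lattice:
  assumes L: "lattice L" shows "quat_order.lattice (opposite_ring R) A (opposite L)"
proof -
  interpret O: quat_order "opposite_ring R" C A \<pi> P \<theta> \<eta> \<sigma> by (rule opposite_quat_order)
  have "x = \<zero>\<^bsub>L\<^esub>" if "a \<in> A - {\<zero>}" "x \<in> carrier L" "x \<odot>\<^sup>r\<^bsub>L\<^esub> a = \<zero>\<^bsub>L\<^esub>" for a x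
    using L that by (auto simp: lattice_def agreeing_actions_def)
  then show ?thesis using L
    by (auto simp: O.lattice_def lattice_def opposite_agreeing intro: opposite_fin_gen)
qed

text \<open>As in \<open>residue_bimodules\<close>, but agreement is tested on elements of
  \<open>A\<close> instead of their cosets modulo \<open>\<pi>\<close>.\<close>

definition coset_bimodules :: "'a set \<Rightarrow> 'a set \<Rightarrow> ('a set, 'a set, 'm) bimodule set"
  where "coset_bimodules I J = {M. fin_gen_bimodule (R Quot I) (R Quot J) M
    \<and> agreeing_actions A (\<lambda>a. I +> a) (\<lambda>a. J +> a) M}"

lemma coset_bimodules_iff:
  assumes I: "ideal I R" and J: "ideal J R"
  shows "M \<in> coset_bimodules I J \<longleftrightarrow> bimodule (R Quot I) (R Quot J) M
    \<and> fin_gen_bimodule R R (pullback R I R J M) \<and> agreeing_actions A id id (pullback R I R J M)"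
proof -
  have "agreeing_actions A id id (pullback R I R J M) \<longleftrightarrow> agreeing_actions A (\<lambda>a. I +> a) (\<lambda>a. J +> a) M"
    by (simp add: agreeing_actions_def)
  then show ?thesis
    using pullback_fin_gen[OF I J, of M] unfolding coset_bimodules_def
    by (auto simp: fin_gen_bimodule_def[of "R Quot I"])
qed

lemma quotient_pullback:
  assumes q: "bimodule_quotient R R L I J N" and L: "lattice L"
    and M: "bimodule (R Quot I) (R Quot J) M" and p: "truncation_map R I R J N L M p"
  shows "M \<in> coset_bimodules I J"
proof -
  interpret bimodule_quotient R R L I J N by fact
  have pb: "bimodule R R (pullback R I R J M)"
    by (rule pullback_bimodule[OF I.ideal_axioms J.ideal_axioms M])
  have p': "p \<in> bimodule_hom R R L (pullback R I R J M)" "p ` carrier L = carrier (pullback R I R J M)"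
    using p by (auto simp: truncation_map_def)
  have "fin_gen_bimodule R R L" "agreeing_actions A id id L" using L by (auto simp: lattice_def)
  then show ?thesis
    unfolding coset_bimodules_iff[OF I.ideal_axioms J.ideal_axioms]
    using M fin_gen_surj[OF _ pb p'] agreeing_surj[OF _ p', of A] A_closed by blast
qed

text \<open>A finite quotient can be copied into every infinite type.\<close>

lemma truncation_exists:
  assumes q: "bimodule_quotient R R L I J N" and L: "lattice L"
    and fin: "finite (carrier (quot_bimodule L N))" and inf: "infinite (UNIV :: 'n set)"
  shows "\<exists>M \<in> coset_bimodules I J :: ('a set, 'a set, 'n) bimodule set. \<exists>p. truncation_map R I R J N L M p"
proof -
  interpret bimodule_quotient R R L I J N by fact
  obtain g :: "_ \<Rightarrow> 'n" where g: "inj_on g (carrier Q)"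
    using infinite_arbitrarily_large[OF inf, of "card (carrier Q)"] fin
      finite_same_card_bij[of "carrier Q"] by (metis bij_betw_imp_inj_on)
  note t = transport[OF Q_bimodule g]
  let ?M = "transport g Q"
  have gh: "g \<in> bimodule_hom (R Quot I) (R Quot J) Q ?M" and im: "g ` carrier Q = carrier ?M"
    using t(1) by (auto simp: bimodule_iso_iff bij_betw_def)
  have z: "g \<zero>\<^bsub>Q\<^esub> = \<zero>\<^bsub>?M\<^esub>" by (rule bimodule_hom_zero[OF Q_bimodule t(2) gh])
  have "truncation_map R I R J N L ?M (\<lambda>x. g (N +>\<^bsub>L\<^esub> x))"
    unfolding truncation_map_def
  proof (intro conjI ballI)
    show "(\<lambda>x. g (N +>\<^bsub>L\<^esub> x)) \<in> bimodule_hom R R L (pullback R I R J ?M)"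
      by (rule bimodule_hom_comp[OF Q_hom]) (simp add: pullback_hom gh)
    show "(\<lambda>x. g (N +>\<^bsub>L\<^esub> x)) ` carrier L = carrier ?M"
      unfolding im[symmetric] Q_carrier by (simp add: image_image)
    fix x assume x: "x \<in> carrier L"
    have "g (N +>\<^bsub>L\<^esub> x) = \<zero>\<^bsub>?M\<^esub> \<longleftrightarrow> N +>\<^bsub>L\<^esub> x = \<zero>\<^bsub>Q\<^esub>"
      unfolding z[symmetric] using x by (intro inj_on_eq_iff[OF g]) (auto simp: Q_carrier Q_zero)
    then show "g (N +>\<^bsub>L\<^esub> x) = \<zero>\<^bsub>?M\<^esub> \<longleftrightarrow> x \<in> N" using Q_kernel[OF x] by simp
  qed
  with quotient_pullback[OF q L t(2) this] show ?thesis by blast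
qed

section \<open>The right truncation\<close>

context
  fixes I J
  assumes I: "ideal I R" and J: "ideal J R"
    and I_\<pi>: "I = (\<lambda>r. \<pi> \<otimes> r) ` carrier R" and J_P: "J = (\<lambda>r. r \<otimes> P) ` carrier R"
begin

lemma P_in_J: "P \<in> J"
  unfolding J_P by (rule image_eqI[of _ _ \<one>]) simp_all

text \<open>\<open>L P\<close> is stable under right scalars because \<open>P R\<close> lies in
  \<open>R P\<close>, and it contains \<open>\<pi> L\<close> because left \<open>\<pi>\<close> acts
  as right \<open>P P\<close>.\<close>

lemma right_quotient:
  assumes L: "lattice L"
  shows "bimodule_quotient R R L I J ((\<lambda>x. x \<odot>\<^sup>r\<^bsub>L\<^esub> P) ` carrier L)" (is "bimodule_quotient R R L I J ?N")
proof -
  interpret L: quat_bimodule R C A \<pi> P \<theta> \<eta> \<sigma> L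
    using L by (intro qbimoduleI) (auto simp: lattice_def fin_gen_bimodule_def)
  have sub: "L.M.right_submodule ?N"
    unfolding L.M.right_submodule_def
  proof (intro conjI ballI)
    show "\<zero>\<^bsub>L\<^esub> \<in> ?N" by (rule image_eqI[of _ _ "\<zero>\<^bsub>L\<^esub>"]) (simp_all add: L.M.zero_rsmult)
  next
    fix x y assume "x \<in> ?N" "y \<in> ?N"
    then obtain u v where "u \<in> carrier L" "v \<in> carrier L" "x = u \<odot>\<^sup>r\<^bsub>L\<^esub> P" "y = v \<odot>\<^sup>r\<^bsub>L\<^esub> P" by blast
    then show "x \<oplus>\<^bsub>L\<^esub> y \<in> ?N"
      by (intro image_eqI[of _ _ "u \<oplus>\<^bsub>L\<^esub> v"]) (simp_all add: L.M.rsmult_l_distr)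
  next
    fix x s assume "x \<in> ?N" and s: "s \<in> carrier R"
    then obtain u where u: "u \<in> carrier L" "x = u \<odot>\<^sup>r\<^bsub>L\<^esub> P" by blast
    obtain t where t: "t \<in> carrier R" "P \<otimes> s = t \<otimes> P" using P_swap_left[OF s] by blast
    then show "x \<odot>\<^sup>r\<^bsub>L\<^esub> s \<in> ?N"
      using u s t by (intro image_eqI[of _ _ "u \<odot>\<^sup>r\<^bsub>L\<^esub> t"])
        (simp_all add: L.M.rsmult_closed L.M.rsmult_assoc[symmetric])
  qed (auto intro: L.M.rsmult_closed)
  have N: "sub_bimodule R R ?N L"
    using sub by (auto simp: L.M.sub_bimodule_iff L.M.smult_rsmult[symmetric] L.M.smult_closed)
  show ?thesis
  proof (intro bimodule_quotient.intro bimodule_quotient_axioms.intro L.M.bimodule_axioms I J N)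
    fix r x assume r: "r \<in> I" and x: "x \<in> carrier L"
    then obtain s where s: "s \<in> carrier R" "r = \<pi> \<otimes> s" unfolding I_\<pi> by blast
    have sx: "s \<odot>\<^bsub>L\<^esub> x \<in> carrier L" using s x by (simp add: L.M.smult_closed)
    have "r \<odot>\<^bsub>L\<^esub> x = s \<odot>\<^bsub>L\<^esub> x \<odot>\<^sup>r\<^bsub>L\<^esub> P \<odot>\<^sup>r\<^bsub>L\<^esub> P"
      using s x L.agree[OF \<pi>_A sx] sx by (simp add: L.M.smult_assoc L.M.rsmult_assoc[symmetric] P_square)
    then show "r \<odot>\<^bsub>L\<^esub> x \<in> ?N" using L.M.rsmult_closed[OF P_closed sx] by blast
  next
    fix s x assume s: "s \<in> J" and x: "x \<in> carrier L"
    then obtain t where t: "t \<in> carrier R" "s = t \<otimes> P" unfolding J_P by blast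
    then have "x \<odot>\<^sup>r\<^bsub>L\<^esub> s = x \<odot>\<^sup>r\<^bsub>L\<^esub> t \<odot>\<^sup>r\<^bsub>L\<^esub> P" using x by (simp add: L.M.rsmult_assoc)
    then show "x \<odot>\<^sup>r\<^bsub>L\<^esub> s \<in> ?N" using L.M.rsmult_closed[OF t(1) x] by blast
  qed
qed

lemma right_residual:
  assumes "M \<in> coset_bimodules I J"
  shows "residual (pullback R I R J M)"
proof -
  have M: "bimodule (R Quot I) (R Quot J) M" "fin_gen_bimodule R R (pullback R I R J M)"
    "agreeing_actions A id id (pullback R I R J M)"
    using assms by (auto simp: coset_bimodules_iff[OF I J])
  interpret M: bimodule "R Quot I" "R Quot J" M by fact
  interpret J: ideal J R by (rule J)
  have "J +> P = \<zero>\<^bsub>R Quot J\<^esub>" using J.a_rcos_const[OF P_in_J] by (simp add: FactRing_def)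
  then show ?thesis using M by (auto simp: residual_def M.rsmult_zero)
qed

lemma right_truncation_map:
  "truncation_map R I R J ((\<lambda>x. x \<odot>\<^sup>r\<^bsub>L\<^esub> P) ` carrier L) L M p \<longleftrightarrow> right_trunc p L (pullback R I R J M)"
  by (auto simp: truncation_map_def right_trunc_def)

theorem right_bijection:
  fixes f :: "'a \<Rightarrow> 'm"
  assumes f: "inj_on f (carrier R)" and inf: "infinite (UNIV :: 'n set)"
  shows "induces_bijection (\<lambda>L. quot_bimodule L ((\<lambda>x. x \<odot>\<^sup>r\<^bsub>L\<^esub> P) ` carrier L)) R R
    {L :: ('a, 'a, 'm) bimodule. lattice L} (R Quot I) (R Quot J)
    (coset_bimodules I J :: ('a set, 'a set, 'n) bimodule set)"
proof (rule truncation_bijection)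
  show "bimodule_quotient R R L I J ((\<lambda>x. x \<odot>\<^sup>r\<^bsub>L\<^esub> P) ` carrier L)" if "L \<in> {L. lattice L}" for L
    using right_quotient that by simp
next
  show "bimodule (R Quot I) (R Quot J) M" if "M \<in> coset_bimodules I J" for M
    using that by (simp add: coset_bimodules_iff[OF I J])
next
  fix L L' :: "('a, 'a, 'm) bimodule" and g x
  assume L: "L \<in> {L. lattice L}" and g: "g \<in> bimodule_iso R R L L'" and x: "x \<in> carrier L"
  interpret L: bimodule R R L using L by (simp add: lattice_def fin_gen_bimodule_def)
  have h: "g \<in> bimodule_hom R R L L'" and im: "g ` carrier L = carrier L'" and inj: "inj_on g (carrier L)"
    using g by (auto simp: bimodule_iso_iff bij_betw_def)
  have "g x \<in> (\<lambda>x. x \<odot>\<^sup>r\<^bsub>L'\<^esub> P) ` carrier L' \<longleftrightarrow> (\<exists>y \<in> carrier L. g x = g (y \<odot>\<^sup>r\<^bsub>L\<^esub> P))"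
    unfolding im[symmetric] using bimodule_hom_rsmult[OF h _ P_closed] by (auto simp: image_iff)
  also have "\<dots> \<longleftrightarrow> x \<in> (\<lambda>x. x \<odot>\<^sup>r\<^bsub>L\<^esub> P) ` carrier L"
    using inj_on_eq_iff[OF inj x L.rsmult_closed[OF P_closed]] by auto
  finally show "g x \<in> (\<lambda>x. x \<odot>\<^sup>r\<^bsub>L'\<^esub> P) ` carrier L' \<longleftrightarrow> x \<in> (\<lambda>x. x \<odot>\<^sup>r\<^bsub>L\<^esub> P) ` carrier L" .
next
  fix L :: "('a, 'a, 'm) bimodule" assume "L \<in> {L. lattice L}"
  then have L: "lattice L" by simp
  let ?N = "(\<lambda>x. x \<odot>\<^sup>r\<^bsub>L\<^esub> P) ` carrier L"
  interpret bimodule_quotient R R L I J ?N by (rule right_quotient[OF L])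
  \<comment> \<open>The quotient is first recognized as a residue bimodule over its own carrier
    type; this makes it finite, so that it can be copied into the prescribed type.\<close>
  have "truncation_map R I R J ?N L Q (\<lambda>x. ?N +>\<^bsub>L\<^esub> x)"
    unfolding truncation_map_def using Q_hom Q_kernel Q_carrier by simp
  then have "Q \<in> coset_bimodules I J"
    by (rule quotient_pullback[OF right_quotient[OF L] L Q_bimodule])
  then have "finite (carrier Q)" using residual_finite[OF right_residual] by simp
  then show "\<exists>M \<in> coset_bimodules I J :: ('a set, 'a set, 'n) bimodule set. \<exists>p. truncation_map R I R J ?N L M p"
    by (rule truncation_exists[OF right_quotient[OF L] L _ inf])
next
  fix L L' :: "('a, 'a, 'm) bimodule" and M :: "('a set, 'a set, 'n) bimodule" and p p'
  assume "L \<in> {L. lattice L}" "L' \<in> {L. lattice L}" and M: "M \<in> coset_bimodules I J"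
    and "truncation_map R I R J ((\<lambda>x. x \<odot>\<^sup>r\<^bsub>L\<^esub> P) ` carrier L) L M p"
    "truncation_map R I R J ((\<lambda>x. x \<odot>\<^sup>r\<^bsub>L'\<^esub> P) ` carrier L') L' M p'"
  then show "bimodule_iso R R L L' \<noteq> {}"
    unfolding right_truncation_map by (intro lattice_unique[OF _ _ right_residual[OF M]]) simp_all
next
  fix M :: "('a set, 'a set, 'n) bimodule" assume M: "M \<in> coset_bimodules I J"
  obtain L :: "('a, 'a, 'm) bimodule" and p where "lattice L" "right_trunc p L (pullback R I R J M)"
    by (rule lattice_exists[OF right_residual[OF M] f])
  then show "\<exists>L \<in> {L :: ('a, 'a, 'm) bimodule. lattice L}.
      \<exists>p. truncation_map R I R J ((\<lambda>x. x \<odot>\<^sup>r\<^bsub>L\<^esub> P) ` carrier L) L M p"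
    unfolding right_truncation_map by blast
qed

end

end

lemma opposite_ideal: assumes "ideal I R" shows "ideal I (opposite_ring R)"
proof -
  interpret I: ideal I R by fact
  have "subgroup I (add_monoid (opposite_ring R))" using I.a_subgroup by simp
  then show ?thesis
    by (intro idealI opposite_ring_is_ring I.ring_axioms) (auto intro: I.I_l_closed I.I_r_closed)
qed

lemma opposite_quotient:
  assumes q: "bimodule_quotient (opposite_ring S) (opposite_ring R) (opposite L) J I N"
    and L: "bimodule R S L" and I: "ideal I R" and J: "ideal J S"
  shows "bimodule_quotient R S L I J N"
proof -
  interpret q: bimodule_quotient "opposite_ring S" "opposite_ring R" "opposite L" J I N by fact
  interpret L: bimodule R S L by fact
  have "sub_bimodule R S N L"
    using q.N unfolding L.sub_bimodule_iff q.L.sub_bimodule_iff L.right_submodule_def q.L.right_submodule_def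
    by auto
  then show ?thesis
    using q.I_N q.J_N
    by (intro bimodule_quotient.intro bimodule_quotient_axioms.intro L I J) auto
qed

section \<open>The left truncation, through the opposite ring\<close>

context quat_order
begin

context
  fixes I J
  assumes I: "ideal I R" and J: "ideal J R"
    and I_\<pi>: "I = (\<lambda>r. \<pi> \<otimes> r) ` carrier R" and J_P: "J = (\<lambda>r. P \<otimes> r) ` carrier R"
begin

interpretation O: quat_order "opposite_ring R" C A \<pi> P \<theta> \<eta> \<sigma>
  by (rule opposite_quat_order)

lemma opposite_ideals: "ideal I (opposite_ring R)" "ideal J (opposite_ring R)"
  "I = (\<lambda>r. \<pi> \<otimes>\<^bsub>opposite_ring R\<^esub> r) ` carrier (opposite_ring R)"
  "J = (\<lambda>r. r \<otimes>\<^bsub>opposite_ring R\<^esub> P) ` carrier (opposite_ring R)"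
proof -
  have "(\<lambda>r. \<pi> \<otimes> r) ` carrier R = (\<lambda>r. r \<otimes> \<pi>) ` carrier R"
    by (intro image_cong refl A_central[OF \<pi>_A])
  with I_\<pi> show "I = (\<lambda>r. \<pi> \<otimes>\<^bsub>opposite_ring R\<^esub> r) ` carrier (opposite_ring R)"
    unfolding opposite_ring_simps by (rule trans)
  show "J = (\<lambda>r. r \<otimes>\<^bsub>opposite_ring R\<^esub> P) ` carrier (opposite_ring R)"
    unfolding opposite_ring_simps by (rule J_P)
qed (rule opposite_ideal[OF I], rule opposite_ideal[OF J])

lemma left_quotient:
  assumes L: "lattice L"
  shows "bimodule_quotient R R L J I ((\<lambda>x. P \<odot>\<^bsub>L\<^esub> x) ` carrier L)"
proof -
  have "bimodule R R L" using L by (simp add: lattice_def fin_gen_bimodule_def)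
  then show ?thesis
    by (intro opposite_quotient[OF _ _ J I]
        O.right_quotient[OF opposite_ideals opposite_lattice[OF L], unfolded opposite_simps])
qed

lemma left_residual:
  assumes "M \<in> coset_bimodules J I"
  shows "O.residual (opposite (pullback R J R I M))"
proof -
  have M: "bimodule (R Quot J) (R Quot I) M" "fin_gen_bimodule R R (pullback R J R I M)"
    "agreeing_actions A id id (pullback R J R I M)"
    using assms by (auto simp: coset_bimodules_iff[OF J I])
  interpret M: bimodule "R Quot J" "R Quot I" M by fact
  interpret J: ideal J R by (rule J)
  have "P \<in> J" unfolding J_P by (rule image_eqI[of _ _ \<one>]) simp_all
  then have "J +> P = \<zero>\<^bsub>R Quot J\<^esub>" using J.a_rcos_const by (simp add: FactRing_def)
  then show ?thesis
    using opposite_fin_gen[OF M(2)] M by (auto simp: O.residual_def M.zero_smult opposite_agreeing)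
qed

lemma left_truncation_map:
  "truncation_map R J R I ((\<lambda>x. P \<odot>\<^bsub>L\<^esub> x) ` carrier L) L M p
    \<longleftrightarrow> O.right_trunc p (opposite L) (opposite (pullback R J R I M))"
  by (auto simp: truncation_map_def O.right_trunc_def opposite_hom)

text \<open>Uniqueness, finiteness and existence are the right-hand results over the opposite ring,
  applied to opposite bimodules; isomorphisms are the same maps on both sides.\<close>

theorem left_bijection:
  fixes f :: "'a \<Rightarrow> 'm"
  assumes f: "inj_on f (carrier R)" and inf: "infinite (UNIV :: 'n set)"
  shows "induces_bijection (\<lambda>L. quot_bimodule L ((\<lambda>x. P \<odot>\<^bsub>L\<^esub> x) ` carrier L)) R R
    {L :: ('a, 'a, 'm) bimodule. lattice L} (R Quot J) (R Quot I)
    (coset_bimodules J I :: ('a set, 'a set, 'n) bimodule set)"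
proof (rule truncation_bijection)
  show "bimodule_quotient R R L J I ((\<lambda>x. P \<odot>\<^bsub>L\<^esub> x) ` carrier L)" if "L \<in> {L. lattice L}" for L
    using left_quotient that by simp
next
  show "bimodule (R Quot J) (R Quot I) M" if "M \<in> coset_bimodules J I" for M
    using that by (simp add: coset_bimodules_iff[OF J I])
next
  fix L L' :: "('a, 'a, 'm) bimodule" and g x
  assume L: "L \<in> {L. lattice L}" and g: "g \<in> bimodule_iso R R L L'" and x: "x \<in> carrier L"
  interpret L: bimodule R R L using L by (simp add: lattice_def fin_gen_bimodule_def)
  have h: "g \<in> bimodule_hom R R L L'" and im: "g ` carrier L = carrier L'" and inj: "inj_on g (carrier L)"
    using g by (auto simp: bimodule_iso_iff bij_betw_def)
  have "g x \<in> (\<lambda>x. P \<odot>\<^bsub>L'\<^esub> x) ` carrier L' \<longleftrightarrow> (\<exists>y \<in> carrier L. g x = g (P \<odot>\<^bsub>L\<^esub> y))"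
    unfolding im[symmetric] using bimodule_hom_smult[OF h _ P_closed] by (auto simp: image_iff)
  also have "\<dots> \<longleftrightarrow> x \<in> (\<lambda>x. P \<odot>\<^bsub>L\<^esub> x) ` carrier L"
    using inj_on_eq_iff[OF inj x L.smult_closed[OF P_closed]] by auto
  finally show "g x \<in> (\<lambda>x. P \<odot>\<^bsub>L'\<^esub> x) ` carrier L' \<longleftrightarrow> x \<in> (\<lambda>x. P \<odot>\<^bsub>L\<^esub> x) ` carrier L" .
next
  fix L :: "('a, 'a, 'm) bimodule" assume "L \<in> {L. lattice L}"
  then have L: "lattice L" by simp
  let ?N = "(\<lambda>x. P \<odot>\<^bsub>L\<^esub> x) ` carrier L"
  interpret bimodule_quotient R R L J I ?N by (rule left_quotient[OF L])
  have "truncation_map R J R I ?N L Q (\<lambda>x. ?N +>\<^bsub>L\<^esub> x)"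
    unfolding truncation_map_def using Q_hom Q_kernel Q_carrier by simp
  then have "Q \<in> coset_bimodules J I"
    by (rule quotient_pullback[OF left_quotient[OF L] L Q_bimodule])
  then have "finite (carrier Q)" using O.residual_finite[OF left_residual] by simp
  then show "\<exists>M \<in> coset_bimodules J I :: ('a set, 'a set, 'n) bimodule set. \<exists>p. truncation_map R J R I ?N L M p"
    by (rule truncation_exists[OF left_quotient[OF L] L _ inf])
next
  fix L L' :: "('a, 'a, 'm) bimodule" and M :: "('a set, 'a set, 'n) bimodule" and p p'
  assume "L \<in> {L. lattice L}" "L' \<in> {L. lattice L}" and M: "M \<in> coset_bimodules J I"
    and t: "truncation_map R J R I ((\<lambda>x. P \<odot>\<^bsub>L\<^esub> x) ` carrier L) L M p"
      "truncation_map R J R I ((\<lambda>x. P \<odot>\<^bsub>L'\<^esub> x) ` carrier L') L' M p'"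
  then have "lattice L" "lattice L'" by simp_all
  then show "bimodule_iso R R L L' \<noteq> {}"
    using O.lattice_unique[OF opposite_lattice opposite_lattice left_residual[OF M]] t
    unfolding left_truncation_map opposite_iso by blast
next
  fix M :: "('a set, 'a set, 'n) bimodule" assume M: "M \<in> coset_bimodules J I"
  have f': "inj_on f (carrier (opposite_ring R))" using f by simp
  obtain L :: "('a, 'a, 'm) bimodule" and p where L: "O.lattice L"
    and p: "O.right_trunc p L (opposite (pullback R J R I M))"
    by (rule O.lattice_exists[OF left_residual[OF M] f'])
  \<comment> \<open>The lattice found lives over the opposite ring; its opposite lives over
    \<open>R\<close>, as taking opposites twice changes nothing.\<close>
  have "lattice (opposite L)" using O.opposite_lattice[OF L] by simp
  moreover have "truncation_map R J R I ((\<lambda>x. P \<odot>\<^bsub>opposite L\<^esub> x) ` carrier (opposite L)) (opposite L) M p"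
    using p by (auto simp: truncation_map_def O.right_trunc_def bimodule_hom_def hom_def)
  ultimately show "\<exists>L \<in> {L :: ('a, 'a, 'm) bimodule. lattice L}.
      \<exists>p. truncation_map R J R I ((\<lambda>x. P \<odot>\<^bsub>L\<^esub> x) ` carrier L) L M p"
    by blast
qed

end

end

section \<open>The maximal order of a quaternion division algebra\<close>

text \<open>Negation in the restricted structure is an inverse taken there; uniqueness of inverses
  identifies it with the ambient one.\<close>

lemma (in ring) subring_minus:
  assumes H: "subring H R" and x: "x \<in> H"
  shows "\<ominus>\<^bsub>R\<lparr>carrier := H\<rparr>\<^esub> x = \<ominus> x"
proof -
  interpret H: ring "R\<lparr>carrier := H\<rparr>" by (rule subring_is_ring[OF H])
  have xR: "x \<in> carrier R" using subringE(1)[OF H] x by auto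
  have "(\<ominus> x) \<oplus>\<^bsub>R\<lparr>carrier := H\<rparr>\<^esub> x = \<zero>\<^bsub>R\<lparr>carrier := H\<rparr>\<^esub>" using xR by (simp add: l_neg)
  then show ?thesis using H.minus_equality[of "\<ominus> x" x] x subringE(5)[OF H x] by simp
qed

lemma (in ring) subring_nat_pow: "x [^]\<^bsub>R\<lparr>carrier := H\<rparr>\<^esub> (n::nat) = x [^] n"
  by (simp add: nat_pow_def)

locale quat_setting = quaternion_division_algebra B F for B :: "'b ring" (structure) and F +
  fixes OF OB K OK :: "'b set" and v :: "'b \<Rightarrow> int" and \<sigma> :: "'b \<Rightarrow> 'b" and \<pi> P :: 'b
  assumes F_local: "nonarch_local_field (B\<lparr>carrier := F\<rparr>) v"
    and OF_def: "OF = valuation_ring (B\<lparr>carrier := F\<rparr>) v"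
    and OB_maximal: "maximal_order B F OF OB"
    and K_unramified: "unramified_quadratic_extension B F v K"
    and OK_def: "OK = integral_closure B OF K"
    and \<sigma>_iso: "\<sigma> \<in> ring_iso (B\<lparr>carrier := K\<rparr>) (B\<lparr>carrier := K\<rparr>)"
    and \<sigma>_F: "\<forall>a \<in> F. \<sigma> a = a" and \<sigma>_nontrivial: "\<exists>a \<in> K. \<sigma> a \<noteq> a"
    and \<pi>_F: "\<pi> \<in> F - {\<zero>}" and v_\<pi>: "v \<pi> = 1"
    and P_OB: "P \<in> OB" and OB_bij: "bij_betw (\<lambda>(a, b). a \<oplus> b \<otimes> P) (OK \<times> OK) OB"
    and P_sq: "P \<otimes> P = \<pi>" and P_conj: "\<forall>a \<in> OK. P \<otimes> a = \<sigma> a \<otimes> P"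
begin

section \<open>The centre F and its valuation\<close>

sublocale FF: nonarch_local_field "B\<lparr>carrier := F\<rparr>" v
  by (rule F_local)

lemma F_sub: "subring F B" "F \<subseteq> carrier B"
  using subfieldE[OF subfield] by auto

lemma F_closed [simp]: "x \<in> F \<Longrightarrow> x \<in> carrier B"
  using F_sub by auto

lemma F_ops: "\<zero> \<in> F" "\<one> \<in> F" "x \<in> F \<Longrightarrow> \<ominus> x \<in> F" "\<lbrakk>x \<in> F; y \<in> F\<rbrakk> \<Longrightarrow> x \<oplus> y \<in> F"
  "\<lbrakk>x \<in> F; y \<in> F\<rbrakk> \<Longrightarrow> x \<otimes> y \<in> F" "x \<in> F \<Longrightarrow> x \<noteq> \<zero> \<Longrightarrow> inv x \<in> F"
  "x \<in> F \<Longrightarrow> x \<noteq> \<zero> \<Longrightarrow> x \<otimes> inv x = \<one>"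
  using subringE[OF F_sub(1)] subfield_m_inv[OF subfield, of x] by auto

lemma central: "\<lbrakk>x \<in> F; y \<in> carrier B\<rbrakk> \<Longrightarrow> x \<otimes> y = y \<otimes> x"
  using centre by blast

lemma no_zero_div:
  assumes "x \<in> carrier B" "y \<in> carrier B" "x \<otimes> y = \<zero>" shows "x = \<zero> \<or> y = \<zero>"
proof (rule ccontr)
  assume n: "\<not> ?thesis"
  then have "x \<in> Units B" using assms division by auto
  then have "inv x \<otimes> (x \<otimes> y) = y" using assms(1,2) m_assoc[of "inv x" x y] by simp
  then show False using n assms \<open>x \<in> Units B\<close> by simp
qed

lemma one_nonzero: "\<one> \<noteq> \<zero>"
  using subfieldE(6)[OF subfield] .

lemma v_mul: "\<lbrakk>x \<in> F; x \<noteq> \<zero>; y \<in> F; y \<noteq> \<zero>\<rbrakk> \<Longrightarrow> v (x \<otimes> y) = v x + v y"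
  using FF.v_mult[of x y] by simp

lemma v_plus: "\<lbrakk>x \<in> F; x \<noteq> \<zero>; y \<in> F; y \<noteq> \<zero>; x \<oplus> y \<noteq> \<zero>\<rbrakk> \<Longrightarrow> min (v x) (v y) \<le> v (x \<oplus> y)"
  using FF.v_add[of x y] by simp

lemma v_one: "v \<one> = 0"
  using v_mul[of \<one> \<one>] F_ops one_nonzero by simp

lemma v_inv: assumes "x \<in> F" "x \<noteq> \<zero>" shows "v (inv x) = - v x" "inv x \<noteq> \<zero>"
proof -
  show n: "inv x \<noteq> \<zero>" using F_ops(7)[OF assms] assms one_nonzero by auto
  have "v \<one> = v x + v (inv x)" using v_mul[OF assms F_ops(6)[OF assms] n] F_ops(7)[OF assms] by simp
  then show "v (inv x) = - v x" using v_one by simp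
qed

text \<open>\<open>(-1)^2 = 1\<close> gives \<open>2 v(-1) = 0\<close>.\<close>

lemma v_neg: assumes "x \<in> F" "x \<noteq> \<zero>" shows "v (\<ominus> x) = v x"
proof -
  have m: "\<ominus> \<one> \<in> F" "\<ominus> \<one> \<noteq> \<zero>" using F_ops one_nonzero by auto
  have "v (\<ominus> \<one> \<otimes> \<ominus> \<one>) = 0" using v_one by (simp add: l_minus r_minus)
  then have "v (\<ominus> \<one>) = 0" using v_mul[OF m m] by simp
  moreover have "\<ominus> x = \<ominus> \<one> \<otimes> x" using assms by (simp add: l_minus)
  ultimately show ?thesis using v_mul[OF m assms] by simp
qed

lemma v_pow: assumes "x \<in> F" "x \<noteq> \<zero>"
  shows "x [^] (n::nat) \<in> F \<and> x [^] n \<noteq> \<zero> \<and> v (x [^] n) = int n * v x"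
proof (induction n)
  case 0 then show ?case using F_ops one_nonzero v_one by simp
next
  case (Suc n)
  then show ?case
    using assms F_ops(5) no_zero_div[of "x [^] n" x] v_mul[of "x [^] n" x] by (auto simp: algebra_simps)
qed

lemma OF_iff: "x \<in> OF \<longleftrightarrow> x \<in> F \<and> (x = \<zero> \<or> 0 \<le> v x)"
  by (auto simp: OF_def valuation_ring_def)

lemma OF_F: "x \<in> OF \<Longrightarrow> x \<in> F"
  by (simp add: OF_iff)

lemma OF_closed [simp]: "x \<in> OF \<Longrightarrow> x \<in> carrier B"
  by (simp add: OF_iff)

lemma OF_ops: "\<zero> \<in> OF" "\<one> \<in> OF" "x \<in> OF \<Longrightarrow> \<ominus> x \<in> OF" "\<lbrakk>x \<in> OF; y \<in> OF\<rbrakk> \<Longrightarrow> x \<otimes> y \<in> OF"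
  "\<lbrakk>x \<in> OF; y \<in> OF\<rbrakk> \<Longrightarrow> x \<oplus> y \<in> OF"
proof -
  show "\<zero> \<in> OF" "\<one> \<in> OF" using F_ops v_one by (auto simp: OF_iff)
  show "x \<in> OF \<Longrightarrow> \<ominus> x \<in> OF" using F_ops(3) v_neg by (cases "x = \<zero>") (auto simp: OF_iff)
  show "x \<otimes> y \<in> OF" if "x \<in> OF" "y \<in> OF"
    using that F_ops(5) v_mul[of x y] by (cases "x = \<zero> \<or> y = \<zero>") (auto simp: OF_iff)
  show "x \<oplus> y \<in> OF" if "x \<in> OF" "y \<in> OF"
    using that F_ops(4) v_plus[of x y] by (cases "x = \<zero> \<or> y = \<zero>") (auto simp: OF_iff)
qed

lemma \<pi>_facts: "\<pi> \<in> F" "\<pi> \<noteq> \<zero>" "\<pi> \<in> OF" "\<pi> \<in> carrier B"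
  using \<pi>_F v_\<pi> by (auto simp: OF_iff)

lemma OF_divide:
  assumes "x \<in> F" "x = \<zero> \<or> 1 \<le> v x" obtains y where "y \<in> OF" "x = \<pi> \<otimes> y"
proof
  show "inv \<pi> \<otimes> x \<in> OF"
    using assms F_ops(5,6) \<pi>_facts v_inv[OF \<pi>_facts(1,2)] v_mul[of "inv \<pi>" x] v_\<pi>
    by (cases "x = \<zero>") (auto simp: OF_iff)
  show "x = \<pi> \<otimes> (inv \<pi> \<otimes> x)"
    using assms \<pi>_facts F_ops(6,7)[OF \<pi>_facts(1,2)] by (simp flip: m_assoc)
qed

lemma OF_inv: assumes "x \<in> OF" "x \<noteq> \<zero>" "v x = 0" shows "inv x \<in> OF" "x \<otimes> inv x = \<one>"
  using assms F_ops(6,7) v_inv[of x] by (auto simp: OF_iff)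

lemma OF_unit_or:
  assumes "x \<in> OF" shows "(x \<noteq> \<zero> \<and> v x = 0) \<or> (\<exists>y \<in> OF. x = \<pi> \<otimes> y)"
proof (cases "x = \<zero> \<or> 1 \<le> v x")
  case True
  then show ?thesis using OF_divide[of x] assms OF_F by blast
next
  case False
  then show ?thesis using assms by (auto simp: OF_iff)
qed

section \<open>The ring of integers of K\<close>

lemma K_sub: "subfield K B" "F \<subseteq> K"
  using K_unramified by (auto simp: unramified_quadratic_extension_def)

lemma K_closed [simp]: "x \<in> K \<Longrightarrow> x \<in> carrier B"
  using subfieldE(3)[OF K_sub(1)] by auto

lemma K_comm: "\<lbrakk>x \<in> K; y \<in> K\<rbrakk> \<Longrightarrow> x \<otimes> y = y \<otimes> x"
  using subfieldE(4)[OF K_sub(1)] .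

lemma K_ops: "\<zero> \<in> K" "\<one> \<in> K" "x \<in> K \<Longrightarrow> \<ominus> x \<in> K" "\<lbrakk>x \<in> K; y \<in> K\<rbrakk> \<Longrightarrow> x \<oplus> y \<in> K"
  "\<lbrakk>x \<in> K; y \<in> K\<rbrakk> \<Longrightarrow> x \<otimes> y \<in> K"
  using subringE[OF subfieldE(1)[OF K_sub(1)]] by auto

lemma OK_K: "x \<in> OK \<Longrightarrow> x \<in> K"
  by (simp add: OK_def integral_closure_def)

lemma OK_closed [simp]: "x \<in> OK \<Longrightarrow> x \<in> carrier B"
  by (simp add: OK_K)

lemma OF_OK: assumes x: "x \<in> OF" shows "x \<in> OK"
proof -
  \<comment> \<open>Coefficient lists begin with the leading coefficient: this is the monic
    polynomial \<open>X - x\<close>.\<close>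
  have "eval [\<one>, \<ominus> x] x = \<zero>" using x by (simp add: r_neg)
  then show ?thesis
    using x K_sub(2) OF_F OF_ops(2) OF_ops(3)[OF x] unfolding OK_def integral_closure_def
    by (intro CollectI conjI exI[of _ "[\<one>, \<ominus> x]"]) auto
qed

text \<open>The definition of unramified provides some uniformizer \<open>\<pi>0\<close>, which
  differs from \<open>\<pi>\<close> by a unit of O_F. That O_K is a ring is read off from the locale
  \<open>maximalideal\<close>, whose ambient structure is a ring.\<close>

lemma OK_maximal: "maximalideal (\<pi> <# OK) (B\<lparr>carrier := OK\<rparr>)" and OK_subring: "subring OK B"
proof -
  obtain \<pi>0 where \<pi>0: "\<pi>0 \<in> F" "\<pi>0 \<noteq> \<zero>" "v \<pi>0 = 1"
    and max: "maximalideal (\<pi>0 <# OK) (B\<lparr>carrier := OK\<rparr>)"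
    using K_unramified unfolding unramified_quadratic_extension_def OK_def OF_def Let_def by blast
  interpret max: maximalideal "\<pi>0 <# OK" "B\<lparr>carrier := OK\<rparr>" by (rule max)
  have "OK \<subseteq> carrier B" by auto
  then show sub: "subring OK B" using subring_iff[of OK] max.ring_axioms by simp
  obtain u where u: "u \<in> OF" "\<pi>0 = \<pi> \<otimes> u" using OF_divide[OF \<pi>0(1)] \<pi>0(3) by auto
  have uF: "u \<in> F" "u \<noteq> \<zero>" using u \<pi>0(2) \<pi>_facts by (auto simp: OF_iff)
  have "v u = 0" using v_mul[OF \<pi>_facts(1,2) uF] u(2) \<pi>0(3) v_\<pi> by simp
  then have ui: "inv u \<in> OF" "u \<otimes> inv u = \<one>" using OF_inv[OF u(1) uF(2)] by auto
  have "\<pi> <# OK = \<pi>0 <# OK"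
  proof
    show "\<pi>0 <# OK \<subseteq> \<pi> <# OK"
    proof
      fix x assume "x \<in> \<pi>0 <# OK"
      then obtain y where y: "y \<in> OK" "x = \<pi>0 \<otimes> y" by (auto simp: l_coset_def)
      then have "x = \<pi> \<otimes> (u \<otimes> y)" using u \<pi>_facts by (simp add: m_assoc)
      then show "x \<in> \<pi> <# OK" using subringE(6)[OF sub OF_OK[OF u(1)] y(1)] by (auto simp: l_coset_def)
    qed
    show "\<pi> <# OK \<subseteq> \<pi>0 <# OK"
    proof
      fix x assume "x \<in> \<pi> <# OK"
      then obtain y where y: "y \<in> OK" "x = \<pi> \<otimes> y" by (auto simp: l_coset_def)
      have "\<pi>0 \<otimes> (inv u \<otimes> y) = \<pi> \<otimes> (u \<otimes> inv u) \<otimes> y"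
        using u ui(1) \<pi>_facts y(1) by (simp add: m_assoc)
      then have "x = \<pi>0 \<otimes> (inv u \<otimes> y)" using ui(2) y \<pi>_facts by simp
      then show "x \<in> \<pi>0 <# OK" using subringE(6)[OF sub OF_OK[OF ui(1)] y(1)] by (auto simp: l_coset_def)
    qed
  qed
  then show "maximalideal (\<pi> <# OK) (B\<lparr>carrier := OK\<rparr>)" using max by simp
qed

lemma OK_ops: "\<zero> \<in> OK" "\<one> \<in> OK" "x \<in> OK \<Longrightarrow> \<ominus> x \<in> OK" "\<lbrakk>x \<in> OK; y \<in> OK\<rbrakk> \<Longrightarrow> x \<oplus> y \<in> OK"
  "\<lbrakk>x \<in> OK; y \<in> OK\<rbrakk> \<Longrightarrow> x \<otimes> y \<in> OK" "\<lbrakk>x \<in> OK; y \<in> OK\<rbrakk> \<Longrightarrow> x \<ominus> y \<in> OK"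
  using subringE[OF OK_subring] by (auto simp: a_minus_def)

lemma OK_comm: "\<lbrakk>x \<in> OK; y \<in> OK\<rbrakk> \<Longrightarrow> x \<otimes> y = y \<otimes> x"
  using K_comm OK_K by auto

text \<open>Since \<open>v x\<close> is negative, the power in front of the leading coefficient, of
  exponent \<open>length p - 1\<close>, gives the smallest lower bound among all terms.\<close>

lemma eval_valuation:
  assumes x: "x \<in> F" "x \<noteq> \<zero>" "v x < 0" and p: "set p \<subseteq> OF" "p \<noteq> []"
  shows "eval p x \<in> F \<and> (eval p x = \<zero> \<or> (int (length p) - 1) * v x \<le> v (eval p x))"
  using p
proof (induction p)
  case (Cons a p)
  note xn = v_pow[OF x(1,2)]
  have a: "a \<in> OF" using Cons.prems by simp
  have e: "eval (a # p) x = a \<otimes> x [^] length p \<oplus> eval p x" by simp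
  let ?m = "a \<otimes> x [^] length p"
  have m: "?m \<in> F" "?m = \<zero> \<or> int (length p) * v x \<le> v ?m"
    using a xn[of "length p"] F_ops(5) OF_F v_mul[of a "x [^] length p"]
    by (cases "a = \<zero>"; auto simp: OF_iff)+
  show ?case
  proof (cases "p = []")
    case True
    then show ?thesis using m e by simp
  next
    case False
    then have IH: "eval p x \<in> F" "eval p x = \<zero> \<or> (int (length p) - 1) * v x \<le> v (eval p x)"
      using Cons by auto
    have "int (length p) * v x \<le> (int (length p) - 1) * v x" using x(3) by (simp add: algebra_simps)
    then have IH': "eval p x = \<zero> \<or> int (length p) * v x \<le> v (eval p x)" using IH(2) by linarith
    show ?thesis
      unfolding e using m IH(1) IH' F_ops(4)[OF m(1) IH(1)] v_plus[OF m(1) _ IH(1)]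
      by (cases "?m = \<zero> \<or> eval p x = \<zero> \<or> ?m \<oplus> eval p x = \<zero>") auto
  qed
qed simp

text \<open>O_F is integrally closed: in \<open>x^n + q(x) = 0\<close> with \<open>v x < 0\<close>,
  the valuation of \<open>q(x)\<close> would be at least \<open>(n-1) v x\<close>, which exceeds
  \<open>n v x\<close>.\<close>

lemma F_OK: assumes "x \<in> F" "x \<in> OK" shows "x \<in> OF"
proof (rule ccontr)
  assume n: "x \<notin> OF"
  then have x: "x \<in> F" "x \<noteq> \<zero>" "v x < 0" using assms by (auto simp: OF_iff)
  obtain p where p: "p \<noteq> []" "set p \<subseteq> OF" "hd p = \<one>" "eval p x = \<zero>"
    using assms(2) by (auto simp: OK_def integral_closure_def)
  obtain q where q: "p = \<one> # q" using p by (cases p) auto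
  note xn = v_pow[OF x(1,2)]
  let ?n = "length q"
  have e: "x [^] ?n \<oplus> eval q x = \<zero>" using p(4) q xn[of ?n] by simp
  show False
  proof (cases "q = []")
    case True
    then show ?thesis using e one_nonzero by simp
  next
    case False
    have ev: "eval q x \<in> F" "eval q x = \<zero> \<or> (int ?n - 1) * v x \<le> v (eval q x)"
      using eval_valuation[OF x _ False] p(2) q by auto
    have xq: "x [^] ?n = \<ominus> eval q x" using minus_equality[OF e] xn[of ?n] ev(1) by simp
    then have nz: "eval q x \<noteq> \<zero>" using xn[of ?n] by auto
    then have "int ?n * v x = v (eval q x)" using xq v_neg[OF ev(1)] xn[of ?n] by simp
    then have "(int ?n - 1) * v x \<le> int ?n * v x" using ev(2) nz by simp
    then show ?thesis using x(3) by (simp add: algebra_simps)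
  qed
qed

section \<open>Conjugation and norm on O_K\<close>

lemma \<sigma>_hom:
  "a \<in> K \<Longrightarrow> \<sigma> a \<in> K" "\<lbrakk>a \<in> K; b \<in> K\<rbrakk> \<Longrightarrow> \<sigma> (a \<oplus> b) = \<sigma> a \<oplus> \<sigma> b"
  "\<lbrakk>a \<in> K; b \<in> K\<rbrakk> \<Longrightarrow> \<sigma> (a \<otimes> b) = \<sigma> a \<otimes> \<sigma> b"
  using \<sigma>_iso by (auto simp: ring_iso_def ring_hom_def)

text \<open>\<open>\<sigma>\<close> fixes the coefficients of an integral equation.\<close>

lemma \<sigma>_OK: assumes a: "a \<in> OK" shows "\<sigma> a \<in> OK"
proof -
  obtain p where p: "p \<noteq> []" "set p \<subseteq> OF" "hd p = \<one>" "eval p a = \<zero>" and aK: "a \<in> K"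
    using a by (auto simp: OK_def integral_closure_def)
  have pow: "a [^] n \<in> K \<and> \<sigma> (a [^] n) = \<sigma> a [^] n" for n :: nat
  proof (induction n)
    case 0 then show ?case using K_ops(2) \<sigma>_F F_ops(2) by simp
  next
    case (Suc n) then show ?case using \<sigma>_hom aK K_ops(5) by simp
  qed
  have "eval q a \<in> K \<and> \<sigma> (eval q a) = eval q (\<sigma> a)" if "set q \<subseteq> OF" for q
    using that
  proof (induction q)
    case Nil then show ?case using K_ops(1) \<sigma>_F F_ops(1) by simp
  next
    case (Cons c q)
    then have c: "c \<in> K" "\<sigma> c = c" using OF_F K_sub(2) \<sigma>_F by auto
    then show ?case using Cons \<sigma>_hom pow[of "length q"] K_ops(4,5) by simp
  qed
  from this[OF p(2)] have "eval p (\<sigma> a) = \<zero>" using p(4) \<sigma>_F F_ops(1) by simp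
  then show ?thesis using p \<sigma>_hom(1)[OF aK] by (auto simp: OK_def integral_closure_def)
qed

lemma \<sigma>_minus: assumes "x \<in> OK" shows "\<sigma> (\<ominus> x) = \<ominus> \<sigma> x"
proof -
  have "\<sigma> (\<ominus> x) \<oplus> \<sigma> x = \<zero>"
    using \<sigma>_hom(2)[of "\<ominus> x" x] assms OK_ops(3) OK_K \<sigma>_F F_ops(1) by (simp add: l_neg)
  then show ?thesis
    using minus_equality[of "\<sigma> (\<ominus> x)" "\<sigma> x"] assms OK_ops(3) \<sigma>_OK by simp
qed

lemma \<sigma>_diff: "\<lbrakk>x \<in> OK; y \<in> OK\<rbrakk> \<Longrightarrow> \<sigma> (x \<ominus> y) = \<sigma> x \<ominus> \<sigma> y"
  using \<sigma>_hom(2)[of x "\<ominus> y"] \<sigma>_minus OK_ops(3) OK_K by (simp add: a_minus_def)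

lemma P_closed: "P \<in> carrier B" and OB_subring: "subring OB B"
proof -
  show "subring OB B" using OB_maximal by (simp add: maximal_order_def is_order_def)
  then show "P \<in> carrier B" using P_OB subringE(1) by blast
qed

lemma OB_closed [simp]: "x \<in> OB \<Longrightarrow> x \<in> carrier B"
  using subringE(1)[OF OB_subring] by blast

lemma OB_decomp: "r \<in> OB \<longleftrightarrow> (\<exists>a \<in> OK. \<exists>b \<in> OK. r = a \<oplus> b \<otimes> P)"
  using bij_betw_imp_surj_on[OF OB_bij] by (auto simp: image_def)

lemma OB_unique:
  assumes "a \<in> OK" "b \<in> OK" "a' \<in> OK" "b' \<in> OK" "a \<oplus> b \<otimes> P = a' \<oplus> b' \<otimes> P"
  shows "a = a' \<and> b = b'"
  using inj_onD[OF bij_betw_imp_inj_on[OF OB_bij], of "(a, b)" "(a', b')"] assms by auto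

lemma OK_OB: assumes "a \<in> OK" shows "a \<in> OB"
proof -
  have "a = a \<oplus> \<zero> \<otimes> P" using assms P_closed by simp
  then show ?thesis unfolding OB_decomp using assms OK_ops(1) by blast
qed

lemma cancel_right:
  assumes "x \<in> carrier B" "y \<in> carrier B" "z \<in> carrier B" "z \<noteq> \<zero>" "x \<otimes> z = y \<otimes> z" shows "x = y"
proof -
  have "(x \<ominus> y) \<otimes> z = \<zero>" using assms(1-3,5) by (simp add: a_minus_def l_distr l_minus r_neg)
  then have "x \<ominus> y = \<zero>" using no_zero_div[of "x \<ominus> y" z] assms by simp
  then show ?thesis using assms by simp
qed

text \<open>Conjugating twice by \<open>P\<close> is conjugation by the central element
  \<open>\<pi>\<close>, so the square of \<open>\<sigma>\<close> is trivial on O_K.\<close>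

lemma \<sigma>_\<sigma>_OK: assumes a: "a \<in> OK" shows "\<sigma> (\<sigma> a) = a"
proof -
  have s: "\<sigma> a \<in> OK" "\<sigma> (\<sigma> a) \<in> OK" using a \<sigma>_OK by auto
  have "\<sigma> (\<sigma> a) \<otimes> \<pi> = (\<sigma> (\<sigma> a) \<otimes> P) \<otimes> P" using s P_closed P_sq by (simp add: m_assoc)
  also have "\<sigma> (\<sigma> a) \<otimes> P = P \<otimes> \<sigma> a" using P_conj s(1) by simp
  also have "P \<otimes> \<sigma> a \<otimes> P = P \<otimes> (\<sigma> a \<otimes> P)" using s(1) P_closed by (simp add: m_assoc)
  also have "\<sigma> a \<otimes> P = P \<otimes> a" using P_conj a by simp
  also have "P \<otimes> (P \<otimes> a) = \<pi> \<otimes> a" using P_closed a by (simp add: P_sq flip: m_assoc)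
  also have "\<dots> = a \<otimes> \<pi>" by (rule central[OF \<pi>_facts(1) OK_closed[OF a]])
  finally show ?thesis using cancel_right[of "\<sigma> (\<sigma> a)" a \<pi>] s a \<pi>_facts by simp
qed

text \<open>The order spans \<open>B\<close> over the centre \<open>F\<close>, so commuting with it
  means being central.\<close>

lemma centralizer:
  assumes z: "z \<in> carrier B" and OB: "\<And>x. x \<in> OB \<Longrightarrow> z \<otimes> x = x \<otimes> z" shows "z \<in> F"
proof -
  obtain us where us: "set us \<subseteq> OB" "Span F us = carrier B"
    using OB_maximal by (auto simp: maximal_order_def is_order_def)
  have "x \<in> carrier B \<and> z \<otimes> x = x \<otimes> z" if "x \<in> Span F us" for x
    using us(1) that
  proof (induction us arbitrary: x)
    case Nil then show ?case using z by simp
  next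
    case (Cons u us)
    then obtain k w where kw: "k \<in> F" "w \<in> Span F us" "x = k \<otimes> u \<oplus> w"
      by (auto simp: line_extension_mem_iff)
    have w: "w \<in> carrier B" "z \<otimes> w = w \<otimes> z" using Cons kw(2) by auto
    have u: "u \<in> carrier B" "z \<otimes> u = u \<otimes> z" using Cons.prems(1) OB by auto
    have "z \<otimes> (k \<otimes> u) = k \<otimes> (z \<otimes> u)" using z kw(1) u(1) central[of k z] by (simp flip: m_assoc)
    also have "\<dots> = k \<otimes> u \<otimes> z" using z kw(1) u by (simp add: m_assoc)
    finally show ?case using kw w u z by (simp add: l_distr r_distr)
  qed
  then show ?thesis using centre z us(2) by blast
qed

text \<open>A fixed \<open>z\<close> commutes with O_K and with \<open>P\<close>, hence with O_B. So
  it lies in \<open>F\<close>, and integrality puts it into O_F.\<close>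

lemma fixed_OF:
  assumes z: "z \<in> OK" "\<sigma> z = z" shows "z \<in> OF"
proof -
  have "z \<otimes> x = x \<otimes> z" if x: "x \<in> OB" for x
  proof -
    obtain a b where ab: "a \<in> OK" "b \<in> OK" "x = a \<oplus> b \<otimes> P" using x unfolding OB_decomp by blast
    have "z \<otimes> (b \<otimes> P) = b \<otimes> (z \<otimes> P)" using z ab P_closed OK_comm[of z b] by (simp flip: m_assoc)
    also have "z \<otimes> P = P \<otimes> z" using P_conj z by simp
    finally show ?thesis using ab z P_closed OK_comm[of z a] by (simp add: l_distr r_distr m_assoc)
  qed
  then show ?thesis using F_OK centralizer[of z] z by simp
qed

lemma OK_prime:
  assumes "a \<in> OK" "b \<in> OK" "c \<in> OK" "a \<otimes> b = \<pi> \<otimes> c"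
  shows "(\<exists>d \<in> OK. a = \<pi> \<otimes> d) \<or> (\<exists>d \<in> OK. b = \<pi> \<otimes> d)"
proof -
  interpret max: maximalideal "\<pi> <# OK" "B\<lparr>carrier := OK\<rparr>" by (rule OK_maximal)
  have "cring (B\<lparr>carrier := OK\<rparr>)"
    by (rule cring.intro[OF max.ring_axioms], rule max.monoid_comm_monoidI) (simp add: OK_comm)
  then interpret prime: primeideal "\<pi> <# OK" "B\<lparr>carrier := OK\<rparr>"
    by (rule cring.maximalideal_prime[OF _ OK_maximal])
  have "a \<otimes> b \<in> \<pi> <# OK" using assms by (auto simp: l_coset_def)
  then show ?thesis using prime.I_prime[of a b] assms by (auto simp: l_coset_def)
qed

lemma \<pi>_nonunit_OK: "b \<in> OK \<Longrightarrow> \<pi> \<otimes> b \<noteq> \<one>"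
proof
  assume b: "b \<in> OK" "\<pi> \<otimes> b = \<one>"
  have ip: "inv \<pi> \<in> F" "inv \<pi> \<otimes> \<pi> = \<one>"
    using F_ops(6,7)[OF \<pi>_facts(1,2)] central[OF \<pi>_facts(1)] by auto
  have "inv \<pi> \<otimes> (\<pi> \<otimes> b) = b" using ip b(1) \<pi>_facts by (simp flip: m_assoc)
  then have "b = inv \<pi>" using b ip by simp
  then have "inv \<pi> \<in> OF" using F_OK ip(1) b(1) by simp
  then show False using v_inv[OF \<pi>_facts(1,2)] v_\<pi> by (simp add: OF_iff)
qed

lemma OK_norm: assumes c: "c \<in> OK" shows "c \<otimes> \<sigma> c \<in> OF" "c \<oplus> \<sigma> c \<in> OF"
proof -
  have s: "\<sigma> c \<in> OK" "\<sigma> (\<sigma> c) = c" using c \<sigma>_OK \<sigma>_\<sigma>_OK by auto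
  have "\<sigma> (c \<otimes> \<sigma> c) = c \<otimes> \<sigma> c" using s c \<sigma>_hom(3) OK_K OK_comm by simp
  then show "c \<otimes> \<sigma> c \<in> OF" using fixed_OF OK_ops(5) c s by simp
  have "\<sigma> (c \<oplus> \<sigma> c) = c \<oplus> \<sigma> c" using s c \<sigma>_hom(2) OK_K a_comm by simp
  then show "c \<oplus> \<sigma> c \<in> OF" using fixed_OF OK_ops(4) c s by simp
qed

text \<open>Decided by the norm in O_F. An invertible norm inverts \<open>c\<close>; a norm
  divisible by \<open>\<pi>\<close> makes \<open>\<pi>\<close> divide \<open>c\<close> or
  \<open>\<sigma> c\<close>, and the second case is conjugate to the first.\<close>

lemma OK_unit_or:
  assumes c: "c \<in> OK" shows "(\<exists>b \<in> OK. c \<otimes> b = \<one>) \<or> (\<exists>b \<in> OK. c = \<pi> \<otimes> b)"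
  using OF_unit_or[OF OK_norm(1)[OF c]]
proof
  assume n: "c \<otimes> \<sigma> c \<noteq> \<zero> \<and> v (c \<otimes> \<sigma> c) = 0"
  note i = OF_inv[OF OK_norm(1)[OF c]]
  have "c \<otimes> (\<sigma> c \<otimes> inv (c \<otimes> \<sigma> c)) = \<one>"
    using i n c \<sigma>_OK[OF c] by (simp add: m_assoc)
  then show ?thesis using i(1) n \<sigma>_OK[OF c] OK_ops(5) OF_OK by blast
next
  assume "\<exists>y \<in> OF. c \<otimes> \<sigma> c = \<pi> \<otimes> y"
  then obtain y where y: "y \<in> OK" "c \<otimes> \<sigma> c = \<pi> \<otimes> y" using OF_OK by blast
  from OK_prime[OF c \<sigma>_OK[OF c] y] show ?thesis
  proof
    assume "\<exists>d \<in> OK. \<sigma> c = \<pi> \<otimes> d"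
    then obtain d where d: "d \<in> OK" "\<sigma> c = \<pi> \<otimes> d" by blast
    have "c = \<sigma> (\<pi> \<otimes> d)" using d(2) \<sigma>_\<sigma>_OK[OF c] by simp
    also have "\<dots> = \<pi> \<otimes> \<sigma> d" using \<sigma>_hom(3)[of \<pi> d] d(1) OK_K \<pi>_facts K_sub(2) \<sigma>_F by auto
    finally show ?thesis using \<sigma>_OK[OF d(1)] by blast
  qed blast
qed

text \<open>If \<open>\<pi>^n\<close> divides \<open>s\<close>, it divides \<open>\<sigma> s\<close>
  too, so the norm of \<open>s\<close> has valuation at least \<open>n\<close>; for nonzero
  \<open>s\<close> the norm is nonzero and its valuation finite.\<close>

lemma OK_separated:
  assumes s: "s \<in> OK" and d: "\<And>n::nat. \<exists>d \<in> OK. s = \<pi> [^] n \<otimes> d" shows "s = \<zero>"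
proof (rule ccontr)
  assume nz: "s \<noteq> \<zero>"
  have pw: "\<pi> [^] n \<in> F \<and> \<pi> [^] n \<noteq> \<zero> \<and> v (\<pi> [^] n) = int n" for n :: nat
    using v_pow[OF \<pi>_facts(1,2), of n] v_\<pi> by simp
  have "s \<otimes> \<sigma> s \<noteq> \<zero>"
  proof
    assume "s \<otimes> \<sigma> s = \<zero>"
    then have "\<sigma> s = \<zero>" using no_zero_div[of s "\<sigma> s"] nz s \<sigma>_OK by auto
    then show False using \<sigma>_\<sigma>_OK[OF s] \<sigma>_F F_ops(1) nz by simp
  qed
  have "int n \<le> v (s \<otimes> \<sigma> s)" for n :: nat
  proof -
    obtain d where d: "d \<in> OK" "s = \<pi> [^] n \<otimes> d" using d by blast
    have s2: "\<sigma> s = \<pi> [^] n \<otimes> \<sigma> d" using d \<sigma>_hom(3)[of "\<pi> [^] n" d] OK_K pw[of n] K_sub(2) \<sigma>_F by auto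
    have "s \<otimes> \<sigma> s = \<pi> [^] n \<otimes> (d \<otimes> (\<pi> [^] n \<otimes> \<sigma> d))"
      unfolding s2 using d pw[of n] \<sigma>_OK[OF d(1)] by (simp add: m_assoc)
    also have "d \<otimes> (\<pi> [^] n \<otimes> \<sigma> d) = \<pi> [^] n \<otimes> (d \<otimes> \<sigma> d)"
      using d(1) pw[of n] \<sigma>_OK[OF d(1)] central[of "\<pi> [^] n" d] by (simp flip: m_assoc)
    finally have e: "s \<otimes> \<sigma> s = \<pi> [^] n \<otimes> (\<pi> [^] n \<otimes> (d \<otimes> \<sigma> d))" .
    let ?N = "d \<otimes> \<sigma> d"
    have N: "?N \<in> F" "?N \<noteq> \<zero>" "0 \<le> v ?N"
      using OK_norm(1)[OF d(1)] e \<open>s \<otimes> \<sigma> s \<noteq> \<zero>\<close> pw[of n] by (auto simp: OF_iff)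
    have "v (s \<otimes> \<sigma> s) = int n + (int n + v ?N)"
      unfolding e using v_mul[of "\<pi> [^] n" "\<pi> [^] n \<otimes> ?N"] v_mul[of "\<pi> [^] n" ?N]
        pw[of n] N F_ops(5)[of "\<pi> [^] n" ?N] no_zero_div[of "\<pi> [^] n" ?N] by fastforce
    then show ?thesis using N(3) by simp
  qed
  from this[of "nat (v (s \<otimes> \<sigma> s)) + 1"] show False by (simp split: if_splits)
qed

end

text \<open>\<open>x (p r) = p (s r)\<close> as soon as \<open>x p = p s\<close>, so the right ideal
  generated by \<open>p\<close> is two-sided.\<close>

lemma (in ring) normal_element_ideal:
  assumes p: "p \<in> carrier R" and swap: "\<And>x. x \<in> carrier R \<Longrightarrow> \<exists>s \<in> carrier R. x \<otimes> p = p \<otimes> s"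
  shows "ideal ((\<lambda>r. p \<otimes> r) ` carrier R) R" (is "ideal ?J R")
proof (rule idealI[OF ring_axioms])
  show "subgroup ?J (add_monoid R)"
  proof (rule add.subgroupI)
    show "?J \<noteq> {}" using zero_closed by blast
    show "\<ominus> x \<in> ?J" if "x \<in> ?J" for x
    proof -
      from that obtain r where "r \<in> carrier R" "x = p \<otimes> r" by blast
      then show ?thesis using p by (intro image_eqI[of _ _ "\<ominus> r"]) (simp_all add: r_minus)
    qed
    show "x \<oplus> y \<in> ?J" if "x \<in> ?J" "y \<in> ?J" for x y
    proof -
      from that obtain r s where "r \<in> carrier R" "s \<in> carrier R" "x = p \<otimes> r" "y = p \<otimes> s" by blast
      then show ?thesis using p by (intro image_eqI[of _ _ "r \<oplus> s"]) (simp_all add: r_distr)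
    qed
  qed (use p in auto)
next
  fix a x assume "a \<in> ?J" and x: "x \<in> carrier R"
  then obtain r where r: "r \<in> carrier R" "a = p \<otimes> r" by blast
  then show "a \<otimes> x \<in> ?J" using x p by (intro image_eqI[of _ _ "r \<otimes> x"]) (simp_all add: m_assoc)
  obtain s where s: "s \<in> carrier R" "x \<otimes> p = p \<otimes> s" using swap[OF x] by blast
  have "x \<otimes> a = (x \<otimes> p) \<otimes> r" using r x p by (simp add: m_assoc)
  also have "\<dots> = p \<otimes> (s \<otimes> r)" unfolding s(2) using s(1) r(1) p by (simp add: m_assoc)
  finally show "x \<otimes> a \<in> ?J" using s r by blast
qed

context quat_order
begin

lemma P_image: "(\<lambda>r. P \<otimes> r) ` carrier R = (\<lambda>r. r \<otimes> P) ` carrier R"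
  using P_swap_left P_swap_right by (fastforce simp: image_iff)

lemma ideal_P: "ideal ((\<lambda>r. P \<otimes> r) ` carrier R) R"
  by (rule R.normal_element_ideal[OF P_closed P_swap_right])

lemma ideal_\<pi>: "ideal ((\<lambda>r. \<pi> \<otimes> r) ` carrier R) R"
  by (rule R.normal_element_ideal[OF \<pi>_closed]) (metis A_central \<pi>_A)

end

section \<open>Residues modulo pi, and a generator of O_K over O_F\<close>

context quat_setting
begin

text \<open>The residue field is a quotient by the valuation ideal, and elements of that ideal are
  multiples of \<open>\<pi>\<close>.\<close>

lemma OF_residues:
  obtains D where "finite D" "D \<subseteq> OF" "\<And>a. a \<in> OF \<Longrightarrow> \<exists>d \<in> D. \<exists>y \<in> OF. a = d \<oplus> \<pi> \<otimes> y"
proof -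
  let ?R = "B\<lparr>carrier := F, carrier := valuation_ring (B\<lparr>carrier := F\<rparr>) v\<rparr>"
  let ?m = "valuation_ideal (B\<lparr>carrier := F\<rparr>) v"
  have cR: "carrier ?R = OF" by (simp add: OF_def)
  have "finite ((\<lambda>r. ?m +>\<^bsub>?R\<^esub> r) ` OF)"
    using FF.finite_residue_field unfolding carrier_Quot by (simp add: OF_def)
  then obtain D where D: "D \<subseteq> OF" "finite D" "(\<lambda>r. ?m +>\<^bsub>?R\<^esub> r) ` OF = (\<lambda>r. ?m +>\<^bsub>?R\<^esub> r) ` D"
    using finite_subset_image[OF _ subset_refl] by metis
  have "\<exists>d \<in> D. \<exists>y \<in> OF. a = d \<oplus> \<pi> \<otimes> y" if a: "a \<in> OF" for a
  proof -
    have "?m +>\<^bsub>?R\<^esub> a \<in> (\<lambda>r. ?m +>\<^bsub>?R\<^esub> r) ` D" using a D(3) by blast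
    then obtain d where d: "d \<in> D" "?m +>\<^bsub>?R\<^esub> a = ?m +>\<^bsub>?R\<^esub> d" by blast
    have "\<zero> \<in> ?m" using F_ops(1) by (simp add: valuation_ideal_def)
    then have "a \<in> ?m +>\<^bsub>?R\<^esub> a" using a by (auto simp: a_r_coset_def' intro!: bexI[of _ \<zero>])
    then obtain x where x: "x \<in> ?m" "a = x \<oplus> d" unfolding d(2) by (auto simp: a_r_coset_def')
    then have "x \<in> F" "x = \<zero> \<or> 1 \<le> v x" by (auto simp: valuation_ideal_def)
    then obtain y where y: "y \<in> OF" "x = \<pi> \<otimes> y" by (rule OF_divide)
    have "a = d \<oplus> \<pi> \<otimes> y" using x(2) y d(1) D(1) \<pi>_facts by (auto simp: a_comm)
    then show ?thesis using d(1) y(1) by blast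
  qed
  then show thesis using that D by blast
qed

definition cong_\<pi> :: "'b \<Rightarrow> 'b \<Rightarrow> bool"
  where "cong_\<pi> x y \<longleftrightarrow> x \<in> OK \<and> y \<in> OK \<and> (\<exists>d \<in> OK. x = y \<oplus> \<pi> \<otimes> d)"

lemma cong_sym: "cong_\<pi> x y \<Longrightarrow> cong_\<pi> y x"
proof -
  assume "cong_\<pi> x y"
  then obtain d where d: "x \<in> OK" "y \<in> OK" "d \<in> OK" "x = y \<oplus> \<pi> \<otimes> d" by (auto simp: cong_\<pi>_def)
  have "y = x \<oplus> \<pi> \<otimes> (\<ominus> d)" unfolding d(4) using d(2,3) \<pi>_facts by (simp add: r_minus a_assoc r_neg)
  then show "cong_\<pi> y x" using d OK_ops(3) by (auto simp: cong_\<pi>_def)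
qed

lemma cong_trans: "cong_\<pi> x y \<Longrightarrow> cong_\<pi> y z \<Longrightarrow> cong_\<pi> x z"
proof -
  assume "cong_\<pi> x y" "cong_\<pi> y z"
  then obtain d e where d: "x \<in> OK" "z \<in> OK" "d \<in> OK" "e \<in> OK" "x = z \<oplus> \<pi> \<otimes> e \<oplus> \<pi> \<otimes> d"
    by (auto simp: cong_\<pi>_def)
  then have "x = z \<oplus> \<pi> \<otimes> (e \<oplus> d)" using \<pi>_facts by (simp add: r_distr a_assoc)
  then show "cong_\<pi> x z" using d OK_ops(4) by (auto simp: cong_\<pi>_def)
qed

lemma cong_mult:
  assumes "cong_\<pi> x y" "cong_\<pi> x' y'" shows "cong_\<pi> (x \<otimes> x') (y \<otimes> y')"
proof -
  obtain d e where d: "x \<in> OK" "y \<in> OK" "x' \<in> OK" "y' \<in> OK" "d \<in> OK" "e \<in> OK"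
    "x = y \<oplus> \<pi> \<otimes> d" "x' = y' \<oplus> \<pi> \<otimes> e" using assms by (auto simp: cong_\<pi>_def)
  have "x \<otimes> x' = y \<otimes> x' \<oplus> \<pi> \<otimes> (d \<otimes> x')"
    unfolding d(7) using d(1-6) \<pi>_facts by (simp add: l_distr m_assoc)
  also have "y \<otimes> x' = y \<otimes> y' \<oplus> \<pi> \<otimes> (y \<otimes> e)"
    unfolding d(8) using d(1-6) \<pi>_facts central[OF \<pi>_facts(1), of y] by (simp add: r_distr flip: m_assoc)
  finally have "x \<otimes> x' = y \<otimes> y' \<oplus> \<pi> \<otimes> (y \<otimes> e \<oplus> d \<otimes> x')"
    using d(1-6) \<pi>_facts by (simp add: r_distr a_assoc)
  moreover have "x \<otimes> x' \<in> OK" "y \<otimes> y' \<in> OK" "y \<otimes> e \<oplus> d \<otimes> x' \<in> OK"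
    using d(1-6) by (auto intro: OK_ops)
  ultimately show ?thesis unfolding cong_\<pi>_def by blast
qed

text \<open>\<open>(x - y)^2 = x^2 - y^2 + 2 (y^2 - x y)\<close>, where \<open>2\<close> is a
  multiple of \<open>\<pi>\<close>; as \<open>\<pi>\<close> is prime in O_K, it divides
  \<open>x - y\<close>.\<close>

lemma square_inj:
  assumes two: "e \<in> OK" "\<one> \<oplus> \<one> = \<pi> \<otimes> e" and sq: "cong_\<pi> (x \<otimes> x) (y \<otimes> y)" and xy: "x \<in> OK" "y \<in> OK"
  shows "cong_\<pi> x y"
proof -
  obtain d where d: "d \<in> OK" "x \<otimes> x = y \<otimes> y \<oplus> \<pi> \<otimes> d" using sq by (auto simp: cong_\<pi>_def)
  let ?w = "y \<otimes> y \<ominus> x \<otimes> y"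
  have w: "?w \<in> OK" using xy OK_ops by auto
  have c: "x \<in> carrier B" "y \<in> carrier B" "d \<in> carrier B" "e \<in> carrier B" using xy d two by auto
  have "(x \<ominus> y) \<otimes> (x \<ominus> y)
      = (x \<otimes> x \<oplus> (y \<otimes> y \<oplus> (\<ominus> (x \<otimes> y) \<oplus> \<ominus> (x \<otimes> y)))) \<oplus> (y \<otimes> y \<oplus> \<ominus> (y \<otimes> y))"
    using c OK_comm[OF xy] by (simp add: a_minus_def l_distr r_distr l_minus r_minus minus_add r_neg a_ac)
  also have "\<dots> = (x \<otimes> x \<ominus> y \<otimes> y) \<oplus> (\<one> \<oplus> \<one>) \<otimes> ?w"
    using c by (simp add: a_minus_def l_distr a_ac)
  also have "x \<otimes> x \<ominus> y \<otimes> y = \<pi> \<otimes> d"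
    unfolding d(2) using c \<pi>_facts by (simp add: a_minus_def a_ac r_neg r_neg2)
  also have "(\<one> \<oplus> \<one>) \<otimes> ?w = \<pi> \<otimes> (e \<otimes> ?w)" unfolding two(2) using c w \<pi>_facts by (simp add: m_assoc)
  also have "\<pi> \<otimes> d \<oplus> \<pi> \<otimes> (e \<otimes> ?w) = \<pi> \<otimes> (d \<oplus> e \<otimes> ?w)" using c w \<pi>_facts by (simp add: r_distr)
  finally have "(x \<ominus> y) \<otimes> (x \<ominus> y) = \<pi> \<otimes> (d \<oplus> e \<otimes> ?w)" .
  moreover have "x \<ominus> y \<in> OK" "d \<oplus> e \<otimes> ?w \<in> OK" using xy d(1) two(1) w by (auto intro: OK_ops)
  ultimately obtain f where f: "f \<in> OK" "x \<ominus> y = \<pi> \<otimes> f" using OK_prime by blast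
  have "x = y \<oplus> \<pi> \<otimes> f" using c unfolding f(2)[symmetric] using add_minus_cancel[of x y] by (simp add: a_comm)
  then show ?thesis using f(1) xy by (auto simp: cong_\<pi>_def)
qed

text \<open>If \<open>\<sigma>\<close> is trivial modulo \<open>\<pi>\<close>, then \<open>2c\<close> is congruent to the trace of \<open>c\<close>, and \<open>c\<^sup>2\<close> to its
  norm.  In residue characteristic 2 the squares \<open>c\<^bsup>2^i\<^esup>\<close> with \<open>i \<ge> 1\<close> are therefore congruent to
  elements of a finite set, and squaring is injective modulo \<open>\<pi>\<close>.\<close>

lemma reduces_to_OF:
  assumes triv: "\<And>c. c \<in> OK \<Longrightarrow> cong_\<pi> (\<sigma> c) c" and c: "c \<in> OK"
  shows "\<exists>b \<in> OF. cong_\<pi> c b"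
  using OF_unit_or[OF OF_ops(5)[OF OF_ops(2,2)]]
proof
  assume n: "\<one> \<oplus> \<one> \<noteq> \<zero> \<and> v (\<one> \<oplus> \<one>) = 0"
  \<comment> \<open>With \<open>2\<close> invertible, half the trace of \<open>c\<close> is
    congruent to \<open>c\<close>.\<close>
  let ?w = "inv (\<one> \<oplus> \<one>)"
  have w: "?w \<in> OF" "(\<one> \<oplus> \<one>) \<otimes> ?w = \<one>" using OF_inv[OF OF_ops(5)[OF OF_ops(2,2)]] n by auto
  obtain d where d: "d \<in> OK" "\<sigma> c = c \<oplus> \<pi> \<otimes> d" using triv[OF c] by (auto simp: cong_\<pi>_def)
  note cl = OK_closed[OF c] OK_closed[OF d(1)] OF_closed[OF w(1)] \<pi>_facts(4)
  have "?w \<otimes> (c \<oplus> \<sigma> c) = ?w \<otimes> ((\<one> \<oplus> \<one>) \<otimes> c \<oplus> \<pi> \<otimes> d)"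
    unfolding d(2) using cl by (simp add: l_distr a_assoc)
  also have "\<dots> = ((\<one> \<oplus> \<one>) \<otimes> ?w) \<otimes> c \<oplus> \<pi> \<otimes> (?w \<otimes> d)"
    using cl central[OF OF_F[OF w(1)], of "\<one> \<oplus> \<one>"] central[OF OF_F[OF w(1)], of \<pi>]
    by (simp add: r_distr flip: m_assoc)
  finally have "?w \<otimes> (c \<oplus> \<sigma> c) = c \<oplus> \<pi> \<otimes> (?w \<otimes> d)" unfolding w(2) using cl by simp
  moreover have "?w \<otimes> (c \<oplus> \<sigma> c) \<in> OF" using OF_ops(4)[OF w(1) OK_norm(2)[OF c]] .
  ultimately have "cong_\<pi> (?w \<otimes> (c \<oplus> \<sigma> c)) c"
    using c OF_OK OK_ops(5)[OF OF_OK[OF w(1)] d(1)] by (auto simp: cong_\<pi>_def)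
  then show ?thesis using cong_sym \<open>?w \<otimes> (c \<oplus> \<sigma> c) \<in> OF\<close> by blast
next
  assume "\<exists>y \<in> OF. \<one> \<oplus> \<one> = \<pi> \<otimes> y"
  then obtain e where e: "e \<in> OK" "\<one> \<oplus> \<one> = \<pi> \<otimes> e" using OF_OK by blast
  obtain D where D: "finite D" "D \<subseteq> OF" "\<And>a. a \<in> OF \<Longrightarrow> \<exists>d \<in> D. \<exists>y \<in> OF. a = d \<oplus> \<pi> \<otimes> y"
    using OF_residues by blast
  define f where "f i = c [^] ((2::nat) ^ i)" for i :: nat
  have f: "f i \<in> OK" for i
  proof -
    have "c [^] n \<in> OK" for n :: nat by (induction n) (auto simp: OK_ops c)
    then show ?thesis by (simp add: f_def)
  qed
  have fS: "f (Suc i) = f i \<otimes> f i" for i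
    using c by (simp add: f_def nat_pow_mult mult_2)
  have f0: "f 0 = c" using c by (simp add: f_def)
  have "\<exists>d \<in> D. cong_\<pi> (f (Suc i)) d" for i
  proof -
    note n = OK_norm(1)[OF f, of i]
    obtain d y where d: "d \<in> D" "y \<in> OF" "f i \<otimes> \<sigma> (f i) = d \<oplus> \<pi> \<otimes> y" using D(3)[OF n] by blast
    have "cong_\<pi> (f i \<otimes> \<sigma> (f i)) (f i \<otimes> f i)"
    proof (rule cong_mult[OF _ triv[OF f]])
      show "cong_\<pi> (f i) (f i)" using cong_trans[OF cong_sym[OF triv[OF f]] triv[OF f]] .
    qed
    moreover have "cong_\<pi> (f i \<otimes> \<sigma> (f i)) d"
      unfolding cong_\<pi>_def using d D(2) OF_OK n by blast
    ultimately show ?thesis using d(1) cong_trans[OF cong_sym] unfolding fS by blast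
  qed
  then obtain r where r: "\<And>i. r i \<in> D \<and> cong_\<pi> (f (Suc i)) (r i)" by metis
  \<comment> \<open>Pigeonhole: the residues \<open>r i\<close> all lie in the finite set
    \<open>D\<close>.\<close>
  have "\<not> inj r"
  proof
    assume "inj r"
    moreover have "finite (range r)" using r D(1) by (meson finite_subset image_subsetI)
    ultimately show False using finite_imageD[of r UNIV] by simp
  qed
  then obtain i j where ij: "i < j" "r i = r j"
    unfolding inj_def by (metis linorder_neqE_nat)
  then have "cong_\<pi> (f (Suc i)) (f (Suc j))" using cong_trans cong_sym r by metis
  then have "cong_\<pi> (f (Suc i)) (f (Suc i + (j - i)))" using ij(1) by simp
  \<comment> \<open>Undoing squarings moves the coincidence down to index 0. The other index
    \<open>j - i\<close> is positive, so \<open>c\<close> is congruent to one of the powers already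
    known to reduce to \<open>D\<close>.\<close>
  have descend: "cong_\<pi> (f m) (f (m + k)) \<Longrightarrow> cong_\<pi> (f 0) (f k)" for m k
  proof (induction m)
    case (Suc m)
    then have "cong_\<pi> (f m \<otimes> f m) (f (m + k) \<otimes> f (m + k))" by (simp add: fS)
    then show ?case using Suc.IH square_inj[OF e _ f f] by blast
  qed simp
  have k: "j - i = Suc (j - i - 1)" using ij(1) by simp
  have "cong_\<pi> c (f (Suc (j - i - 1)))"
    using descend[OF \<open>cong_\<pi> (f (Suc i)) (f (Suc i + (j - i)))\<close>] unfolding f0 by (subst (asm) k)
  then have "cong_\<pi> c (r (j - i - 1))" using r cong_trans by blast
  then show ?thesis using r D(2) by blast
qed

text \<open>Otherwise no \<open>\<sigma> c - c\<close> is a unit, so \<open>\<sigma>\<close> is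
  trivial modulo \<open>\<pi>\<close> and \<open>O_K = O_F + \<pi> O_K\<close>. Iteration makes
  \<open>\<sigma> c - c\<close> divisible by all powers of \<open>\<pi>\<close>, so
  \<open>\<sigma>\<close> fixes O_K, and in the end \<open>K\<close> would be central.\<close>

lemma \<theta>_ex: "\<exists>\<theta> \<in> OK. \<exists>\<eta> \<in> OK. (\<sigma> \<theta> \<ominus> \<theta>) \<otimes> \<eta> = \<one>"
proof (rule ccontr)
  assume none: "\<not> ?thesis"
  have triv: "cong_\<pi> (\<sigma> c) c" if c: "c \<in> OK" for c
  proof -
    have sc: "\<sigma> c \<ominus> c \<in> OK" using c \<sigma>_OK OK_ops by auto
    then obtain b where b: "b \<in> OK" "\<sigma> c \<ominus> c = \<pi> \<otimes> b" using OK_unit_or[OF sc] none c by blast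
    have "\<sigma> c = c \<oplus> \<pi> \<otimes> b"
      unfolding b(2)[symmetric] using c \<sigma>_OK[OF c] add_minus_cancel[of "\<sigma> c" c] by (simp add: a_comm)
    then show ?thesis unfolding cong_\<pi>_def using b(1) c \<sigma>_OK[OF c] by blast
  qed
  \<comment> \<open>Writing \<open>d = b + \<pi> e\<close> with \<open>b\<close> in O_F, the fixed
    part \<open>b\<close> cancels and one more factor \<open>\<pi>\<close> comes out.\<close>
  have step: "\<exists>d \<in> OK. \<sigma> c \<ominus> c = \<pi> [^] n \<otimes> (\<sigma> d \<ominus> d)" if "c \<in> OK" for c and n :: nat
    using that
  proof (induction n)
    case 0
    then show ?case using \<sigma>_OK by (intro bexI[of _ c]) auto
  next
    case (Suc n)
    then obtain d where d: "d \<in> OK" "\<sigma> c \<ominus> c = \<pi> [^] n \<otimes> (\<sigma> d \<ominus> d)" by blast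
    obtain b e where b: "b \<in> OF" "e \<in> OK" "d = b \<oplus> \<pi> \<otimes> e"
      using reduces_to_OF[OF triv d(1)] by (auto simp: cong_\<pi>_def)
    have be: "b \<in> K" "e \<in> K" "\<pi> \<in> K" "\<sigma> b = b" "\<sigma> \<pi> = \<pi>"
      using b OF_F OK_K \<pi>_facts K_sub(2) \<sigma>_F by auto
    have "\<sigma> d = b \<oplus> \<pi> \<otimes> \<sigma> e" unfolding b(3) using be \<sigma>_hom K_ops(5) by simp
    then have "\<sigma> d \<ominus> d = (b \<oplus> \<pi> \<otimes> \<sigma> e) \<ominus> (b \<oplus> \<pi> \<otimes> e)" using b(3) by simp
    also have "\<dots> = (b \<oplus> \<ominus> b) \<oplus> (\<pi> \<otimes> \<sigma> e \<ominus> \<pi> \<otimes> e)"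
      using b \<sigma>_OK[OF b(2)] \<pi>_facts by (simp add: a_minus_def minus_add a_ac)
    also have "\<dots> = \<pi> \<otimes> (\<sigma> e \<ominus> e)"
      using b \<sigma>_OK[OF b(2)] \<pi>_facts by (simp add: r_neg a_minus_def r_distr r_minus)
    finally have "\<sigma> c \<ominus> c = \<pi> [^] Suc n \<otimes> (\<sigma> e \<ominus> e)"
      unfolding d(2) using b \<sigma>_OK[OF b(2)] \<pi>_facts by (simp add: m_assoc)
    then show ?case using b(2) by blast
  qed
  have fixed: "\<sigma> c = c" if c: "c \<in> OK" for c
  proof -
    have "\<sigma> c \<ominus> c = \<zero>"
    proof (rule OK_separated)
      show "\<sigma> c \<ominus> c \<in> OK" using c \<sigma>_OK OK_ops by auto
      show "\<exists>d \<in> OK. \<sigma> c \<ominus> c = \<pi> [^] n \<otimes> d" for n :: nat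
        using step[OF c, of n] \<sigma>_OK OK_ops(6) by blast
    qed
    then show ?thesis using c \<sigma>_OK[OF c] by simp
  qed
  \<comment> \<open>Now O_K is central, hence so are \<open>P\<close> and O_B; then \<open>K\<close>
    centralizes O_B and falls into \<open>F\<close>, which \<open>\<sigma>\<close> fixes.\<close>
  have OK_F: "OK \<subseteq> F" using fixed_OF[OF _ fixed] OF_F by blast
  have "P \<otimes> x = x \<otimes> P" if x: "x \<in> OB" for x
  proof -
    obtain a b where ab: "a \<in> OK" "b \<in> OK" "x = a \<oplus> b \<otimes> P" using x unfolding OB_decomp by blast
    then have F: "a \<in> F" "b \<in> F" using OK_F by auto
    have "P \<otimes> (b \<otimes> P) = P \<otimes> b \<otimes> P" using F P_closed by (simp add: m_assoc)
    also have "\<dots> = b \<otimes> P \<otimes> P" by (simp only: central[OF F(2) P_closed])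
    finally show ?thesis
      unfolding ab(3) using P_closed F central[OF F(1) P_closed] by (simp add: l_distr r_distr)
  qed
  then have PF: "P \<in> F" using centralizer P_closed by blast
  have OBF: "OB \<subseteq> F"
  proof
    fix x assume "x \<in> OB"
    then obtain a b where ab: "a \<in> OK" "b \<in> OK" "x = a \<oplus> b \<otimes> P" unfolding OB_decomp by blast
    then have "a \<in> F" "b \<in> F" using OK_F by auto
    then show "x \<in> F" unfolding ab(3) by (intro F_ops(4,5) PF)
  qed
  have "K \<subseteq> F"
  proof
    fix x assume "x \<in> K"
    then show "x \<in> F" using centralizer[of x] OBF central[of _ x] by (metis K_closed subsetD)
  qed
  then show False using \<sigma>_nontrivial \<sigma>_F by blast
qed

lemma quat_order_ex: obtains \<theta> \<eta> where "quat_order (B\<lparr>carrier := OB\<rparr>) OK OF \<pi> P \<theta> \<eta> \<sigma>"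
proof -
  obtain \<theta> \<eta> where \<theta>: "\<theta> \<in> OK" "\<eta> \<in> OK" "(\<sigma> \<theta> \<ominus> \<theta>) \<otimes> \<eta> = \<one>"
    using \<theta>_ex by blast
  let ?R = "B\<lparr>carrier := OB\<rparr>"
  interpret R: ring ?R by (rule subring_is_ring[OF OB_subring])
  have minus: "x \<in> OB \<Longrightarrow> \<ominus>\<^bsub>?R\<^esub> x = \<ominus> x" for x by (rule subring_minus[OF OB_subring])
  have cl: "\<sigma> \<theta> \<in> OK" "\<sigma> \<eta> \<in> OK" "\<sigma> \<theta> \<ominus> \<theta> \<in> OK" using \<theta> \<sigma>_OK OK_ops by auto
  \<comment> \<open>\<open>\<sigma>\<close> changes the sign of
    \<open>\<sigma> \<theta> - \<theta>\<close>, hence of its inverse.\<close>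
  have \<eta>: "\<sigma> \<eta> = \<ominus> \<eta>"
  proof -
    have s: "\<sigma> (\<sigma> \<theta> \<ominus> \<theta>) = \<ominus> (\<sigma> \<theta> \<ominus> \<theta>)"
      using \<sigma>_diff[OF cl(1) \<theta>(1)] \<sigma>_\<sigma>_OK[OF \<theta>(1)] \<theta>(1) cl(1)
      by (simp add: a_minus_def minus_add a_comm)
    have "\<sigma> (\<sigma> \<theta> \<ominus> \<theta>) \<otimes> \<sigma> \<eta> = \<one>"
      using \<sigma>_hom(3)[of "\<sigma> \<theta> \<ominus> \<theta>" \<eta>] \<theta> cl OK_K \<sigma>_F F_ops(2) by simp
    then have "(\<sigma> \<theta> \<ominus> \<theta>) \<otimes> (\<ominus> \<sigma> \<eta>) = (\<sigma> \<theta> \<ominus> \<theta>) \<otimes> \<eta>"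
      unfolding s \<theta>(3) using cl \<theta>(1) by (simp add: l_minus r_minus)
    then have "\<eta> \<otimes> (\<sigma> \<theta> \<ominus> \<theta>) \<otimes> (\<ominus> \<sigma> \<eta>) = \<eta> \<otimes> (\<sigma> \<theta> \<ominus> \<theta>) \<otimes> \<eta>"
      using cl \<theta> by (simp add: m_assoc)
    then have "\<ominus> \<sigma> \<eta> = \<eta>" using \<theta> cl OK_comm[OF cl(3) \<theta>(2)] by simp
    then show ?thesis using cl(2) by (metis OK_closed minus_minus)
  qed
  \<comment> \<open>Subtracting \<open>c = s + t \<theta>\<close> from its conjugate gives
    \<open>\<sigma> c - c = t (\<sigma> \<theta> - \<theta>)\<close>. This dictates
    \<open>t\<close>, which is fixed because both factors change sign, and then
    \<open>s\<close>.\<close>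
  have gen: "\<exists>s \<in> OF. \<exists>t \<in> OF. c = s \<oplus> t \<otimes> \<theta>" if c: "c \<in> OK" for c
  proof -
    have sc: "\<sigma> c \<in> OK" "\<sigma> (\<sigma> c) = c" "\<sigma> c \<ominus> c \<in> OK" using c \<sigma>_OK \<sigma>_\<sigma>_OK OK_ops(6) by auto
    let ?t = "(\<sigma> c \<ominus> c) \<otimes> \<eta>"
    have tK: "?t \<in> OK" using sc \<theta> OK_ops(5) by simp
    have "\<sigma> ?t = (c \<ominus> \<sigma> c) \<otimes> (\<ominus> \<eta>)"
      using \<sigma>_hom(3)[of "\<sigma> c \<ominus> c" \<eta>] sc \<theta>(2) OK_K \<sigma>_diff[OF sc(1) c] \<eta> by simp
    also have "\<dots> = \<ominus> (c \<ominus> \<sigma> c) \<otimes> \<eta>" using c sc \<theta>(2) by (simp add: l_minus r_minus)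
    also have "\<ominus> (c \<ominus> \<sigma> c) = \<sigma> c \<ominus> c" using c sc by (simp add: a_minus_def minus_add a_comm)
    finally have tF: "?t \<in> OF" by (rule fixed_OF[OF tK])
    then have st: "\<sigma> ?t = ?t" using \<sigma>_F OF_F by blast
    let ?s = "c \<ominus> ?t \<otimes> \<theta>"
    have t\<theta>: "?t \<otimes> \<theta> \<in> OK" "?t \<otimes> \<sigma> \<theta> \<in> OK" using tK \<theta>(1) cl OK_ops(5) by auto
    have sK: "?s \<in> OK" using c t\<theta> OK_ops(6) by simp
    have "?t \<otimes> (\<sigma> \<theta> \<ominus> \<theta>) = (\<sigma> c \<ominus> c) \<otimes> (\<eta> \<otimes> (\<sigma> \<theta> \<ominus> \<theta>))" using sc \<theta> cl by (simp add: m_assoc)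
    also have "\<dots> = \<sigma> c \<ominus> c" using \<theta> OK_comm[OF cl(3) \<theta>(2)] sc by simp
    finally have "?t \<otimes> \<sigma> \<theta> \<ominus> ?t \<otimes> \<theta> = \<sigma> c \<ominus> c" using tK \<theta>(1) cl by (simp add: a_minus_def r_distr r_minus)
    then have e: "?t \<otimes> \<sigma> \<theta> = (\<sigma> c \<ominus> c) \<oplus> ?t \<otimes> \<theta>"
      using add_minus_cancel[of "?t \<otimes> \<sigma> \<theta>" "?t \<otimes> \<theta>"] t\<theta> by simp
    have "\<sigma> ?s = \<sigma> c \<ominus> ?t \<otimes> \<sigma> \<theta>"
      using \<sigma>_diff[OF c t\<theta>(1)] \<sigma>_hom(3)[OF OK_K[OF tK] OK_K[OF \<theta>(1)]] st by simp
    also have "\<dots> = (\<sigma> c \<oplus> \<ominus> \<sigma> c) \<oplus> (c \<ominus> ?t \<otimes> \<theta>)"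
      unfolding e using c sc t\<theta>(1) by (simp add: a_minus_def minus_add a_ac)
    also have "\<dots> = ?s" using c sc(1) t\<theta>(1) by (simp add: r_neg)
    finally have "?s \<in> OF" by (rule fixed_OF[OF sK])
    moreover have "c = ?s \<oplus> ?t \<otimes> \<theta>" using add_minus_cancel[of c "?t \<otimes> \<theta>"] c t\<theta> by simp
    ultimately show ?thesis using tF by blast
  qed
  have "quat_order ?R OK OF \<pi> P \<theta> \<eta> \<sigma>"
  proof (intro quat_order.intro quat_order_axioms.intro R.ring_axioms)
    show "subring OK ?R"
      by (rule R.subringI) (auto simp: OK_OB OK_ops minus)
    show "\<exists>a \<in> OK. \<exists>b \<in> OK. r = a \<oplus>\<^bsub>?R\<^esub> b \<otimes>\<^bsub>?R\<^esub> P" if "r \<in> carrier ?R" for r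
      using that OB_decomp by simp
    show "a = \<zero>\<^bsub>?R\<^esub> \<and> b = \<zero>\<^bsub>?R\<^esub>"
      if "a \<in> OK" "b \<in> OK" "a \<oplus>\<^bsub>?R\<^esub> b \<otimes>\<^bsub>?R\<^esub> P = \<zero>\<^bsub>?R\<^esub>" for a b
      using OB_unique[of a b \<zero> \<zero>] that OK_ops(1) P_closed by simp
    show "(\<sigma> \<theta> \<ominus>\<^bsub>?R\<^esub> \<theta>) \<otimes>\<^bsub>?R\<^esub> \<eta> = \<one>\<^bsub>?R\<^esub>"
      using \<theta> minus[OF OK_OB[OF \<theta>(1)]] by (simp add: a_minus_def)
    show "r = \<zero>\<^bsub>?R\<^esub>" if r: "r \<in> carrier ?R"
      "\<And>n::nat. \<exists>s \<in> carrier ?R. r = s \<otimes>\<^bsub>?R\<^esub> \<pi> [^]\<^bsub>?R\<^esub> n" for r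
    proof -
      obtain a b where ab: "a \<in> OK" "b \<in> OK" "r = a \<oplus> b \<otimes> P" using r(1) OB_decomp by auto
      \<comment> \<open>By uniqueness of components, divisibility of \<open>r\<close> by a power of
        \<open>\<pi>\<close> passes to both components.\<close>
      have "\<exists>a' \<in> OK. \<exists>b' \<in> OK. a = \<pi> [^] n \<otimes> a' \<and> b = \<pi> [^] n \<otimes> b'" for n :: nat
      proof -
        have pn: "\<pi> [^] n \<in> OF" by (induction n) (auto simp: OF_ops \<pi>_facts)
        obtain s where s: "s \<in> OB" "r = s \<otimes> \<pi> [^] n" using r(2)[of n] by (auto simp: subring_nat_pow)
        obtain a' b' where ab': "a' \<in> OK" "b' \<in> OK" "s = a' \<oplus> b' \<otimes> P" using s(1) unfolding OB_decomp by blast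
        have "r = \<pi> [^] n \<otimes> s" using s central[OF OF_F[OF pn], of s] by simp
        also have "\<dots> = \<pi> [^] n \<otimes> a' \<oplus> (\<pi> [^] n \<otimes> b') \<otimes> P"
          unfolding ab'(3) using ab'(1,2) pn P_closed by (simp add: r_distr m_assoc)
        finally have "a = \<pi> [^] n \<otimes> a' \<and> b = \<pi> [^] n \<otimes> b'"
          using ab ab'(1,2) OF_OK[OF pn] by (intro OB_unique) (auto intro: OK_ops)
        then show ?thesis using ab' by blast
      qed
      then have "a = \<zero>" "b = \<zero>" using OK_separated[OF ab(1)] OK_separated[OF ab(2)] by blast+
      then show ?thesis using ab(3) P_closed by simp
    qed
    show "\<exists>D. finite D \<and> D \<subseteq> OK \<and> (\<forall>c \<in> OK. \<exists>d \<in> D. \<exists>b \<in> OK. c = d \<oplus>\<^bsub>?R\<^esub> \<pi> \<otimes>\<^bsub>?R\<^esub> b)"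
    proof -
      obtain D where D: "finite D" "D \<subseteq> OF" "\<And>a. a \<in> OF \<Longrightarrow> \<exists>d \<in> D. \<exists>y \<in> OF. a = d \<oplus> \<pi> \<otimes> y"
        using OF_residues by blast
      \<comment> \<open>Residues of O_K are obtained from residues of the two coefficients with
        respect to \<open>1, \<theta>\<close>.\<close>
      let ?D = "(\<lambda>(d, d'). d \<oplus> d' \<otimes> \<theta>) ` (D \<times> D)"
      have "\<exists>d \<in> ?D. \<exists>b \<in> OK. c = d \<oplus> \<pi> \<otimes> b" if c: "c \<in> OK" for c
      proof -
        obtain s t where st: "s \<in> OF" "t \<in> OF" "c = s \<oplus> t \<otimes> \<theta>" using gen[OF c] by blast
        obtain d y where d: "d \<in> D" "y \<in> OF" "s = d \<oplus> \<pi> \<otimes> y" using D(3)[OF st(1)] by blast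
        obtain d' y' where d': "d' \<in> D" "y' \<in> OF" "t = d' \<oplus> \<pi> \<otimes> y'" using D(3)[OF st(2)] by blast
        have m: "d \<in> carrier B" "d' \<in> carrier B" "y \<in> carrier B" "y' \<in> carrier B" "\<theta> \<in> carrier B"
          using d d' D(2) \<theta> by auto
        have "c = (d \<oplus> d' \<otimes> \<theta>) \<oplus> \<pi> \<otimes> (y \<oplus> y' \<otimes> \<theta>)"
          unfolding st(3) d(3) d'(3) using m \<pi>_facts by (simp add: l_distr r_distr m_assoc a_ac)
        moreover have "y \<oplus> y' \<otimes> \<theta> \<in> OK" using d(2) d'(2) OF_OK \<theta>(1) OK_ops by auto
        moreover have "d \<oplus> d' \<otimes> \<theta> \<in> ?D" using d(1) d'(1) by force
        ultimately show ?thesis by blast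
      qed
      moreover have "?D \<subseteq> OK"
        using \<theta>(1) by (auto intro!: OK_ops(4,5) dest!: subsetD[OF D(2)] OF_OK)
      ultimately show ?thesis using D(1) by (intro exI[of _ ?D]) simp
    qed
    show "r = \<zero>\<^bsub>?R\<^esub>" if "a \<in> OF" "a \<noteq> \<zero>\<^bsub>?R\<^esub>" "r \<in> carrier ?R" "a \<otimes>\<^bsub>?R\<^esub> r = \<zero>\<^bsub>?R\<^esub>" for a r
      using no_zero_div[of a r] that by auto
    show "a \<otimes>\<^bsub>?R\<^esub> r = r \<otimes>\<^bsub>?R\<^esub> a" if "a \<in> OF" "r \<in> carrier ?R" for a r
      using central[OF OF_F[OF that(1)], of r] that by simp
    show "P \<otimes>\<^bsub>?R\<^esub> a = \<sigma> a \<otimes>\<^bsub>?R\<^esub> P" if "a \<in> OK" for a using P_conj that by simp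
    show "a \<otimes>\<^bsub>?R\<^esub> b = b \<otimes>\<^bsub>?R\<^esub> a" if "a \<in> OK" "b \<in> OK" for a b using OK_comm[OF that] by simp
    show "\<theta> \<oplus>\<^bsub>?R\<^esub> \<sigma> \<theta> \<in> OF" "\<theta> \<otimes>\<^bsub>?R\<^esub> \<sigma> \<theta> \<in> OF" using OK_norm[OF \<theta>(1)] by simp_all
    show "\<sigma> a = a" if "a \<in> OF" for a using that OF_F \<sigma>_F by blast
  qed (use OF_OK P_OB P_sq \<sigma>_OK \<sigma>_hom OK_K \<sigma>_\<sigma>_OK \<pi>_facts \<theta> gen OK_unit_or \<pi>_nonunit_OK in auto)
  then show thesis by (rule that)
qed

text \<open>The structure map of \<open>residue_bimodules\<close> adds \<open>J\<close> to a coset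
  of \<open>\<pi> O_F\<close>. As \<open>\<pi> O_F\<close> lies in \<open>J\<close>, the result is
  the coset of \<open>a\<close> modulo \<open>J\<close>, so agreement can be tested on elements of
  O_F.\<close>

lemma coset_set_add:
  assumes J: "ideal J (B\<lparr>carrier := OB\<rparr>)" and \<pi>J: "\<pi> <# OF \<subseteq> J" and a: "a \<in> OF"
  shows "((\<pi> <# OF) +>\<^bsub>B\<lparr>carrier := OF\<rparr>\<^esub> a) <+>\<^bsub>B\<^esub> J = J +>\<^bsub>B\<lparr>carrier := OB\<rparr>\<^esub> a"
proof -
  interpret J: ideal J "B\<lparr>carrier := OB\<rparr>" by (rule J)
  have JB: "x \<in> J \<Longrightarrow> x \<in> carrier B" for x using J.Icarr by auto
  have Ja: "x \<in> J \<Longrightarrow> y \<in> J \<Longrightarrow> x \<oplus> y \<in> J" for x y 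
    using additive_subgroup.a_closed[OF J.additive_subgroup_axioms] by simp
  have z: "\<zero> \<in> \<pi> <# OF" using OF_ops(1) \<pi>_facts by (auto simp: l_coset_def intro!: bexI[of _ \<zero>])
  show ?thesis
  proof
    show "((\<pi> <# OF) +>\<^bsub>B\<lparr>carrier := OF\<rparr>\<^esub> a) <+>\<^bsub>B\<^esub> J \<subseteq> J +>\<^bsub>B\<lparr>carrier := OB\<rparr>\<^esub> a"
    proof
      fix x assume "x \<in> ((\<pi> <# OF) +>\<^bsub>B\<lparr>carrier := OF\<rparr>\<^esub> a) <+>\<^bsub>B\<^esub> J"
      then obtain h k where hk: "h \<in> \<pi> <# OF" "k \<in> J" "x = h \<oplus> a \<oplus> k"
        by (auto simp: a_r_coset_def' set_add_def')
      then have "h \<in> J" using \<pi>J by blast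
      then have "x = (h \<oplus> k) \<oplus> a" "h \<oplus> k \<in> J" using hk a JB Ja by (auto simp: a_ac)
      then show "x \<in> J +>\<^bsub>B\<lparr>carrier := OB\<rparr>\<^esub> a" by (auto simp: a_r_coset_def')
    qed
    show "J +>\<^bsub>B\<lparr>carrier := OB\<rparr>\<^esub> a \<subseteq> ((\<pi> <# OF) +>\<^bsub>B\<lparr>carrier := OF\<rparr>\<^esub> a) <+>\<^bsub>B\<^esub> J"
    proof
      fix x assume "x \<in> J +>\<^bsub>B\<lparr>carrier := OB\<rparr>\<^esub> a"
      then obtain k where k: "k \<in> J" "x = k \<oplus> a" by (auto simp: a_r_coset_def')
      then have "x = (\<zero> \<oplus> a) \<oplus> k" using a JB by (simp add: a_comm)
      moreover have "\<zero> \<oplus> a \<in> (\<pi> <# OF) +>\<^bsub>B\<lparr>carrier := OF\<rparr>\<^esub> a"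
        using z by (auto simp: a_r_coset_def')
      ultimately show "x \<in> ((\<pi> <# OF) +>\<^bsub>B\<lparr>carrier := OF\<rparr>\<^esub> a) <+>\<^bsub>B\<^esub> J"
        using k(1) unfolding set_add_def' by blast
    qed
  qed
qed

lemma residue_bimodules_eq:
  assumes q: "quat_order (B\<lparr>carrier := OB\<rparr>) OK OF \<pi> P \<theta> \<eta> \<sigma>"
    and x: "ideal (x <# OB) (B\<lparr>carrier := OB\<rparr>)" "\<pi> <# OF \<subseteq> x <# OB"
    and y: "ideal (y <# OB) (B\<lparr>carrier := OB\<rparr>)" "\<pi> <# OF \<subseteq> y <# OB"
  shows "residue_bimodules B OF OB \<pi> x y
    = quat_order.coset_bimodules (B\<lparr>carrier := OB\<rparr>) OF (x <# OB) (y <# OB)"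
  unfolding residue_bimodules_def quat_order.coset_bimodules_def[OF q] quot_by_def agreeing_actions_def
    carrier_Quot
  by (auto simp: coset_set_add[OF x] coset_set_add[OF y])

end

theorem corollary2p2p3:
  fixes B :: "'b ring" and F O\<^sub>F O\<^sub>B K O\<^sub>K :: "'b set"
    and v :: "'b \<Rightarrow> int" and \<sigma> :: "'b \<Rightarrow> 'b" and \<pi> P :: 'b
  assumes B: "quaternion_division_algebra B F"
    and F: "nonarch_local_field (B\<lparr>carrier := F\<rparr>) v"
    and O\<^sub>F: "O\<^sub>F = valuation_ring (B\<lparr>carrier := F\<rparr>) v"
    and O\<^sub>B: "maximal_order B F O\<^sub>F O\<^sub>B"
    and K: "unramified_quadratic_extension B F v K"
    and O\<^sub>K: "O\<^sub>K = integral_closure B O\<^sub>F K"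
    and \<sigma>: "\<sigma> \<in> ring_iso (B\<lparr>carrier := K\<rparr>) (B\<lparr>carrier := K\<rparr>)"
      "\<forall>a \<in> F. \<sigma> a = a" "\<exists>a \<in> K. \<sigma> a \<noteq> a"
    and \<pi>: "\<pi> \<in> F - {\<zero>\<^bsub>B\<^esub>}" "v \<pi> = 1"
    and P: "P \<in> O\<^sub>B"
      "bij_betw (\<lambda>(a, b). a \<oplus>\<^bsub>B\<^esub> b \<otimes>\<^bsub>B\<^esub> P) (O\<^sub>K \<times> O\<^sub>K) O\<^sub>B"
      "P \<otimes>\<^bsub>B\<^esub> P = \<pi>"
      "\<forall>a \<in> O\<^sub>K. P \<otimes>\<^bsub>B\<^esub> a = \<sigma> a \<otimes>\<^bsub>B\<^esub> P"
    \<comment> \<open>the types of carriers are large enough for all isomorphism classes to be represented\<close>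
    and large: "\<exists>f :: 'b \<Rightarrow> 'm. inj_on f (carrier B)" "infinite (UNIV :: 'n set)"
  shows "induces_bijection (right_truncation P)
       (B\<lparr>carrier := O\<^sub>B\<rparr>) (B\<lparr>carrier := O\<^sub>B\<rparr>)
       (bilattices B O\<^sub>F O\<^sub>B :: ('b, 'b, 'm) bimodule set)
       (quot_by B O\<^sub>B \<pi>) (quot_by B O\<^sub>B P)
       (residue_bimodules B O\<^sub>F O\<^sub>B \<pi> \<pi> P :: ('b set, 'b set, 'n) bimodule set)
     \<and> induces_bijection (left_truncation P)
         (B\<lparr>carrier := O\<^sub>B\<rparr>) (B\<lparr>carrier := O\<^sub>B\<rparr>)
         (bilattices B O\<^sub>F O\<^sub>B :: ('b, 'b, 'm) bimodule set)
         (quot_by B O\<^sub>B P) (quot_by B O\<^sub>B \<pi>)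
         (residue_bimodules B O\<^sub>F O\<^sub>B \<pi> P \<pi> :: ('b set, 'b set, 'n) bimodule set)"
proof -
  interpret quat_setting B F O\<^sub>F O\<^sub>B K O\<^sub>K v \<sigma> \<pi> P
    by (intro quat_setting.intro quat_setting_axioms.intro assms)
  let ?R = "B\<lparr>carrier := O\<^sub>B\<rparr>"
  obtain \<theta> \<eta> where q: "quat_order ?R O\<^sub>K O\<^sub>F \<pi> P \<theta> \<eta> \<sigma>" by (rule quat_order_ex)
  interpret Q: quat_order ?R O\<^sub>K O\<^sub>F \<pi> P \<theta> \<eta> \<sigma> by (rule q)
  have cosets: "\<pi> <#\<^bsub>B\<^esub> O\<^sub>B = (\<lambda>r. \<pi> \<otimes>\<^bsub>?R\<^esub> r) ` carrier ?R"
    "P <#\<^bsub>B\<^esub> O\<^sub>B = (\<lambda>r. P \<otimes>\<^bsub>?R\<^esub> r) ` carrier ?R"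
    by (auto simp: l_coset_def)
  have I: "ideal (\<pi> <#\<^bsub>B\<^esub> O\<^sub>B) ?R" and J: "ideal (P <#\<^bsub>B\<^esub> O\<^sub>B) ?R"
    unfolding cosets by (rule Q.ideal_\<pi>, rule Q.ideal_P)
  have sub_I: "\<pi> <#\<^bsub>B\<^esub> O\<^sub>F \<subseteq> \<pi> <#\<^bsub>B\<^esub> O\<^sub>B"
    using OF_OK OK_OB by (auto simp: l_coset_def)
  \<comment> \<open>With \<open>\<pi> = P P\<close>, multiples of \<open>\<pi>\<close> are multiples
    of \<open>P\<close>.\<close>
  have "\<pi> \<otimes>\<^bsub>B\<^esub> x \<in> P <#\<^bsub>B\<^esub> O\<^sub>B" if x: "x \<in> O\<^sub>F" for x
  proof -
    have "P \<otimes>\<^bsub>B\<^esub> x \<in> O\<^sub>B" using subringE(6)[OF OB_subring P_OB OK_OB[OF OF_OK[OF x]]] .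
    moreover have "\<pi> \<otimes>\<^bsub>B\<^esub> x = P \<otimes>\<^bsub>B\<^esub> (P \<otimes>\<^bsub>B\<^esub> x)"
      using x P_closed by (simp add: P_sq flip: m_assoc)
    ultimately show ?thesis by (auto simp: l_coset_def)
  qed
  then have sub_J: "\<pi> <#\<^bsub>B\<^esub> O\<^sub>F \<subseteq> P <#\<^bsub>B\<^esub> O\<^sub>B" by (auto simp: l_coset_def)
  obtain f :: "'b \<Rightarrow> 'm" where "inj_on f (carrier B)" using large(1) by blast
  then have f: "inj_on f (carrier ?R)" by (rule inj_on_subset) auto
  have U: "(bilattices B O\<^sub>F O\<^sub>B :: ('b, 'b, 'm) bimodule set) = {L. Q.lattice L}"
    by (auto simp: bilattices_def Q.lattice_def)
  \<comment> \<open>\<open>right_bijection\<close> takes the ideal in the form \<open>R P\<close>,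
    whereas \<open>quot_by\<close> uses the coset \<open>P R\<close>; \<open>P_image\<close>
    identifies them.\<close>
  have "induces_bijection (right_truncation P) ?R ?R
      (bilattices B O\<^sub>F O\<^sub>B :: ('b, 'b, 'm) bimodule set)
      (quot_by B O\<^sub>B \<pi>) (quot_by B O\<^sub>B P)
      (residue_bimodules B O\<^sub>F O\<^sub>B \<pi> \<pi> P :: ('b set, 'b set, 'n) bimodule set)"
    unfolding U residue_bimodules_eq[OF q I sub_I J sub_J] quot_by_def right_truncation_def[abs_def]
    by (rule Q.right_bijection[OF I J cosets(1) _ f large(2)]) (unfold cosets(2), rule Q.P_image)
  moreover have "induces_bijection (left_truncation P) ?R ?R
      (bilattices B O\<^sub>F O\<^sub>B :: ('b, 'b, 'm) bimodule set)
      (quot_by B O\<^sub>B P) (quot_by B O\<^sub>B \<pi>)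
      (residue_bimodules B O\<^sub>F O\<^sub>B \<pi> P \<pi> :: ('b set, 'b set, 'n) bimodule set)"
    unfolding U residue_bimodules_eq[OF q J sub_J I sub_I] quot_by_def left_truncation_def[abs_def]
    by (rule Q.left_bijection[OF I J cosets f large(2)])
  ultimately show ?thesis by blast
qed

end
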